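(* Let $G$ be a countable sofic group, let $\Sigma = \{\sigma_i : G\to \mathrm{Sym}(d_i)\}_{i=1}^\infty$ be a sofic approximation sequence for $G$, and let $(X,\mu)$ be a standard probability space. Let $G$ act on $(X^G,\mu^G)$ by the Bernoulli action. Then $$h_{\Sigma,\mu^G}(X^G,G) = H(\mu),$$ where both sides take values in the extended reals (so that the left side is $+\infty$ when $H(\mu)=+\infty$).
   Context: A standard probability space is a standard Borel space with a Borel probability measure (atoms allowed). **Bernoulli action.** For a standard probability space $(X,\mu)$, $X^G$ carries the product Borel structure and product measure $\mu^G$, and $G$ acts by $g\cdot(x_h)_{h\in G} = (x_{g^{-1}h})_{h\in G}$. **Base entropy.** For a finite measurable partition $\mathcal Q$ of $X$, $H_\mu(\mathcal Q) = -\sum_{Q\in\mathcal Q}\mu(Q)\log\mu(Q)$ (with $0\log 0=0$). $H(\mu)\in[0,+\infty]$ is the supremum of $H_\mu(\mathcal Q)$ over all finite measurable partitions $\mathcal Q$ of $X$. **Sofic approximation sequence.** $\mathrm{Sym}(d)$ is the permutation group of $\{1,\dots,d\}$. A sofic approximation sequence for $G$ is a sequence of maps (not necessarily homomorphisms) $\sigma_i: G\to \mathrm{Sym}(d_i)$, written $s\mapsto\sigma_{i,s}$, with $d_i$ positive integers, $d_i\to\infty$, such that $\lim_{i\to\infty}\frac1{d_i}|\{k : \sigma_{i,st}(k)=\sigma_{i,s}\sigma_{i,t}(k)\}| = 1$ for all $s,t\in G$, and $\lim_{i\to\infty}\frac1{d_i}|\{k:\sigma_{i,s}(k)\ne\sigma_{i,t}(k)\}|=1$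 for all distinct $s,t\in G$. A countable group is sofic if it admits such a sequence. **Sofic measure entropy.** First let $Y$ be a compact metrizable space with a continuous action of $G$ preserving a Borel probability measure $\nu$. For $f\in C(Y)$ and $g\in G$ let $\alpha_g(f)(y)=f(g^{-1}y)$. Let $\mathcal P$ be a finite partition of unity in $C(Y)$ (a finite set of nonnegative continuous functions summing to $1$) which is dynamically generating: no proper $G$-invariant unital $C^*$-subalgebra of $C(Y)$ contains $\mathcal P$. For $d\in\mathbb N$ and unital homomorphisms ($*$-homomorphisms) $\varphi,\psi: C(Y)\to\mathbb C^d$ put $\rho_{\mathcal P,\infty}(\varphi,\psi)=\max_{p\in\mathcal P}\|\varphi(p)-\psi(p)\|_\infty$. Let $\zeta$ be the uniform probability measure on $\{1,\dots,d\}$, regarded also as a functional on $\mathbb C^d\cong C(\{1,\dots,d\})$, and let $\|f\|_2=\zeta(|f|^2)^{1/2}$. For a map $\sigma:G\to\mathrm{Sym}(d)$, write $\sigma_s(f)=f\circ\sigma_s^{-1}$ for $f\in\mathbb C^d$, $s\in G$. For a nonempty finite $F\subseteq G$, $m\in\mathbb N$, $\delta>0$, let $\mathcal P_{F,m}$ be the set of all products $\alpha_{s_1}(p_1)\cdots\alpha_{s_j}(p_j)$ with $1\le j\le m$, $p_1,\dots,p_j\in\mathcal P$, $s_1,\dots,s_j\in F$. Let $\mathrm{Hom}_\nu^Y(\mathcal P,F,m,\delta,\sigma)$ be the set of all unital homomorphisms $\varphi:C(Y)\to\mathbb C^d$ such that (i) $|\zeta\circ\varphi(f)-\nu(f)|<\delta$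 for all $f\in\mathcal P_{F,m}$, where $\nu(f)=\int f\,d\nu$, and (ii) $\|\varphi\circ\alpha_s(f)-\sigma_s\circ\varphi(f)\|_2<\delta$ for all $f\in\mathcal P$ and $s\in F$. Let $N_\varepsilon(\cdot,\rho_{\mathcal P,\infty})$ be the maximal cardinality of an $\varepsilon$-separated subset (distinct elements at $\rho_{\mathcal P,\infty}$-distance at least $\varepsilon$), with $\log 0=-\infty$. Then $$h_{\Sigma,\nu}(Y,G)=\sup_{\varepsilon>0}\inf_F\inf_{m\in\mathbb N}\inf_{\delta>0}\limsup_{i\to\infty}\frac1{d_i}\log N_\varepsilon\big(\mathrm{Hom}_\nu^Y(\mathcal P,F,m,\delta,\sigma_i),\rho_{\mathcal P,\infty}\big),$$ with $F$ ranging over nonempty finite subsets of $G$. It is a known fact that this value does not depend on the choice of dynamically generating $\mathcal P$ and is invariant under measure-theoretic isomorphism of actions. For a measure-preserving action of $G$ on a standard probability space $(Z,\lambda)$, $h_{\Sigma,\lambda}(Z,G)$ is defined as the value $h_{\Sigma,\nu}(Y,G)$ for any such $(Y,\nu)$, admitting a finite dynamically generating partition of unity, that is measurably isomorphic to $(Z,\lambda)$ as a $G$-action. For the Bernoulli action on $(X^G,\mu^G)$ one may take $X$ to be a Borel subset of $[0,1]$, $Y=\overline X^{\,G}$ with the shift action, $\nu$ the product of the extension of $\mu$ to $\overline X$, and $\mathcal P=\{p,1-p\}$ where $p((x_g)_{g\in G})=x_e$, with $e$ the identity of $G$. *)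

theory Defs
  imports
    "HOL-Probability.Probability"
    "HOL-Algebra.Group_Action"
begin

section \<open>Standard Borel spaces and Shannon entropy\<close>

definition borel_of :: "'a topology \<Rightarrow> 'a measure" where
  "borel_of T = sigma (topspace T) {U. openin T U}"

definition standard_borel :: "'a measure \<Rightarrow> bool" where
  "standard_borel M \<longleftrightarrow>
     (\<exists>T. completely_metrizable_space T \<and> second_countable T \<and> sets M = sets (borel_of T))"

definition finite_measurable_partition :: "'a measure \<Rightarrow> 'a set set \<Rightarrow> bool" where
  "finite_measurable_partition M Q \<longleftrightarrow>
     finite Q \<and> Q \<subseteq> sets M \<and> partition_on (space M) Q"

text \<open>The convention \<open>0 log 0 = 0\<close> holds automatically.\<close>

definition partition_entropy :: "'a measure \<Rightarrow> 'a set set \<Rightarrow> real" where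
  "partition_entropy M Q = - (\<Sum>A\<in>Q. measure M A * ln (measure M A))"

definition base_entropy :: "'a measure \<Rightarrow> ereal" where
  "base_entropy M = (SUP Q\<in>{Q. finite_measurable_partition M Q}. ereal (partition_entropy M Q))"

section \<open>Sofic groups\<close>

text \<open>Only the values \<open>\<sigma> i s\<close> with \<open>s\<close> in the carrier of \<open>G\<close> are relevant.
  The group \<open>Sym(d)\<close> consists of the \<open>p\<close> with \<open>p permutes {1..d}\<close>.\<close>

definition sofic_approximation ::
    "('g, 'r) monoid_scheme \<Rightarrow> (nat \<Rightarrow> nat) \<Rightarrow> (nat \<Rightarrow> 'g \<Rightarrow> nat \<Rightarrow> nat) \<Rightarrow> bool" where
  "sofic_approximation G d \<sigma> \<longleftrightarrow>
     (\<forall>i. d i > 0) \<and> filterlim d at_top sequentially \<and>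
     (\<forall>i. \<forall>s\<in>carrier G. \<sigma> i s permutes {1..d i}) \<and>
     (\<forall>s\<in>carrier G. \<forall>t\<in>carrier G.
        (\<lambda>i. real (card {k\<in>{1..d i}. \<sigma> i (s \<otimes>\<^bsub>G\<^esub> t) k = \<sigma> i s (\<sigma> i t k)}) / real (d i))
          \<longlonglongrightarrow> 1) \<and>
     (\<forall>s\<in>carrier G. \<forall>t\<in>carrier G. s \<noteq> t \<longrightarrow>
        (\<lambda>i. real (card {k\<in>{1..d i}. \<sigma> i s k \<noteq> \<sigma> i t k}) / real (d i)) \<longlonglongrightarrow> 1)"

definition sofic_group :: "('g, 'r) monoid_scheme \<Rightarrow> bool" where
  "sofic_group G \<longleftrightarrow>
     group G \<and> countable (carrier G) \<and> (\<exists>d \<sigma>. sofic_approximation G d \<sigma>)"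

section \<open>Measure-preserving actions\<close>

text \<open>Actions are those of \<^locale>\<open>group_action\<close>: each \<open>a g\<close> is an extensional bijection
  of the space, and \<open>a (g h) = a g \<circ> a h\<close> on it.\<close>

definition pmp_action ::
    "('g, 'r) monoid_scheme \<Rightarrow> 'a measure \<Rightarrow> ('g \<Rightarrow> 'a \<Rightarrow> 'a) \<Rightarrow> bool" where
  "pmp_action G M a \<longleftrightarrow>
     prob_space M \<and> group_action G (space M) a \<and>
     (\<forall>g\<in>carrier G. a g \<in> M \<rightarrow>\<^sub>M M \<and> distr M M (a g) = M)"

definition isomorphic_actions ::
    "('g, 'r) monoid_scheme \<Rightarrow> 'a measure \<Rightarrow> ('g \<Rightarrow> 'a \<Rightarrow> 'a) \<Rightarrow>
     'b measure \<Rightarrow> ('g \<Rightarrow> 'b \<Rightarrow> 'b) \<Rightarrow> bool" where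
  "isomorphic_actions G M a N b \<longleftrightarrow>
     (\<exists>A\<in>sets M. \<exists>B\<in>sets N. \<exists>\<theta>.
        emeasure M (space M - A) = 0 \<and> emeasure N (space N - B) = 0 \<and>
        (\<forall>g\<in>carrier G. a g ` A \<subseteq> A) \<and> (\<forall>g\<in>carrier G. b g ` B \<subseteq> B) \<and>
        bij_betw \<theta> A B \<and>
        \<theta> \<in> restrict_space M A \<rightarrow>\<^sub>M restrict_space N B \<and>
        inv_into A \<theta> \<in> restrict_space N B \<rightarrow>\<^sub>M restrict_space M A \<and>
        distr (restrict_space M A) (restrict_space N B) \<theta> = restrict_space N B \<and>
        (\<forall>g\<in>carrier G. \<forall>z\<in>A. \<theta> (a g z) = b g (\<theta> z)))"

text \<open>The action of \<open>G\<close> on \<open>X\<^sup>G\<close>, where \<open>X\<^sup>G\<close> with the product measure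
  is \<^term>\<open>PiM (carrier G) (\<lambda>_. M)\<close>.\<close>

definition bernoulli_action ::
    "('g, 'r) monoid_scheme \<Rightarrow> 'a measure \<Rightarrow> 'g \<Rightarrow> ('g \<Rightarrow> 'a) \<Rightarrow> 'g \<Rightarrow> 'a" where
  "bernoulli_action G M g =
     (\<lambda>x\<in>space (PiM (carrier G) (\<lambda>_. M)). \<lambda>h\<in>carrier G. x (inv\<^bsub>G\<^esub> g \<otimes>\<^bsub>G\<^esub> h))"

section \<open>The algebra of continuous functions\<close>

text \<open>Functions on the space \<open>Y = topspace T\<close>, and elements of \<open>\<complex>\<^sup>d\<close>, are extensional,
  so that equality in HOL is equality on \<open>Y\<close>, respectively on \<open>{1..d}\<close>.\<close>

definition cfun :: "'y topology \<Rightarrow> ('y \<Rightarrow> complex) set" where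
  "cfun T = {f \<in> extensional (topspace T). continuous_map T euclidean f}"

definition unital_C_star_subalgebra :: "'y topology \<Rightarrow> ('y \<Rightarrow> complex) set \<Rightarrow> bool" where
  "unital_C_star_subalgebra T A \<longleftrightarrow>
     A \<subseteq> cfun T \<and>
     (\<lambda>y\<in>topspace T. 1) \<in> A \<and>
     (\<forall>f\<in>A. \<forall>g\<in>A. (\<lambda>y\<in>topspace T. f y + g y) \<in> A) \<and>
     (\<forall>c. \<forall>f\<in>A. (\<lambda>y\<in>topspace T. c * f y) \<in> A) \<and>
     (\<forall>f\<in>A. \<forall>g\<in>A. (\<lambda>y\<in>topspace T. f y * g y) \<in> A) \<and>
     (\<forall>f\<in>A. (\<lambda>y\<in>topspace T. cnj (f y)) \<in> A) \<and>
     (\<forall>f\<in>cfun T. (\<forall>e>0. \<exists>g\<in>A. \<forall>y\<in>topspace T. cmod (f y - g y) \<le> e) \<longrightarrow> f \<in> A)"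

definition translate ::
    "('g, 'r) monoid_scheme \<Rightarrow> 'y topology \<Rightarrow> ('g \<Rightarrow> 'y \<Rightarrow> 'y) \<Rightarrow> 'g \<Rightarrow>
     ('y \<Rightarrow> complex) \<Rightarrow> 'y \<Rightarrow> complex" where
  "translate G T b g f = (\<lambda>y\<in>topspace T. f (b (inv\<^bsub>G\<^esub> g) y))"

definition partition_of_unity :: "'y topology \<Rightarrow> ('y \<Rightarrow> complex) set \<Rightarrow> bool" where
  "partition_of_unity T P \<longleftrightarrow>
     finite P \<and> P \<subseteq> cfun T \<and> (\<forall>p\<in>P. \<forall>y\<in>topspace T. p y \<in> \<real>\<^sub>\<ge>\<^sub>0) \<and>
     (\<forall>y\<in>topspace T. (\<Sum>p\<in>P. p y) = 1)"

definition dynamically_generating ::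
    "('g, 'r) monoid_scheme \<Rightarrow> 'y topology \<Rightarrow> ('g \<Rightarrow> 'y \<Rightarrow> 'y) \<Rightarrow>
     ('y \<Rightarrow> complex) set \<Rightarrow> bool" where
  "dynamically_generating G T b P \<longleftrightarrow>
     (\<forall>A. unital_C_star_subalgebra T A \<and> (\<forall>g\<in>carrier G. translate G T b g ` A \<subseteq> A) \<and> P \<subseteq> A
        \<longrightarrow> A = cfun T)"

definition unital_hom ::
    "'y topology \<Rightarrow> nat \<Rightarrow> (('y \<Rightarrow> complex) \<Rightarrow> nat \<Rightarrow> complex) set" where
  "unital_hom T d = {\<phi> \<in> cfun T \<rightarrow>\<^sub>E ({1..d} \<rightarrow>\<^sub>E UNIV). \<forall>k\<in>{1..d}.
     \<phi> (\<lambda>y\<in>topspace T. 1) k = 1 \<and>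
     (\<forall>f\<in>cfun T. \<forall>g\<in>cfun T. \<phi> (\<lambda>y\<in>topspace T. f y + g y) k = \<phi> f k + \<phi> g k) \<and>
     (\<forall>c. \<forall>f\<in>cfun T. \<phi> (\<lambda>y\<in>topspace T. c * f y) k = c * \<phi> f k) \<and>
     (\<forall>f\<in>cfun T. \<forall>g\<in>cfun T. \<phi> (\<lambda>y\<in>topspace T. f y * g y) k = \<phi> f k * \<phi> g k) \<and>
     (\<forall>f\<in>cfun T. \<phi> (\<lambda>y\<in>topspace T. cnj (f y)) k = cnj (\<phi> f k))}"

section \<open>Sofic measure entropy of a topological model\<close>

definition uniform_mean :: "nat \<Rightarrow> (nat \<Rightarrow> complex) \<Rightarrow> complex" where
  "uniform_mean d v = (\<Sum>k\<in>{1..d}. v k) / of_nat d"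

definition norm_two :: "nat \<Rightarrow> (nat \<Rightarrow> complex) \<Rightarrow> real" where
  "norm_two d v = sqrt ((\<Sum>k\<in>{1..d}. (cmod (v k))\<^sup>2) / real d)"

definition norm_max :: "nat \<Rightarrow> (nat \<Rightarrow> complex) \<Rightarrow> real" where
  "norm_max d v = Max ((\<lambda>k. cmod (v k)) ` {1..d})"

definition rho_max ::
    "nat \<Rightarrow> ('y \<Rightarrow> complex) set \<Rightarrow> (('y \<Rightarrow> complex) \<Rightarrow> nat \<Rightarrow> complex) \<Rightarrow>
     (('y \<Rightarrow> complex) \<Rightarrow> nat \<Rightarrow> complex) \<Rightarrow> real" where
  "rho_max d P \<phi> \<psi> = Max ((\<lambda>p. norm_max d (\<lambda>k. \<phi> p k - \<psi> p k)) ` P)"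

text \<open>The set \<open>P\<^bsub>F,m\<^esub>\<close> of products \<open>\<alpha>\<^bsub>s 1\<^esub>(p 1) \<dots> \<alpha>\<^bsub>s j\<^esub>(p j)\<close> with \<open>1 \<le> j \<le> m\<close>.\<close>

definition product_set ::
    "('g, 'r) monoid_scheme \<Rightarrow> 'y topology \<Rightarrow> ('g \<Rightarrow> 'y \<Rightarrow> 'y) \<Rightarrow> ('y \<Rightarrow> complex) set \<Rightarrow>
     'g set \<Rightarrow> nat \<Rightarrow> ('y \<Rightarrow> complex) set" where
  "product_set G T b P F m =
     {(\<lambda>y\<in>topspace T. \<Prod>l\<in>{1..j}. translate G T b (s l) (p l) y) | j s p.
        1 \<le> j \<and> j \<le> m \<and> (\<forall>l\<in>{1..j}. s l \<in> F) \<and> (\<forall>l\<in>{1..j}. p l \<in> P)}"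

text \<open>Here \<open>\<tau> : G \<rightarrow> Sym(d)\<close> acts on \<open>\<complex>\<^sup>d\<close> by \<open>v \<mapsto> v \<circ> (\<tau> s)\<^sup>-\<^sup>1\<close>.\<close>

definition approx_hom ::
    "('g, 'r) monoid_scheme \<Rightarrow> 'y topology \<Rightarrow> 'y measure \<Rightarrow> ('g \<Rightarrow> 'y \<Rightarrow> 'y) \<Rightarrow>
     ('y \<Rightarrow> complex) set \<Rightarrow> 'g set \<Rightarrow> nat \<Rightarrow> real \<Rightarrow> nat \<Rightarrow> ('g \<Rightarrow> nat \<Rightarrow> nat) \<Rightarrow>
     (('y \<Rightarrow> complex) \<Rightarrow> nat \<Rightarrow> complex) set" where
  "approx_hom G T N b P F m \<delta> d \<tau> = {\<phi> \<in> unital_hom T d.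
     (\<forall>f\<in>product_set G T b P F m. cmod (uniform_mean d (\<phi> f) - (\<integral>y. f y \<partial>N)) < \<delta>) \<and>
     (\<forall>f\<in>P. \<forall>s\<in>F.
        norm_two d (\<lambda>k. \<phi> (translate G T b s f) k - \<phi> f (inv_into {1..d} (\<tau> s) k)) < \<delta>)}"

definition separation_number :: "real \<Rightarrow> 'a set \<Rightarrow> ('a \<Rightarrow> 'a \<Rightarrow> real) \<Rightarrow> enat" where
  "separation_number \<epsilon> A \<rho> =
     (SUP S\<in>{S. finite S \<and> S \<subseteq> A \<and> (\<forall>x\<in>S. \<forall>y\<in>S. x \<noteq> y \<longrightarrow> \<rho> x y \<ge> \<epsilon>)}. enat (card S))"

definition log_enat :: "enat \<Rightarrow> ereal" where
  "log_enat n = (case n of enat k \<Rightarrow> if k = 0 then -\<infinity> else ereal (ln (real k)) | \<infinity> \<Rightarrow> \<infinity>)"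

definition model_entropy ::
    "('g, 'r) monoid_scheme \<Rightarrow> (nat \<Rightarrow> nat) \<Rightarrow> (nat \<Rightarrow> 'g \<Rightarrow> nat \<Rightarrow> nat) \<Rightarrow>
     'y topology \<Rightarrow> 'y measure \<Rightarrow> ('g \<Rightarrow> 'y \<Rightarrow> 'y) \<Rightarrow> ('y \<Rightarrow> complex) set \<Rightarrow> ereal" where
  "model_entropy G d \<sigma> T N b P =
     (SUP \<epsilon>\<in>{0<..}. INF F\<in>{F. finite F \<and> F \<noteq> {} \<and> F \<subseteq> carrier G}. INF m. INF \<delta>\<in>{0<..}.
        limsup (\<lambda>i. ereal (1 / real (d i)) *
          log_enat (separation_number \<epsilon> (approx_hom G T N b P F m \<delta> (d i) (\<sigma> i))
            (rho_max (d i) P))))"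

definition topological_model ::
    "('g, 'r) monoid_scheme \<Rightarrow> 'y topology \<Rightarrow> 'y measure \<Rightarrow> ('g \<Rightarrow> 'y \<Rightarrow> 'y) \<Rightarrow>
     ('y \<Rightarrow> complex) set \<Rightarrow> bool" where
  "topological_model G T N b P \<longleftrightarrow>
     compact_space T \<and> metrizable_space T \<and> sets N = sets (borel_of T) \<and>
     pmp_action G N b \<and> (\<forall>g\<in>carrier G. continuous_map T T (b g)) \<and>
     partition_of_unity T P \<and> dynamically_generating G T b P"

section \<open>Sofic measure entropy of a measure-preserving action\<close>

text \<open>The common value of the entropy over all topological models of the action, with all
  finite dynamically generating partitions of unity. The underlying set of a model is any
  subset of \<^typ>\<open>nat \<Rightarrow> real\<close>, with any topology; as compact metrizable spaces embed in the
  Hilbert cube, this covers all of them up to homeomorphism.\<close>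

definition sofic_entropy ::
    "('g, 'r) monoid_scheme \<Rightarrow> (nat \<Rightarrow> nat) \<Rightarrow> (nat \<Rightarrow> 'g \<Rightarrow> nat \<Rightarrow> nat) \<Rightarrow>
     'z measure \<Rightarrow> ('g \<Rightarrow> 'z \<Rightarrow> 'z) \<Rightarrow> ereal" where
  "sofic_entropy G d \<sigma> M a =
     (THE h. \<exists>(T :: (nat \<Rightarrow> real) topology) N b P.
        topological_model G T N b P \<and> isomorphic_actions G M a N b \<and>
        h = model_entropy G d \<sigma> T N b P)"

end

theory Submission
  imports Defs
begin

text \<open>
  Uniqueness of the value is the point: whatever the model of the Bernoulli action and the generating
  partition of unity, its entropy is \<open>H(\<mu>)\<close>. A homomorphism \<open>C(Y) \<rightarrow> \<complex>\<^sup>d\<close> is a \<open>d\<close>-tuple of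
  points of \<open>Y\<close>, a microstate if its empirical distribution is close to that of the action.

  Upper bound: up to a small error in measure, a point of \<open>Y\<close> is determined to precision \<open>\<epsilon>\<close> by the
  letters, under a finite coding of \<open>X\<close>, that lie in a finite window. Hence a microstate is determined
  up to \<open>\<epsilon>\<close>, off a small set of sites, by a word of length \<open>d\<close> with nearly the right letter
  frequencies. There are about \<open>exp(d H)\<close> such words, and the errors contribute a factor of small
  exponential rate.

  Lower bound: for a random word with independent letters, replacing each site by a function of the
  window around it gives a microstate with high probability; the weak law of large numbers needed for
  this holds because most windows of the sofic approximation are disjoint. Every single word has
  probability about \<open>exp(- d H)\<close>, and closeness of microstates forces closeness of the words in Hamming
  distance, so a maximal separated set of microstates has nearly \<open>exp(d H)\<close> elements.
\<close>

section \<open>Sofic approximations\<close>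

text \<open>Two mismatches shape the proof. A model controls only \<open>P\<close> and its
  translates, and the letters of the base are merely measurable functions on \<open>Y\<close>,
  because the isomorphism respects measure and not topology. The first gap is closed by induction
  over the invariant C*-algebra generated by \<open>P\<close>: approximate equivariance, convergence
  of averages and closeness of pairs extend from \<open>P\<close> to all of C(Y). The second is
  closed by continuous functions within 1/4 of the letter indicators off a set of small measure.
  Indicators take only the values 0 and 1, so fixed tolerances such as 1/4, 1/3 and 1/2 suffice to
  read a letter. Statements of the form "for suitable F, m, \<delta> and all large i, every
  microstate ..." are packed into a filter, which turns most of the \<epsilon> bookkeeping into
  arithmetic of limits. The order of quantifiers in the entropy is felt in the lower bound, where
  one separation scale \<epsilon> has to be fixed before F, m and \<delta> are given.\<close>

lemma frac_tendsto_zero: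
  fixes d :: "nat \<Rightarrow> nat"
  assumes "\<And>i. d i > 0"
    and "(\<lambda>i. real (card {k\<in>{1..d i}. P i k}) / real (d i)) \<longlonglongrightarrow> 1"
  shows "(\<lambda>i. real (card {k\<in>{1..d i}. \<not> P i k}) / real (d i)) \<longlonglongrightarrow> 0"
proof -
  have "real (card {k\<in>{1..d i}. \<not> P i k}) / real (d i)
      = 1 - real (card {k\<in>{1..d i}. P i k}) / real (d i)" for i
  proof -
    have "card {k\<in>{1..d i}. \<not> P i k} + card {k\<in>{1..d i}. P i k} = card {1..d i}"
      by (subst card_Un_disjoint[symmetric]) (auto intro!: arg_cong[where f=card, of _ "{1..d i}", simplified])
    then have "real (card {k\<in>{1..d i}. \<not> P i k}) = real (d i) - real (card {k\<in>{1..d i}. P i k})"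
      by simp
    then show ?thesis using assms(1)[of i] by (simp add: diff_divide_distrib)
  qed
  then show ?thesis using tendsto_diff[OF tendsto_const[of 1] assms(2)] by simp
qed

locale sofic_sequence = group G for G :: "('g, 'r) monoid_scheme" (structure) +
  fixes d :: "nat \<Rightarrow> nat" and \<sigma> :: "nat \<Rightarrow> 'g \<Rightarrow> nat \<Rightarrow> nat"
  assumes sofic: "sofic_approximation G d \<sigma>"
begin

text \<open>Condition (ii) of the entropy involves \<sigma>_s only through its inverse. Inverses
  compose in reversed order, T_{sg} = T_g T_s at most sites, just as coordinates do under the shift
  z -> z(s .). Hence the letter of a word at \<open>T i g k\<close> plays the role of coordinate
  \<open>g\<close> of the point seen from site \<open>k\<close>.\<close>

definition T :: "nat \<Rightarrow> 'g \<Rightarrow> nat \<Rightarrow> nat" where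
  "T i g = inv_into {1..d i} (\<sigma> i g)"

lemma d_pos: "d i > 0"
  using sofic by (auto simp: sofic_approximation_def)

lemma d_at_top: "filterlim d at_top sequentially"
  using sofic by (auto simp: sofic_approximation_def)

lemma sigma_permutes: "g \<in> carrier G \<Longrightarrow> \<sigma> i g permutes {1..d i}"
  using sofic by (auto simp: sofic_approximation_def)

lemma sigma_in: "g \<in> carrier G \<Longrightarrow> k \<in> {1..d i} \<Longrightarrow> \<sigma> i g k \<in> {1..d i}"
  using permutes_in_image[OF sigma_permutes] by blast

lemma inj_sigma: "g \<in> carrier G \<Longrightarrow> inj_on (\<sigma> i g) {1..d i}"
  using permutes_inj_on[OF sigma_permutes] .

lemma T_sigma [simp]: "g \<in> carrier G \<Longrightarrow> k \<in> {1..d i} \<Longrightarrow> T i g (\<sigma> i g k) = k"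
  unfolding T_def by (rule inv_into_f_f[OF inj_sigma])

lemma sigma_T [simp]: "g \<in> carrier G \<Longrightarrow> k \<in> {1..d i} \<Longrightarrow> \<sigma> i g (T i g k) = k"
  unfolding T_def using permutes_image[OF sigma_permutes] by (intro f_inv_into_f) auto

lemma T_in: "g \<in> carrier G \<Longrightarrow> k \<in> {1..d i} \<Longrightarrow> T i g k \<in> {1..d i}"
  unfolding T_def using permutes_image[OF sigma_permutes] by (intro inv_into_into) auto

lemma bij_T: "g \<in> carrier G \<Longrightarrow> bij_betw (T i g) {1..d i} {1..d i}"
  unfolding T_def using permutes_imp_bij[OF sigma_permutes] by (rule bij_betw_inv_into)

text \<open>\<open>T i (s \<otimes> g)\<close> injects the sites where the inverses fail to compose
  into those where \<sigma> fails to be multiplicative: at l = T_{sg} k the equation \<sigma>_{sg} l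
  = \<sigma>_s \<sigma>_g l would give k = \<sigma>_s \<sigma>_g l, hence T_g T_s k = l.\<close>

lemma T_mult_frac:
  assumes "s \<in> carrier G" "g \<in> carrier G"
  shows "(\<lambda>i. real (card {k\<in>{1..d i}. T i (s \<otimes> g) k \<noteq> T i g (T i s k)}) / real (d i)) \<longlonglongrightarrow> 0"
proof -
  have lim: "(\<lambda>i. real (card {k\<in>{1..d i}. \<sigma> i (s \<otimes> g) k \<noteq> \<sigma> i s (\<sigma> i g k)}) / real (d i)) \<longlonglongrightarrow> 0"
    using sofic assms by (intro frac_tendsto_zero d_pos) (auto simp: sofic_approximation_def)
  have "card {k\<in>{1..d i}. T i (s \<otimes> g) k \<noteq> T i g (T i s k)}
      \<le> card {k\<in>{1..d i}. \<sigma> i (s \<otimes> g) k \<noteq> \<sigma> i s (\<sigma> i g k)}" for i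
  proof (rule card_inj_on_le[where f = "\<lambda>k. T i (s \<otimes> g) k"])
    show "inj_on (T i (s \<otimes> g)) {k\<in>{1..d i}. T i (s \<otimes> g) k \<noteq> T i g (T i s k)}"
      using bij_T[of "s \<otimes> g" i] assms by (auto simp: bij_betw_def intro: inj_on_subset)
    have "T i (s \<otimes> g) k = T i g (T i s k)"
      if k: "k \<in> {1..d i}" and eq: "\<sigma> i (s \<otimes> g) (T i (s \<otimes> g) k) = \<sigma> i s (\<sigma> i g (T i (s \<otimes> g) k))" for k
    proof -
      define l where "l = T i (s \<otimes> g) k"
      have l: "l \<in> {1..d i}" using T_in k assms by (auto simp: l_def)
      have "k = \<sigma> i s (\<sigma> i g l)" using eq k assms by (simp add: l_def)
      then have "T i g (T i s k) = l" using l assms sigma_in[of g l i] by simp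
      then show ?thesis by (simp add: l_def)
    qed
    then show "T i (s \<otimes> g) ` {k\<in>{1..d i}. T i (s \<otimes> g) k \<noteq> T i g (T i s k)}
        \<subseteq> {k\<in>{1..d i}. \<sigma> i (s \<otimes> g) k \<noteq> \<sigma> i s (\<sigma> i g k)}"
      using T_in[of "s \<otimes> g"] assms by blast
  qed auto
  then show ?thesis
    by (intro tendsto_sandwich[OF _ _ tendsto_const lim]) (auto intro!: divide_right_mono always_eventually)
qed

text \<open>If T_s k and T_g k are the same site l, then \<sigma>_s l = k = \<sigma>_g l, and the
  map from k to l is injective.\<close>

lemma T_eq_frac:
  assumes "s \<in> carrier G" "g \<in> carrier G" "s \<noteq> g"
  shows "(\<lambda>i. real (card {k\<in>{1..d i}. T i s k = T i g k}) / real (d i)) \<longlonglongrightarrow> 0"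
proof -
  have lim: "(\<lambda>i. real (card {k\<in>{1..d i}. \<not> \<sigma> i s k \<noteq> \<sigma> i g k}) / real (d i)) \<longlonglongrightarrow> 0"
    using sofic assms by (intro frac_tendsto_zero d_pos) (auto simp: sofic_approximation_def)
  have "card {k\<in>{1..d i}. T i s k = T i g k} \<le> card {k\<in>{1..d i}. \<not> \<sigma> i s k \<noteq> \<sigma> i g k}" for i
  proof (rule card_inj_on_le[where f = "T i s"])
    show "inj_on (T i s) {k\<in>{1..d i}. T i s k = T i g k}"
      using bij_T[of s i] assms by (auto simp: bij_betw_def intro: inj_on_subset)
    show "T i s ` {k\<in>{1..d i}. T i s k = T i g k} \<subseteq> {k\<in>{1..d i}. \<not> \<sigma> i s k \<noteq> \<sigma> i g k}"
    proof (rule image_subsetI)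
      fix k assume "k \<in> {k\<in>{1..d i}. T i s k = T i g k}"
      then have k: "k \<in> {1..d i}" and eq: "T i s k = T i g k" by auto
      have "\<sigma> i g (T i s k) = k" unfolding eq using k assms by simp
      then have "\<sigma> i s (T i s k) = \<sigma> i g (T i s k)" using k assms by simp
      then show "T i s k \<in> {k\<in>{1..d i}. \<not> \<sigma> i s k \<noteq> \<sigma> i g k}"
        using T_in[of s k i] k assms by simp
    qed
  qed auto
  then show ?thesis
    by (intro tendsto_sandwich[OF _ _ tendsto_const lim]) (auto intro!: divide_right_mono always_eventually)
qed

end

section \<open>Counting words and the law of large numbers for windows\<close>

text \<open>Counting by weights: every word in \<open>S\<close> has product weight at least exp(-B),
  while all words together weigh at most C^|A|. With C = 1 and \<open>q\<close> a probability vector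
  this counts words with prescribed frequencies; with letters weighted by agreement with a fixed
  word it bounds Hamming balls.\<close>

lemma card_words_le:
  fixes q :: "'k \<Rightarrow> 'v \<Rightarrow> real"
  assumes "finite A" "finite V"
    and pos: "\<And>k v. k \<in> A \<Longrightarrow> v \<in> V \<Longrightarrow> q k v > 0"
    and le: "\<And>k. k \<in> A \<Longrightarrow> (\<Sum>v\<in>V. q k v) \<le> C"
    and S: "S \<subseteq> PiE A (\<lambda>_. V)"
    and B: "\<And>w. w \<in> S \<Longrightarrow> (\<Sum>k\<in>A. - ln (q k (w k))) \<le> B"
  shows "real (card S) \<le> C ^ card A * exp B"
proof -
  have prod_ge: "exp (- B) \<le> (\<Prod>k\<in>A. q k (w k))" if w: "w \<in> S" for w
  proof -
    have "exp (- B) \<le> exp (\<Sum>k\<in>A. ln (q k (w k)))"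
      using B[OF w] by (simp add: sum_negf)
    also have "\<dots> = (\<Prod>k\<in>A. q k (w k))"
      using pos S w by (subst exp_sum[OF \<open>finite A\<close>]) (intro prod.cong refl exp_ln, auto)
    finally show ?thesis .
  qed
  have "real (card S) * exp (- B) = (\<Sum>w\<in>S. exp (- B))"
    by simp
  also have "\<dots> \<le> (\<Sum>w\<in>S. \<Prod>k\<in>A. q k (w k))"
    by (intro sum_mono prod_ge)
  also have "\<dots> \<le> (\<Sum>w\<in>PiE A (\<lambda>_. V). \<Prod>k\<in>A. q k (w k))"
    using assms by (intro sum_mono2 finite_PiE prod_nonneg) (auto intro!: less_imp_le[OF pos])
  also have "\<dots> = (\<Prod>k\<in>A. \<Sum>v\<in>V. q k v)"
    using assms by (subst prod_sum_PiE) auto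
  also have "\<dots> \<le> (\<Prod>k\<in>A. C)"
    using le by (intro prod_mono) (auto intro!: sum_nonneg less_imp_le[OF pos])
  finally have "real (card S) * exp (- B) \<le> C ^ card A" by simp
  then have "real (card S) * exp (- B) * exp B \<le> C ^ card A * exp B"
    by (rule mult_right_mono) simp
  then show ?thesis by (simp add: mult.assoc flip: exp_add)
qed

text \<open>Apply \<open>card_words_le\<close> with weight 1 for agreement with \<open>z\<close> and
  a small weight \<open>x\<close> for any other letter; a word in the ball pays the factor
  \<open>x\<close> at no more than \<kappa> n sites.\<close>

lemma card_hamming_ball_le:
  assumes "finite V" "t > 0"
  obtains \<kappa> where "\<kappa> > 0"
    "\<And>n z. real (card {u \<in> PiE {1..n::nat} (\<lambda>_. V). real (card {k\<in>{1..n}. u k \<noteq> z k}) \<le> \<kappa> * real n})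
       \<le> exp (t * real n)"
proof -
  \<comment> \<open>\<open>x\<close> makes 1 + |V| x at most exp(t/2), and \<open>\<kappa>\<close>
    makes x^(-\<kappa> n) equal to exp(t n / 2); the minimum with 1/2 keeps ln x negative.\<close>
  define x where "x = min (1/2) (t / (2 * (1 + real (card V))))"
  define \<kappa> where "\<kappa> = t / (2 * (- ln x))"
  have x: "0 < x" "x < 1" using assms by (auto simp: x_def)
  then have lnx: "ln x < 0" by simp
  have \<kappa>: "\<kappa> > 0" unfolding \<kappa>_def using lnx assms by (intro divide_pos_pos) auto
  have bound: "real (card {u \<in> PiE {1..n::nat} (\<lambda>_. V). real (card {k\<in>{1..n}. u k \<noteq> z k}) \<le> \<kappa> * real n})
       \<le> exp (t * real n)" for n z
  proof -
    have "real (card {u \<in> PiE {1..n::nat} (\<lambda>_. V). real (card {k\<in>{1..n}. u k \<noteq> z k}) \<le> \<kappa> * real n})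
      \<le> (1 + real (card V) * x) ^ card {1..n} * exp (\<kappa> * real n * (- ln x))"
    proof (rule card_words_le[where q = "\<lambda>k v. if v = z k then 1 else x" and V = V])
      fix k
      have "(\<Sum>v\<in>V. if v = z k then 1 else x) \<le> (\<Sum>v\<in>V. (if v = z k then 1 else 0) + x)"
        using x by (intro sum_mono) auto
      also have "\<dots> \<le> 1 + real (card V) * x"
        using assms by (simp add: sum.distrib)
      finally show "(\<Sum>v\<in>V. if v = z k then 1 else x) \<le> 1 + real (card V) * x" .
    next
      fix w assume "w \<in> {u \<in> PiE {1..n::nat} (\<lambda>_. V). real (card {k\<in>{1..n}. u k \<noteq> z k}) \<le> \<kappa> * real n}"
      then have w: "real (card {k\<in>{1..n}. w k \<noteq> z k}) \<le> \<kappa> * real n" by simp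
      have "(\<Sum>k = 1..n. - ln (if w k = z k then 1 else x)) = (\<Sum>k\<in>{k\<in>{1..n}. w k \<noteq> z k}. - ln x)"
        by (intro sum.mono_neutral_cong_right) auto
      also have "\<dots> = real (card {k\<in>{1..n}. w k \<noteq> z k}) * (- ln x)" by simp
      also have "\<dots> \<le> \<kappa> * real n * (- ln x)"
        using w lnx by (intro mult_right_mono) auto
      finally show "(\<Sum>k = 1..n. - ln (if w k = z k then 1 else x)) \<le> \<kappa> * real n * (- ln x)" .
    qed (use assms x in auto)
    also have "\<dots> \<le> exp (t / 2) ^ n * exp (t / 2 * real n)"
    proof (intro mult_mono)
      have "real (card V) * x \<le> (1 + real (card V)) * (t / (2 * (1 + real (card V))))"
        using x by (intro mult_mono) (auto simp: x_def)
      also have "\<dots> = t / 2" by (simp add: field_simps)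
      finally have "1 + real (card V) * x \<le> exp (t / 2)"
        using exp_ge_add_one_self[of "t/2"] by linarith
      then show "(1 + real (card V) * x) ^ card {1..n} \<le> exp (t / 2) ^ n"
        using x by (auto intro!: power_mono)
      show "exp (\<kappa> * real n * - ln x) \<le> exp (t / 2 * real n)"
        using lnx by (simp add: \<kappa>_def)
    qed auto
    also have "\<dots> = exp (t * real n)"
      by (simp add: exp_of_nat_mult[symmetric] exp_add[symmetric] algebra_simps)
    finally show ?thesis .
  qed
  show ?thesis using that[OF \<kappa> bound] .
qed

text \<open>Expand the square. The term of sites k, l vanishes if the window of k is injective, so
  that its letters are distributed as under the product measure and the mean is 0, and if the
  windows of k and l use disjoint sites, so that the two factors are independent. Each surviving
  term is at most C^2. Those with a non-injective site number at most 2 |B| n. Those with meeting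
  windows number at most |W|^2 n, because k together with g, g' such that \<tau> g k = \<tau> g' l
  determines l.\<close>

lemma second_moment_window_sum:
  fixes \<mu> :: "'a measure" and \<tau> :: "'g \<Rightarrow> nat \<Rightarrow> nat" and h :: "('g \<Rightarrow> 'a) \<Rightarrow> real"
  assumes "prob_space \<mu>" and W: "finite W"
    and \<tau>: "\<And>g k. g \<in> W \<Longrightarrow> k \<in> {1..n} \<Longrightarrow> \<tau> g k \<in> {1..n}"
    and inj: "\<And>g. g \<in> W \<Longrightarrow> inj_on (\<tau> g) {1..n}"
    and h[measurable]: "h \<in> borel_measurable (PiM W (\<lambda>_. \<mu>))"
    and C: "\<And>z. z \<in> space (PiM W (\<lambda>_. \<mu>)) \<Longrightarrow> \<bar>h z\<bar> \<le> C"
    and h0: "(\<integral>z. h z \<partial>PiM W (\<lambda>_. \<mu>)) = 0"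
  shows "(\<integral>u. (\<Sum>k=1..n. h (\<lambda>g\<in>W. u (\<tau> g k)))\<^sup>2 \<partial>PiM {1..n} (\<lambda>_. \<mu>))
    \<le> C\<^sup>2 * (2 * real (card {k\<in>{1..n}. \<not> inj_on (\<lambda>g. \<tau> g k) W}) * real n + real (card W)^2 * real n)"
proof -
  interpret \<mu>: prob_space \<mu> by fact
  define A where "A = {1..n}"
  define M where "M = PiM A (\<lambda>_. \<mu>)"
  interpret M: prob_space M unfolding M_def by (intro prob_space_PiM assms(1))
  define f where "f k u = h (\<lambda>g\<in>W. u (\<tau> g k))" for k u
  have \<tau>A: "\<tau> g k \<in> A" if "g \<in> W" "k \<in> A" for g k using \<tau> that by (auto simp: A_def)
  have win[measurable]: "(\<lambda>u. \<lambda>g\<in>W. u (\<tau> g k)) \<in> M \<rightarrow>\<^sub>M PiM W (\<lambda>_. \<mu>)" if "k \<in> A" for k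
    unfolding M_def using \<tau>A that by (intro measurable_restrict measurable_component_singleton) auto
  have f[measurable]: "f k \<in> borel_measurable M" if "k \<in> A" for k
    unfolding f_def using win[OF that] by measurable
  have fC: "\<bar>f k u\<bar> \<le> C" if "k \<in> A" "u \<in> space M" for k u
    unfolding f_def using measurable_space[OF win[OF that(1)] that(2)] by (rule C)
  have f_int: "integrable M (f k)" if "k \<in> A" for k
    using that fC by (intro M.integrable_const_bound[where B = C]) auto
  have C2: "\<bar>f k u * f l u\<bar> \<le> C\<^sup>2" if "k \<in> A" "l \<in> A" "u \<in> space M" for k l u
    using mult_mono[OF fC[of k u] fC[of l u]] that fC[of k u] by (simp add: abs_mult power2_eq_square)
  have ff_int: "integrable M (\<lambda>u. f k u * f l u)" if "k \<in> A" "l \<in> A" for k l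
    using that C2 by (intro M.integrable_const_bound[where B = "C\<^sup>2"]) auto
  have f0: "(\<integral>u. f k u \<partial>M) = 0" if "k \<in> A" "inj_on (\<lambda>g. \<tau> g k) W" for k
  proof -
    have "distr M (PiM W (\<lambda>_. \<mu>)) (\<lambda>u. \<lambda>g\<in>W. u (\<tau> g k)) = PiM W (\<lambda>_. \<mu>)"
      unfolding M_def
      using distr_PiM_reindex[of A "\<lambda>_. \<mu>" "\<lambda>g. \<tau> g k" W] that \<tau>A \<open>prob_space \<mu>\<close> by auto
    then have "(\<integral>u. f k u \<partial>M) = (\<integral>z. h z \<partial>PiM W (\<lambda>_. \<mu>))"
      unfolding f_def using integral_distr[OF win[OF that(1)] h] by simp
    then show ?thesis using h0 by simp
  qed
  define J where "J k = (\<lambda>g. \<tau> g k) ` W" for k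
  have indep: "M.indep_vars (\<lambda>_. \<mu>) (\<lambda>a u. u a) A" if "A \<noteq> {}"
  proof (subst M.indep_vars_iff_distr_eq_PiM')
    show "A \<noteq> {}" by fact
    show "M.random_variable \<mu> (\<lambda>u. u a)" if "a \<in> A" for a
      unfolding M_def using that by simp
    have "distr M (PiM A (\<lambda>_. \<mu>)) (\<lambda>u. \<lambda>a\<in>A. u a) = distr M M (\<lambda>u. u)"
      unfolding M_def by (intro distr_cong) (auto simp: space_PiM PiE_restrict)
    also have "\<dots> = PiM A (\<lambda>a. distr M \<mu> (\<lambda>u. u a))"
      unfolding M_def by (auto simp: distr_id intro!: PiM_cong distr_PiM_component[symmetric] assms(1))
    finally show "distr M (PiM A (\<lambda>_. \<mu>)) (\<lambda>u. \<lambda>a\<in>A. u a) = PiM A (\<lambda>a. distr M \<mu> (\<lambda>u. u a))" .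
  qed
  have prod0: "(\<integral>u. f k u * f l u \<partial>M) = 0"
    if k: "k \<in> A" "inj_on (\<lambda>g. \<tau> g k) W" and l: "l \<in> A" and disj: "J k \<inter> J l = {}" for k l
  proof -
    have JA: "J k \<subseteq> A" "J l \<subseteq> A" using k l \<tau>A by (auto simp: J_def)
    have m: "(\<lambda>v. h (\<lambda>g\<in>W. v (\<tau> g k))) \<in> borel_measurable (PiM (J k) (\<lambda>_. \<mu>))" for k
    proof -
      have "(\<lambda>v. \<lambda>g\<in>W. v (\<tau> g k)) \<in> PiM (J k) (\<lambda>_. \<mu>) \<rightarrow>\<^sub>M PiM W (\<lambda>_. \<mu>)"
        by (intro measurable_restrict measurable_component_singleton) (auto simp: J_def)
      then show ?thesis by measurable
    qed
    have "M.indep_var borel ((\<lambda>v. h (\<lambda>g\<in>W. v (\<tau> g k))) \<circ> (\<lambda>u. restrict (\<lambda>i. u i) (J k)))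
        borel ((\<lambda>v. h (\<lambda>g\<in>W. v (\<tau> g l))) \<circ> (\<lambda>u. restrict (\<lambda>i. u i) (J l)))"
      using indep k JA disj by (intro M.indep_var_compose[OF M.indep_var_restrict m m]) auto
    moreover have "(\<lambda>v. h (\<lambda>g\<in>W. v (\<tau> g k))) \<circ> (\<lambda>u. restrict (\<lambda>i. u i) (J k)) = f k" for k
      by (auto simp: fun_eq_iff f_def J_def intro!: arg_cong[where f = h])
    ultimately have "M.indep_var borel (f k) borel (f l)" by simp
    then have "(\<integral>u. f k u * f l u \<partial>M) = (\<integral>u. f k u \<partial>M) * (\<integral>u. f l u \<partial>M)"
      using f_int k l by (intro M.indep_var_lebesgue_integral)
    then show ?thesis using f0[OF k] by simp
  qed
  define B where "B = {k\<in>A. \<not> inj_on (\<lambda>g. \<tau> g k) W}"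
  define X where "X = {(k, l) \<in> A \<times> A. J k \<inter> J l \<noteq> {}}"
  have fin: "finite A" "finite B" by (auto simp: A_def B_def)
  have cX: "card X \<le> card W ^ 2 * n"
  proof -
    have "X \<subseteq> (\<lambda>(g, g', k). (k, inv_into A (\<tau> g') (\<tau> g k))) ` (W \<times> W \<times> A)"
    proof safe
      fix k l assume "(k, l) \<in> X"
      then obtain g g' where gg: "g \<in> W" "g' \<in> W" "\<tau> g k = \<tau> g' l" "k \<in> A" "l \<in> A"
        by (auto simp: X_def J_def)
      then have "inv_into A (\<tau> g') (\<tau> g k) = l"
        using inj[of g'] by (simp add: A_def)
      then show "(k, l) \<in> (\<lambda>(g, g', k). (k, inv_into A (\<tau> g') (\<tau> g k))) ` (W \<times> W \<times> A)"
        using gg by (auto intro!: image_eqI[where x = "(g, g', k)"])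
    qed
    then have "card X \<le> card (W \<times> W \<times> A)"
      using W fin by (meson card_image_le card_mono finite_SigmaI finite_imageI le_trans)
    then show ?thesis by (simp add: card_cartesian_product A_def power2_eq_square)
  qed
  have "(\<integral>u. (\<Sum>k\<in>A. f k u)\<^sup>2 \<partial>M) = (\<integral>u. (\<Sum>p\<in>A \<times> A. f (fst p) u * f (snd p) u) \<partial>M)"
    by (simp add: power2_eq_square sum_product sum.cartesian_product case_prod_beta)
  also have "\<dots> = (\<Sum>p\<in>A \<times> A. \<integral>u. f (fst p) u * f (snd p) u \<partial>M)"
    by (intro Bochner_Integration.integral_sum ff_int) auto
  also have "\<dots> = (\<Sum>p\<in>(B \<times> A \<union> A \<times> B) \<union> X. \<integral>u. f (fst p) u * f (snd p) u \<partial>M)"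
    using fin by (intro sum.mono_neutral_right) (auto simp: B_def X_def intro!: prod0)
  also have "\<dots> \<le> (\<Sum>p\<in>(B \<times> A \<union> A \<times> B) \<union> X. C\<^sup>2)"
  proof (rule sum_mono)
    fix p assume "p \<in> (B \<times> A \<union> A \<times> B) \<union> X"
    then have p: "fst p \<in> A" "snd p \<in> A" by (auto simp: B_def X_def)
    have "(\<integral>u. f (fst p) u * f (snd p) u \<partial>M) \<le> (\<integral>u. C\<^sup>2 \<partial>M)"
      using p C2 by (intro integral_mono ff_int) (auto simp: abs_le_iff)
    then show "(\<integral>u. f (fst p) u * f (snd p) u \<partial>M) \<le> C\<^sup>2" by (simp add: M.prob_space)
  qed
  also have "\<dots> = real (card ((B \<times> A \<union> A \<times> B) \<union> X)) * C\<^sup>2" by simp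
  also have "\<dots> \<le> (2 * real (card B) * real n + real (card W) ^ 2 * real n) * C\<^sup>2"
  proof (rule mult_right_mono)
    have "card ((B \<times> A \<union> A \<times> B) \<union> X) \<le> card (B \<times> A) + card (A \<times> B) + card X"
      by (meson add_le_mono card_Un_le le_refl le_trans)
    also have "\<dots> \<le> card B * n + n * card B + card W ^ 2 * n"
      using cX by (simp add: card_cartesian_product A_def)
    finally have "real (card ((B \<times> A \<union> A \<times> B) \<union> X)) \<le> real (card B * n + n * card B + card W ^ 2 * n)"
      by (rule of_nat_mono)
    then show "real (card ((B \<times> A \<union> A \<times> B) \<union> X)) \<le> 2 * real (card B) * real n + real (card W) ^ 2 * real n"
      by (simp add: algebra_simps)
  qed simp
  finally show ?thesis by (simp add: A_def B_def M_def f_def mult.commute)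
qed

context sofic_sequence
begin

text \<open>A window fails to be injective only where two of its finitely many elements collide, and
  every single collision has vanishing frequency.\<close>

lemma window_not_inj_frac:
  assumes "finite W" "W \<subseteq> carrier G"
  shows "(\<lambda>i. real (card {k\<in>{1..d i}. \<not> inj_on (\<lambda>g. T i g k) W}) / real (d i)) \<longlonglongrightarrow> 0"
proof -
  define E where "E = {(s, g). s \<in> W \<and> g \<in> W \<and> s \<noteq> g}"
  have E: "finite E" by (rule finite_subset[of _ "W \<times> W"]) (use assms in \<open>auto simp: E_def\<close>)
  have lim: "(\<lambda>i. \<Sum>p\<in>E. real (card {k\<in>{1..d i}. T i (fst p) k = T i (snd p) k}) / real (d i)) \<longlonglongrightarrow> 0"
    using assms by (intro tendsto_null_sum T_eq_frac) (auto simp: E_def)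
  have "real (card {k\<in>{1..d i}. \<not> inj_on (\<lambda>g. T i g k) W}) / real (d i)
     \<le> (\<Sum>p\<in>E. real (card {k\<in>{1..d i}. T i (fst p) k = T i (snd p) k}) / real (d i))" for i
  proof -
    have "card {k\<in>{1..d i}. \<not> inj_on (\<lambda>g. T i g k) W}
        \<le> card (\<Union>p\<in>E. {k\<in>{1..d i}. T i (fst p) k = T i (snd p) k})"
      using E by (intro card_mono finite_UN_I) (auto simp: inj_on_def E_def)
    also have "\<dots> \<le> (\<Sum>p\<in>E. card {k\<in>{1..d i}. T i (fst p) k = T i (snd p) k})"
      by (rule card_UN_le[OF E])
    finally have "real (card {k\<in>{1..d i}. \<not> inj_on (\<lambda>g. T i g k) W})
        \<le> (\<Sum>p\<in>E. real (card {k\<in>{1..d i}. T i (fst p) k = T i (snd p) k}))"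
      unfolding of_nat_sum[symmetric] by (rule of_nat_mono)
    then show ?thesis by (simp add: divide_right_mono flip: sum_divide_distrib)
  qed
  then show ?thesis
    by (intro tendsto_sandwich[OF _ _ tendsto_const lim]) (auto intro!: always_eventually)
qed

text \<open>Chebyshev's inequality for the centred function \<open>h'\<close>, which is bounded by 2
  C. After division by d^2 the second moment bound consists of the frequency of non-injective
  windows and of a term |W|^2 / d, and both tend to 0.\<close>

lemma window_law_of_large_numbers:
  fixes \<mu> :: "'a measure" and h :: "('g \<Rightarrow> 'a) \<Rightarrow> real"
  assumes "prob_space \<mu>" and W: "finite W" "W \<subseteq> carrier G"
    and h[measurable]: "h \<in> borel_measurable (PiM W (\<lambda>_. \<mu>))"
    and C: "\<And>z. z \<in> space (PiM W (\<lambda>_. \<mu>)) \<Longrightarrow> \<bar>h z\<bar> \<le> C"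
    and \<eta>: "\<eta> > 0"
  shows "(\<lambda>i. measure (PiM {1..d i} (\<lambda>_. \<mu>)) {u \<in> space (PiM {1..d i} (\<lambda>_. \<mu>)).
      \<bar>(\<Sum>k=1..d i. h (\<lambda>g\<in>W. u (T i g k))) / real (d i) - (\<integral>z. h z \<partial>PiM W (\<lambda>_. \<mu>))\<bar> \<ge> \<eta>}) \<longlonglongrightarrow> 0"
proof -
  interpret \<mu>: prob_space \<mu> by fact
  interpret PW: prob_space "PiM W (\<lambda>_. \<mu>)" by (intro prob_space_PiM assms(1))
  define m where "m = (\<integral>z. h z \<partial>PiM W (\<lambda>_. \<mu>))"
  define h' where "h' z = h z - m" for z
  have h'[measurable]: "h' \<in> borel_measurable (PiM W (\<lambda>_. \<mu>))" unfolding h'_def by measurable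
  have hint: "integrable (PiM W (\<lambda>_. \<mu>)) h"
    using C by (intro PW.integrable_const_bound[where B = C]) auto
  have h'0: "(\<integral>z. h' z \<partial>PiM W (\<lambda>_. \<mu>)) = 0"
    unfolding h'_def using hint by (simp add: m_def PW.prob_space)
  have "\<bar>m\<bar> \<le> C"
  proof -
    have "\<bar>m\<bar> \<le> (\<integral>z. \<bar>h z\<bar> \<partial>PiM W (\<lambda>_. \<mu>))" unfolding m_def by (rule integral_abs_bound)
    also have "\<dots> \<le> (\<integral>z. C \<partial>PiM W (\<lambda>_. \<mu>))" using hint C by (intro integral_mono) auto
    finally show ?thesis by (simp add: PW.prob_space)
  qed
  then have C': "\<bar>h' z\<bar> \<le> 2 * C" if "z \<in> space (PiM W (\<lambda>_. \<mu>))" for z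
    using C[OF that] by (auto simp: h'_def)
  define b where "b i = real (card {k\<in>{1..d i}. \<not> inj_on (\<lambda>g. T i g k) W}) / real (d i)" for i
  define p where "p i = measure (PiM {1..d i} (\<lambda>_. \<mu>)) {u \<in> space (PiM {1..d i} (\<lambda>_. \<mu>)).
      \<bar>(\<Sum>k=1..d i. h (\<lambda>g\<in>W. u (T i g k))) / real (d i) - m\<bar> \<ge> \<eta>}" for i
  have bound: "p i \<le> (2 * C)\<^sup>2 * (2 * b i + real (card W)^2 * (1 / real (d i))) / \<eta>\<^sup>2" for i
  proof -
    define M where "M = PiM {1..d i} (\<lambda>_. \<mu>)"
    interpret M: prob_space M unfolding M_def by (intro prob_space_PiM assms(1))
    define S where "S u = (\<Sum>k=1..d i. h' (\<lambda>g\<in>W. u (T i g k)))" for u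
    have win: "(\<lambda>u. \<lambda>g\<in>W. u (T i g k)) \<in> M \<rightarrow>\<^sub>M PiM W (\<lambda>_. \<mu>)" if "k \<in> {1..d i}" for k
      unfolding M_def using T_in W that by (intro measurable_restrict measurable_component_singleton) blast
    have S[measurable]: "S \<in> borel_measurable M"
      unfolding S_def using measurable_compose[OF win h'] by (intro borel_measurable_sum) auto
    have SC: "\<bar>S u\<bar> \<le> real (d i) * (2 * C)" if "u \<in> space M" for u
    proof -
      have "\<bar>S u\<bar> \<le> (\<Sum>k=1..d i. \<bar>h' (\<lambda>g\<in>W. u (T i g k))\<bar>)" unfolding S_def by (rule sum_abs)
      also have "\<dots> \<le> (\<Sum>k=1..d i. 2 * C)"
        using measurable_space[OF win that] by (intro sum_mono C') auto
      finally show ?thesis by simp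
    qed
    have S2: "integrable M (\<lambda>u. (S u)\<^sup>2)"
      using power_mono[OF SC, where n = 2] 
      by (intro M.integrable_const_bound[where B = "(real (d i) * (2 * C))\<^sup>2"]) auto
    have Seq: "(\<Sum>k=1..d i. h (\<lambda>g\<in>W. u (T i g k))) / real (d i) - m = S u / real (d i)" for u
      using d_pos[of i] by (simp add: S_def h'_def sum_subtractf diff_divide_distrib)
    have "p i = M.prob {u \<in> space M. \<bar>S u / real (d i)\<bar> \<ge> \<eta>}"
      unfolding p_def M_def Seq ..
    also have "\<dots> \<le> (\<integral>u. (S u / real (d i))\<^sup>2 \<partial>M) / \<eta>\<^sup>2"
      using S2 \<eta> by (intro M.second_moment_method) (auto simp: power_divide)
    also have "\<dots> = (\<integral>u. (S u)\<^sup>2 \<partial>M) / (real (d i))\<^sup>2 / \<eta>\<^sup>2"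
      by (simp add: power_divide)
    also have "\<dots> \<le> ((2 * C)\<^sup>2 * (2 * real (card {k\<in>{1..d i}. \<not> inj_on (\<lambda>g. T i g k) W}) * real (d i)
        + real (card W)^2 * real (d i))) / (real (d i))\<^sup>2 / \<eta>\<^sup>2"
    proof (intro divide_right_mono)
      show "(\<integral>u. (S u)\<^sup>2 \<partial>M) \<le> ((2 * C)\<^sup>2 * (2 * real (card {k\<in>{1..d i}. \<not> inj_on (\<lambda>g. T i g k) W}) * real (d i)
        + real (card W)^2 * real (d i)))"
        unfolding S_def M_def
        using W T_in bij_T \<open>prob_space \<mu>\<close> h'0 C'
        by (intro second_moment_window_sum h') (auto simp: bij_betw_def)
    qed auto
    also have "\<dots> = (2 * C)\<^sup>2 * (2 * b i + real (card W)^2 * (1 / real (d i))) / \<eta>\<^sup>2"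
    proof -
      have "a * (2 * x * D + w * D) / D\<^sup>2 / e = a * (2 * (x / D) + w * (1 / D)) / e"
        if "D > 0" for a x w D e :: real
      proof -
        have *: "(2 * x * D + w * D) / D\<^sup>2 = 2 * (x / D) + w * (1 / D)"
          using that by (simp add: power2_eq_square add_divide_distrib)
        show ?thesis unfolding times_divide_eq_right[symmetric, of a] * ..
      qed
      then show ?thesis using d_pos[of i] by (simp add: b_def)
    qed
    finally show ?thesis .
  qed
  have "(\<lambda>i. 1 / real (d i)) \<longlonglongrightarrow> 0"
    using filterlim_compose[OF filterlim_real_sequentially d_at_top]
    by (intro tendsto_divide_0[OF tendsto_const] filterlim_at_top_imp_at_infinity)
  then have "(\<lambda>i. (2 * C)\<^sup>2 * (2 * b i + real (card W)^2 * (1 / real (d i))) / \<eta>\<^sup>2)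
      \<longlonglongrightarrow> (2 * C)\<^sup>2 * (2 * 0 + real (card W)^2 * 0) / \<eta>\<^sup>2"
    using window_not_inj_frac[OF W] \<eta> unfolding b_def[symmetric]
    by (intro tendsto_intros) auto
  then have lim: "(\<lambda>i. (2 * C)\<^sup>2 * (2 * b i + real (card W)^2 * (1 / real (d i))) / \<eta>\<^sup>2) \<longlonglongrightarrow> 0"
    by simp
  have "0 \<le> p i" for i by (simp add: p_def)
  then have "p \<longlonglongrightarrow> 0"
    by (intro tendsto_sandwich[OF _ _ tendsto_const lim] always_eventually allI bound)
  then show ?thesis unfolding p_def m_def .
qed

end

section \<open>Continuous functions and their characters\<close>

lemma space_borel_of [simp]: "space (borel_of X) = topspace X"
  unfolding borel_of_def by (rule space_measure_of) (auto dest: openin_subset)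

lemma sets_borel_of: "sets (borel_of X) = sigma_sets (topspace X) {U. openin X U}"
  unfolding borel_of_def by (rule sets_measure_of) (auto dest: openin_subset)

lemma continuous_map_pair_compose:
  fixes h :: "'b::topological_space \<times> 'c::topological_space \<Rightarrow> 'd::topological_space"
  assumes "continuous_map X euclidean f" "continuous_map X euclidean g" "continuous_on UNIV h"
  shows "continuous_map X euclidean (\<lambda>x. h (f x, g x))"
proof -
  have "((\<lambda>x. h (f x, g x)) \<longlongrightarrow> h (f a, g a)) (atin X a)" if "a \<in> topspace X" for a
    by (rule continuous_on_tendsto_compose[OF assms(3) tendsto_Pair])
      (use that assms(1,2) in \<open>auto simp: continuous_map_atin\<close>)
  then show ?thesis by (simp add: continuous_map_atin)
qed

lemma continuous_map_euclidean_compose: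
  fixes h :: "'b::topological_space \<Rightarrow> 'd::topological_space"
  assumes "continuous_map X euclidean f" "continuous_on UNIV h"
  shows "continuous_map X euclidean (\<lambda>x. h (f x))"
  using continuous_map_compose[OF assms(1), of euclidean h] assms(2) by (simp add: o_def)

lemma borel_measurable_continuous_map:
  fixes f :: "'y \<Rightarrow> 'b::topological_space"
  assumes "continuous_map X euclidean f" "sets N = sets (borel_of X)"
  shows "f \<in> borel_measurable N"
proof (rule borel_measurableI)
  fix S :: "'b set" assume "open S"
  have "space N = topspace X" using sets_eq_imp_space_eq[OF assms(2)] by simp
  then have "f -` S \<inter> space N = {x \<in> topspace X. f x \<in> S}" by auto
  moreover have "openin X {x \<in> topspace X. f x \<in> S}"
    using openin_continuous_map_preimage[OF assms(1), of S] \<open>open S\<close> by simp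
  ultimately show "f -` S \<inter> space N \<in> sets N"
    using assms(2) by (auto simp: sets_borel_of)
qed

lemma cfun_restrict_iff:
  "(\<lambda>y\<in>topspace Y. f y) \<in> cfun Y \<longleftrightarrow> continuous_map Y euclidean f"
  unfolding cfun_def by (auto elim: continuous_map_eq)

lemma cfun_continuous: "f \<in> cfun Y \<Longrightarrow> continuous_map Y euclidean f"
  by (simp add: cfun_def)

lemma cfun_restrict: "f \<in> cfun Y \<Longrightarrow> restrict f (topspace Y) = f"
  by (auto simp: cfun_def extensional_restrict)

lemma cfun_const: "(\<lambda>y\<in>topspace Y. c) \<in> cfun Y"
  by (simp add: cfun_restrict_iff)

lemma cfun_add: "f \<in> cfun Y \<Longrightarrow> g \<in> cfun Y \<Longrightarrow> (\<lambda>y\<in>topspace Y. f y + g y) \<in> cfun Y"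
  unfolding cfun_restrict_iff
  using continuous_map_pair_compose[of Y f g "\<lambda>p. fst p + snd p"]
  by (auto intro!: continuous_intros simp: cfun_continuous)

lemma cfun_mult: "f \<in> cfun Y \<Longrightarrow> g \<in> cfun Y \<Longrightarrow> (\<lambda>y\<in>topspace Y. f y * g y) \<in> cfun Y"
  unfolding cfun_restrict_iff
  using continuous_map_pair_compose[OF cfun_continuous cfun_continuous, of f Y g "\<lambda>p. fst p * snd p"]
  by (simp add: continuous_on_mult continuous_on_fst continuous_on_snd)

lemma cfun_cmult: "f \<in> cfun Y \<Longrightarrow> (\<lambda>y\<in>topspace Y. c * f y) \<in> cfun Y"
  unfolding cfun_restrict_iff
  using continuous_map_euclidean_compose[of Y f "\<lambda>z. c * z"]
  by (auto intro!: continuous_intros simp: cfun_continuous)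

lemma cfun_cnj: "f \<in> cfun Y \<Longrightarrow> (\<lambda>y\<in>topspace Y. cnj (f y)) \<in> cfun Y"
  unfolding cfun_restrict_iff
  using continuous_map_euclidean_compose[of Y f cnj]
  by (auto intro!: continuous_intros simp: cfun_continuous)

lemma cfun_bounded:
  assumes "compact_space Y" "f \<in> cfun Y"
  obtains B where "B > 0" "\<And>y. y \<in> topspace Y \<Longrightarrow> cmod (f y) \<le> B"
proof -
  have "compactin euclidean (f ` topspace Y)"
    using assms by (intro image_compactin[OF _ cfun_continuous]) (auto simp: compact_space_def)
  then have "bounded (f ` topspace Y)" by (simp add: compact_imp_bounded)
  then show ?thesis using that by (auto simp: bounded_pos)
qed

text \<open>Gelfand's argument. If the character differs from evaluation at every point, then for
  each y some function in its kernel does not vanish at y. By compactness finitely many of them have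
  no common zero, so the sum of their squared moduli is an invertible element of the kernel, which
  is absurd.\<close>

lemma unital_hom_point_evaluation:
  assumes Y: "compact_space Y" and \<phi>: "\<phi> \<in> unital_hom Y n" and k: "k \<in> {1..n}"
  shows "\<exists>y\<in>topspace Y. \<forall>f\<in>cfun Y. \<phi> f k = f y"
proof (rule ccontr)
  assume "\<not> ?thesis"
  then have "\<forall>y\<in>topspace Y. \<exists>f. f \<in> cfun Y \<and> \<phi> f k \<noteq> f y" by blast
  then obtain F where F: "\<And>y. y \<in> topspace Y \<Longrightarrow> F y \<in> cfun Y \<and> \<phi> (F y) k \<noteq> F y y" by metis
  have one: "\<phi> (\<lambda>y\<in>topspace Y. 1) k = 1"
    and add: "\<And>f g. f \<in> cfun Y \<Longrightarrow> g \<in> cfun Y \<Longrightarrow> \<phi> (\<lambda>y\<in>topspace Y. f y + g y) k = \<phi> f k + \<phi> g k"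
    and cmult: "\<And>c f. f \<in> cfun Y \<Longrightarrow> \<phi> (\<lambda>y\<in>topspace Y. c * f y) k = c * \<phi> f k"
    and mult: "\<And>f g. f \<in> cfun Y \<Longrightarrow> g \<in> cfun Y \<Longrightarrow> \<phi> (\<lambda>y\<in>topspace Y. f y * g y) k = \<phi> f k * \<phi> g k"
    using \<phi> k by (auto simp: unital_hom_def)
  have const: "\<phi> (\<lambda>y\<in>topspace Y. c) k = c" for c
    using cmult[of "\<lambda>y\<in>topspace Y. 1" c] one by (simp add: cfun_const cong: restrict_cong)
  define H where "H y = (\<lambda>x\<in>topspace Y. F y x + (\<lambda>x\<in>topspace Y. - \<phi> (F y) k) x)" for y
  have H: "H y \<in> cfun Y" "\<phi> (H y) k = 0" if "y \<in> topspace Y" for y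
  proof -
    show "H y \<in> cfun Y" unfolding H_def using F[OF that] by (intro cfun_add cfun_const) auto
    have "\<phi> (H y) k = \<phi> (F y) k + \<phi> (\<lambda>x\<in>topspace Y. - \<phi> (F y) k) k"
      unfolding H_def using F[OF that] by (intro add cfun_const) auto
    then show "\<phi> (H y) k = 0" using const by simp
  qed
  define U where "U y = {x \<in> topspace Y. H y x \<in> - {0}}" for y
  have U: "openin Y (U y)" "y \<in> U y" if "y \<in> topspace Y" for y
  proof -
    show "openin Y (U y)" unfolding U_def
      using cfun_continuous[OF H(1)[OF that]] by (rule openin_continuous_map_preimage) auto
    show "y \<in> U y" using F[OF that] that by (auto simp: U_def H_def)
  qed
  have "\<exists>\<F>. finite \<F> \<and> \<F> \<subseteq> U ` topspace Y \<and> topspace Y \<subseteq> \<Union>\<F>"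
    using Y[unfolded compact_space_alt, rule_format, of "U ` topspace Y"] U by blast
  then obtain D where D: "finite D" "D \<subseteq> topspace Y" "topspace Y \<subseteq> (\<Union>y\<in>D. U y)"
    by (metis finite_subset_image)
  \<comment> \<open>The squared moduli are written as products with the conjugate, so that
    multiplicativity alone keeps them in the kernel.\<close>
  define K where "K E = (\<lambda>x\<in>topspace Y. \<Sum>y\<in>E. H y x * cnj (H y x))" for E
  have K: "K E \<in> cfun Y \<and> \<phi> (K E) k = 0" if "finite E" "E \<subseteq> topspace Y" for E
    using that
  proof (induction E rule: finite_induct)
    case empty
    have "K {} = (\<lambda>y\<in>topspace Y. 0)" unfolding K_def by (simp only: sum.empty)
    then show ?case using const[of 0] cfun_const[of 0 Y] by (simp only: simp_thms)
  next
    case (insert y E)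
    define L where "L = (\<lambda>x\<in>topspace Y. H y x * (\<lambda>x\<in>topspace Y. cnj (H y x)) x)"
    have y: "y \<in> topspace Y" and E: "K E \<in> cfun Y" "\<phi> (K E) k = 0" using insert by auto
    have L: "L \<in> cfun Y" unfolding L_def by (intro cfun_mult cfun_cnj H y)
    have "\<phi> L k = \<phi> (H y) k * \<phi> (\<lambda>x\<in>topspace Y. cnj (H y x)) k"
      unfolding L_def by (intro mult cfun_cnj H y)
    then have L0: "\<phi> L k = 0" using H y by simp
    have "K (insert y E) = (\<lambda>x\<in>topspace Y. L x + K E x)"
      using insert by (auto simp: K_def L_def)
    then show ?case using cfun_add[OF L E(1)] add[OF L E(1)] L0 E by (simp only: add_0 simp_thms)
  qed
  have nz: "K D x \<noteq> 0" if x: "x \<in> topspace Y" for x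
  proof -
    obtain y where "y \<in> D" "H y x \<noteq> 0" using D x by (auto simp: U_def)
    then have "(\<Sum>y\<in>D. (cmod (H y x))\<^sup>2) > 0"
      using D by (intro sum_pos2[of D y]) auto
    moreover have "K D x = complex_of_real (\<Sum>y\<in>D. (cmod (H y x))\<^sup>2)"
      using x unfolding K_def of_real_sum complex_norm_square by simp
    ultimately show ?thesis by (metis less_irrefl of_real_eq_0_iff)
  qed
  define R where "R = (\<lambda>x\<in>topspace Y. inverse (K D x))"
  have KD: "K D \<in> cfun Y" "\<phi> (K D) k = 0" using K D by auto
  have "continuous_map Y euclidean (\<lambda>x. inverse (K D x))"
  proof -
    have "continuous_map Y (top_of_set (- {0})) (K D)"
      using cfun_continuous[OF KD(1)] nz by (auto simp: continuous_map_in_subtopology)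
    moreover have "continuous_map (top_of_set (- {0})) euclidean (inverse :: complex \<Rightarrow> complex)"
      by (simp add: continuous_on_inverse)
    ultimately have "continuous_map Y euclidean (inverse \<circ> K D)" by (rule continuous_map_compose)
    then show ?thesis by (simp add: o_def)
  qed
  then have R: "R \<in> cfun Y" by (simp add: R_def cfun_restrict_iff)
  have "\<phi> (\<lambda>x\<in>topspace Y. K D x * R x) k = 0" using mult[OF KD(1) R] KD by simp
  moreover have "(\<lambda>x\<in>topspace Y. K D x * R x) = (\<lambda>x\<in>topspace Y. 1)"
    using nz by (auto simp: R_def)
  ultimately show False using one by (metis zero_neq_one)
qed

lemma point_evaluation_unital_hom:
  assumes "\<And>k. k \<in> {1..n} \<Longrightarrow> y k \<in> topspace Y"
  shows "(\<lambda>f\<in>cfun Y. \<lambda>k\<in>{1..n}. f (y k)) \<in> unital_hom Y n"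
  unfolding unital_hom_def using assms
  by (auto simp: cfun_const cfun_add cfun_mult cfun_cmult cfun_cnj)

text \<open>Compactness covers \<open>Y\<close> by finitely many open cells, on each of which all
  functions in \<open>Q\<close> stay within \<epsilon> of their value at a centre; \<open>J\<close>
  is the number of a cell containing the point and \<open>y\<close> lists the centres.\<close>

lemma finite_continuous_quantization:
  assumes Y: "compact_space Y" "sets N = sets (borel_of Y)" and Q: "finite Q" "Q \<subseteq> cfun Y" and "\<epsilon> > 0"
  obtains n :: nat and y J where "J \<in> N \<rightarrow>\<^sub>M count_space UNIV"
    "\<And>x. x \<in> topspace Y \<Longrightarrow> J x < n" "\<And>j. j < n \<Longrightarrow> y j \<in> topspace Y"
    "\<And>x f. x \<in> topspace Y \<Longrightarrow> f \<in> Q \<Longrightarrow> cmod (f x - f (y (J x))) < \<epsilon>"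
proof -
  define U where "U y = topspace Y \<inter> (\<Inter>f\<in>Q. {x \<in> topspace Y. f x \<in> ball (f y) \<epsilon>})" for y
  have U: "openin Y (U y)" for y
  proof -
    have "openin Y ((\<Inter>f\<in>Q. {x \<in> topspace Y. f x \<in> ball (f y) \<epsilon>}) \<inter> topspace Y)"
      using Q by (intro openin_INT openin_continuous_map_preimage[OF cfun_continuous]) auto
    then show ?thesis by (simp add: U_def Int_commute)
  qed
  have U': "y \<in> U y" if "y \<in> topspace Y" for y
    using that \<open>\<epsilon> > 0\<close> by (auto simp: U_def)
  have "\<exists>\<F>. finite \<F> \<and> \<F> \<subseteq> U ` topspace Y \<and> topspace Y \<subseteq> \<Union>\<F>"
    using Y(1)[unfolded compact_space_alt, rule_format, of "U ` topspace Y"] U U' by blast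
  then obtain D where D: "finite D" "D \<subseteq> topspace Y" "topspace Y \<subseteq> (\<Union>y\<in>D. U y)"
    by (metis finite_subset_image)
  obtain ys where ys: "set ys = D" using D finite_list by metis
  \<comment> \<open>Choosing the least admissible index makes overlapping cells into a measurable
    partition.\<close>
  define J where "J x = (LEAST j. j < length ys \<and> x \<in> U (ys ! j))" for x
  have ex: "\<exists>j. j < length ys \<and> x \<in> U (ys ! j)" if x: "x \<in> topspace Y" for x
    proof -
    obtain y where "y \<in> set ys" "x \<in> U y" using D x ys by blast
    then show ?thesis by (metis in_set_conv_nth)
  qed
  have J: "J x < length ys \<and> x \<in> U (ys ! J x)" if "x \<in> topspace Y" for x
    unfolding J_def using LeastI_ex[OF ex[OF that]] .
  have sp: "space N = topspace Y" using sets_eq_imp_space_eq[OF Y(2)] by simp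
  have UN: "U y \<in> sets N" for y using U Y(2) by (auto simp: sets_borel_of)
  have "J \<in> N \<rightarrow>\<^sub>M count_space UNIV"
  proof -
    have "Measurable.pred N (\<lambda>x. j < length ys \<and> x \<in> U (ys ! j))" for j
      using UN by (intro pred_intros_logic) (auto simp: pred_sets2)
    then show ?thesis unfolding J_def by measurable
  qed
  moreover have "ys ! j \<in> topspace Y" if "j < length ys" for j using that ys D by auto
  moreover have "cmod (f x - f (ys ! J x)) < \<epsilon>" if "x \<in> topspace Y" "f \<in> Q" for x f
    using J[OF that(1)] that by (auto simp: U_def dist_norm norm_minus_commute)
  ultimately show ?thesis using that[of J "length ys" "\<lambda>j. ys ! j"] J by blast
qed

section \<open>Averages over sites and closeness in mean\<close>

lemma avg_le_const:
  fixes f :: "nat \<Rightarrow> real"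
  assumes "\<And>k. k \<in> {1..n} \<Longrightarrow> f k \<le> c" "c \<ge> 0"
  shows "(\<Sum>k=1..n. f k) / real n \<le> c"
proof -
  have "(\<Sum>k=1..n. f k) \<le> (\<Sum>k=1..n. c)" using assms by (intro sum_mono) auto
  then show ?thesis using assms by (cases "n = 0") (auto simp: field_simps)
qed

lemma avg_mono:
  fixes f :: "nat \<Rightarrow> real"
  assumes "\<And>k. k \<in> {1..n} \<Longrightarrow> f k \<le> g k"
  shows "(\<Sum>k=1..n. f k) / real n \<le> (\<Sum>k=1..n. g k) / real n"
  using assms by (intro divide_right_mono sum_mono) auto

text \<open>Cauchy-Schwarz; it turns the bounds on \<open>norm_two\<close> that define microstates
  into L1 bounds.\<close>

lemma avg_le_root_mean_square:
  fixes f :: "nat \<Rightarrow> real"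
  shows "(\<Sum>k=1..n. f k) / real n \<le> sqrt ((\<Sum>k=1..n. (f k)\<^sup>2) / real n)"
proof (cases "n = 0")
  case False
  have "((\<Sum>k=1..n. f k))\<^sup>2 \<le> (\<Sum>k=1..n. (f k)\<^sup>2) * real n"
    using Cauchy_Schwarz_ineq_sum[of f "\<lambda>_. 1" "{1..n}"] by simp
  then have "((\<Sum>k=1..n. f k) / real n)\<^sup>2 \<le> (\<Sum>k=1..n. (f k)\<^sup>2) / real n"
    using False by (simp add: power2_eq_square field_simps)
  then show ?thesis by (rule real_le_rsqrt)
qed simp

lemma tendsto_zero_approx:
  fixes f :: "'x \<Rightarrow> real"
  assumes "\<And>e. e > 0 \<Longrightarrow> \<exists>g. (g \<longlongrightarrow> 0) F \<and> (\<forall>\<^sub>F x in F. \<bar>f x\<bar> \<le> \<bar>g x\<bar> + e)"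
  shows "(f \<longlongrightarrow> 0) F"
proof (rule tendstoI)
  fix e :: real assume "e > 0"
  then obtain g where g: "(g \<longlongrightarrow> 0) F" "\<forall>\<^sub>F x in F. \<bar>f x\<bar> \<le> \<bar>g x\<bar> + e / 2"
    using assms[of "e/2"] by auto
  have "\<forall>\<^sub>F x in F. dist (g x) 0 < e / 2" using g(1) \<open>e > 0\<close> by (intro tendstoD) auto
  with g(2) show "\<forall>\<^sub>F x in F. dist (f x) 0 < e"
    by eventually_elim (simp add: dist_real_def)
qed

text \<open>The L1 mean is used because it passes directly through sums, products with bounded
  functions and uniform limits, and because Markov's inequality converts it into a bound on the
  number of bad sites.\<close>

definition L1_close where
  "L1_close F n u v f \<longleftrightarrow>
     ((\<lambda>x. (\<Sum>k=1..n x. cmod (f (u x k) - f (v x k))) / real (n x :: nat)) \<longlongrightarrow> 0) F"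

text \<open>A single pointwise inequality covers all closure steps of the induction over C(Y). Two
  dominating functions are allowed because of sums and products; the error \<open>e\<close> is there
  for uniform limits.\<close>

lemma L1_close_domination:
  assumes "\<And>e. e > 0 \<Longrightarrow> \<exists>g c h c'. L1_close F n u v g \<and> L1_close F n u v h \<and> c \<ge> 0 \<and> c' \<ge> 0 \<and>
     (\<forall>y\<in>Y. \<forall>y'\<in>Y. cmod (f y - f y') \<le> c * cmod (g y - g y') + c' * cmod (h y - h y') + e)"
    and "\<forall>\<^sub>F x in F. \<forall>k\<in>{1..n x}. u x k \<in> Y \<and> v x k \<in> Y"
  shows "L1_close F n u v f"
  unfolding L1_close_def
proof (rule tendsto_zero_approx)
  fix e :: real assume e: "e > 0"
  obtain g c h c' where g: "L1_close F n u v g" "L1_close F n u v h" "c \<ge> 0" "c' \<ge> 0"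
    and le: "\<And>y y'. y \<in> Y \<Longrightarrow> y' \<in> Y \<Longrightarrow> cmod (f y - f y') \<le> c * cmod (g y - g y') + c' * cmod (h y - h y') + e"
    using assms(1)[OF e] by blast
  let ?a = "\<lambda>f x. (\<Sum>k=1..n x. cmod (f (u x k) - f (v x k))) / real (n x)"
  show "\<exists>g. (g \<longlongrightarrow> 0) F \<and> (\<forall>\<^sub>F x in F. \<bar>?a f x\<bar> \<le> \<bar>g x\<bar> + e)"
  proof (intro exI conjI)
    show "((\<lambda>x. c * ?a g x + c' * ?a h x) \<longlongrightarrow> 0) F"
      using g unfolding L1_close_def by (intro tendsto_add_zero tendsto_mult_right_zero)
    show "\<forall>\<^sub>F x in F. \<bar>?a f x\<bar> \<le> \<bar>c * ?a g x + c' * ?a h x\<bar> + e"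
      using assms(2)
    proof eventually_elim
      case (elim x)
      have pos: "?a f x \<ge> 0" "?a g x \<ge> 0" "?a h x \<ge> 0" for f by (auto intro!: divide_nonneg_nonneg sum_nonneg)
      have "?a f x - (c * ?a g x + c' * ?a h x)
         = (\<Sum>k=1..n x. cmod (f (u x k) - f (v x k)) - (c * cmod (g (u x k) - g (v x k)) + c' * cmod (h (u x k) - h (v x k)))) / real (n x)"
        by (simp add: sum_subtractf sum.distrib sum_distrib_left diff_divide_distrib add_divide_distrib)
      also have "\<dots> \<le> e"
        using e elim le by (intro avg_le_const) (auto simp: algebra_simps)
      finally have "?a f x \<le> c * ?a g x + c' * ?a h x + e" by linarith
      then show ?case using abs_of_nonneg[OF pos(1)[of f]] abs_ge_self[of "c * ?a g x + c' * ?a h x"] by linarith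
    qed
  qed
qed

section \<open>Microstates of a topological model\<close>

locale sofic_model = sofic_sequence G d \<sigma> for G :: "('g, 'r) monoid_scheme" (structure) and d \<sigma> +
  fixes Y :: "'y topology" and N :: "'y measure" and b :: "'g \<Rightarrow> 'y \<Rightarrow> 'y"
    and P :: "('y \<Rightarrow> complex) set"
  assumes model: "topological_model G Y N b P"
begin

lemma compact_Y: "compact_space Y"
  and metrizable_Y: "metrizable_space Y"
  and sets_N: "sets N = sets (borel_of Y)"
  and pmp_N: "pmp_action G N b"
  and continuous_b: "g \<in> carrier G \<Longrightarrow> continuous_map Y Y (b g)"
  and finite_P: "finite P"
  and P_cfun: "p \<in> P \<Longrightarrow> p \<in> cfun Y"
  and P_nonneg: "p \<in> P \<Longrightarrow> y \<in> topspace Y \<Longrightarrow> p y \<in> \<real>\<^sub>\<ge>\<^sub>0"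
  and P_sum: "y \<in> topspace Y \<Longrightarrow> (\<Sum>p\<in>P. p y) = 1"
  and P_generating: "dynamically_generating G Y b P"
  using model by (auto simp: topological_model_def partition_of_unity_def)

lemma space_N: "space N = topspace Y"
  using sets_eq_imp_space_eq[OF sets_N] by simp

sublocale N: prob_space N
  using pmp_N by (simp add: pmp_action_def)

sublocale act: group_action G "topspace Y" b
  using pmp_N by (simp add: pmp_action_def space_N)

lemma Y_nonempty: "topspace Y \<noteq> {}"
  using N.not_empty space_N by simp

lemma P_nonempty: "P \<noteq> {}"
  using P_sum Y_nonempty by force

lemma P_le_one: assumes "p \<in> P" "y \<in> topspace Y" shows "cmod (p y) \<le> 1"
proof -
  have *: "cmod (p y) = Re (p y)" if "p \<in> P" for p
    using P_nonneg[OF that assms(2)] by (auto simp: complex_nonneg_Reals_iff complex_eq_iff cmod_def)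
  have "cmod (p y) \<le> (\<Sum>p\<in>P. cmod (p y))" using finite_P assms by (intro member_le_sum) auto
  also have "\<dots> = Re (\<Sum>p\<in>P. p y)" using * by simp
  finally show ?thesis using P_sum assms by simp
qed

abbreviation C :: "'g \<Rightarrow> 'y \<Rightarrow> 'y" where "C s \<equiv> b (inv s)"

lemma C_in: "s \<in> carrier G \<Longrightarrow> y \<in> topspace Y \<Longrightarrow> C s y \<in> topspace Y"
  using act.element_image by blast

text \<open>\<open>C\<close> reverses products in the same way as \<open>T\<close>: C_g C_s = C_{sg}
  on points and T_g T_s = T_{sg} at most sites. This match is what makes a comparison of p(C_s y_k)
  with p(y at T_s k) stable under further translation.\<close>

lemma C_mult: "s \<in> carrier G \<Longrightarrow> g \<in> carrier G \<Longrightarrow> y \<in> topspace Y \<Longrightarrow> C g (C s y) = C (s \<otimes> g) y"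
  using act.composition_rule[of y "inv g" "inv s"] by (simp add: inv_mult_group)

lemma C_one: "y \<in> topspace Y \<Longrightarrow> C \<one> y = y"
  using act.id_eq_one by (metis inv_one restrict_apply')

lemma continuous_C: "s \<in> carrier G \<Longrightarrow> continuous_map Y Y (C s)"
  by (rule continuous_b) simp

lemma translate_in: "s \<in> carrier G \<Longrightarrow> f \<in> cfun Y \<Longrightarrow> translate G Y b s f \<in> cfun Y"
  unfolding translate_def cfun_restrict_iff
  using continuous_map_compose[OF continuous_C cfun_continuous] by (simp add: o_def)

lemma translate_apply: "y \<in> topspace Y \<Longrightarrow> translate G Y b s f y = f (C s y)"
  by (simp add: translate_def)

lemma cfun_measurable: "f \<in> cfun Y \<Longrightarrow> f \<in> borel_measurable N"
  by (rule borel_measurable_continuous_map[OF cfun_continuous sets_N])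

lemma cfun_integrable: assumes "f \<in> cfun Y" shows "integrable N f"
proof -
  obtain B where "\<And>y. y \<in> topspace Y \<Longrightarrow> cmod (f y) \<le> B" using cfun_bounded[OF compact_Y assms] by metis
  then show ?thesis using assms by (intro N.integrable_const_bound[of _ B] cfun_measurable) (auto simp: space_N)
qed

text \<open>The functions all of whose translates, and conjugates of translates, satisfy
  \<open>Q\<close> form an invariant unital C*-subalgebra containing \<open>P\<close>; by dynamical
  generation it is all of C(Y).\<close>

lemma cfun_induct [consumes 1, case_names one gen add cmult mult lim]:
  assumes f: "f \<in> cfun Y"
    and one: "Q (\<lambda>y\<in>topspace Y. 1)"
    and gen: "\<And>s p. s \<in> carrier G \<Longrightarrow> p \<in> P \<Longrightarrow> Q (translate G Y b s p)"
    and add: "\<And>f g. f \<in> cfun Y \<Longrightarrow> g \<in> cfun Y \<Longrightarrow> Q f \<Longrightarrow> Q g \<Longrightarrow> Q (\<lambda>y\<in>topspace Y. f y + g y)"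
    and cmult: "\<And>c f. f \<in> cfun Y \<Longrightarrow> Q f \<Longrightarrow> Q (\<lambda>y\<in>topspace Y. c * f y)"
    and mult: "\<And>f g. f \<in> cfun Y \<Longrightarrow> g \<in> cfun Y \<Longrightarrow> Q f \<Longrightarrow> Q g \<Longrightarrow> Q (\<lambda>y\<in>topspace Y. f y * g y)"
    and lim: "\<And>f. f \<in> cfun Y \<Longrightarrow> (\<And>e. e > 0 \<Longrightarrow> \<exists>g\<in>cfun Y. Q g \<and> (\<forall>y\<in>topspace Y. cmod (f y - g y) \<le> e)) \<Longrightarrow> Q f"
  shows "Q f"
proof -
  let ?t = "\<lambda>s. translate G Y b s"
  let ?c = "\<lambda>f. (\<lambda>y\<in>topspace Y. cnj (f y))"
  \<comment> \<open>Quantifying over all translates builds in invariance. Carrying the conjugates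
    along makes the set self-adjoint without asking of \<open>Q\<close> that it be closed under
    conjugation.\<close>
  define A where "A = {f \<in> cfun Y. \<forall>s\<in>carrier G. Q (?t s f) \<and> Q (?c (?t s f))}"
  have t_add: "?t s (\<lambda>y\<in>topspace Y. f y + g y) = (\<lambda>y\<in>topspace Y. ?t s f y + ?t s g y)"
    and t_cmult: "?t s (\<lambda>y\<in>topspace Y. c * f y) = (\<lambda>y\<in>topspace Y. c * ?t s f y)"
    and t_mult: "?t s (\<lambda>y\<in>topspace Y. f y * g y) = (\<lambda>y\<in>topspace Y. ?t s f y * ?t s g y)"
    and t_cnj: "?t s (?c f) = ?c (?t s f)"
    and t_const: "?t s (\<lambda>y\<in>topspace Y. c) = (\<lambda>y\<in>topspace Y. c)"
    if "s \<in> carrier G" for s f g c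
    using C_in[OF that] by (auto simp: translate_def fun_eq_iff)
  have c_add: "?c (\<lambda>y\<in>topspace Y. f y + g y) = (\<lambda>y\<in>topspace Y. ?c f y + ?c g y)"
    and c_cmult: "?c (\<lambda>y\<in>topspace Y. c * f y) = (\<lambda>y\<in>topspace Y. cnj c * ?c f y)"
    and c_mult: "?c (\<lambda>y\<in>topspace Y. f y * g y) = (\<lambda>y\<in>topspace Y. ?c f y * ?c g y)"
    for f g c by auto
  have c_cnj: "?c (?c f) = f" if "f \<in> cfun Y" for f
  proof -
    have "?c (?c f) = restrict f (topspace Y)" by auto
    then show ?thesis using cfun_restrict[OF that] by (rule trans)
  qed
  have c_one: "?c (\<lambda>y\<in>topspace Y. 1) = (\<lambda>y\<in>topspace Y. 1)" by auto
  have "unital_C_star_subalgebra Y A"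
    unfolding unital_C_star_subalgebra_def
  proof (intro conjI ballI allI impI)
    show "A \<subseteq> cfun Y" by (auto simp: A_def)
    show "(\<lambda>y\<in>topspace Y. 1) \<in> A" using one by (simp add: A_def t_const c_one cfun_const del: restrict_apply)
    show "(\<lambda>y\<in>topspace Y. f y + g y) \<in> A" if "f \<in> A" "g \<in> A" for f g
      using that by (simp add: A_def t_add c_add add cfun_add cfun_cnj translate_in del: restrict_apply)
    show "(\<lambda>y\<in>topspace Y. c * f y) \<in> A" if "f \<in> A" for c f
      using that by (simp add: A_def t_cmult c_cmult cmult cfun_cmult cfun_cnj translate_in del: restrict_apply)
    show "(\<lambda>y\<in>topspace Y. f y * g y) \<in> A" if "f \<in> A" "g \<in> A" for f g
      using that by (simp add: A_def t_mult c_mult mult cfun_mult cfun_cnj translate_in del: restrict_apply)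
    show "?c f \<in> A" if "f \<in> A" for f
      using that by (simp add: A_def t_cnj c_cnj cfun_cnj translate_in del: restrict_apply)
    show "f \<in> A" if f: "f \<in> cfun Y" and *: "\<forall>e>0. \<exists>g\<in>A. \<forall>y\<in>topspace Y. cmod (f y - g y) \<le> e" for f
      unfolding A_def
    proof (intro CollectI conjI f ballI)
      fix s assume s: "s \<in> carrier G"
      show "Q (?t s f)"
      proof (rule lim)
        fix e :: real assume "e > 0"
        then obtain g where g: "g \<in> A" "\<And>y. y \<in> topspace Y \<Longrightarrow> cmod (f y - g y) \<le> e" using * by blast
        then show "\<exists>g\<in>cfun Y. Q g \<and> (\<forall>y\<in>topspace Y. cmod (?t s f y - g y) \<le> e)"
          using s C_in by (intro bexI[of _ "?t s g"]) (auto simp: A_def translate_apply translate_in)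
      qed (intro translate_in s f)
      show "Q (?c (?t s f))"
      proof (rule lim)
        fix e :: real assume "e > 0"
        then obtain g where g: "g \<in> A" "\<And>y. y \<in> topspace Y \<Longrightarrow> cmod (f y - g y) \<le> e" using * by blast
        then show "\<exists>g\<in>cfun Y. Q g \<and> (\<forall>y\<in>topspace Y. cmod (?c (?t s f) y - g y) \<le> e)"
          using s C_in by (intro bexI[of _ "?c (?t s g)"])
            (auto simp: A_def translate_apply translate_in cfun_cnj simp flip: complex_cnj_diff)
      qed (intro cfun_cnj translate_in s f)
    qed
  qed
  moreover have "?t g ` A \<subseteq> A" if g: "g \<in> carrier G" for g
  proof (rule image_subsetI)
    fix f assume f: "f \<in> A"
    have "?t s (?t g f) = ?t (s \<otimes> g) f" if s: "s \<in> carrier G" for s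
      using C_mult[OF s g] C_in[OF s] by (auto simp: translate_def fun_eq_iff)
    then show "?t g f \<in> A" using f g by (auto simp: A_def translate_in)
  qed
  moreover have "P \<subseteq> A"
  proof
    fix p assume p: "p \<in> P"
    \<comment> \<open>Partition functions are real-valued, so the clause about conjugates repeats
      the one about translates.\<close>
    have "?c (?t s p) = ?t s p" if s: "s \<in> carrier G" for s
      using P_nonneg[OF p C_in[OF s]] 
      by (auto simp: translate_def fun_eq_iff complex_nonneg_Reals_iff complex_eq_iff)
    then show "p \<in> A" using gen p P_cfun by (auto simp: A_def)
  qed
  ultimately have "A = cfun Y" using P_generating by (auto simp: dynamically_generating_def)
  then have "f \<in> A" using f by simp
  then have "Q (?t \<one> f)" by (simp add: A_def)
  moreover have "?t \<one> f = restrict f (topspace Y)" using C_one by (auto simp: translate_def)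
  ultimately have "Q (restrict f (topspace Y))" by simp
  then have "Q f" using cfun_restrict[OF f] by (simp only:)
  then show ?thesis .
qed

text \<open>Closeness in mean survives sums, multiples and uniform limits, and also products, since
  continuous functions on the compact space are bounded. Translates of \<open>P\<close> therefore
  control every continuous function.\<close>

lemma L1_close_cfun:
  assumes f: "f \<in> cfun Y"
    and uv: "\<forall>\<^sub>F x in F. \<forall>k\<in>{1..n x}. u x k \<in> topspace Y \<and> v x k \<in> topspace Y"
    and gen: "\<And>s p. s \<in> carrier G \<Longrightarrow> p \<in> P \<Longrightarrow> L1_close F n u v (translate G Y b s p)"
  shows "L1_close F n u v f"
  using f
proof (induction rule: cfun_induct)
  case one
  show ?case
    by (rule L1_close_domination[OF _ uv], rule exI[of _ "\<lambda>_. 0"], rule exI[of _ 0], rule exI[of _ "\<lambda>_. 0"], rule exI[of _ 0])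
      (auto simp: L1_close_def)
next
  case (add f g)
  have le: "cmod (f y + g y - (f y' + g y')) \<le> cmod (f y - f y') + cmod (g y - g y')" for y y'
    using norm_triangle_ineq[of "f y - f y'" "g y - g y'"] by (simp add: algebra_simps)
  show ?case
    by (rule L1_close_domination[OF _ uv], rule exI[of _ f], rule exI[of _ 1], rule exI[of _ g], rule exI[of _ 1])
      (use add in \<open>auto intro!: order_trans[OF le]\<close>)
next
  case (cmult c f)
  show ?case
    by (rule L1_close_domination[OF _ uv], rule exI[of _ f], rule exI[of _ "cmod c"], rule exI[of _ f], rule exI[of _ 0])
      (use cmult in \<open>auto simp: norm_mult simp flip: right_diff_distrib\<close>)
next
  case (mult f g)
  obtain B where B: "B > 0" "\<And>y. y \<in> topspace Y \<Longrightarrow> cmod (f y) \<le> B" using cfun_bounded[OF compact_Y mult(1)] by blast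
  obtain B' where B': "B' > 0" "\<And>y. y \<in> topspace Y \<Longrightarrow> cmod (g y) \<le> B'" using cfun_bounded[OF compact_Y mult(2)] by blast
  have le: "cmod (f y * g y - f y' * g y') \<le> B' * cmod (f y - f y') + B * cmod (g y - g y') + e"
    if "y \<in> topspace Y" "y' \<in> topspace Y" "e > 0" for y y' e
  proof -
    have "cmod (f y * g y - f y' * g y') = cmod (g y * (f y - f y') + f y' * (g y - g y'))"
      by (simp add: algebra_simps)
    also have "\<dots> \<le> cmod (g y) * cmod (f y - f y') + cmod (f y') * cmod (g y - g y')"
      using norm_triangle_ineq[of "g y * (f y - f y')" "f y' * (g y - g y')"] by (simp add: norm_mult)
    also have "\<dots> \<le> B' * cmod (f y - f y') + B * cmod (g y - g y')"
      using that B B' by (intro add_mono mult_right_mono) auto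
    finally show ?thesis using that by simp
  qed
  show ?case
    by (rule L1_close_domination[OF _ uv], rule exI[of _ f], rule exI[of _ B'], rule exI[of _ g], rule exI[of _ B])
      (use mult le B B' in auto)
next
  case (lim f)
  show ?case
  proof (rule L1_close_domination[OF _ uv])
    fix e :: real assume "e > 0"
    then obtain g where g: "g \<in> cfun Y" "L1_close F n u v g" "\<And>y. y \<in> topspace Y \<Longrightarrow> cmod (f y - g y) \<le> e / 2"
      using lim(2)[of "e/2"] by auto
    have "cmod (f y - f y') \<le> cmod (g y - g y') + e" if "y \<in> topspace Y" "y' \<in> topspace Y" for y y'
    proof -
      have "f y - f y' = (g y - g y') + (f y - g y) - (f y' - g y')" by simp
      then have "cmod (f y - f y') \<le> cmod (g y - g y') + cmod (f y - g y) + cmod (f y' - g y')"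
        by (metis norm_triangle_ineq norm_triangle_ineq4 order_trans add_mono_thms_linordered_semiring(3))
      then show ?thesis using g(3)[OF that(1)] g(3)[OF that(2)] by simp
    qed
    then show "\<exists>g c h c'. L1_close F n u v g \<and> L1_close F n u v h \<and> c \<ge> 0 \<and> c' \<ge> 0 \<and>
        (\<forall>y\<in>topspace Y. \<forall>y'\<in>topspace Y. cmod (f y - f y') \<le> c * cmod (g y - g y') + c' * cmod (h y - h y') + e)"
      using g by (intro exI[of _ g] exI[of _ 1] exI[of _ g] exI[of _ 0]) auto
  qed
qed (fact gen)

end

declare One_nat_def [simp del]

definition point_evaluation :: "'y topology \<Rightarrow> nat \<Rightarrow> (nat \<Rightarrow> 'y) \<Rightarrow> ('y \<Rightarrow> complex) \<Rightarrow> nat \<Rightarrow> complex" where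
  "point_evaluation Y n y = (\<lambda>f\<in>cfun Y. \<lambda>k\<in>{1..n}. f (y k))"

lemma point_evaluation_apply [simp]:
  "f \<in> cfun Y \<Longrightarrow> k \<in> {1..n} \<Longrightarrow> point_evaluation Y n y f k = f (y k)"
  by (simp add: point_evaluation_def)

section \<open>Homomorphisms as tuples of points, and the filter of good microstates\<close>

context sofic_model
begin

lemma product_set_mono: "F \<subseteq> F' \<Longrightarrow> m \<le> m' \<Longrightarrow> product_set G Y b P F m \<subseteq> product_set G Y b P F' m'"
proof
  fix f assume "F \<subseteq> F'" "m \<le> m'" "f \<in> product_set G Y b P F m"
  then obtain j s p where "f = (\<lambda>y\<in>topspace Y. \<Prod>l\<in>{1..j}. translate G Y b (s l) (p l) y)" "1 \<le> j" "j \<le> m'"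
    "\<forall>l\<in>{1..j}. s l \<in> F'" "\<forall>l\<in>{1..j}. p l \<in> P"
    unfolding product_set_def by fastforce
  then show "f \<in> product_set G Y b P F' m'" unfolding product_set_def by blast
qed

lemma cfun_prod:
  assumes "\<And>l. l \<in> {1..j::nat} \<Longrightarrow> f l \<in> cfun Y"
  shows "(\<lambda>y\<in>topspace Y. \<Prod>l\<in>{1..j}. f l y) \<in> cfun Y"
  using assms
proof (induction j)
  case (Suc j)
  have "(\<lambda>y\<in>topspace Y. (\<lambda>y\<in>topspace Y. \<Prod>l\<in>{1..j}. f l y) y * f (Suc j) y) \<in> cfun Y"
    using Suc by (intro cfun_mult) auto
  also have "(\<lambda>y\<in>topspace Y. (\<lambda>y\<in>topspace Y. \<Prod>l\<in>{1..j}. f l y) y * f (Suc j) y)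
      = (\<lambda>y\<in>topspace Y. \<Prod>l\<in>{1..Suc j}. f l y)"
    by (auto simp: fun_eq_iff)
  finally show ?case .
qed (simp add: cfun_const del: restrict_apply)

lemma product_set_cfun: "F \<subseteq> carrier G \<Longrightarrow> product_set G Y b P F m \<subseteq> cfun Y"
  unfolding product_set_def using P_cfun by (auto intro!: cfun_prod translate_in)

text \<open>Values outside \<open>{1..d i}\<close> are left free, so one homomorphism is represented
  by many tuples. Separated families are therefore always counted among homomorphisms, with tuples
  serving as representatives.\<close>

definition microstates where
  "microstates F m \<delta> i = {y \<in> {1..d i} \<rightarrow> topspace Y.
     (\<forall>f\<in>product_set G Y b P F m. cmod ((\<Sum>k=1..d i. f (y k)) / of_nat (d i) - (\<integral>y. f y \<partial>N)) < \<delta>) \<and>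
     (\<forall>p\<in>P. \<forall>s\<in>F. sqrt ((\<Sum>k=1..d i. (cmod (p (C s (y k)) - p (y (T i s k))))\<^sup>2) / real (d i)) < \<delta>)}"

lemma microstates_in: "y \<in> microstates F m \<delta> i \<Longrightarrow> k \<in> {1..d i} \<Longrightarrow> y k \<in> topspace Y"
  by (auto simp: microstates_def)

lemma microstates_antimono:
  assumes "F \<subseteq> F'" "m \<le> m'" "\<delta>' \<le> \<delta>"
  shows "microstates F' m' \<delta>' i \<subseteq> microstates F m \<delta> i"
proof
  fix y assume y: "y \<in> microstates F' m' \<delta>' i"
  show "y \<in> microstates F m \<delta> i"
    unfolding microstates_def
  proof (intro CollectI conjI ballI)
    show "y \<in> {1..d i} \<rightarrow> topspace Y" using y by (simp add: microstates_def)
  next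
    fix f assume "f \<in> product_set G Y b P F m"
    then have "f \<in> product_set G Y b P F' m'" using product_set_mono[OF assms(1,2)] by blast
    then show "cmod ((\<Sum>k=1..d i. f (y k)) / of_nat (d i) - (\<integral>y. f y \<partial>N)) < \<delta>"
      using y assms(3) unfolding microstates_def by (auto intro: less_le_trans)
  next
    fix p s assume "p \<in> P" "s \<in> F"
    then have "sqrt ((\<Sum>k=1..d i. (cmod (p (C s (y k)) - p (y (T i s k))))\<^sup>2) / real (d i)) < \<delta>'"
      using y assms(1) unfolding microstates_def by blast
    then show "sqrt ((\<Sum>k=1..d i. (cmod (p (C s (y k)) - p (y (T i s k))))\<^sup>2) / real (d i)) < \<delta>"
      using assms(3) by (rule less_le_trans)
  qed
qed

lemma point_evaluation_approx_hom_iff: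
  assumes F: "F \<subseteq> carrier G" and y: "y \<in> {1..d i} \<rightarrow> topspace Y"
  shows "point_evaluation Y (d i) y \<in> approx_hom G Y N b P F m \<delta> (d i) (\<sigma> i) \<longleftrightarrow> y \<in> microstates F m \<delta> i"
proof -
  let ?\<phi> = "point_evaluation Y (d i) y"
  have hom: "?\<phi> \<in> unital_hom Y (d i)"
    unfolding point_evaluation_def using y by (intro point_evaluation_unital_hom) auto
  have 1: "uniform_mean (d i) (?\<phi> f) = (\<Sum>k=1..d i. f (y k)) / of_nat (d i)"
    if "f \<in> product_set G Y b P F m" for f
  proof -
    have "f \<in> cfun Y" using that product_set_cfun[OF F] by blast
    then show ?thesis unfolding uniform_mean_def by simp
  qed
  have 2: "norm_two (d i) (\<lambda>k. ?\<phi> (translate G Y b s p) k - ?\<phi> p (inv_into {1..d i} (\<sigma> i s) k))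
      = sqrt ((\<Sum>k=1..d i. (cmod (p (C s (y k)) - p (y (T i s k))))\<^sup>2) / real (d i))"
    if p: "p \<in> P" and s: "s \<in> F" for p s
  proof -
    have "?\<phi> (translate G Y b s p) k - ?\<phi> p (inv_into {1..d i} (\<sigma> i s) k) = p (C s (y k)) - p (y (T i s k))"
      if k: "k \<in> {1..d i}" for k
    proof -
      have "T i s k \<in> {1..d i}" using T_in s F k by blast
      then show ?thesis
        unfolding T_def[symmetric] using P_cfun[OF p] translate_in[OF _ P_cfun[OF p], of s] s F y k
        by (simp add: translate_apply Pi_iff subset_iff)
    qed
    then show ?thesis unfolding norm_two_def by simp
  qed
  show ?thesis
    unfolding approx_hom_def microstates_def using hom y 1 2 by simp
qed

text \<open>Each coordinate of a homomorphism is a character of C(Y), hence evaluation at a point;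
  the two conditions then translate literally.\<close>

lemma approx_hom_eq:
  assumes F: "F \<subseteq> carrier G"
  shows "approx_hom G Y N b P F m \<delta> (d i) (\<sigma> i) = point_evaluation Y (d i) ` microstates F m \<delta> i"
proof (intro equalityI subsetI)
  fix \<phi> assume \<phi>: "\<phi> \<in> approx_hom G Y N b P F m \<delta> (d i) (\<sigma> i)"
  then have hom: "\<phi> \<in> unital_hom Y (d i)" by (simp add: approx_hom_def)
  then have "\<forall>k\<in>{1..d i}. \<exists>y. y \<in> topspace Y \<and> (\<forall>f\<in>cfun Y. \<phi> f k = f y)"
    using unital_hom_point_evaluation[OF compact_Y hom] by blast
  then obtain y where y: "\<And>k. k \<in> {1..d i} \<Longrightarrow> y k \<in> topspace Y"
    "\<And>k f. k \<in> {1..d i} \<Longrightarrow> f \<in> cfun Y \<Longrightarrow> \<phi> f k = f (y k)" by metis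
  have "\<phi> \<in> cfun Y \<rightarrow>\<^sub>E ({1..d i} \<rightarrow>\<^sub>E UNIV)" using hom by (simp add: unital_hom_def)
  then have "\<phi> = point_evaluation Y (d i) y"
    using y(2) by (auto simp: point_evaluation_def fun_eq_iff PiE_iff extensional_def)
  moreover from this have "y \<in> microstates F m \<delta> i"
    using \<phi> point_evaluation_approx_hom_iff[OF F, of y i m \<delta>] y(1) by auto
  ultimately show "\<phi> \<in> point_evaluation Y (d i) ` microstates F m \<delta> i" by blast
next
  fix \<phi> assume "\<phi> \<in> point_evaluation Y (d i) ` microstates F m \<delta> i"
  then show "\<phi> \<in> approx_hom G Y N b P F m \<delta> (d i) (\<sigma> i)"
    using point_evaluation_approx_hom_iff[OF F] by (auto simp: microstates_def)
qed

lemma rho_max_less_iff: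
  assumes "n > 0"
  shows "rho_max n P (point_evaluation Y n y) (point_evaluation Y n y') < \<epsilon>
    \<longleftrightarrow> (\<forall>p\<in>P. \<forall>k\<in>{1..n}. cmod (p (y k) - p (y' k)) < \<epsilon>)"
proof -
  have "rho_max n P (point_evaluation Y n y) (point_evaluation Y n y') < \<epsilon>
    \<longleftrightarrow> (\<forall>p\<in>P. norm_max n (\<lambda>k. point_evaluation Y n y p k - point_evaluation Y n y' p k) < \<epsilon>)"
    unfolding rho_max_def using finite_P P_nonempty by (subst Max_less_iff) auto
  also have "\<dots> \<longleftrightarrow> (\<forall>p\<in>P. \<forall>k\<in>{1..n}. cmod (point_evaluation Y n y p k - point_evaluation Y n y' p k) < \<epsilon>)"
    unfolding norm_max_def using assms by (subst Max_less_iff) auto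
  finally show ?thesis using P_cfun by simp
qed

text \<open>This is the quantifier prefix under which the infima over F, m, \<delta> and the limit
  in i are bounded: some parameters, then all large i, then all microstates. The index is paired
  with the tuple so that limits can involve both.\<close>

definition micro_ev :: "(nat \<times> (nat \<Rightarrow> 'y) \<Rightarrow> bool) \<Rightarrow> bool" where
  "micro_ev Q \<longleftrightarrow> (\<exists>F m \<delta>. finite F \<and> F \<noteq> {} \<and> F \<subseteq> carrier G \<and> \<delta> > 0 \<and>
     (\<forall>\<^sub>F i in sequentially. \<forall>y\<in>microstates F m \<delta> i. Q (i, y)))"

definition micro_filter :: "(nat \<times> (nat \<Rightarrow> 'y)) filter" where
  "micro_filter = Abs_filter micro_ev"

text \<open>Enlarging \<open>F\<close> by the unit only shrinks the set of microstates, so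
  nonemptiness of \<open>F\<close> costs nothing.\<close>

lemma micro_evI:
  assumes "finite F" "F \<subseteq> carrier G" "\<delta> > 0" "\<forall>\<^sub>F i in sequentially. \<forall>y\<in>microstates F m \<delta> i. Q (i, y)"
  shows "micro_ev Q"
  unfolding micro_ev_def
proof (intro exI conjI)
  show "finite (insert \<one> F)" "insert \<one> F \<noteq> {}" "insert \<one> F \<subseteq> carrier G" "\<delta> > 0" using assms by auto
  show "\<forall>\<^sub>F i in sequentially. \<forall>y\<in>microstates (insert \<one> F) m \<delta> i. Q (i, y)"
    using assms(4) microstates_antimono[of F "insert \<one> F" m m \<delta> \<delta>]
    by (auto elim!: eventually_mono)
qed

text \<open>Conjunctions are handled by the union of the sets F, the maximum of the m and the
  minimum of the \<delta>, because microstates shrink along this order.\<close>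

lemma eventually_micro_filter: "eventually Q micro_filter \<longleftrightarrow> micro_ev Q"
  unfolding micro_filter_def
proof (rule eventually_Abs_filter, rule is_filter.intro)
  show "micro_ev (\<lambda>_. True)" by (rule micro_evI[where F = "{}" and m = 0 and \<delta> = 1]) auto
  show "micro_ev (\<lambda>x. A x \<and> B x)" if AB: "micro_ev A" "micro_ev B" for A B
  proof -
    obtain F m \<delta> where F: "finite F" "F \<subseteq> carrier G" "\<delta> > 0"
      "\<forall>\<^sub>F i in sequentially. \<forall>y\<in>microstates F m \<delta> i. A (i, y)" using AB(1) unfolding micro_ev_def by blast
    obtain F' m' \<delta>' where F': "finite F'" "F' \<subseteq> carrier G" "\<delta>' > 0"
      "\<forall>\<^sub>F i in sequentially. \<forall>y\<in>microstates F' m' \<delta>' i. B (i, y)" using AB(2) unfolding micro_ev_def by blast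
    show ?thesis
    proof (rule micro_evI[where F = "F \<union> F'" and m = "max m m'" and \<delta> = "min \<delta> \<delta>'"])
      show "\<forall>\<^sub>F i in sequentially. \<forall>y\<in>microstates (F \<union> F') (max m m') (min \<delta> \<delta>') i. A (i, y) \<and> B (i, y)"
        using F(4) F'(4)
      proof eventually_elim
        case (elim i)
        then show ?case
          using microstates_antimono[of F "F \<union> F'" m "max m m'" "min \<delta> \<delta>'" \<delta> i]
            microstates_antimono[of F' "F \<union> F'" m' "max m m'" "min \<delta> \<delta>'" \<delta>' i] by auto
      qed
    qed (use F F' in auto)
  qed
  show "micro_ev B" if "\<forall>x. A x \<longrightarrow> B x" "micro_ev A" for A B
    using that unfolding micro_ev_def by (blast intro: eventually_mono)
qed

lemma eventually_micro_filter_fst: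
  "eventually Q sequentially \<Longrightarrow> eventually (\<lambda>x. Q (fst x)) micro_filter"
  unfolding eventually_micro_filter by (rule micro_evI[where F = "{}" and m = 0 and \<delta> = 1]) (auto elim: eventually_mono)

lemma filterlim_fst_micro_filter: "filterlim fst sequentially micro_filter"
  unfolding filterlim_iff by (auto intro: eventually_micro_filter_fst)

lemma eventually_micro_filter_in: "\<forall>\<^sub>F x in micro_filter. \<forall>k\<in>{1..d (fst x)}. snd x k \<in> topspace Y"
  unfolding eventually_micro_filter by (rule micro_evI[where F = "{}" and m = 0 and \<delta> = 1]) (auto simp: microstates_in)

lemma sum_T: "s \<in> carrier G \<Longrightarrow> (\<Sum>k=1..d i. f (T i s k)) = (\<Sum>k=1..d i. f k)"
  using sum.reindex_bij_betw[OF bij_T] by simp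

text \<open>This is condition (ii) for F = {s} and \<delta> = e, weakened from the quadratic mean to
  L1; for m = 0 condition (i) is void.\<close>

lemma equivariance_generator:
  assumes "p \<in> P" "s \<in> carrier G"
  shows "((\<lambda>x. (\<Sum>k=1..d (fst x). cmod (p (C s (snd x k)) - p (snd x (T (fst x) s k)))) / real (d (fst x))) \<longlongrightarrow> 0) micro_filter"
proof (rule tendstoI)
  fix e :: real assume e: "e > 0"
  have "micro_ev (\<lambda>x. dist ((\<Sum>k=1..d (fst x). cmod (p (C s (snd x k)) - p (snd x (T (fst x) s k)))) / real (d (fst x))) 0 < e)"
  proof (rule micro_evI[where F = "{s}" and m = 0 and \<delta> = e], goal_cases)
    case 4
    have "(\<Sum>k=1..d i. cmod (p (C s (y k)) - p (y (T i s k)))) / real (d i) < e" 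
      if "y \<in> microstates {s} 0 e i" for y i
      using that assms avg_le_root_mean_square[of "\<lambda>k. cmod (p (C s (y k)) - p (y (T i s k)))" "d i"]
      by (auto simp: microstates_def intro: le_less_trans)
    moreover have "(\<Sum>k=1..d i. cmod (p (C s (y k)) - p (y (T i s k)))) / real (d i) \<ge> 0" for y i
      by (intro divide_nonneg_nonneg sum_nonneg) auto
    ultimately show ?case by (intro always_eventually) (auto simp: dist_real_def sum_nonneg)
  qed (use e assms in auto)
  then show "\<forall>\<^sub>F x in micro_filter. dist ((\<Sum>k=1..d (fst x). cmod (p (C s (snd x k)) - p (snd x (T (fst x) s k)))) / real (d (fst x))) 0 < e"
    by (simp add: eventually_micro_filter)
qed

text \<open>Condition (ii) speaks of \<open>P\<close> only, so the case to settle is a translate of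
  p by g. There p(C_{sg} y_k) is compared with p(y at T_{sg} k), the site T_{sg} k is replaced by
  T_g T_s k at the cost of 2 per bad site, and equivariance for g is applied at the site T_s k.
  Averages over T_s k equal averages over k because T_s is a permutation.\<close>

lemma microstates_equivariant:
  assumes f: "f \<in> cfun Y" and s: "s \<in> carrier G"
  shows "L1_close micro_filter (\<lambda>x. d (fst x)) (\<lambda>x k. C s (snd x k)) (\<lambda>x k. snd x (T (fst x) s k)) f"
proof (rule L1_close_cfun[OF f])
  show "\<forall>\<^sub>F x in micro_filter. \<forall>k\<in>{1..d (fst x)}. C s (snd x k) \<in> topspace Y \<and> snd x (T (fst x) s k) \<in> topspace Y"
    using eventually_micro_filter_in by eventually_elim (use C_in T_in s in blast)
next
  fix g p assume g: "g \<in> carrier G" and p: "p \<in> P"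
  define n where "n x = d (fst x)" for x :: "nat \<times> (nat \<Rightarrow> 'y)"
  let ?e = "\<lambda>s x. (\<Sum>k=1..n x. cmod (p (C s (snd x k)) - p (snd x (T (fst x) s k)))) / real (n x)"
  let ?bad = "\<lambda>i. real (card {k\<in>{1..d i}. T i (s \<otimes> g) k \<noteq> T i g (T i s k)}) / real (d i)"
  have lim: "((\<lambda>x. ?e (s \<otimes> g) x + 2 * ?bad (fst x) + ?e g x) \<longlongrightarrow> 0) micro_filter"
    unfolding n_def using p g s
    by (intro tendsto_add_zero tendsto_mult_right_zero equivariance_generator
        filterlim_compose[OF T_mult_frac filterlim_fst_micro_filter]) auto
  have le: "\<forall>\<^sub>F x in micro_filter. (\<Sum>k=1..n x. cmod (translate G Y b g p (C s (snd x k)) - translate G Y b g p (snd x (T (fst x) s k)))) / real (n x)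
      \<le> ?e (s \<otimes> g) x + 2 * ?bad (fst x) + ?e g x"
    using eventually_micro_filter_in
  proof eventually_elim
    case (elim x)
    obtain i y where x: "x = (i, y)" by (cases x)
    have y: "y k \<in> topspace Y" if "k \<in> {1..d i}" for k using elim that by (simp add: x)
    have "cmod (translate G Y b g p (C s (y k)) - translate G Y b g p (y (T i s k)))
       \<le> cmod (p (C (s \<otimes> g) (y k)) - p (y (T i (s \<otimes> g) k)))
         + 2 * (if T i (s \<otimes> g) k \<noteq> T i g (T i s k) then 1 else 0)
         + cmod (p (C g (y (T i s k))) - p (y (T i g (T i s k))))" if k: "k \<in> {1..d i}" for k
    proof -
      have Tk: "T i s k \<in> {1..d i}" "T i (s \<otimes> g) k \<in> {1..d i}" "T i g (T i s k) \<in> {1..d i}"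
        using T_in g s k by auto
      have "translate G Y b g p (C s (y k)) - translate G Y b g p (y (T i s k))
         = (p (C (s \<otimes> g) (y k)) - p (y (T i (s \<otimes> g) k))) + (p (y (T i (s \<otimes> g) k)) - p (y (T i g (T i s k))))
           - (p (C g (y (T i s k))) - p (y (T i g (T i s k))))"
        using C_in C_mult y Tk k s g by (simp add: translate_apply)
      moreover have "cmod (p (y (T i (s \<otimes> g) k)) - p (y (T i g (T i s k))))
         \<le> 2 * (if T i (s \<otimes> g) k \<noteq> T i g (T i s k) then 1 else 0)"
        using norm_triangle_ineq4[of "p (y (T i (s \<otimes> g) k))" "p (y (T i g (T i s k)))"]
          P_le_one[OF p y[OF Tk(2)]] P_le_one[OF p y[OF Tk(3)]] by simp
      moreover have "cmod (u + v - w) \<le> cmod u + cmod v + cmod w" for u v w :: complex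
        using norm_triangle_ineq4[of "u + v" w] norm_triangle_ineq[of u v] by linarith
      ultimately show ?thesis by (smt (verit, best))
    qed
    then have "(\<Sum>k=1..d i. cmod (translate G Y b g p (C s (y k)) - translate G Y b g p (y (T i s k)))) / real (d i)
       \<le> (\<Sum>k=1..d i. cmod (p (C (s \<otimes> g) (y k)) - p (y (T i (s \<otimes> g) k)))
         + 2 * (if T i (s \<otimes> g) k \<noteq> T i g (T i s k) then 1 else 0)
         + cmod (p (C g (y (T i s k))) - p (y (T i g (T i s k))))) / real (d i)"
      by (rule avg_mono)
    also have "\<dots> = ?e (s \<otimes> g) x + 2 * ?bad (fst x) + ?e g x"
      using sum_T[OF s, of "\<lambda>l. cmod (p (C g (y l)) - p (y (T i g l)))" i]
      by (simp add: x n_def sum.distrib add_divide_distrib sum_distrib_left[symmetric] sum.If_cases Int_def conj_commute)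
    finally show ?case by (simp add: x n_def)
  qed
  show "L1_close micro_filter (\<lambda>x. d (fst x)) (\<lambda>x k. C s (snd x k)) (\<lambda>x k. snd x (T (fst x) s k)) (translate G Y b g p)"
    unfolding L1_close_def n_def[symmetric]
    by (rule tendsto_sandwich[OF _ le tendsto_const lim])
      (auto intro!: always_eventually divide_nonneg_nonneg sum_nonneg)
qed

end

section \<open>Empirical averages of arbitrary continuous functions\<close>

context sofic_model
begin

definition empirical :: "('y \<Rightarrow> complex) \<Rightarrow> bool" where
  "empirical f \<longleftrightarrow> ((\<lambda>x. (\<Sum>k=1..d (fst x). f (snd x k)) / of_nat (d (fst x))) \<longlongrightarrow> (\<integral>y. f y \<partial>N)) micro_filter"

lemma empirical_cong:
  assumes "\<And>y. y \<in> topspace Y \<Longrightarrow> f y = g y"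
  shows "empirical f \<longleftrightarrow> empirical g"
proof -
  have "(\<integral>y. f y \<partial>N) = (\<integral>y. g y \<partial>N)"
    using assms by (intro Bochner_Integration.integral_cong) (auto simp: space_N)
  moreover have "\<forall>\<^sub>F x in micro_filter. (\<Sum>k=1..d (fst x). f (snd x k)) / complex_of_nat (d (fst x))
      = (\<Sum>k=1..d (fst x). g (snd x k)) / of_nat (d (fst x))"
    using eventually_micro_filter_in by eventually_elim (use assms in auto)
  ultimately show ?thesis unfolding empirical_def by (simp add: tendsto_cong)
qed

lemma empirical_add:
  assumes "empirical f" "empirical g" "integrable N f" "integrable N g"
  shows "empirical (\<lambda>y. f y + g y)"
  using tendsto_add[OF assms(1,2)[unfolded empirical_def]] assms(3,4)
  by (simp add: empirical_def sum.distrib add_divide_distrib)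

lemma empirical_cmult:
  assumes "empirical f" "integrable N f"
  shows "empirical (\<lambda>y. c * f y)"
  using tendsto_mult_left[OF assms(1)[unfolded empirical_def], of c] assms(2)
  by (simp add: empirical_def sum_distrib_left)

lemma empirical_limit:
  assumes f: "integrable N f"
    and ap: "\<And>e. e > 0 \<Longrightarrow> \<exists>g. empirical g \<and> integrable N g \<and> (\<forall>y\<in>topspace Y. cmod (f y - g y) \<le> e)"
  shows "empirical f"
  unfolding empirical_def
proof (rule tendstoI)
  fix e :: real assume e: "e > 0"
  obtain g where g: "empirical g" "integrable N g" "\<And>y. y \<in> topspace Y \<Longrightarrow> cmod (f y - g y) \<le> e / 3"
    using ap[of "e/3"] e by auto
  have int: "cmod ((\<integral>y. g y \<partial>N) - (\<integral>y. f y \<partial>N)) \<le> e / 3"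
  proof -
    have "cmod ((\<integral>y. g y \<partial>N) - (\<integral>y. f y \<partial>N)) = cmod (\<integral>y. f y - g y \<partial>N)"
      using f g by (simp add: norm_minus_commute)
    also have "\<dots> \<le> (\<integral>y. cmod (f y - g y) \<partial>N)" by (rule integral_norm_bound)
    also have "\<dots> \<le> (\<integral>y. e / 3 \<partial>N)" using f g by (intro integral_mono) (auto simp: space_N)
    finally show ?thesis by (simp add: N.prob_space)
  qed
  have "\<forall>\<^sub>F x in micro_filter. dist ((\<Sum>k=1..d (fst x). g (snd x k)) / of_nat (d (fst x))) (\<integral>y. g y \<partial>N) < e / 3"
    using g(1) e unfolding empirical_def by (intro tendstoD) auto
  then show "\<forall>\<^sub>F x in micro_filter. dist ((\<Sum>k=1..d (fst x). f (snd x k)) / of_nat (d (fst x))) (\<integral>y. f y \<partial>N) < e"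
    using eventually_micro_filter_in
  proof eventually_elim
    case (elim x)
    let ?n = "d (fst x)" and ?y = "snd x"
    have "cmod ((\<Sum>k=1..?n. f (?y k)) / of_nat ?n - (\<Sum>k=1..?n. g (?y k)) / of_nat ?n)
        = cmod (\<Sum>k=1..?n. f (?y k) - g (?y k)) / real ?n"
      by (simp add: sum_subtractf norm_divide flip: diff_divide_distrib)
    also have "\<dots> \<le> (\<Sum>k=1..?n. cmod (f (?y k) - g (?y k))) / real ?n"
      by (intro divide_right_mono norm_sum) auto
    also have "\<dots> \<le> e / 3" using elim g(3) e by (intro avg_le_const) auto
    finally have "dist ((\<Sum>k=1..?n. f (?y k)) / of_nat ?n) ((\<Sum>k=1..?n. g (?y k)) / of_nat ?n) \<le> e / 3"
      by (simp add: dist_norm)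
    moreover have "dist (\<integral>y. g y \<partial>N) (\<integral>y. f y \<partial>N) \<le> e / 3" using int by (simp add: dist_norm)
    ultimately show ?case
      using elim(1) dist_triangle[of "(\<Sum>k=1..?n. f (?y k)) / of_nat ?n" "\<integral>y. f y \<partial>N" "(\<Sum>k=1..?n. g (?y k)) / of_nat ?n"]
        dist_triangle[of "(\<Sum>k=1..?n. g (?y k)) / of_nat ?n" "\<integral>y. f y \<partial>N" "\<integral>y. g y \<partial>N"] by linarith
  qed
qed

text \<open>The union of the sets \<open>product_set\<close> over all finite F and all m, together
  with the empty product: admitting j = 0 puts the constant 1 into the set.\<close>

definition all_products :: "('y \<Rightarrow> complex) set" where
  "all_products = {(\<lambda>y\<in>topspace Y. \<Prod>l\<in>{1..j}. translate G Y b (s l) (p l) y) | (j::nat) s p.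
     (\<forall>l\<in>{1..j}. s l \<in> carrier G) \<and> (\<forall>l\<in>{1..j}. p l \<in> P)}"

lemma all_products_cfun: "g \<in> all_products \<Longrightarrow> g \<in> cfun Y"
  unfolding all_products_def using P_cfun by (auto intro!: cfun_prod translate_in)

text \<open>A nonempty product with j factors belongs to \<open>product_set\<close> for the finite
  set of its translating elements and m = j, so condition (i) with \<delta> = e applies
  directly.\<close>

lemma empirical_all_products: assumes "g \<in> all_products" shows "empirical g"
proof -
  obtain j s p where g: "g = (\<lambda>y\<in>topspace Y. \<Prod>l\<in>{1..j::nat}. translate G Y b (s l) (p l) y)"
    and s: "\<forall>l\<in>{1..j}. s l \<in> carrier G" and p: "\<forall>l\<in>{1..j}. p l \<in> P"
    using assms unfolding all_products_def by blast
  show ?thesis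
  proof (cases "j = 0")
    case True
    have *: "(\<Sum>k=1..d i. 1) / of_nat (d i) = (1 :: complex)" for i using d_pos[of i] by simp
    have "empirical (\<lambda>_. 1)"
      unfolding empirical_def * by (simp add: N.prob_space)
    then show ?thesis using True by (subst empirical_cong[of _ "\<lambda>_. 1"]) (auto simp: g)
  next
    case False
    then have gF: "g \<in> product_set G Y b P (s ` {1..j}) j"
      unfolding product_set_def g using p by force
    show ?thesis
      unfolding empirical_def
    proof (rule tendstoI)
      fix e :: real assume e: "e > 0"
      show "\<forall>\<^sub>F x in micro_filter. dist ((\<Sum>k=1..d (fst x). g (snd x k)) / of_nat (d (fst x))) (\<integral>y. g y \<partial>N) < e"
        unfolding eventually_micro_filter
        by (rule micro_evI[where F = "s ` {1..j}" and m = j and \<delta> = e])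
          (use e s gF in \<open>auto simp: microstates_def dist_norm\<close>)
    qed
  qed
qed

lemma all_products_mult:
  assumes "g \<in> all_products" "t \<in> carrier G" "q \<in> P"
  obtains g' where "g' \<in> all_products" "\<And>y. y \<in> topspace Y \<Longrightarrow> g' y = translate G Y b t q y * g y"
proof -
  obtain j s p where g: "g = (\<lambda>y\<in>topspace Y. \<Prod>l\<in>{1..j::nat}. translate G Y b (s l) (p l) y)"
    and s: "\<forall>l\<in>{1..j}. s l \<in> carrier G" and p: "\<forall>l\<in>{1..j}. p l \<in> P"
    using assms unfolding all_products_def by blast
  define s' p' where "s' = s(Suc j := t)" and "p' = p(Suc j := q)"
  define g' where "g' = (\<lambda>y\<in>topspace Y. \<Prod>l\<in>{1..Suc j}. translate G Y b (s' l) (p' l) y)"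
  have "g' \<in> all_products"
    unfolding all_products_def g'_def using s p assms(2,3)
    by (intro CollectI exI[of _ "Suc j"] exI[of _ s'] exI[of _ p']) (auto simp: s'_def p'_def le_Suc_eq)
  moreover have "(\<Prod>l\<in>{1..j}. translate G Y b (s' l) (p' l) y) = (\<Prod>l\<in>{1..j}. translate G Y b (s l) (p l) y)" for y
    by (intro prod.cong) (auto simp: s'_def p'_def)
  then have "g' y = translate G Y b t q y * g y" if "y \<in> topspace Y" for y
    using that by (simp add: g'_def g) (simp add: s'_def p'_def mult.commute)
  ultimately show ?thesis using that by blast
qed

lemma cfun_mult_integrable: "f \<in> cfun Y \<Longrightarrow> g \<in> cfun Y \<Longrightarrow> integrable N (\<lambda>y. f y * g y)"
  using cfun_integrable[OF cfun_mult, of f g]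
  by (subst Bochner_Integration.integrable_cong[OF refl, of _ _ "\<lambda>y\<in>topspace Y. f y * g y"]) (auto simp: space_N)

text \<open>The set of functions satisfying the conclusion is not visibly closed under products. The
  induction therefore runs over the multipliers of \<open>A1\<close>, the functions whose products with
  all elements of \<^const>\<open>all_products\<close> satisfy it.\<close>

lemma microstates_empirical:
  assumes f: "f \<in> cfun Y"
  shows "empirical f"
proof -
  define A1 where "A1 h \<longleftrightarrow> h \<in> cfun Y \<and> (\<forall>g\<in>all_products. empirical (\<lambda>y. h y * g y))" for h
  have A1_cong: "A1 h'" if "A1 h" "h' \<in> cfun Y" "\<And>y. y \<in> topspace Y \<Longrightarrow> h y = h' y" for h h'
    using that empirical_cong[of "\<lambda>y. h y * g y" "\<lambda>y. h' y * g y" for g] by (auto simp: A1_def)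
  have A1_add: "A1 (\<lambda>y\<in>topspace Y. h y + h' y)" if "A1 h" "A1 h'" for h h'
    unfolding A1_def
  proof (intro conjI ballI)
    show "(\<lambda>y\<in>topspace Y. h y + h' y) \<in> cfun Y" using that by (auto simp: A1_def intro: cfun_add)
    fix g assume g: "g \<in> all_products"
    have "empirical (\<lambda>y. h y * g y + h' y * g y)"
      using that g by (intro empirical_add cfun_mult_integrable) (auto simp: A1_def all_products_cfun)
    then show "empirical (\<lambda>y. (\<lambda>y\<in>topspace Y. h y + h' y) y * g y)"
      by (rule empirical_cong[THEN iffD1, rotated]) (simp add: algebra_simps)
  qed
  have A1_cmult: "A1 (\<lambda>y\<in>topspace Y. c * h y)" if "A1 h" for h c
    unfolding A1_def
  proof (intro conjI ballI)
    show "(\<lambda>y\<in>topspace Y. c * h y) \<in> cfun Y" using that by (auto simp: A1_def intro: cfun_cmult)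
    fix g assume g: "g \<in> all_products"
    have "empirical (\<lambda>y. c * (h y * g y))"
      using that g by (intro empirical_cmult cfun_mult_integrable) (auto simp: A1_def all_products_cfun)
    then show "empirical (\<lambda>y. (\<lambda>y\<in>topspace Y. c * h y) y * g y)"
      by (rule empirical_cong[THEN iffD1, rotated]) (simp add: algebra_simps)
  qed
  define A2 where "A2 f \<longleftrightarrow> (\<forall>h. A1 h \<longrightarrow> A1 (\<lambda>y\<in>topspace Y. f y * h y))" for f
  have "A2 f"
    using f
  proof (induction f rule: cfun_induct)
    case one
    show ?case unfolding A2_def
    proof (intro allI impI)
      fix h assume h: "A1 h"
      then show "A1 (\<lambda>y\<in>topspace Y. (\<lambda>y\<in>topspace Y. 1) y * h y)"
      proof (rule A1_cong)
        show "(\<lambda>y\<in>topspace Y. (\<lambda>y\<in>topspace Y. 1) y * h y) \<in> cfun Y"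
          using h by (intro cfun_mult cfun_const) (simp add: A1_def)
      qed simp
    qed
  next
    case (gen t q)
    show ?case unfolding A2_def
    proof (intro allI impI)
      fix h assume h: "A1 h"
      show "A1 (\<lambda>y\<in>topspace Y. translate G Y b t q y * h y)"
        unfolding A1_def
      proof (intro conjI ballI)
        show "(\<lambda>y\<in>topspace Y. translate G Y b t q y * h y) \<in> cfun Y"
          using h gen P_cfun by (intro cfun_mult translate_in) (auto simp: A1_def)
        fix g assume "g \<in> all_products"
        then obtain g' where g': "g' \<in> all_products" "\<And>y. y \<in> topspace Y \<Longrightarrow> g' y = translate G Y b t q y * g y"
          using all_products_mult gen by blast
        have "empirical (\<lambda>y. h y * g' y)" using h g' by (simp add: A1_def)
        then show "empirical (\<lambda>y. (\<lambda>y\<in>topspace Y. translate G Y b t q y * h y) y * g y)"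
          by (rule empirical_cong[THEN iffD1, rotated]) (simp add: g')
      qed
    qed
  next
    case (add f f')
    show ?case unfolding A2_def
    proof (intro allI impI)
      fix h assume h: "A1 h"
      have "A1 (\<lambda>y\<in>topspace Y. (\<lambda>y\<in>topspace Y. f y * h y) y + (\<lambda>y\<in>topspace Y. f' y * h y) y)"
        using add h unfolding A2_def by (intro A1_add) blast+
      then show "A1 (\<lambda>y\<in>topspace Y. (\<lambda>y\<in>topspace Y. f y + f' y) y * h y)"
        proof (rule A1_cong)
        show "(\<lambda>y\<in>topspace Y. (\<lambda>y\<in>topspace Y. f y + f' y) y * h y) \<in> cfun Y"
          using add h by (intro cfun_mult cfun_add) (auto simp: A1_def)
      qed (simp add: algebra_simps)
    qed
  next
    case (cmult c f)
    show ?case unfolding A2_def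
    proof (intro allI impI)
      fix h assume h: "A1 h"
      have "A1 (\<lambda>y\<in>topspace Y. c * (\<lambda>y\<in>topspace Y. f y * h y) y)"
        using cmult h unfolding A2_def by (intro A1_cmult) blast
      then show "A1 (\<lambda>y\<in>topspace Y. (\<lambda>y\<in>topspace Y. c * f y) y * h y)"
        proof (rule A1_cong)
        show "(\<lambda>y\<in>topspace Y. (\<lambda>y\<in>topspace Y. c * f y) y * h y) \<in> cfun Y"
          using cmult h by (intro cfun_mult cfun_cmult) (auto simp: A1_def)
      qed (simp add: algebra_simps)
    qed
  next
    case (mult f f')
    \<comment> \<open>Multiplication by f' and then by f stays inside \<open>A1\<close>. This
      composition of multipliers is the closure under products that is not visible for the averages
      themselves.\<close>
    show ?case unfolding A2_def
    proof (intro allI impI)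
      fix h assume h: "A1 h"
      have "A1 (\<lambda>y\<in>topspace Y. f y * (\<lambda>y\<in>topspace Y. f' y * h y) y)"
        using mult h unfolding A2_def by blast
      then show "A1 (\<lambda>y\<in>topspace Y. (\<lambda>y\<in>topspace Y. f y * f' y) y * h y)"
        proof (rule A1_cong)
        show "(\<lambda>y\<in>topspace Y. (\<lambda>y\<in>topspace Y. f y * f' y) y * h y) \<in> cfun Y"
          using mult h by (intro cfun_mult) (auto simp: A1_def)
      qed (simp add: algebra_simps)
    qed
  next
    case (lim f)
    show ?case unfolding A2_def
    proof (intro allI impI)
      fix h assume h: "A1 h"
      show "A1 (\<lambda>y\<in>topspace Y. f y * h y)"
        unfolding A1_def
      proof (intro conjI ballI)
        show fh: "(\<lambda>y\<in>topspace Y. f y * h y) \<in> cfun Y" using h lim by (auto intro: cfun_mult simp: A1_def)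
        fix k assume k: "k \<in> all_products"
        have hk: "(\<lambda>y\<in>topspace Y. h y * k y) \<in> cfun Y"
          using h by (intro cfun_mult all_products_cfun[OF k]) (simp add: A1_def)
        obtain B where "B > 0" "\<And>y. y \<in> topspace Y \<Longrightarrow> cmod ((\<lambda>y\<in>topspace Y. h y * k y) y) \<le> B"
          using cfun_bounded[OF compact_Y hk] by blast
        then have B: "B > 0" "\<And>y. y \<in> topspace Y \<Longrightarrow> cmod (h y * k y) \<le> B" by simp_all
        show "empirical (\<lambda>y. (\<lambda>y\<in>topspace Y. f y * h y) y * k y)"
        proof (rule empirical_limit)
          show "integrable N (\<lambda>y. (\<lambda>y\<in>topspace Y. f y * h y) y * k y)"
            by (rule cfun_mult_integrable[OF fh all_products_cfun[OF k]])
          fix e :: real assume e: "e > 0"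
          obtain g where g: "g \<in> cfun Y" "A2 g" "\<And>y. y \<in> topspace Y \<Longrightarrow> cmod (f y - g y) \<le> e / B"
            using lim(2)[of "e / B"] e B by auto
          have gh: "A1 (\<lambda>y\<in>topspace Y. g y * h y)" using g(2) h unfolding A2_def by blast
          show "\<exists>g. empirical g \<and> integrable N g \<and> (\<forall>y\<in>topspace Y. cmod ((\<lambda>y\<in>topspace Y. f y * h y) y * k y - g y) \<le> e)"
          proof (intro exI conjI ballI)
            show "empirical (\<lambda>y. (\<lambda>y\<in>topspace Y. g y * h y) y * k y)" using gh k unfolding A1_def by blast
            show "integrable N (\<lambda>y. (\<lambda>y\<in>topspace Y. g y * h y) y * k y)"
              using gh unfolding A1_def by (intro cfun_mult_integrable all_products_cfun[OF k]) blast
            fix y assume y: "y \<in> topspace Y"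
            have "(\<lambda>y\<in>topspace Y. f y * h y) y * k y - (\<lambda>y\<in>topspace Y. g y * h y) y * k y = (f y - g y) * (h y * k y)"
              using y by (simp add: algebra_simps)
            then have "cmod ((\<lambda>y\<in>topspace Y. f y * h y) y * k y - (\<lambda>y\<in>topspace Y. g y * h y) y * k y) = cmod (f y - g y) * cmod (h y * k y)"
              by (simp only: norm_mult)
            also have "\<dots> \<le> e / B * B" using g(3) B y e by (intro mult_mono) auto
            finally show "cmod ((\<lambda>y\<in>topspace Y. f y * h y) y * k y - (\<lambda>y\<in>topspace Y. g y * h y) y * k y) \<le> e"
              using B by simp
          qed
        qed
      qed
    qed
  qed
  \<comment> \<open>The multiplier f is finally applied to the constant 1 and tested against the
    empty product.\<close>
  have one: "(\<lambda>y\<in>topspace Y. 1) \<in> all_products"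
    unfolding all_products_def by (intro CollectI exI[of _ 0]) auto
  have "A1 (\<lambda>y\<in>topspace Y. 1)"
    unfolding A1_def
  proof (intro conjI ballI cfun_const)
    fix g assume "g \<in> all_products"
    then have "empirical g" by (rule empirical_all_products)
    then show "empirical (\<lambda>y. (\<lambda>y\<in>topspace Y. 1) y * g y)"
      by (rule empirical_cong[THEN iffD1, rotated]) simp
  qed
  with \<open>A2 f\<close> have "A1 (\<lambda>y\<in>topspace Y. f y * (\<lambda>y\<in>topspace Y. 1) y)" unfolding A2_def by blast
  with one have "empirical (\<lambda>y. (\<lambda>y\<in>topspace Y. f y * (\<lambda>y\<in>topspace Y. 1) y) y * (\<lambda>y\<in>topspace Y. 1) y)"
    unfolding A1_def by blast
  then show ?thesis by (rule empirical_cong[THEN iffD1, rotated]) simp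
qed

end

section \<open>Pairs of microstates that are close on \<open>P\<close>\<close>

context sofic_model
begin

text \<open>Both members of a pair run through good microstates at the same index while their
  \<open>rho_max\<close> distance falls below every \<epsilon>. Taking \<epsilon> into the filter
  allows closeness on \<open>P\<close> to be treated as a limit, on a par with equivariance.\<close>

definition pair_filter :: "(nat \<times> (nat \<Rightarrow> 'y) \<times> (nat \<Rightarrow> 'y)) filter" where
  "pair_filter = inf (filtercomap (\<lambda>(i, y, y'). (i, y)) micro_filter)
     (inf (filtercomap (\<lambda>(i, y, y'). (i, y')) micro_filter)
       (INF \<epsilon>\<in>{0<..}. principal {(i, y, y'). \<forall>p\<in>P. \<forall>k\<in>{1..d i}. cmod (p (y k) - p (y' k)) < \<epsilon>}))"

lemma filterlim_pair_filter:
  "filterlim (\<lambda>(i, y, y'). (i, y)) micro_filter pair_filter"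
  "filterlim (\<lambda>(i, y, y'). (i, y')) micro_filter pair_filter"
  unfolding pair_filter_def
  by (rule filterlim_mono[OF filterlim_filtercomap order_refl]; simp add: le_infI1 le_infI2)+

lemma eventually_pair_filter_less:
  assumes "\<epsilon> > 0"
  shows "\<forall>\<^sub>F (i, y, y') in pair_filter. \<forall>p\<in>P. \<forall>k\<in>{1..d i}. cmod (p (y k) - p (y' k)) < \<epsilon>"
proof -
  have "pair_filter \<le> principal {(i, y, y'). \<forall>p\<in>P. \<forall>k\<in>{1..d i}. cmod (p (y k) - p (y' k)) < \<epsilon>}"
    unfolding pair_filter_def using assms by (intro le_infI2 INF_lower) auto
  then show ?thesis
    by (rule filter_leD) (auto simp: eventually_principal)
qed

text \<open>Unpacks the filter into explicit parameters. The \<epsilon> found here later becomes the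
  separation scale of the lower bound.\<close>

lemma eventually_pair_filterD:
  assumes "eventually Q pair_filter"
  obtains F m \<delta> \<epsilon> where "finite F" "F \<subseteq> carrier G" "\<delta> > 0" "\<epsilon> > 0"
    "\<forall>\<^sub>F i in sequentially. \<forall>y\<in>microstates F m \<delta> i. \<forall>y'\<in>microstates F m \<delta> i.
       (\<forall>p\<in>P. \<forall>k\<in>{1..d i}. cmod (p (y k) - p (y' k)) < \<epsilon>) \<longrightarrow> Q (i, y, y')"
proof -
  let ?S = "\<lambda>\<epsilon>. {(i, y, y'). \<forall>p\<in>P. \<forall>k\<in>{1..d i}. cmod (p (y k) - p (y' k)) < \<epsilon>} :: (nat \<times> (nat \<Rightarrow> 'y) \<times> (nat \<Rightarrow> 'y)) set"
  obtain A B C where A: "eventually A micro_filter" and B: "eventually B micro_filter"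
    and C: "eventually C (INF \<epsilon>\<in>{0<..}. principal (?S \<epsilon>))"
    and Q: "\<And>i y y'. A (i, y) \<Longrightarrow> B (i, y') \<Longrightarrow> C (i, y, y') \<Longrightarrow> Q (i, y, y')"
    using assms unfolding pair_filter_def eventually_inf eventually_filtercomap by force
  have "\<exists>\<epsilon>\<in>{0<..}. eventually C (principal (?S \<epsilon>))"
    using C
  proof (subst (asm) eventually_INF_base)
    show "\<exists>x\<in>{0<..}. principal (?S x) \<le> inf (principal (?S a)) (principal (?S b))" if "a \<in> {0<..}" "b \<in> {0<..}" for a b :: real
      using that by (intro bexI[of _ "min a b"]) auto
  qed auto
  then obtain \<epsilon> where \<epsilon>: "\<epsilon> > 0" "\<And>i y y'. (i, y, y') \<in> ?S \<epsilon> \<Longrightarrow> C (i, y, y')"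
    by (auto simp: eventually_principal)
  have "eventually (\<lambda>x. A x \<and> B x) micro_filter" using A B by (rule eventually_conj)
  then obtain F m \<delta> where F: "finite F" "F \<subseteq> carrier G" "\<delta> > 0"
    "\<forall>\<^sub>F i in sequentially. \<forall>y\<in>microstates F m \<delta> i. A (i, y) \<and> B (i, y)"
    unfolding eventually_micro_filter micro_ev_def by blast
  show ?thesis
  proof (rule that[OF F(1-3) \<epsilon>(1)])
    show "\<forall>\<^sub>F i in sequentially. \<forall>y\<in>microstates F m \<delta> i. \<forall>y'\<in>microstates F m \<delta> i.
       (\<forall>p\<in>P. \<forall>k\<in>{1..d i}. cmod (p (y k) - p (y' k)) < \<epsilon>) \<longrightarrow> Q (i, y, y')"
      using F(4) by eventually_elim (use Q \<epsilon>(2) in auto)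
  qed
qed

text \<open>Closeness on \<open>P\<close> passes to translates through the chain p(C_s y_k), p(y at
  T_s k), p(y' at T_s k), p(C_s y'_k): the outer steps are equivariance of the two microstates, the
  middle one is closeness at the site T_s k. \<open>L1_close_cfun\<close> extends this to all of
  C(Y).\<close>

lemma pair_L1_close:
  assumes f: "f \<in> cfun Y"
  shows "L1_close pair_filter (\<lambda>x. d (fst x)) (\<lambda>x. fst (snd x)) (\<lambda>x. snd (snd x)) f"
proof (rule L1_close_cfun[OF f])
  have "\<forall>\<^sub>F x in pair_filter. \<forall>k\<in>{1..d (fst x)}. fst (snd x) k \<in> topspace Y"
    using eventually_micro_filter_in[THEN filterlim_pair_filter(1)[unfolded filterlim_iff, rule_format]]
    by (auto simp: case_prod_beta)
  moreover have "\<forall>\<^sub>F x in pair_filter. \<forall>k\<in>{1..d (fst x)}. snd (snd x) k \<in> topspace Y"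
    using eventually_micro_filter_in[THEN filterlim_pair_filter(2)[unfolded filterlim_iff, rule_format]]
    by (auto simp: case_prod_beta)
  ultimately show "\<forall>\<^sub>F x in pair_filter. \<forall>k\<in>{1..d (fst x)}. fst (snd x) k \<in> topspace Y \<and> snd (snd x) k \<in> topspace Y"
    by eventually_elim blast
  note ev = this
  fix s p assume s: "s \<in> carrier G" and p: "p \<in> P"
  define n where "n x = d (fst x)" for x :: "nat \<times> (nat \<Rightarrow> 'y) \<times> (nat \<Rightarrow> 'y)"
  let ?e = "\<lambda>i y. (\<Sum>k=1..d i. cmod (p (C s (y k)) - p (y (T i s k)))) / real (d i)"
  let ?c = "\<lambda>x. (\<Sum>k=1..n x. cmod (p (fst (snd x) k) - p (snd (snd x) k))) / real (n x)"
  have e: "((\<lambda>x. ?e (fst x) (fst (snd x))) \<longlongrightarrow> 0) pair_filter" "((\<lambda>x. ?e (fst x) (snd (snd x))) \<longlongrightarrow> 0) pair_filter"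
    using filterlim_compose[OF equivariance_generator[OF p s] filterlim_pair_filter(1)]
      filterlim_compose[OF equivariance_generator[OF p s] filterlim_pair_filter(2)]
    by (simp_all add: case_prod_beta)
  have c: "(?c \<longlongrightarrow> 0) pair_filter"
  proof (rule tendstoI)
    fix e :: real assume e: "e > 0"
    show "\<forall>\<^sub>F x in pair_filter. dist (?c x) 0 < e"
      using eventually_pair_filter_less[OF half_gt_zero[OF e]]
    proof eventually_elim
      case (elim x)
      then have "?c x \<le> e / 2" using p e by (intro avg_le_const) (auto simp: n_def case_prod_beta intro: less_imp_le)
      moreover have "?c x \<ge> 0" by (intro divide_nonneg_nonneg sum_nonneg) auto
      moreover have "e / 2 < e" using e by simp
      ultimately show ?case unfolding dist_real_def by linarith
    qed
  qed
  have lim: "((\<lambda>x. ?e (fst x) (fst (snd x)) + ?c x + ?e (fst x) (snd (snd x))) \<longlongrightarrow> 0) pair_filter"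
    by (intro tendsto_add_zero e c)
  have le: "\<forall>\<^sub>F x in pair_filter. (\<Sum>k=1..n x. cmod (translate G Y b s p (fst (snd x) k) - translate G Y b s p (snd (snd x) k))) / real (n x)
      \<le> ?e (fst x) (fst (snd x)) + ?c x + ?e (fst x) (snd (snd x))"
    using ev
  proof eventually_elim
    case (elim x)
    obtain i y y' where x: "x = (i, y, y')" by (cases x)
    have "cmod (translate G Y b s p (y k) - translate G Y b s p (y' k))
      \<le> cmod (p (C s (y k)) - p (y (T i s k))) + cmod (p (y (T i s k)) - p (y' (T i s k)))
        + cmod (p (C s (y' k)) - p (y' (T i s k)))" if k: "k \<in> {1..d i}" for k
    proof -
      have "translate G Y b s p (y k) - translate G Y b s p (y' k)
        = (p (C s (y k)) - p (y (T i s k))) + (p (y (T i s k)) - p (y' (T i s k))) - (p (C s (y' k)) - p (y' (T i s k)))"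
        using elim k by (simp add: translate_apply x)
      moreover have "cmod (u + v - w) \<le> cmod u + cmod v + cmod w" for u v w :: complex
        using norm_triangle_ineq4[of "u + v" w] norm_triangle_ineq[of u v] by linarith
      ultimately show ?thesis by (simp only:)
    qed
    then have "(\<Sum>k=1..d i. cmod (translate G Y b s p (y k) - translate G Y b s p (y' k))) / real (d i)
      \<le> (\<Sum>k=1..d i. cmod (p (C s (y k)) - p (y (T i s k))) + cmod (p (y (T i s k)) - p (y' (T i s k)))
        + cmod (p (C s (y' k)) - p (y' (T i s k)))) / real (d i)"
      by (rule avg_mono)
    also have "\<dots> = ?e (fst x) (fst (snd x)) + ?c x + ?e (fst x) (snd (snd x))"
      using sum_T[OF s, of "\<lambda>l. cmod (p (y l) - p (y' l))" i]
      by (simp add: x n_def sum.distrib add_divide_distrib)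
    finally show ?case by (simp add: x n_def)
  qed
  show "L1_close pair_filter (\<lambda>x. d (fst x)) (\<lambda>x. fst (snd x)) (\<lambda>x. snd (snd x)) (translate G Y b s p)"
    unfolding L1_close_def n_def[symmetric]
    by (rule tendsto_sandwich[OF _ le tendsto_const lim])
      (auto intro!: always_eventually divide_nonneg_nonneg sum_nonneg)
qed

end

section \<open>From an isomorphism of actions to maps defined everywhere\<close>

lemma distr_extend_restrict_space:
  assumes A: "A \<in> sets M" "emeasure M (space M - A) = 0" and B: "B \<in> sets N" "emeasure N (space N - B) = 0"
    and \<theta>: "\<theta> \<in> restrict_space M A \<rightarrow>\<^sub>M restrict_space N B"
    and eq: "distr (restrict_space M A) (restrict_space N B) \<theta> = restrict_space N B"
    and y0: "y0 \<in> space N"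
  shows "(\<lambda>z. if z \<in> A then \<theta> z else y0) \<in> M \<rightarrow>\<^sub>M N"
    and "distr M N (\<lambda>z. if z \<in> A then \<theta> z else y0) = N"
proof -
  have AM: "A \<inter> space M = A" and BN: "B \<inter> space N = B"
    using A(1) B(1) sets.sets_into_space by blast+
  have "\<theta> \<in> restrict_space M A \<rightarrow>\<^sub>M N"
    using \<theta> by (simp add: measurable_restrict_space2_iff)
  then show m: "(\<lambda>z. if z \<in> A then \<theta> z else y0) \<in> M \<rightarrow>\<^sub>M N"
    using measurable_restrict_space_iff[of A M y0 N \<theta>] A(1) y0 by (simp add: AM)
  show "distr M N (\<lambda>z. if z \<in> A then \<theta> z else y0) = N"
  proof (rule measure_eqI)
    fix S assume "S \<in> sets (distr M N (\<lambda>z. if z \<in> A then \<theta> z else y0))"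
    then have S: "S \<in> sets N" by simp
    let ?\<Psi> = "\<lambda>z. if z \<in> A then \<theta> z else y0"
    have pre: "?\<Psi> -` S \<inter> space M \<in> sets M" using m S by (rule measurable_sets)
    have null_A: "space M - A \<in> null_sets M" and null_B: "space N - B \<in> null_sets N"
      using A B by (auto intro!: null_setsI)
    have "emeasure (distr M N ?\<Psi>) S = emeasure M (?\<Psi> -` S \<inter> space M)"
      using m S by (rule emeasure_distr)
    \<comment> \<open>The default value \<open>y0\<close> is taken only on the null complement of
      \<open>A\<close>, which may be cut away.\<close>
    also have "\<dots> = emeasure M ((?\<Psi> -` S \<inter> space M) - (space M - A))"
      using null_A pre by (simp add: emeasure_Diff_null_set)
    also have "(?\<Psi> -` S \<inter> space M) - (space M - A) = \<theta> -` (S \<inter> B) \<inter> space (restrict_space M A)"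
      using measurable_space[OF \<theta>] by (auto simp: space_restrict_space)
    also have "emeasure M \<dots> = emeasure (restrict_space M A) (\<theta> -` (S \<inter> B) \<inter> space (restrict_space M A))"
      using A(1) by (subst emeasure_restrict_space) (auto simp: AM space_restrict_space)
    also have "\<dots> = emeasure (distr (restrict_space M A) (restrict_space N B) \<theta>) (S \<inter> B)"
      using S B by (intro emeasure_distr[symmetric] \<theta>) (auto simp: sets_restrict_space BN)
    also have "\<dots> = emeasure N (S \<inter> B)"
      unfolding eq using B(1) by (subst emeasure_restrict_space) (auto simp: BN)
    also have "S \<inter> B = S - (space N - B)" using sets.sets_into_space[OF S] by auto
    also have "emeasure N \<dots> = emeasure N S" using null_B S by (simp add: emeasure_Diff_null_set)
    finally show "emeasure (distr M N ?\<Psi>) S = emeasure N S" .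
  qed simp
qed

text \<open>The pair \<open>\<Phi>\<close>, \<open>\<Psi>\<close> extends an isomorphism of actions and its inverse to everywhere defined
  maps, equivariant almost everywhere.\<close>

locale bernoulli_model = sofic_model G d \<sigma> Y N b P
  for G :: "('g, 'r) monoid_scheme" (structure) and d \<sigma> and Y :: "'y topology" and N b P +
  fixes \<mu> :: "'a measure" and \<Phi> :: "'y \<Rightarrow> 'g \<Rightarrow> 'a" and \<Psi> :: "('g \<Rightarrow> 'a) \<Rightarrow> 'y"
  assumes prob_\<mu>: "prob_space \<mu>"
    and \<Phi>_measurable: "\<Phi> \<in> N \<rightarrow>\<^sub>M PiM (carrier G) (\<lambda>_. \<mu>)"
    and \<Phi>_distr: "distr N (PiM (carrier G) (\<lambda>_. \<mu>)) \<Phi> = PiM (carrier G) (\<lambda>_. \<mu>)"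
    and \<Psi>_measurable: "\<Psi> \<in> PiM (carrier G) (\<lambda>_. \<mu>) \<rightarrow>\<^sub>M N"
    and \<Psi>_distr: "distr (PiM (carrier G) (\<lambda>_. \<mu>)) N \<Psi> = N"
    and \<Psi>_\<Phi>: "AE y in N. \<Psi> (\<Phi> y) = y"
    and \<Phi>_equivariant: "g \<in> carrier G \<Longrightarrow> AE y in N. \<Phi> (C g y) = (\<lambda>h\<in>carrier G. \<Phi> y (g \<otimes> h))"
    and \<Psi>_equivariant: "g \<in> carrier G \<Longrightarrow>
      AE z in PiM (carrier G) (\<lambda>_. \<mu>). \<Psi> (\<lambda>h\<in>carrier G. z (g \<otimes> h)) = C g (\<Psi> z)"

text \<open>Invariance of the two conull sets keeps both sides of the equivariance relation inside
  the domain of the isomorphism, so its extension by constants is equivariant at every point of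
  these sets.\<close>

lemma isomorphic_bernoulli_model:
  fixes G (structure)
  assumes "sofic_model G d \<sigma> Y N b P" and \<mu>: "prob_space \<mu>"
    and iso: "isomorphic_actions G (PiM (carrier G) (\<lambda>_. \<mu>)) (bernoulli_action G \<mu>) N b"
  obtains \<Phi> \<Psi> where "bernoulli_model G d \<sigma> Y N b P \<mu> \<Phi> \<Psi>"
proof -
  interpret sofic_model G d \<sigma> Y N b P by fact
  define Z where "Z = PiM (carrier G) (\<lambda>_. \<mu>)"
  interpret Z: prob_space Z unfolding Z_def by (intro prob_space_PiM \<mu>)
  obtain A B \<theta> where A: "A \<in> sets Z" "emeasure Z (space Z - A) = 0"
    and B: "B \<in> sets N" "emeasure N (space N - B) = 0"
    and inv_A: "\<forall>g\<in>carrier G. bernoulli_action G \<mu> g ` A \<subseteq> A"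
    and inv_B: "\<forall>g\<in>carrier G. b g ` B \<subseteq> B"
    and bij: "bij_betw \<theta> A B"
    and \<theta>: "\<theta> \<in> restrict_space Z A \<rightarrow>\<^sub>M restrict_space N B"
    and \<theta>': "inv_into A \<theta> \<in> restrict_space N B \<rightarrow>\<^sub>M restrict_space Z A"
    and distr_\<theta>: "distr (restrict_space Z A) (restrict_space N B) \<theta> = restrict_space N B"
    and equi: "\<forall>g\<in>carrier G. \<forall>z\<in>A. \<theta> (bernoulli_action G \<mu> g z) = b g (\<theta> z)"
    using iso unfolding isomorphic_actions_def Z_def[symmetric]
    by (elim bexE exE conjE) (rule that, assumption+)
  have AZ: "A \<subseteq> space Z" and BN: "B \<subseteq> space N"
    using A(1) B(1) sets.sets_into_space by blast+
  have sp_A: "space (restrict_space Z A) = A" and sp_B: "space (restrict_space N B) = B"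
    using AZ BN by (auto simp: space_restrict_space)
  obtain z0 y0 where z0: "z0 \<in> space Z" and y0: "y0 \<in> space N"
    using Z.not_empty N.not_empty by blast
  define \<Psi> where "\<Psi> z = (if z \<in> A then \<theta> z else y0)" for z
  define \<Phi> where "\<Phi> y = (if y \<in> B then inv_into A \<theta> y else z0)" for y
  have distr_\<theta>': "distr (restrict_space N B) (restrict_space Z A) (inv_into A \<theta>) = restrict_space Z A"
  proof -
    have "distr (restrict_space N B) (restrict_space Z A) (inv_into A \<theta>)
       = distr (distr (restrict_space Z A) (restrict_space N B) \<theta>) (restrict_space Z A) (inv_into A \<theta>)"
      by (simp add: distr_\<theta>)
    also have "\<dots> = distr (restrict_space Z A) (restrict_space Z A) (inv_into A \<theta> \<circ> \<theta>)"
      by (rule distr_distr[OF \<theta>' \<theta>])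
    also have "\<dots> = distr (restrict_space Z A) (restrict_space Z A) (\<lambda>z. z)"
      using bij by (intro distr_cong) (auto simp: sp_A bij_betw_def)
    also have "\<dots> = restrict_space Z A" by (rule distr_id)
    finally show ?thesis .
  qed
  have AE_A: "AE z in Z. z \<in> A" using A by (intro AE_I[of _ _ "space Z - A"]) auto
  have AE_B: "AE y in N. y \<in> B" using B by (intro AE_I[of _ _ "space N - B"]) auto
  \<comment> \<open>Acting by the inverse of g cancels the inverse in the definition and leaves the
    plain shift z -> z(g .), the counterpart of \<open>C g\<close>.\<close>
  have act_A: "bernoulli_action G \<mu> (inv g) z = (\<lambda>h\<in>carrier G. z (g \<otimes> h))" if "g \<in> carrier G" "z \<in> A" for g z
    using that AZ by (auto simp: bernoulli_action_def Z_def)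
  have "bernoulli_model G d \<sigma> Y N b P \<mu> \<Phi> \<Psi>"
  proof (intro bernoulli_model.intro bernoulli_model_axioms.intro assms(1) \<mu>, unfold Z_def[symmetric])
    show "\<Phi> \<in> N \<rightarrow>\<^sub>M Z" "distr N Z \<Phi> = Z"
      unfolding \<Phi>_def using distr_extend_restrict_space[OF B A \<theta>' distr_\<theta>' z0] by simp_all
    show "\<Psi> \<in> Z \<rightarrow>\<^sub>M N" "distr Z N \<Psi> = N"
      unfolding \<Psi>_def using distr_extend_restrict_space[OF A B \<theta> distr_\<theta> y0] by simp_all
    show "AE y in N. \<Psi> (\<Phi> y) = y"
      using AE_B bij_betw_inv_into_right[OF bij] bij_betw_apply[OF bij_betw_inv_into[OF bij]]
      by (auto simp: \<Phi>_def \<Psi>_def)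
    show "AE y in N. \<Phi> (C g y) = (\<lambda>h\<in>carrier G. \<Phi> y (g \<otimes> h))" if g: "g \<in> carrier G" for g
      using AE_B
    proof eventually_elim
      case (elim y)
      define z where "z = inv_into A \<theta> y"
      have z: "z \<in> A" "\<theta> z = y"
        using elim bij_betw_inv_into_right[OF bij] bij_betw_apply[OF bij_betw_inv_into[OF bij]] by (auto simp: z_def)
      have in_A: "bernoulli_action G \<mu> (inv g) z \<in> A" and in_B: "C g y \<in> B"
        using bspec[OF inv_A, of "inv g"] bspec[OF inv_B, of "inv g"] g z elim by auto
      have "C g y = \<theta> (bernoulli_action G \<mu> (inv g) z)" using bspec[OF bspec[OF equi, of "inv g"], of z] g z by simp
      then have "inv_into A \<theta> (C g y) = bernoulli_action G \<mu> (inv g) z"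
        using bij_betw_inv_into_left[OF bij in_A] by simp
      then show ?case using in_B elim act_A[OF g z(1)] by (simp add: \<Phi>_def z_def)
    qed
    show "AE z in Z. \<Psi> (\<lambda>h\<in>carrier G. z (g \<otimes> h)) = C g (\<Psi> z)" if g: "g \<in> carrier G" for g
      using AE_A
    proof eventually_elim
      case (elim z)
      have "bernoulli_action G \<mu> (inv g) z \<in> A" using bspec[OF inv_A, of "inv g"] g elim by auto
      then show ?case using elim bspec[OF bspec[OF equi, of "inv g"], of z] g act_A[OF g elim] by (simp add: \<Psi>_def)
    qed
  qed
  then show ?thesis by (rule that)
qed

text \<open>Approximation in probability with the fixed tolerance 1/4. As an indicator has only the
  values 0 and 1, this already identifies membership off a small set. The class \<open>R\<close> is
  a parameter so that one induction serves both for continuous functions on \<open>Y\<close> and for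
  functions of finitely many letters.\<close>

definition approximable :: "'x measure \<Rightarrow> (('x \<Rightarrow> real) \<Rightarrow> bool) \<Rightarrow> 'x set \<Rightarrow> bool" where
  "approximable M R E \<longleftrightarrow>
     (\<forall>\<kappa>>0. \<exists>f. R f \<and> measure M {x \<in> space M. \<bar>f x - indicator E x\<bar> \<ge> 1/4} < \<kappa>)"

section \<open>Approximation by finitely many letters\<close>

text \<open>Complements correspond to 1 - f and binary unions to max, both of which preserve the
  tolerance 1/4. A countable union is exhausted in measure by a finite one, because the measure is
  finite.\<close>

lemma approximable_sigma_sets:
  assumes M: "finite_measure M" and "E \<in> sigma_sets (space M) \<E>" and \<E>: "\<E> \<subseteq> sets M"
    and meas: "\<And>f. R f \<Longrightarrow> f \<in> borel_measurable M"
    and zero: "R (\<lambda>_. 0)" and compl: "\<And>f. R f \<Longrightarrow> R (\<lambda>x. 1 - f x)"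
    and max: "\<And>f g. R f \<Longrightarrow> R g \<Longrightarrow> R (\<lambda>x. max (f x) (g x))"
    and gen: "\<And>E. E \<in> \<E> \<Longrightarrow> approximable M R E"
  shows "approximable M R E"
proof -
  interpret finite_measure M by fact
  have sM: "sigma_sets (space M) \<E> \<subseteq> sets M" using \<E> by (rule sets.sigma_sets_subset)
  have meas_diff: "{x \<in> space M. \<bar>f x - indicator E x\<bar> \<ge> 1/4} \<in> sets M" if "R f" "E \<in> sets M" for f E
    using meas[OF that(1)] that(2) by measurable
  have binary: "approximable M R (A \<union> B)" if AB: "approximable M R A" "approximable M R B" "A \<in> sets M" "B \<in> sets M" for A B
    unfolding approximable_def
  proof (intro allI impI)
    fix \<kappa> :: real assume \<kappa>: "\<kappa> > 0"
    obtain f where f: "R f" "measure M {x \<in> space M. \<bar>f x - indicator A x\<bar> \<ge> 1/4} < \<kappa> / 2"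
      using AB(1)[unfolded approximable_def, rule_format, OF half_gt_zero[OF \<kappa>]] by blast
    obtain g where g: "R g" "measure M {x \<in> space M. \<bar>g x - indicator B x\<bar> \<ge> 1/4} < \<kappa> / 2"
      using AB(2)[unfolded approximable_def, rule_format, OF half_gt_zero[OF \<kappa>]] by blast
    have "measure M {x \<in> space M. \<bar>max (f x) (g x) - indicator (A \<union> B) x\<bar> \<ge> 1/4}
      \<le> measure M ({x \<in> space M. \<bar>f x - indicator A x\<bar> \<ge> 1/4} \<union> {x \<in> space M. \<bar>g x - indicator B x\<bar> \<ge> 1/4})"
    proof (intro finite_measure_mono subsetI)
      fix x assume x: "x \<in> {x \<in> space M. \<bar>max (f x) (g x) - indicator (A \<union> B) x\<bar> \<ge> 1/4}"
      have "\<bar>max (f x) (g x) - indicator (A \<union> B) x\<bar> < 1/4"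
        if "\<bar>f x - indicator A x\<bar> < 1/4" "\<bar>g x - indicator B x\<bar> < 1/4"
        using that by (cases "x \<in> A"; cases "x \<in> B"; cases "f x \<le> g x") (auto simp: abs_less_iff)
      then show "x \<in> {x \<in> space M. \<bar>f x - indicator A x\<bar> \<ge> 1/4} \<union> {x \<in> space M. \<bar>g x - indicator B x\<bar> \<ge> 1/4}"
        using x by (auto simp del: indicator_simps simp: not_le[symmetric])
    qed (use meas_diff f g AB in auto)
    also have "\<dots> \<le> measure M {x \<in> space M. \<bar>f x - indicator A x\<bar> \<ge> 1/4} + measure M {x \<in> space M. \<bar>g x - indicator B x\<bar> \<ge> 1/4}"
      using meas_diff f g AB by (intro measure_Un_le) auto
    also have "\<dots> < \<kappa>" using f g by simp
    finally show "\<exists>f. R f \<and> measure M {x \<in> space M. \<bar>f x - indicator (A \<union> B) x\<bar> \<ge> 1/4} < \<kappa>"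
      using max[OF f(1) g(1)] by blast
  qed
  show ?thesis
    using assms(2)
  proof induction
    case (Basic E)
    then show ?case by (rule gen)
  next
    case Empty
    show ?case unfolding approximable_def using zero by (auto intro!: exI[of _ "\<lambda>_. 0"])
  next
    case (Compl A)
    show ?case unfolding approximable_def
    proof (intro allI impI)
      fix \<kappa> :: real assume "\<kappa> > 0"
      then obtain f where f: "R f" "measure M {x \<in> space M. \<bar>f x - indicator A x\<bar> \<ge> 1/4} < \<kappa>"
        using Compl.IH unfolding approximable_def by blast
      have "{x \<in> space M. \<bar>(1 - f x) - indicator (space M - A) x\<bar> \<ge> 1/4} = {x \<in> space M. \<bar>f x - indicator A x\<bar> \<ge> 1/4}"
        by (auto simp: indicator_def abs_minus_commute)
      then show "\<exists>f. R f \<and> measure M {x \<in> space M. \<bar>f x - indicator (space M - A) x\<bar> \<ge> 1/4} < \<kappa>"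
        using f compl by (intro exI[of _ "\<lambda>x. 1 - f x"]) auto
    qed
  next
    case (Union A)
    have AM: "A i \<in> sets M" for i using Union.hyps sM by blast
    define U where "U n = (\<Union>i<n. A i)" for n
    have UM: "U n \<in> sets M" for n unfolding U_def using AM by auto
    have U_approx: "approximable M R (U n)" for n
    proof (induction n)
      case 0
      show ?case unfolding approximable_def U_def using zero by (auto intro!: exI[of _ "\<lambda>_. 0"])
    next
      case (Suc n)
      have "U (Suc n) = U n \<union> A n" by (auto simp: U_def less_Suc_eq)
      then show ?case using binary[OF Suc Union.IH[of n] UM AM] by simp
    qed
    have "(\<Union>n. U n) = (\<Union>i. A i)" by (auto simp: U_def)
    moreover have "(\<lambda>n. measure M (U n)) \<longlonglongrightarrow> measure M (\<Union>n. U n)"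
      using UM by (intro finite_Lim_measure_incseq) (auto simp: incseq_def U_def intro: order_less_le_trans)
    ultimately have lim: "(\<lambda>n. measure M (U n)) \<longlonglongrightarrow> measure M (\<Union>i. A i)" by simp
    show ?case unfolding approximable_def
    proof (intro allI impI)
      fix \<kappa> :: real assume \<kappa>: "\<kappa> > 0"
      obtain n where n: "\<bar>measure M (U n) - measure M (\<Union>i. A i)\<bar> < \<kappa> / 2"
        using LIMSEQ_D[OF lim, of "\<kappa>/2"] \<kappa> by auto
      obtain f where f: "R f" "measure M {x \<in> space M. \<bar>f x - indicator (U n) x\<bar> \<ge> 1/4} < \<kappa> / 2"
        using U_approx[of n, unfolded approximable_def, rule_format, OF half_gt_zero[OF \<kappa>]] by blast
      have "measure M {x \<in> space M. \<bar>f x - indicator (\<Union>i. A i) x\<bar> \<ge> 1/4}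
        \<le> measure M ({x \<in> space M. \<bar>f x - indicator (U n) x\<bar> \<ge> 1/4} \<union> ((\<Union>i. A i) - U n))"
        using meas_diff[OF f(1) UM] UM AM
        by (intro finite_measure_mono) (auto simp: indicator_def U_def split: if_splits)
      also have "\<dots> \<le> measure M {x \<in> space M. \<bar>f x - indicator (U n) x\<bar> \<ge> 1/4} + measure M ((\<Union>i. A i) - U n)"
        using meas_diff[OF f(1) UM] UM AM by (intro measure_Un_le) auto
      also have "measure M ((\<Union>i. A i) - U n) = measure M (\<Union>i. A i) - measure M (U n)"
        using UM AM by (intro finite_measure_Diff) (auto simp: U_def)
      finally have "measure M {x \<in> space M. \<bar>f x - indicator (\<Union>i. A i) x\<bar> \<ge> 1/4} < \<kappa>"
        using f(2) n[unfolded abs_diff_less_iff] by linarith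
      then show "\<exists>f. R f \<and> measure M {x \<in> space M. \<bar>f x - indicator (\<Union>i. A i) x\<bar> \<ge> 1/4} < \<kappa>"
        using f(1) by blast
    qed
  qed
qed

text \<open>For an open set the complement K is closed, hence a decreasing intersection of open sets
  V_n in a metrizable space. A Urysohn function that is 0 on K and 1 off V_n errs only on V_n - K,
  whose measure tends to 0.\<close>

lemma approximable_continuous:
  assumes Y: "metrizable_space Y" and N: "sets N = sets (borel_of Y)" "finite_measure N" and E: "E \<in> sets N"
  shows "approximable N (\<lambda>f. continuous_map Y euclideanreal f) E"
proof (rule approximable_sigma_sets[OF N(2), where \<E> = "{U. openin Y U}"])
  interpret finite_measure N by fact
  have sp: "space N = topspace Y" using sets_eq_imp_space_eq[OF N(1)] by simp
  show "E \<in> sigma_sets (space N) {U. openin Y U}" using E N(1) by (simp add: sets_borel_of sp)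
  show open_N: "{U. openin Y U} \<subseteq> sets N" using N(1) by (auto simp: sets_borel_of)
  show "f \<in> borel_measurable N" if "continuous_map Y euclideanreal f" for f :: "'a \<Rightarrow> real"
    by (rule borel_measurable_continuous_map[OF that N(1)])
  show "approximable N (\<lambda>f. continuous_map Y euclideanreal f) U" if "U \<in> {U. openin Y U}" for U
    unfolding approximable_def
  proof (intro allI impI)
    fix \<kappa> :: real assume \<kappa>: "\<kappa> > 0"
    define K where "K = topspace Y - U"
    have U: "openin Y U" and K: "closedin Y K" using that by (auto simp: K_def)
    obtain V where V: "\<And>n::nat. openin Y (V n)" "\<And>n. V (Suc n) \<subseteq> V n" "\<Inter>(range V) = K"
      using closed_imp_gdelta_in[OF Y K] unfolding gdelta_in_descending by blast
    have VN: "V n \<in> sets N" and KN: "K \<in> sets N" for n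
    proof -
      show VN: "V n \<in> sets N" for n using V(1) open_N by blast
      have "K = space N - U" by (simp add: K_def sp)
      then show "K \<in> sets N" using U open_N by auto
    qed
    have "(\<lambda>n. measure N (V n)) \<longlonglongrightarrow> measure N (\<Inter>n. V n)"
      using VN V(2) by (intro finite_Lim_measure_decseq) (auto intro: decseq_SucI)
    then have lim: "(\<lambda>n. measure N (V n)) \<longlonglongrightarrow> measure N K" using V(3) by simp
    obtain n where n: "\<bar>measure N (V n) - measure N K\<bar> < \<kappa>"
      using LIMSEQ_D[OF lim \<kappa>] by auto
    have KV: "K \<subseteq> V n" using V(3) by blast
    obtain f where f: "continuous_map Y euclideanreal f" "f ` K \<subseteq> {0}" "f ` (topspace Y - V n) \<subseteq> {1}"
      using Urysohn_lemma_alt[OF metrizable_imp_normal_space[OF Y] K, of "topspace Y - V n" 0 1] V(1) KV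
      by (auto simp: disjnt_def)
    have "{x \<in> space N. \<bar>f x - indicator U x\<bar> \<ge> 1/4} \<subseteq> V n - K"
      using f(2,3) by (auto simp: sp K_def indicator_def split: if_splits)
    then have "measure N {x \<in> space N. \<bar>f x - indicator U x\<bar> \<ge> 1/4} \<le> measure N (V n - K)"
      using VN KN by (intro finite_measure_mono) auto
    also have "\<dots> < \<kappa>" using finite_measure_Diff[OF VN KN KV] n by simp
    finally show "\<exists>f. continuous_map Y euclideanreal f \<and> measure N {x \<in> space N. \<bar>f x - indicator U x\<bar> \<ge> 1/4} < \<kappa>"
      using f by blast
  qed
  show "continuous_map Y euclideanreal (\<lambda>x. 1 - f x)" if "continuous_map Y euclideanreal f" for f :: "'a \<Rightarrow> real"
    using that by (intro continuous_map_diff) auto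
  show "continuous_map Y euclideanreal (\<lambda>x. max (f x) (g x))"
    if "continuous_map Y euclideanreal f" "continuous_map Y euclideanreal g" for f g :: "'a \<Rightarrow> real"
    using that by (intro continuous_map_real_max)
qed auto

text \<open>The word takes finitely many values and each value is attained on a measurable set, so
  an arbitrary function \<open>h\<close> of the word is measurable.\<close>

lemma measurable_finite_word:
  assumes W: "finite W" "W \<subseteq> I" and c: "c \<in> \<mu> \<rightarrow>\<^sub>M count_space UNIV" "finite (c ` space \<mu>)"
    and h: "\<And>w. h w \<in> space L"
  shows "(\<lambda>z. h (\<lambda>g\<in>W. c (z g))) \<in> PiM I (\<lambda>_. \<mu>) \<rightarrow>\<^sub>M L"
proof -
  let ?V = "PiE W (\<lambda>_. c ` space \<mu>)"
  have comp: "(\<lambda>z. z g) \<in> PiM I (\<lambda>_. \<mu>) \<rightarrow>\<^sub>M \<mu>" if "g \<in> W" for g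
    using W that by (intro measurable_component_singleton) auto
  have "(\<lambda>z. \<lambda>g\<in>W. c (z g)) \<in> PiM I (\<lambda>_. \<mu>) \<rightarrow>\<^sub>M count_space ?V"
  proof (subst measurable_count_space_eq2)
    show "finite ?V" using W c by (intro finite_PiE) auto
    show "(\<lambda>z. \<lambda>g\<in>W. c (z g)) \<in> space (PiM I (\<lambda>_. \<mu>)) \<rightarrow> ?V
      \<and> (\<forall>v\<in>?V. (\<lambda>z. \<lambda>g\<in>W. c (z g)) -` {v} \<inter> space (PiM I (\<lambda>_. \<mu>)) \<in> sets (PiM I (\<lambda>_. \<mu>)))"
    proof (intro conjI ballI)
      show "(\<lambda>z. \<lambda>g\<in>W. c (z g)) \<in> space (PiM I (\<lambda>_. \<mu>)) \<rightarrow> ?V"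
        using measurable_space[OF comp] by auto
      fix v assume v: "v \<in> ?V"
      have "(\<lambda>z. \<lambda>g\<in>W. c (z g)) -` {v} \<inter> space (PiM I (\<lambda>_. \<mu>))
        = {z \<in> space (PiM I (\<lambda>_. \<mu>)). \<forall>g\<in>W. c (z g) = v g}"
        using v by (auto simp: fun_eq_iff PiE_iff extensional_def)
      also have "\<dots> \<in> sets (PiM I (\<lambda>_. \<mu>))"
      proof (rule sets.sets_Collect_finite_All[OF _ W(1)])
        fix g assume "g \<in> W"
        have "{z \<in> space (PiM I (\<lambda>_. \<mu>)). c (z g) = v g}
          = (\<lambda>z. c (z g)) -` {v g} \<inter> space (PiM I (\<lambda>_. \<mu>))" by auto
        also have "\<dots> \<in> sets (PiM I (\<lambda>_. \<mu>))"
          using measurable_compose[OF comp[OF \<open>g \<in> W\<close>] c(1)] by (rule measurable_sets) auto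
        finally show "{z \<in> space (PiM I (\<lambda>_. \<mu>)). c (z g) = v g} \<in> sets (PiM I (\<lambda>_. \<mu>))" .
      qed
      finally show "(\<lambda>z. \<lambda>g\<in>W. c (z g)) -` {v} \<inter> space (PiM I (\<lambda>_. \<mu>)) \<in> sets (PiM I (\<lambda>_. \<mu>))" .
    qed
  qed
  moreover have "h \<in> count_space ?V \<rightarrow>\<^sub>M L" using h by auto
  ultimately show ?thesis by (rule measurable_compose)
qed

text \<open>A finite measurable partition of the base with numbered cells. Numbers rather than sets,
  so that several codes can be merged into one through an encoding of lists.\<close>

definition finite_code :: "'a measure \<Rightarrow> ('a \<Rightarrow> nat) \<Rightarrow> bool" where
  "finite_code \<mu> c \<longleftrightarrow> c \<in> \<mu> \<rightarrow>\<^sub>M count_space UNIV \<and> finite (c ` space \<mu>)"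

text \<open>The common refinement of finitely many partitions.\<close>

lemma finite_code_list:
  assumes "\<And>c. c \<in> set cs \<Longrightarrow> finite_code \<mu> c"
  shows "finite_code \<mu> (\<lambda>x. list_encode (map (\<lambda>c. c x) cs))"
  using assms
proof (induction cs)
  case Nil
  show ?case by (auto simp: finite_code_def intro: finite_subset[of _ "{list_encode []}"])
next
  case (Cons c cs)
  let ?c' = "\<lambda>x. list_encode (map (\<lambda>c. c x) cs)"
  have c: "finite_code \<mu> c" "finite_code \<mu> ?c'" using Cons by auto
  have [measurable]: "c \<in> \<mu> \<rightarrow>\<^sub>M count_space UNIV" "?c' \<in> \<mu> \<rightarrow>\<^sub>M count_space UNIV"
    using c by (auto simp: finite_code_def)
  have eq: "list_encode (map (\<lambda>c. c x) (c # cs)) = (\<lambda>(a, b). Suc (prod_encode (a, b))) (c x, ?c' x)" for x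
    by simp
  have "(\<lambda>x. Suc (prod_encode (c x, ?c' x))) \<in> \<mu> \<rightarrow>\<^sub>M count_space UNIV" by measurable
  moreover have "(\<lambda>x. Suc (prod_encode (c x, ?c' x))) ` space \<mu>
      \<subseteq> (\<lambda>(a, b). Suc (prod_encode (a, b))) ` (c ` space \<mu> \<times> ?c' ` space \<mu>)" by auto
  then have "finite ((\<lambda>x. Suc (prod_encode (c x, ?c' x))) ` space \<mu>)"
    by (rule finite_subset) (use c in \<open>auto simp: finite_code_def\<close>)
  ultimately show ?case unfolding finite_code_def eq by simp
qed

definition finitary :: "'g set \<Rightarrow> 'a measure \<Rightarrow> (('g \<Rightarrow> 'a) \<Rightarrow> real) \<Rightarrow> bool" where
  "finitary I \<mu> f \<longleftrightarrow> (\<exists>c W S. finite_code \<mu> c \<and> finite W \<and> W \<subseteq> I \<and>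
     f = (\<lambda>z. indicator S (\<lambda>g\<in>W. c (z g))))"

lemma finitaryI:
  assumes "finite_code \<mu> c" "finite W" "W \<subseteq> I" "\<And>z. f z = (if Q (\<lambda>g\<in>W. c (z g)) then 1 else 0)"
  shows "finitary I \<mu> f"
  unfolding finitary_def using assms
  by (intro exI[of _ c] exI[of _ W] exI[of _ "Collect Q"]) (auto simp: indicator_def)

text \<open>A set restricting one coordinate is exactly a function of one letter under a two-letter
  code, and such sets generate the product \<sigma>-algebra.\<close>

lemma approximable_finitary:
  fixes \<mu> :: "'a measure" and I :: "'g set"
  assumes \<mu>: "prob_space \<mu>" and E: "E \<in> sets (PiM I (\<lambda>_. \<mu>))"
  shows "approximable (PiM I (\<lambda>_. \<mu>)) (finitary I \<mu>) E"
proof -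
  define Z where "Z = PiM I (\<lambda>_. \<mu>)"
  interpret Z: prob_space Z unfolding Z_def by (intro prob_space_PiM \<mu>)
  have "approximable Z (finitary I \<mu>) E"
  proof (rule approximable_sigma_sets)
    show "finite_measure Z" by (rule Z.finite_measure_axioms)
    let ?E = "{{f \<in> PiE I (\<lambda>_. space \<mu>). f i \<in> A} |i A. i \<in> I \<and> A \<in> sets \<mu>}"
    show "E \<in> sigma_sets (space Z) ?E"
      using E unfolding Z_def by (simp add: sets_PiM_single space_PiM)
    have sgen: "{f \<in> PiE I (\<lambda>_. space \<mu>). f i \<in> A} \<in> sets Z" if "i \<in> I" "A \<in> sets \<mu>" for i A
    proof -
      have "(\<lambda>z. z i) -` A \<inter> space Z \<in> sets Z"
        using that unfolding Z_def by (intro measurable_sets[OF measurable_component_singleton])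
      also have "(\<lambda>z. z i) -` A \<inter> space Z = {f \<in> PiE I (\<lambda>_. space \<mu>). f i \<in> A}"
        by (auto simp: Z_def space_PiM)
      finally show ?thesis .
    qed
    then show "?E \<subseteq> sets Z" by auto
    show "f \<in> borel_measurable Z" if "finitary I \<mu> f" for f
      using that unfolding finitary_def finite_code_def Z_def
      by (auto intro!: measurable_finite_word)
    show "finitary I \<mu> (\<lambda>_. 0)"
      by (rule finitaryI[of \<mu> "\<lambda>_. 0" "{}" I _ "\<lambda>_. False"]) (auto simp: finite_code_def intro: finite_subset[of _ "{0}"])
    show "finitary I \<mu> (\<lambda>z. 1 - f z)" if f: "finitary I \<mu> f" for f
    proof -
      obtain c W S where c: "finite_code \<mu> c" "finite W" "W \<subseteq> I" "f = (\<lambda>z. indicator S (\<lambda>g\<in>W. c (z g)))"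
        using f unfolding finitary_def by blast
      then show ?thesis by (intro finitaryI[of \<mu> c W I _ "\<lambda>w. w \<notin> S"]) auto
    qed
    show "finitary I \<mu> (\<lambda>z. max (f z) (g z))" if fg: "finitary I \<mu> f" "finitary I \<mu> g" for f g
    proof -
      obtain c W S where c: "finite_code \<mu> c" "finite W" "W \<subseteq> I" "f = (\<lambda>z. indicator S (\<lambda>g\<in>W. c (z g)))"
        using fg(1) unfolding finitary_def by blast
      obtain c' W' S' where c': "finite_code \<mu> c'" "finite W'" "W' \<subseteq> I" "g = (\<lambda>z. indicator S' (\<lambda>g\<in>W'. c' (z g)))"
        using fg(2) unfolding finitary_def by blast
      \<comment> \<open>Two finitary functions are put on a common footing by refining their codes
        and uniting their windows; entries 0 and 1 of the decoded list recover the original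
        letters.\<close>
      let ?c = "\<lambda>x. list_encode (map (\<lambda>c. c x) [c, c'])"
      let ?Q = "\<lambda>w. (\<lambda>g\<in>W. list_decode (w g) ! 0) \<in> S \<or> (\<lambda>g\<in>W'. list_decode (w g) ! 1) \<in> S'"
      show ?thesis
      proof (rule finitaryI[where c = ?c and W = "W \<union> W'" and Q = ?Q])
        show "finite_code \<mu> ?c" using c c' by (intro finite_code_list) auto
        show "finite (W \<union> W')" "W \<union> W' \<subseteq> I" using c c' by auto
        fix z :: "'g \<Rightarrow> 'a"
        have "(\<lambda>g\<in>W. list_decode ((\<lambda>g\<in>W \<union> W'. ?c (z g)) g) ! 0) = (\<lambda>g\<in>W. c (z g))"
          "(\<lambda>g\<in>W'. list_decode ((\<lambda>g\<in>W \<union> W'. ?c (z g)) g) ! 1) = (\<lambda>g\<in>W'. c' (z g))"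
          by (auto simp del: list_encode.simps list_decode.simps simp: list_encode_inverse)
        then show "max (f z) (g z) = (if ?Q (\<lambda>g\<in>W \<union> W'. ?c (z g)) then 1 else 0)"
          unfolding c c' by (simp only:) (simp add: indicator_def max_def)
      qed
    qed
    show "approximable Z (finitary I \<mu>) A" if A: "A \<in> ?E" for A
    proof -
      obtain i B where A: "A = {f \<in> PiE I (\<lambda>_. space \<mu>). f i \<in> B}" "i \<in> I" "B \<in> sets \<mu>" using A by blast
      define c :: "'a \<Rightarrow> nat" where "c x = indicator B x" for x
      define f :: "('g \<Rightarrow> 'a) \<Rightarrow> real" where "f z = (if c (z i) = 1 then 1 else 0)" for z
      have "finite_code \<mu> c"
        unfolding finite_code_def c_def using A(3)
        by (auto intro!: finite_subset[of _ "{0, 1}"] simp: indicator_def)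
      then have "finitary I \<mu> f"
        using A(2) by (intro finitaryI[of \<mu> c "{i}" I f "\<lambda>w. w i = 1"]) (auto simp: f_def)
      moreover have "{z \<in> space Z. \<bar>f z - indicator A z\<bar> \<ge> 1/4} = {}"
        using A by (auto simp: Z_def space_PiM f_def c_def indicator_def)
      ultimately show ?thesis
        unfolding approximable_def by (intro allI impI exI[of _ f]) (simp only: measure_empty simp_thms)
    qed
  qed
  then show ?thesis by (simp add: Z_def)
qed

context sofic_model
begin

lemma complex_of_real_cfun:
  "continuous_map Y euclideanreal f \<Longrightarrow> (\<lambda>y\<in>topspace Y. complex_of_real (f y)) \<in> cfun Y"
  unfolding cfun_restrict_iff
  by (rule continuous_map_euclidean_compose[of _ f complex_of_real]) (auto intro!: continuous_intros)

text \<open>The portmanteau inequality for microstates. A Urysohn function lying below the indicator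
  of \<open>U\<close>, with integral at least the measure of \<open>U\<close> minus e/2, has
  averages converging to that integral. Only this lower bound is available for open sets; upper
  bounds later come from complements.\<close>

lemma open_frequency:
  assumes U: "openin Y U" and e: "e > 0"
  shows "\<forall>\<^sub>F x in micro_filter.
    measure N U - e \<le> real (card {k\<in>{1..d (fst x)}. snd x k \<in> U}) / real (d (fst x))"
proof -
  define K where "K = topspace Y - U"
  have K: "closedin Y K" using U by (auto simp: K_def)
  have open_N: "V \<in> sets N" if "openin Y V" for V using that sets_N by (auto simp: sets_borel_of)
  have UN: "U \<in> sets N" using open_N U by blast
  have KN: "K \<in> sets N" unfolding K_def space_N[symmetric] using UN by auto
  obtain V where V: "\<And>n::nat. openin Y (V n)" "\<And>n. V (Suc n) \<subseteq> V n" "\<Inter>(range V) = K"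
    using closed_imp_gdelta_in[OF metrizable_Y K] unfolding gdelta_in_descending by blast
  have "(\<lambda>n. measure N (V n)) \<longlonglongrightarrow> measure N (\<Inter>n. V n)"
    using open_N V by (intro N.finite_Lim_measure_decseq decseq_SucI) auto
  then have lim: "(\<lambda>n. measure N (V n)) \<longlonglongrightarrow> measure N K" using V(3) by simp
  obtain n where n: "\<bar>measure N (V n) - measure N K\<bar> < e / 2"
    using LIMSEQ_D[OF lim, of "e/2"] e by auto
  have KV: "K \<subseteq> V n" using V(3) by blast
  obtain f where f: "continuous_map Y (top_of_set {0..1::real}) f" "f ` K \<subseteq> {0}" "f ` (topspace Y - V n) \<subseteq> {1}"
    using Urysohn_lemma[OF metrizable_imp_normal_space[OF metrizable_Y] K, of "topspace Y - V n" 0 1] V(1) KV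
    by (auto simp: disjnt_def)
  have fc: "continuous_map Y euclideanreal f" and f01: "\<And>y. y \<in> topspace Y \<Longrightarrow> f y \<in> {0..1}"
    using f(1) by (auto simp: continuous_map_in_subtopology image_subset_iff)
  let ?f = "\<lambda>y\<in>topspace Y. complex_of_real (f y)"
  have fm: "f \<in> borel_measurable N" by (rule borel_measurable_continuous_map[OF fc sets_N])
  have fi: "integrable N f"
    using f01 by (intro N.integrable_const_bound[where B = 1] fm) (auto simp: space_N)
  have int_f: "(\<integral>y. ?f y \<partial>N) = complex_of_real (\<integral>y. f y \<partial>N)"
    by (subst integral_complex_of_real[symmetric], rule Bochner_Integration.integral_cong) (auto simp: space_N)
  have "measure N U = 1 - measure N K"
    using N.prob_compl[OF UN] by (simp add: K_def space_N)
  also have "\<dots> - e / 2 \<le> 1 - measure N (V n)" using n[unfolded abs_diff_less_iff] by linarith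
  also have "\<dots> = measure N (space N - V n)" using N.prob_compl[OF open_N[OF V(1)]] by simp
  also have "\<dots> = (\<integral>y. indicator (space N - V n) y \<partial>N)" using open_N[OF V(1)] by simp
  also have "\<dots> \<le> (\<integral>y. f y \<partial>N)"
  proof (rule integral_mono[OF _ fi])
    show "integrable N (indicator (space N - V n) :: 'y \<Rightarrow> real)"
      using open_N[OF V(1), of n] by (intro integrable_real_indicator) (auto simp: N.emeasure_eq_measure)
    show "indicator (space N - V n) y \<le> f y" if "y \<in> space N" for y
      using that f(3) f01 by (auto simp: space_N indicator_def image_subset_iff)
  qed
  finally have int: "measure N U - e / 2 \<le> (\<integral>y. f y \<partial>N)" .
  have "empirical ?f" by (rule microstates_empirical[OF complex_of_real_cfun[OF fc]])
  then have "\<forall>\<^sub>F x in micro_filter. dist ((\<Sum>k=1..d (fst x). ?f (snd x k)) / of_nat (d (fst x))) (\<integral>y. ?f y \<partial>N) < e / 2"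
    unfolding empirical_def by (rule tendstoD) (use e in simp)
  then show ?thesis
    using eventually_micro_filter_in
  proof eventually_elim
    case (elim x)
    let ?n = "d (fst x)" and ?y = "snd x"
    have "(\<Sum>k=1..?n. ?f (?y k)) / of_nat ?n = complex_of_real ((\<Sum>k=1..?n. f (?y k)) / real ?n)"
      using elim(2) by simp
    then have "\<bar>(\<Sum>k=1..?n. f (?y k)) / real ?n - (\<integral>y. f y \<partial>N)\<bar> < e / 2"
      using elim(1) unfolding int_f by (simp only: dist_of_real dist_real_def)
    moreover have "(\<Sum>k=1..?n. f (?y k)) / real ?n \<le> (\<Sum>k=1..?n. if ?y k \<in> U then 1 else 0) / real ?n"
    proof (rule avg_mono)
      fix k assume "k \<in> {1..?n}"
      then have "?y k \<in> topspace Y" using elim(2) by blast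
      then show "f (?y k) \<le> (if ?y k \<in> U then 1 else 0)"
        using f01[of "?y k"] f(2) by (auto simp: K_def image_subset_iff)
    qed
    moreover have "(\<Sum>k=1..?n. if ?y k \<in> U then 1 else 0) = real (card {k\<in>{1..?n}. ?y k \<in> U})"
      by (simp add: sum.If_cases Int_def)
    ultimately show ?case using int by (simp only:)
  qed
qed

end

context bernoulli_model
begin

abbreviation Z :: "('g \<Rightarrow> 'a) measure" where "Z \<equiv> PiM (carrier G) (\<lambda>_. \<mu>)"

sublocale \<mu>: prob_space \<mu> by (rule prob_\<mu>)
sublocale Z: prob_space Z by (intro prob_space_PiM prob_\<mu>)

lemma \<Psi>_in: "z \<in> space Z \<Longrightarrow> \<Psi> z \<in> topspace Y"
  using measurable_space[OF \<Psi>_measurable] by (simp add: space_N)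

lemma \<Phi>_in: "y \<in> topspace Y \<Longrightarrow> \<Phi> y \<in> space Z"
  using measurable_space[OF \<Phi>_measurable] by (simp add: space_N)

text \<open>Quantize \<open>Y\<close> into n cells and approximate each event "the point \<Psi> z
  lies in cell j" by an event in finitely many letters. \<open>\<Theta>\<close> guesses the centre
  of a cell whose approximating event holds. Outside the union of the n error sets exactly the right
  event holds. The given code \<open>c0\<close> is refined along the way, so that its letters stay
  readable from \<open>c\<close>.\<close>

lemma coding:
  assumes Q: "finite Q" "Q \<subseteq> cfun Y" and \<epsilon>: "\<epsilon> > 0" and \<eta>: "\<eta> > 0" and c0: "finite_code \<mu> c0"
  obtains c a W \<Theta> where "finite_code \<mu> c" "\<And>x. c0 x = a (c x)" "finite W" "W \<subseteq> carrier G"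
    "\<And>w. \<Theta> w \<in> topspace Y"
    "measure Z {z \<in> space Z. \<exists>f\<in>Q. cmod (f (\<Psi> z) - f (\<Theta> (\<lambda>g\<in>W. c (z g)))) \<ge> \<epsilon>} < \<eta>"
proof -
  obtain n y J where J: "J \<in> N \<rightarrow>\<^sub>M count_space UNIV" "\<And>x. x \<in> topspace Y \<Longrightarrow> J x < (n::nat)"
    and y: "\<And>j. j < n \<Longrightarrow> y j \<in> topspace Y"
    and close: "\<And>x f. x \<in> topspace Y \<Longrightarrow> f \<in> Q \<Longrightarrow> cmod (f x - f (y (J x))) < \<epsilon>"
    using finite_continuous_quantization[OF compact_Y sets_N Q \<epsilon>] by metis
  define E where "E j = {z \<in> space Z. J (\<Psi> z) = j}" for j
  have JZ: "(\<lambda>z. J (\<Psi> z)) \<in> Z \<rightarrow>\<^sub>M count_space UNIV" using measurable_compose[OF \<Psi>_measurable J(1)] .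
  have EZ: "E j \<in> sets Z" for j
  proof -
    have "(\<lambda>z. J (\<Psi> z)) -` {j} \<inter> space Z \<in> sets Z" using JZ by (rule measurable_sets) auto
    also have "(\<lambda>z. J (\<Psi> z)) -` {j} \<inter> space Z = E j" by (auto simp: E_def)
    finally show ?thesis .
  qed
  \<comment> \<open>The denominator n + 1 makes the n errors sum to strictly less than \<eta>, also
    when n = 0.\<close>
  define R where "R j t \<longleftrightarrow> (case t of (c, W, S) \<Rightarrow> finite_code \<mu> c \<and> finite W \<and> W \<subseteq> carrier G \<and>
      measure Z {z \<in> space Z. \<bar>indicator S (\<lambda>g\<in>W. c (z g)) - indicator (E j) z\<bar> \<ge> (1/4::real)} < \<eta> / (real n + 1))" for j t
  have "\<exists>t. R j t" for j
  proof -
    have pos: "\<eta> / (real n + 1) > 0" using \<eta> by simp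
    obtain f where "finitary (carrier G) \<mu> f" "measure Z {z \<in> space Z. \<bar>f z - indicator (E j) z\<bar> \<ge> 1/4} < \<eta> / (real n + 1)"
      using approximable_finitary[OF prob_\<mu> EZ, unfolded approximable_def, rule_format, OF pos] by blast
    then show ?thesis unfolding finitary_def R_def by blast
  qed
  then have t: "R j (SOME t. R j t)" for j by (rule someI_ex)
  define c W S where "c j = fst (SOME t. R j t)" and "W j = fst (snd (SOME t. R j t))"
    and "S j = snd (snd (SOME t. R j t))" for j
  have c: "finite_code \<mu> (c j)" and W: "finite (W j)" "W j \<subseteq> carrier G"
    and cE: "measure Z {z \<in> space Z. \<bar>indicator (S j) (\<lambda>g\<in>W j. c j (z g)) - indicator (E j) z\<bar> \<ge> (1/4::real)} < \<eta> / (real n + 1)" for j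
    using t[of j] unfolding R_def c_def W_def S_def by (simp_all add: case_prod_beta)
  \<comment> \<open>\<open>c0\<close> is placed at the head of the list, so that head after decoding
    is the required map \<open>a\<close>; the code of cell j therefore stands at position
    \<open>Suc j\<close>.\<close>
  define c' where "c' x = list_encode (map (\<lambda>c. c x) (c0 # map c [0..<n]))" for x
  have c': "finite_code \<mu> c'" unfolding c'_def using c c0 by (intro finite_code_list) auto
  have dec: "list_decode (c' x) = c0 x # map (\<lambda>j. c j x) [0..<n]" for x
    unfolding c'_def by (simp add: list_encode_inverse o_def del: list_encode.simps)
  define W' where "W' = (\<Union>j<n. W j)"
  define T' where "T' w j \<longleftrightarrow> j < n \<and> (\<lambda>g\<in>W j. list_decode (w g) ! Suc j) \<in> S j" for w :: "'g \<Rightarrow> nat" and j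
  obtain y0 where y0: "y0 \<in> topspace Y" using Y_nonempty by blast
  \<comment> \<open>\<open>LEAST\<close> and the default \<open>y0\<close> settle the cases of
    several or no matching cells, which for actual words arise only on the error sets.\<close>
  define \<Theta> where "\<Theta> w = (if \<exists>j. T' w j then y (LEAST j. T' w j) else y0)" for w
  have \<Theta>: "\<Theta> w \<in> topspace Y" for w
  proof (cases "\<exists>j. T' w j")
    case True
    then have "T' w (LEAST j. T' w j)" by (rule LeastI_ex)
    then have "(LEAST j. T' w j) < n" unfolding T'_def[of w "LEAST j. T' w j"] by blast
    then show ?thesis using True y by (simp add: \<Theta>_def)
  qed (simp add: \<Theta>_def y0)
  have T'_eq: "T' (\<lambda>g\<in>W'. c' (z g)) j \<longleftrightarrow> j < n \<and> (\<lambda>g\<in>W j. c j (z g)) \<in> S j" for z j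
  proof -
    have "(\<lambda>g\<in>W j. list_decode ((\<lambda>g\<in>W'. c' (z g)) g) ! Suc j) = (\<lambda>g\<in>W j. c j (z g))" if "j < n"
      using that by (auto simp: W'_def dec)
    then show ?thesis unfolding T'_def by (metis (mono_tags))
  qed
  define B where "B j = {z \<in> space Z. \<bar>indicator (S j) (\<lambda>g\<in>W j. c j (z g)) - indicator (E j) z\<bar> \<ge> (1/4::real)}" for j
  have BZ: "B j \<in> sets Z" for j
  proof -
    have m1: "(\<lambda>z. indicator (S j) (\<lambda>g\<in>W j. c j (z g)) :: real) \<in> borel_measurable Z"
      using c[of j] W[of j] by (intro measurable_finite_word) (auto simp: finite_code_def)
    show ?thesis unfolding B_def using m1 EZ[of j] by measurable
  qed
  have sub: "{z \<in> space Z. \<exists>f\<in>Q. cmod (f (\<Psi> z) - f (\<Theta> (\<lambda>g\<in>W'. c' (z g)))) \<ge> \<epsilon>} \<subseteq> (\<Union>j<n. B j)"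
  proof (rule subsetI, rule ccontr)
    fix z assume z: "z \<in> {z \<in> space Z. \<exists>f\<in>Q. cmod (f (\<Psi> z) - f (\<Theta> (\<lambda>g\<in>W'. c' (z g)))) \<ge> \<epsilon>}"
      and nB: "z \<notin> (\<Union>j<n. B j)"
    have iff: "(\<lambda>g\<in>W j. c j (z g)) \<in> S j \<longleftrightarrow> J (\<Psi> z) = j" if "j < n" for j
    proof -
      have "z \<notin> B j" using nB that by blast
      then have "\<bar>indicator (S j) (\<lambda>g\<in>W j. c j (z g)) - indicator (E j) z\<bar> < (1/4::real)"
        using z by (simp add: B_def)
      moreover have "z \<in> E j \<longleftrightarrow> J (\<Psi> z) = j" using z by (simp add: E_def)
      ultimately show ?thesis
        by (cases "J (\<Psi> z) = j"; cases "(\<lambda>g\<in>W j. c j (z g)) \<in> S j") simp_all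
    qed
    have Jn: "J (\<Psi> z) < n" using J(2) \<Psi>_in z by blast
    have T'_J: "T' (\<lambda>g\<in>W'. c' (z g)) = (\<lambda>j. j = J (\<Psi> z))"
      unfolding fun_eq_iff T'_eq using iff Jn by auto
    have "(LEAST j. j = J (\<Psi> z)) = J (\<Psi> z)" by (rule Least_equality) auto
    then have "\<Theta> (\<lambda>g\<in>W'. c' (z g)) = y (J (\<Psi> z))" unfolding \<Theta>_def T'_J by simp
    then show False using z close[of "\<Psi> z"] \<Psi>_in by fastforce
  qed
  have "measure Z {z \<in> space Z. \<exists>f\<in>Q. cmod (f (\<Psi> z) - f (\<Theta> (\<lambda>g\<in>W'. c' (z g)))) \<ge> \<epsilon>} \<le> measure Z (\<Union>j<n. B j)"
    using sub BZ by (intro Z.finite_measure_mono) auto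
  also have "\<dots> \<le> (\<Sum>j<n. measure Z (B j))"
    using BZ by (intro Z.finite_measure_subadditive_finite) auto
  also have "\<dots> \<le> (\<Sum>j<n. \<eta> / (real n + 1))"
    using cE by (intro sum_mono) (auto simp: B_def intro: less_imp_le)
  also have "\<dots> = \<eta> * (real n / (real n + 1))" by simp
  also have "\<dots> < \<eta> * 1" using \<eta> by (intro mult_strict_left_mono) auto
  finally have "measure Z {z \<in> space Z. \<exists>f\<in>Q. cmod (f (\<Psi> z) - f (\<Theta> (\<lambda>g\<in>W'. c' (z g)))) \<ge> \<epsilon>} < \<eta>" by simp
  moreover have "c0 x = hd (list_decode (c' x))" for x by (simp add: dec)
  moreover have "finite W'" "W' \<subseteq> carrier G" using W by (auto simp: W'_def)
  ultimately show ?thesis using that[of c' "\<lambda>m. hd (list_decode m)" W' \<Theta>] c' \<Theta> by blast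
qed

end

section \<open>Letter probabilities and tools for open conditions\<close>

definition code_prob :: "'a measure \<Rightarrow> ('a \<Rightarrow> nat) \<Rightarrow> nat \<Rightarrow> real" where
  "code_prob \<mu> c j = measure \<mu> {x \<in> space \<mu>. c x = j}"

definition code_entropy :: "'a measure \<Rightarrow> ('a \<Rightarrow> nat) \<Rightarrow> real" where
  "code_entropy \<mu> c = - (\<Sum>j\<in>c ` space \<mu>. code_prob \<mu> c j * ln (code_prob \<mu> c j))"

lemma finite_code_sets: "finite_code \<mu> c \<Longrightarrow> {x \<in> space \<mu>. c x = j} \<in> sets \<mu>"
  using measurable_sets[of c \<mu> "count_space UNIV" "{j}"]
  by (simp add: finite_code_def vimage_def Int_def conj_commute)

lemma code_entropy_le_base_entropy:
  assumes c: "finite_code \<mu> c"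
  shows "ereal (code_entropy \<mu> c) \<le> base_entropy \<mu>"
proof -
  define A where "A j = {x \<in> space \<mu>. c x = j}" for j
  have inj: "inj_on A (c ` space \<mu>)" by (auto simp: inj_on_def A_def)
  have "finite_measurable_partition \<mu> (A ` (c ` space \<mu>))"
    unfolding finite_measurable_partition_def
  proof (intro conjI)
    show "finite (A ` c ` space \<mu>)" using c by (simp add: finite_code_def)
    show "A ` c ` space \<mu> \<subseteq> sets \<mu>" using finite_code_sets[OF c] by (auto simp: A_def)
    show "partition_on (space \<mu>) (A ` c ` space \<mu>)"
      by (intro partition_onI) (auto simp: A_def disjnt_def)
  qed
  then have "ereal (partition_entropy \<mu> (A ` (c ` space \<mu>))) \<le> base_entropy \<mu>"
    unfolding base_entropy_def by (intro SUP_upper) auto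
  also have "partition_entropy \<mu> (A ` (c ` space \<mu>)) = code_entropy \<mu> c"
    unfolding partition_entropy_def code_entropy_def code_prob_def
    by (subst sum.reindex[OF inj]) (simp add: A_def)
  finally show ?thesis .
qed

lemma (in prob_space) sum_code_prob:
  assumes c: "finite_code M c"
  shows "(\<Sum>j\<in>c ` space M. code_prob M c j) = 1"
proof -
  have "(\<Sum>j\<in>c ` space M. code_prob M c j) = prob (\<Union>j\<in>c ` space M. {x \<in> space M. c x = j})"
    unfolding code_prob_def using c finite_code_sets[OF c]
    by (intro finite_measure_finite_Union[symmetric]) (auto simp: finite_code_def disjoint_family_on_def)
  also have "(\<Union>j\<in>c ` space M. {x \<in> space M. c x = j}) = space M" by auto
  finally show ?thesis by (simp add: prob_space)
qed

lemma openin_Collect_ball: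
  assumes "finite A" "\<And>a. a \<in> A \<Longrightarrow> openin Y {y \<in> topspace Y. Q a y}"
  shows "openin Y {y \<in> topspace Y. \<forall>a\<in>A. Q a y}"
proof -
  have "openin Y ((\<Inter>a\<in>A. {y \<in> topspace Y. Q a y}) \<inter> topspace Y)" using assms by (rule openin_INT)
  also have "(\<Inter>a\<in>A. {y \<in> topspace Y. Q a y}) \<inter> topspace Y = {y \<in> topspace Y. \<forall>a\<in>A. Q a y}" by auto
  finally show ?thesis .
qed

lemma openin_Collect_bex:
  assumes "\<And>a. a \<in> A \<Longrightarrow> openin Y {y \<in> topspace Y. Q a y}"
  shows "openin Y {y \<in> topspace Y. \<exists>a\<in>A. Q a y}"
proof -
  have "openin Y (\<Union>a\<in>A. {y \<in> topspace Y. Q a y})" using assms by blast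
  also have "(\<Union>a\<in>A. {y \<in> topspace Y. Q a y}) = {y \<in> topspace Y. \<exists>a\<in>A. Q a y}" by auto
  finally show ?thesis .
qed

lemma openin_Collect_conj:
  assumes "openin Y {y \<in> topspace Y. Q y}" "openin Y {y \<in> topspace Y. R y}"
  shows "openin Y {y \<in> topspace Y. Q y \<and> R y}"
proof -
  have "{y \<in> topspace Y. Q y \<and> R y} = {y \<in> topspace Y. Q y} \<inter> {y \<in> topspace Y. R y}" by auto
  then show ?thesis using openin_Int[OF assms] by simp
qed

text \<open>Markov's inequality at level 1/4, the source of the factor 4 in later error
  budgets.\<close>

lemma fraction_ge_le_avg:
  fixes a :: "nat \<Rightarrow> real"
  assumes "\<And>k. a k \<ge> 0"
  shows "real (card {k\<in>{1..n}. a k \<ge> 1/4}) / real n \<le> 4 * ((\<Sum>k=1..n. a k) / real n)"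
proof -
  have "(\<Sum>k=1..n. if a k \<ge> 1/4 then 1 else 0) / real n \<le> (\<Sum>k=1..n. 4 * a k) / real n"
    using assms by (intro avg_mono) auto
  moreover have "(\<Sum>k=1..n. if a k \<ge> 1/4 then 1 else 0) = real (card {k\<in>{1..n}. a k \<ge> 1/4})"
    by (simp add: sum.If_cases Int_def)
  ultimately show ?thesis by (simp add: sum_distrib_left)
qed

section \<open>Reading letters off a microstate\<close>

context bernoulli_model
begin

lemma C_measurable: "g \<in> carrier G \<Longrightarrow> C g \<in> N \<rightarrow>\<^sub>M N"
  and C_distr: "g \<in> carrier G \<Longrightarrow> distr N N (C g) = N"
  using pmp_N by (auto simp: pmp_action_def)

lemma measure_C_vimage:
  assumes "g \<in> carrier G" "A \<in> sets N"
  shows "measure N {y \<in> space N. C g y \<in> A} = measure N A"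
  using measure_distr[OF C_measurable[OF assms(1)] assms(2)] C_distr[OF assms(1)]
  by (simp add: vimage_def Int_def conj_commute)

lemma measure_\<Phi>_vimage:
  assumes "A \<in> sets Z"
  shows "measure N {y \<in> space N. \<Phi> y \<in> A} = measure Z A"
  using measure_distr[OF \<Phi>_measurable assms] \<Phi>_distr by (simp add: vimage_def Int_def conj_commute)

lemma code_letter:
  assumes c: "finite_code \<mu> c"
  shows "{y \<in> space N. c (\<Phi> y \<one>) = j} \<in> sets N"
    and "measure N {y \<in> space N. c (\<Phi> y \<one>) = j} = code_prob \<mu> c j"
proof -
  have comp: "(\<lambda>z. z \<one>) \<in> Z \<rightarrow>\<^sub>M \<mu>" by (intro measurable_component_singleton) auto
  have A: "(\<lambda>z. z \<one>) -` {x \<in> space \<mu>. c x = j} \<inter> space Z \<in> sets Z"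
    using comp finite_code_sets[OF c] by (rule measurable_sets)
  have eq: "{y \<in> space N. c (\<Phi> y \<one>) = j} = {y \<in> space N. \<Phi> y \<in> (\<lambda>z. z \<one>) -` {x \<in> space \<mu>. c x = j} \<inter> space Z}"
    using \<Phi>_in measurable_space[OF comp] by (auto simp: space_N)
  show "{y \<in> space N. c (\<Phi> y \<one>) = j} \<in> sets N"
    unfolding eq using measurable_sets[OF \<Phi>_measurable A] by (simp add: vimage_def Int_def conj_commute)
  have "measure N {y \<in> space N. c (\<Phi> y \<one>) = j} = measure Z ((\<lambda>z. z \<one>) -` {x \<in> space \<mu>. c x = j} \<inter> space Z)"
    unfolding eq by (rule measure_\<Phi>_vimage[OF A])
  also have "\<dots> = measure (distr Z \<mu> (\<lambda>z. z \<one>)) {x \<in> space \<mu>. c x = j}"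
    using measure_distr[OF comp finite_code_sets[OF c]] by simp
  also have "distr Z \<mu> (\<lambda>z. z \<one>) = \<mu>"
    using distr_PiM_component[of "carrier G" "\<lambda>_. \<mu>" \<one>] prob_\<mu> by simp
  finally show "measure N {y \<in> space N. c (\<Phi> y \<one>) = j} = code_prob \<mu> c j" by (simp add: code_prob_def)
qed

lemma coding_error_sets:
  assumes c: "finite_code \<mu> c" and W: "finite W" "W \<subseteq> carrier G" and \<Theta>: "\<And>w. \<Theta> w \<in> topspace Y"
    and Q: "finite Q" "Q \<subseteq> cfun Y"
  shows "{z \<in> space Z. \<exists>f\<in>Q. cmod (f (\<Psi> z) - f (\<Theta> (\<lambda>g\<in>W. c (z g)))) \<ge> \<epsilon>} \<in> sets Z"
proof (rule sets.sets_Collect_finite_Ex[OF _ Q(1)])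
  fix f assume f: "f \<in> Q"
  have 1: "(\<lambda>z. f (\<Psi> z)) \<in> borel_measurable Z"
    using measurable_compose[OF \<Psi>_measurable cfun_measurable] f Q by blast
  have 2: "(\<lambda>z. f (\<Theta> (\<lambda>g\<in>W. c (z g)))) \<in> borel_measurable Z"
    using c W by (intro measurable_finite_word[where h = "\<lambda>w. f (\<Theta> w)"]) (auto simp: finite_code_def)
  show "{z \<in> space Z. cmod (f (\<Psi> z) - f (\<Theta> (\<lambda>g\<in>W. c (z g)))) \<ge> \<epsilon>} \<in> sets Z"
    using 1 2 by measurable
qed

text \<open>The letter of the unit coordinate is only a measurable function on \<open>Y\<close>; the
  functions \<open>\<xi> j\<close> are continuous stand-ins for its indicators. Letters at other
  coordinates are reached by equivariance, through \<open>\<xi> j\<close> composed with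
  \<open>C g\<close>.\<close>

lemma continuous_code:
  assumes c: "finite_code \<mu> c" and "\<kappa> > 0"
  obtains \<xi> where "\<And>j. continuous_map Y euclideanreal (\<xi> j)"
    "\<And>j. measure N {y \<in> space N. \<bar>\<xi> j y - (if j = c (\<Phi> y \<one>) then 1 else 0)\<bar> \<ge> 1/4} < \<kappa>"
    "\<And>j. {y \<in> space N. \<bar>\<xi> j y - (if j = c (\<Phi> y \<one>) then 1 else 0)\<bar> \<ge> 1/4} \<in> sets N"
proof -
  define D where "D j = {y \<in> space N. c (\<Phi> y \<one>) = j}" for j
  have D: "D j \<in> sets N" for j unfolding D_def by (rule code_letter[OF c])
  have "\<exists>f. continuous_map Y euclideanreal f \<and> measure N {y \<in> space N. \<bar>f y - indicator (D j) y\<bar> \<ge> 1/4} < \<kappa>" for j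
    using approximable_continuous[OF metrizable_Y sets_N N.finite_measure_axioms D[of j]] \<open>\<kappa> > 0\<close>
    unfolding approximable_def by blast
  then obtain \<xi> where \<xi>: "\<And>j. continuous_map Y euclideanreal (\<xi> j)"
    "\<And>j. measure N {y \<in> space N. \<bar>\<xi> j y - indicator (D j) y\<bar> \<ge> 1/4} < \<kappa>" by metis
  have eq: "{y \<in> space N. \<bar>\<xi> j y - (if j = c (\<Phi> y \<one>) then 1 else 0)\<bar> \<ge> 1/4}
    = {y \<in> space N. \<bar>\<xi> j y - indicator (D j) y\<bar> \<ge> 1/4}" for j
    by (auto simp: D_def indicator_def)
  have "{y \<in> space N. \<bar>\<xi> j y - indicator (D j) y\<bar> \<ge> 1/4} \<in> sets N" for j
    using borel_measurable_continuous_map[OF \<xi>(1)[of j] sets_N] D[of j] by measurable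
  then show ?thesis using that[of \<xi>] \<xi> unfolding eq by blast
qed

text \<open>The number of \<open>k\<close> at which a good microstate \<open>y\<close> violates an open condition of large measure is
  small. The conditions are chosen so that, where they hold, the letters \<open>\<omega> (y (T i g k))\<close>
  determine \<open>y k\<close> up to \<open>\<epsilon>\<close>.\<close>

lemma microstate_code:
  assumes c: "finite_code \<mu> c" and W: "finite W" "W \<subseteq> carrier G" and \<Theta>: "\<And>w. \<Theta> w \<in> topspace Y"
    and err: "measure Z {z \<in> space Z. \<exists>p\<in>P. cmod (p (\<Psi> z) - p (\<Theta> (\<lambda>g\<in>W. c (z g)))) \<ge> \<epsilon>} < \<kappa>"
    and \<tau>: "\<tau> > 0"
  obtains \<omega> where "\<And>y. \<omega> y \<in> c ` space \<mu>"
    "\<forall>\<^sub>F x in micro_filter. \<forall>j\<in>c ` space \<mu>.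
      \<bar>real (card {k\<in>{1..d (fst x)}. \<omega> (snd x k) = j}) / real (d (fst x)) - code_prob \<mu> c j\<bar> \<le> \<tau>"
    "\<forall>\<^sub>F x in micro_filter. real (card {k\<in>{1..d (fst x)}. \<exists>p\<in>P.
       cmod (p (snd x k) - p (\<Theta> (\<lambda>g\<in>W. \<omega> (snd x (T (fst x) g k))))) \<ge> \<epsilon>}) / real (d (fst x)) \<le> \<kappa> + \<tau>"
proof -
  define R where "R = c ` space \<mu>"
  define r where "r = real (card R)"
  define w where "w = real (card W)"
  have R: "finite R" "R \<noteq> {}" using c \<mu>.not_empty by (auto simp: R_def finite_code_def)
  \<comment> \<open>The denominator dominates both error budgets: r (r + 1) for letter frequencies,
    and for badly coded sites w r (misread letters in the measure of \<open>U\<close>) plus 1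
    (frequency of \<open>U\<close>) plus 4 w r (Markov for equivariance).\<close>
  define \<kappa>' where "\<kappa>' = \<tau> / ((r + 1)^2 + 5 * w * r + 1)"
  have rw: "r \<ge> 0" "w \<ge> 0" by (simp_all add: r_def w_def)
  have M: "(r + 1)^2 + 5 * w * r + 1 > 0" using rw by (intro add_nonneg_pos add_nonneg_nonneg) auto
  have \<kappa>': "\<kappa>' > 0" using \<tau> M by (simp add: \<kappa>'_def)
  have \<kappa>'M: "\<kappa>' * ((r + 1)^2 + 5 * w * r + 1) = \<tau>" using M by (simp add: \<kappa>'_def)
  obtain \<xi> where \<xi>: "\<And>j. continuous_map Y euclideanreal (\<xi> j)"
    "\<And>j. measure N {y \<in> space N. \<bar>\<xi> j y - (if j = c (\<Phi> y \<one>) then 1 else 0)\<bar> \<ge> 1/4} < \<kappa>'"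
    "\<And>j. {y \<in> space N. \<bar>\<xi> j y - (if j = c (\<Phi> y \<one>) then 1 else 0)\<bar> \<ge> 1/4} \<in> sets N"
    using continuous_code[OF c \<kappa>'] by blast
  define B where "B j = {y \<in> space N. \<bar>\<xi> j y - (if j = c (\<Phi> y \<one>) then 1 else 0)\<bar> \<ge> 1/4}" for j
  have B: "B j \<in> sets N" "measure N (B j) \<le> \<kappa>'" for j
    using \<xi>(2,3)[of j] by (auto simp: B_def)
  obtain j0 where j0: "j0 \<in> R" using R by blast
  \<comment> \<open>The letter whose continuous stand-in exceeds 1/2; it is forced as soon as every
    \<open>\<xi> i\<close> is within 1/2 of its intended value. In ambiguous cases any fixed choice
    will do.\<close>
  define \<omega> where "\<omega> y = (if \<exists>j\<in>R. \<xi> j y > 1/2 then SOME j. j \<in> R \<and> \<xi> j y > 1/2 else j0)" for y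
  have \<omega>_R: "\<omega> y \<in> R" for y
    unfolding \<omega>_def using j0 someI_ex[of "\<lambda>j. j \<in> R \<and> \<xi> j y > 1/2"] by auto
  have \<omega>_eq: "\<omega> y = j" if j: "j \<in> R" and close: "\<And>i. i \<in> R \<Longrightarrow> \<bar>\<xi> i y - (if i = j then 1 else 0)\<bar> < 1/2" for y j
  proof -
    have iff: "i \<in> R \<and> \<xi> i y > 1/2 \<longleftrightarrow> i = j" for i
    proof (cases "i \<in> R")
      case True
      have "\<bar>\<xi> i y - (if i = j then 1 else 0)\<bar> < 1/2" by (rule close[OF True])
      then show ?thesis using True unfolding abs_diff_less_iff by (cases "i = j") auto
    qed (use j in auto)
    then have "\<exists>j\<in>R. \<xi> j y > 1/2" by blast
    then show ?thesis unfolding \<omega>_def iff by simp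
  qed
  have open_close: "openin Y {y \<in> topspace Y. \<bar>\<xi> i y - a\<bar> < e}" for i a e
  proof -
    have "openin Y {y \<in> topspace Y. \<xi> i y \<in> ball a e}"
      using \<xi>(1) by (rule openin_continuous_map_preimage) simp
    then show ?thesis by (simp add: dist_real_def abs_minus_commute)
  qed
  define D where "D j = {y \<in> topspace Y. \<forall>i\<in>R. \<bar>\<xi> i y - (if i = j then 1 else 0)\<bar> < 1/2}" for j
  have D: "openin Y (D j)" for j
  proof -
    show ?thesis unfolding D_def by (intro openin_Collect_ball R open_close)
  qed
  have open_N: "V \<in> sets N" if "openin Y V" for V using that sets_N by (auto simp: sets_borel_of)
  have N_D: "code_prob \<mu> c j - r * \<kappa>' \<le> measure N (D j)" if j: "j \<in> R" for j
  proof -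
    have "{y \<in> space N. c (\<Phi> y \<one>) = j} \<subseteq> D j \<union> (\<Union>i\<in>R. B i)"
    proof
      fix y assume y: "y \<in> {y \<in> space N. c (\<Phi> y \<one>) = j}"
      show "y \<in> D j \<union> (\<Union>i\<in>R. B i)"
      proof (cases "y \<in> (\<Union>i\<in>R. B i)")
        case False
        have "\<bar>\<xi> i y - (if i = j then 1 else 0)\<bar> < 1/2" if i: "i \<in> R" for i
        proof -
          have "y \<notin> B i" using False i by blast
          then have "\<not> 1/4 \<le> \<bar>\<xi> i y - (if i = c (\<Phi> y \<one>) then 1 else 0)\<bar>" using y unfolding B_def by blast
          moreover have "c (\<Phi> y \<one>) = j" using y by blast
          ultimately show ?thesis by simp
        qed
        then show ?thesis using y unfolding D_def space_N by blast
      qed blast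
    qed
    then have "code_prob \<mu> c j \<le> measure N (D j \<union> (\<Union>i\<in>R. B i))"
      unfolding code_letter(2)[OF c, symmetric]
      by (rule N.finite_measure_mono) (intro sets.Un sets.finite_UN open_N D B R)
    also have "\<dots> \<le> measure N (D j) + measure N (\<Union>i\<in>R. B i)"
      using open_N[OF D] B R by (intro measure_Un_le sets.finite_UN) auto
    also have "measure N (\<Union>i\<in>R. B i) \<le> (\<Sum>i\<in>R. measure N (B i))"
      using B R by (intro N.finite_measure_subadditive_finite) auto
    also have "\<dots> \<le> (\<Sum>i\<in>R. \<kappa>')" using B by (intro sum_mono)
    finally show ?thesis by (simp add: r_def)
  qed
  \<comment> \<open>The open condition asks for accuracy 1/4 at the points C_g y. The passage to the
    site T_g k costs less than another 1/4, and the resulting 1/2 is the tolerance under which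
    \<open>\<omega>\<close> reads the right letter.\<close>
  define U where "U = {y \<in> topspace Y. \<exists>v\<in>PiE W (\<lambda>_. R). (\<forall>g\<in>W. \<forall>i\<in>R. \<bar>\<xi> i (C g y) - (if i = v g then 1 else 0)\<bar> < 1/4)
    \<and> (\<forall>p\<in>P. cmod (p y - p (\<Theta> v)) < \<epsilon>)}"
  have U: "openin Y U"
  proof -
    have o1: "openin Y {y \<in> topspace Y. \<bar>\<xi> i (C g y) - a\<bar> < 1/4}" if "g \<in> W" for i g a
    proof -
      have "openin Y {y \<in> topspace Y. C g y \<in> {y \<in> topspace Y. \<bar>\<xi> i y - a\<bar> < 1/4}}"
        by (rule openin_continuous_map_preimage[OF continuous_C open_close]) (use that W in blast)
      also have "{y \<in> topspace Y. C g y \<in> {y \<in> topspace Y. \<bar>\<xi> i y - a\<bar> < 1/4}} = {y \<in> topspace Y. \<bar>\<xi> i (C g y) - a\<bar> < 1/4}"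
        using C_in that W by auto
      finally show ?thesis .
    qed
    have o2: "openin Y {y \<in> topspace Y. cmod (p y - a) < \<epsilon>}" if "p \<in> P" for p a
    proof -
      have "openin Y {y \<in> topspace Y. p y \<in> ball a \<epsilon>}"
        using cfun_continuous[OF P_cfun[OF that]] by (rule openin_continuous_map_preimage) simp
      then show ?thesis by (simp add: dist_norm norm_minus_commute)
    qed
    show ?thesis
      unfolding U_def by (intro openin_Collect_bex openin_Collect_conj openin_Collect_ball W(1) R(1) finite_P o1 o2)
  qed
  have N_U: "1 - \<kappa> - w * r * \<kappa>' \<le> measure N U"
  proof -
    define E where "E = {z \<in> space Z. \<exists>p\<in>P. cmod (p (\<Psi> z) - p (\<Theta> (\<lambda>g\<in>W. c (z g)))) \<ge> \<epsilon>}"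
    have E: "E \<in> sets Z"
      unfolding E_def using c W \<Theta> finite_P P_cfun by (intro coding_error_sets) auto
    define E' where "E' = {y \<in> space N. \<Phi> y \<in> E}"
    have E': "E' \<in> sets N" "measure N E' < \<kappa>"
    proof -
      show "E' \<in> sets N" unfolding E'_def
        using measurable_sets[OF \<Phi>_measurable E] by (simp add: vimage_def Int_def conj_commute)
      show "measure N E' < \<kappa>" unfolding E'_def measure_\<Phi>_vimage[OF E] using err by (simp add: E_def)
    qed
    define F where "F = (\<Union>a\<in>W \<times> R. {y \<in> space N. C (fst a) y \<in> B (snd a)})"
    have CB: "{y \<in> space N. C g y \<in> B i} \<in> sets N" "measure N {y \<in> space N. C g y \<in> B i} \<le> \<kappa>'" if "g \<in> W" for g i
    proof -
      have g: "g \<in> carrier G" using that W by blast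
      show "{y \<in> space N. C g y \<in> B i} \<in> sets N"
        using measurable_sets[OF C_measurable[OF g] B(1)] by (simp add: vimage_def Int_def conj_commute)
      show "measure N {y \<in> space N. C g y \<in> B i} \<le> \<kappa>'" unfolding measure_C_vimage[OF g B(1)] by (rule B(2))
    qed
    have F: "F \<in> sets N" unfolding F_def using CB W R by (intro sets.finite_UN) auto
    have "measure N F \<le> (\<Sum>a\<in>W \<times> R. measure N {y \<in> space N. C (fst a) y \<in> B (snd a)})"
      unfolding F_def using CB W R by (intro N.finite_measure_subadditive_finite) auto
    also have "\<dots> \<le> (\<Sum>a\<in>W \<times> R. \<kappa>')" using CB by (intro sum_mono) auto
    also have "\<dots> = w * r * \<kappa>'" by (simp add: card_cartesian_product w_def r_def)
    finally have NF: "measure N F \<le> w * r * \<kappa>'" .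
    have ae1: "AE y in N. \<forall>g\<in>W. \<Phi> (C g y) = (\<lambda>h\<in>carrier G. \<Phi> y (g \<otimes> h))"
      using W \<Phi>_equivariant by (intro AE_finite_allI) auto
    \<comment> \<open>Away from the coding error \<open>E'\<close> and the misread letters
      \<open>F\<close>, the true word of \<Phi> y over the window witnesses membership in
      \<open>U\<close>, since \<Phi> (C_g y) at the unit is \<Phi> y at g.\<close>
    have "AE y in N. y \<in> space N \<longrightarrow> y \<in> U \<union> (E' \<union> F)"
      using ae1 \<Psi>_\<Phi> AE_space
    proof eventually_elim
      case (elim y)
      show ?case
      proof (rule impI, rule ccontr)
        assume y: "y \<in> space N" and "y \<notin> U \<union> (E' \<union> F)"
        then have nU: "y \<notin> U" and nE: "\<Phi> y \<notin> E" and nF: "\<And>g i. g \<in> W \<Longrightarrow> i \<in> R \<Longrightarrow> C g y \<notin> B i"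
          by (auto simp: E'_def F_def)
        have yY: "y \<in> topspace Y" using y by (simp add: space_N)
        define v where "v = (\<lambda>g\<in>W. c (\<Phi> y g))"
        have \<Phi>y: "\<Phi> y \<in> space Z" using \<Phi>_in yY by blast
        have v: "v \<in> PiE W (\<lambda>_. R)"
          using \<Phi>y W by (auto simp: v_def R_def space_PiM PiE_iff)
        have "\<bar>\<xi> i (C g y) - (if i = v g then 1 else 0)\<bar> < 1/4" if g: "g \<in> W" and i: "i \<in> R" for g i
        proof -
          have gG: "g \<in> carrier G" using g W by blast
          have "\<Phi> (C g y) \<one> = \<Phi> y g" using elim(1) g gG by simp
          then have "c (\<Phi> (C g y) \<one>) = v g" using g by (simp add: v_def)
          moreover have "\<not> 1/4 \<le> \<bar>\<xi> i (C g y) - (if i = c (\<Phi> (C g y) \<one>) then 1 else 0)\<bar>"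
            using nF[OF g i] C_in[OF gG yY] unfolding B_def space_N by blast
          ultimately show ?thesis by (simp only: not_le)
        qed
        moreover have "cmod (p y - p (\<Theta> v)) < \<epsilon>" if "p \<in> P" for p
          using nE \<Phi>y that elim(2) by (auto simp: E_def v_def not_le)
        ultimately have "y \<in> U" using v yY unfolding U_def by blast
        then show False using nU by blast
      qed
    qed
    then have "measure N (space N) \<le> measure N (U \<union> (E' \<union> F))"
      using open_N[OF U] E' F by (intro N.finite_measure_mono_AE) auto
    also have "\<dots> \<le> measure N U + measure N (E' \<union> F)"
      using open_N[OF U] E' F by (intro measure_Un_le) auto
    also have "measure N (E' \<union> F) \<le> measure N E' + measure N F"
      using E' F by (intro measure_Un_le) auto
    finally show ?thesis using E'(2) NF by (simp add: N.prob_space)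
  qed
  have evO: "\<forall>\<^sub>F x in micro_filter. \<forall>j\<in>R. measure N (D j) - \<kappa>'
      \<le> real (card {k\<in>{1..d (fst x)}. snd x k \<in> D j}) / real (d (fst x))"
    using R open_frequency[OF D \<kappa>'] by (intro eventually_ball_finite) auto
  have freq: "\<forall>\<^sub>F x in micro_filter. \<forall>j\<in>R.
      \<bar>real (card {k\<in>{1..d (fst x)}. \<omega> (snd x k) = j}) / real (d (fst x)) - code_prob \<mu> c j\<bar> \<le> \<tau>"
    using evO
  proof eventually_elim
    case (elim x)
    define n where "n = d (fst x)"
    define y where "y = snd x"
    define f where "f j = real (card {k\<in>{1..n}. \<omega> (y k) = j}) / real n" for j
    have n: "n > 0" using d_pos by (simp add: n_def)
    have lower: "code_prob \<mu> c j - (r + 1) * \<kappa>' \<le> f j" if j: "j \<in> R" for j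
    proof -
      have "{k\<in>{1..n}. y k \<in> D j} \<subseteq> {k\<in>{1..n}. \<omega> (y k) = j}"
        using \<omega>_eq[OF j] by (auto simp: D_def)
      then have "real (card {k\<in>{1..n}. y k \<in> D j}) / real n \<le> f j"
        unfolding f_def by (intro divide_right_mono of_nat_mono card_mono) auto
      then show ?thesis
        using bspec[OF elim j] N_D[OF j] by (simp add: n_def y_def algebra_simps)
    qed
    \<comment> \<open>Open sets yield only lower bounds for frequencies. As frequencies and
      probabilities both sum to 1, lower bounds for all letters force the upper ones, at the cost of
      a factor r.\<close>
    have "(\<Sum>j\<in>R. f j) = 1"
    proof -
      have "(\<Sum>j\<in>R. card {k\<in>{1..n}. \<omega> (y k) = j}) = card (\<Union>j\<in>R. {k\<in>{1..n}. \<omega> (y k) = j})"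
        using R by (intro card_UN_disjoint[symmetric]) auto
      also have "(\<Union>j\<in>R. {k\<in>{1..n}. \<omega> (y k) = j}) = {1..n}" using \<omega>_R by auto
      finally have "(\<Sum>j\<in>R. real (card {k\<in>{1..n}. \<omega> (y k) = j})) = real n"
        unfolding of_nat_sum[symmetric] by simp
      then show ?thesis using n by (simp add: f_def flip: sum_divide_distrib)
    qed
    moreover have "(\<Sum>j\<in>R. code_prob \<mu> c j) = 1" unfolding R_def by (rule \<mu>.sum_code_prob[OF c])
    ultimately have sums: "(\<Sum>j\<in>R. f j - code_prob \<mu> c j + (r + 1) * \<kappa>') = r * (r + 1) * \<kappa>'"
      by (simp add: sum.distrib sum_subtractf r_def)
    have "r * (r + 1) * \<kappa>' \<le> \<tau>"
    proof -
      have "\<kappa>' * (r * (r + 1)) \<le> \<kappa>' * ((r + 1)^2 + 5 * w * r + 1)"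
        using \<kappa>' rw by (intro mult_left_mono) (auto simp: power2_eq_square algebra_simps)
      then show ?thesis using \<kappa>'M by (simp add: mult.commute mult.left_commute)
    qed
    have step: "(r + 1) * \<kappa>' \<le> \<tau>"
    proof -
      have "\<kappa>' * (r + 1) \<le> \<kappa>' * ((r + 1)^2 + 5 * w * r + 1)"
        using \<kappa>' rw by (intro mult_left_mono) (auto simp: power2_eq_square algebra_simps)
      then show ?thesis using \<kappa>'M by (simp add: mult.commute)
    qed
    show ?case
    proof
      fix j assume j: "j \<in> R"
      have "f j - code_prob \<mu> c j + (r + 1) * \<kappa>' \<le> (\<Sum>j\<in>R. f j - code_prob \<mu> c j + (r + 1) * \<kappa>')"
        using R j lower by (intro member_le_sum) (auto simp: algebra_simps)
      then have "f j - code_prob \<mu> c j \<le> \<tau>"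
        using sums \<open>r * (r + 1) * \<kappa>' \<le> \<tau>\<close> \<kappa>' rw mult_nonneg_nonneg[of "r + 1" \<kappa>'] by linarith
      moreover have "code_prob \<mu> c j - f j \<le> \<tau>" using lower[OF j] step by linarith
      ultimately show "\<bar>real (card {k\<in>{1..d (fst x)}. \<omega> (snd x k) = j}) / real (d (fst x)) - code_prob \<mu> c j\<bar> \<le> \<tau>"
        by (simp add: f_def n_def y_def abs_le_iff)
    qed
  qed
  have evU: "\<forall>\<^sub>F x in micro_filter. measure N U - \<kappa>' \<le> real (card {k\<in>{1..d (fst x)}. snd x k \<in> U}) / real (d (fst x))"
    by (rule open_frequency[OF U \<kappa>'])
  have evC: "\<forall>\<^sub>F x in micro_filter. \<forall>a\<in>W \<times> R.
      (\<Sum>k=1..d (fst x). \<bar>\<xi> (snd a) (C (fst a) (snd x k)) - \<xi> (snd a) (snd x (T (fst x) (fst a) k))\<bar>) / real (d (fst x)) < \<kappa>'"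
  proof (intro eventually_ball_finite ballI)
    fix a assume a: "a \<in> W \<times> R"
    let ?f = "\<lambda>y\<in>topspace Y. complex_of_real (\<xi> (snd a) y)"
    have s: "fst a \<in> carrier G" using a W by auto
    have "L1_close micro_filter (\<lambda>x. d (fst x)) (\<lambda>x k. C (fst a) (snd x k)) (\<lambda>x k. snd x (T (fst x) (fst a) k)) ?f"
      by (intro microstates_equivariant complex_of_real_cfun \<xi> s)
    then have "\<forall>\<^sub>F x in micro_filter. (\<Sum>k=1..d (fst x). cmod (?f (C (fst a) (snd x k)) - ?f (snd x (T (fst x) (fst a) k)))) / real (d (fst x)) < \<kappa>'"
      unfolding L1_close_def using \<kappa>' by (rule order_tendstoD)
    then show "\<forall>\<^sub>F x in micro_filter.
      (\<Sum>k=1..d (fst x). \<bar>\<xi> (snd a) (C (fst a) (snd x k)) - \<xi> (snd a) (snd x (T (fst x) (fst a) k))\<bar>) / real (d (fst x)) < \<kappa>'"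
      using eventually_micro_filter_in
    proof eventually_elim
      case (elim x)
      have "cmod (?f (C (fst a) (snd x k)) - ?f (snd x (T (fst x) (fst a) k)))
        = \<bar>\<xi> (snd a) (C (fst a) (snd x k)) - \<xi> (snd a) (snd x (T (fst x) (fst a) k))\<bar>" if k: "k \<in> {1..d (fst x)}" for k
      proof -
        have "C (fst a) (snd x k) \<in> topspace Y" using C_in s elim(2) k by blast
        moreover have "snd x (T (fst x) (fst a) k) \<in> topspace Y" using T_in s elim(2) k by blast
        ultimately show ?thesis by (simp flip: of_real_diff)
      qed
      then show ?case using elim(1) by simp
    qed
  qed (use W R in auto)
  have bad: "\<forall>\<^sub>F x in micro_filter. real (card {k\<in>{1..d (fst x)}. \<exists>p\<in>P.
       cmod (p (snd x k) - p (\<Theta> (\<lambda>g\<in>W. \<omega> (snd x (T (fst x) g k))))) \<ge> \<epsilon>}) / real (d (fst x)) \<le> \<kappa> + \<tau>"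
    using evU evC
  proof eventually_elim
    case (elim x)
    define n where "n = d (fst x)"
    define y where "y = snd x"
    define t where "t = T (fst x)"
    have n: "n > 0" using d_pos by (simp add: n_def)
    define X where "X a = {k\<in>{1..n}. \<bar>\<xi> (snd a) (C (fst a) (y k)) - \<xi> (snd a) (y (t (fst a) k))\<bar> \<ge> 1/4}" for a
    have X: "real (card (X a)) / real n \<le> 4 * \<kappa>'" if "a \<in> W \<times> R" for a
    proof -
      have "real (card (X a)) / real n \<le> 4 * ((\<Sum>k=1..n. \<bar>\<xi> (snd a) (C (fst a) (y k)) - \<xi> (snd a) (y (t (fst a) k))\<bar>) / real n)"
        unfolding X_def by (rule fraction_ge_le_avg) simp
      also have "\<dots> \<le> 4 * \<kappa>'"
        using bspec[OF elim(2) that] by (simp add: n_def y_def t_def)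
      finally show ?thesis .
    qed
    have "{k\<in>{1..n}. \<exists>p\<in>P. cmod (p (y k) - p (\<Theta> (\<lambda>g\<in>W. \<omega> (y (t g k))))) \<ge> \<epsilon>}
      \<subseteq> {k\<in>{1..n}. y k \<notin> U} \<union> (\<Union>a\<in>W \<times> R. X a)"
    proof (rule subsetI, rule ccontr)
      fix k assume k: "k \<in> {k\<in>{1..n}. \<exists>p\<in>P. cmod (p (y k) - p (\<Theta> (\<lambda>g\<in>W. \<omega> (y (t g k))))) \<ge> \<epsilon>}"
        and nk: "k \<notin> {k\<in>{1..n}. y k \<notin> U} \<union> (\<Union>a\<in>W \<times> R. X a)"
      have "y k \<in> U" using k nk by auto
      then obtain v where v: "v \<in> PiE W (\<lambda>_. R)"
        "\<And>g i. g \<in> W \<Longrightarrow> i \<in> R \<Longrightarrow> \<bar>\<xi> i (C g (y k)) - (if i = v g then 1 else 0)\<bar> < 1/4"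
        "\<And>p. p \<in> P \<Longrightarrow> cmod (p (y k) - p (\<Theta> v)) < \<epsilon>"
        unfolding U_def by blast
      have "\<omega> (y (t g k)) = v g" if g: "g \<in> W" for g
      proof (rule \<omega>_eq)
        show "v g \<in> R" using v(1) g by auto
        fix i assume i: "i \<in> R"
        have "k \<notin> X (g, i)" using nk g i by blast
        then have "\<bar>\<xi> i (C g (y k)) - \<xi> i (y (t g k))\<bar> < 1/4" using k by (auto simp: X_def not_le)
        then show "\<bar>\<xi> i (y (t g k)) - (if i = v g then 1 else 0)\<bar> < 1/2"
          using v(2)[OF g i] unfolding abs_less_iff by linarith
      qed
      then have "(\<lambda>g\<in>W. \<omega> (y (t g k))) = v" using v(1) by (auto simp: PiE_iff extensional_def)
      then show False using k v(3) by force
    qed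
    then have "card {k\<in>{1..n}. \<exists>p\<in>P. cmod (p (y k) - p (\<Theta> (\<lambda>g\<in>W. \<omega> (y (t g k))))) \<ge> \<epsilon>}
        \<le> card ({k\<in>{1..n}. y k \<notin> U} \<union> (\<Union>a\<in>W \<times> R. X a))"
      using W R by (intro card_mono) (auto simp: X_def)
    also have "\<dots> \<le> card {k\<in>{1..n}. y k \<notin> U} + card (\<Union>a\<in>W \<times> R. X a)"
      by (rule card_Un_le)
    also have "\<dots> \<le> card {k\<in>{1..n}. y k \<notin> U} + (\<Sum>a\<in>W \<times> R. card (X a))"
      using W R by (intro add_left_mono card_UN_le) auto
    finally have "real (card {k\<in>{1..n}. \<exists>p\<in>P. cmod (p (y k) - p (\<Theta> (\<lambda>g\<in>W. \<omega> (y (t g k))))) \<ge> \<epsilon>})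
        \<le> real (card {k\<in>{1..n}. y k \<notin> U} + (\<Sum>a\<in>W \<times> R. card (X a)))"
      by (rule of_nat_mono)
    then have "real (card {k\<in>{1..n}. \<exists>p\<in>P. cmod (p (y k) - p (\<Theta> (\<lambda>g\<in>W. \<omega> (y (t g k))))) \<ge> \<epsilon>}) / real n
        \<le> real (card {k\<in>{1..n}. y k \<notin> U} + (\<Sum>a\<in>W \<times> R. card (X a))) / real n"
      by (rule divide_right_mono) simp
    also have "\<dots> = real (card {k\<in>{1..n}. y k \<notin> U}) / real n + (\<Sum>a\<in>W \<times> R. real (card (X a)) / real n)"
      by (simp add: add_divide_distrib sum_divide_distrib)
    \<comment> \<open>The first summand bounds the frequency of sites with y k outside
      \<open>U\<close>, the second collects the sites where some \<open>\<xi> i\<close> at y(T_g k)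
      differs from its value at C_g (y k) by 1/4 or more.\<close>
    also have "\<dots> \<le> (\<kappa> + w * r * \<kappa>' + \<kappa>') + (\<Sum>a\<in>W \<times> R. 4 * \<kappa>')"
    proof (intro add_mono sum_mono X)
      have "card {k\<in>{1..n}. y k \<notin> U} + card {k\<in>{1..n}. y k \<in> U} = card {1..n}"
      proof -
        have "card {1..n} = card ({k\<in>{1..n}. y k \<notin> U} \<union> {k\<in>{1..n}. y k \<in> U})"
          by (rule arg_cong[where f = card]) auto
        also have "\<dots> = card {k\<in>{1..n}. y k \<notin> U} + card {k\<in>{1..n}. y k \<in> U}"
          by (rule card_Un_disjoint) auto
        finally show ?thesis by simp
      qed
      then have "real (card {k\<in>{1..n}. y k \<notin> U}) = real n - real (card {k\<in>{1..n}. y k \<in> U})" by simp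
      then have "real (card {k\<in>{1..n}. y k \<notin> U}) / real n = 1 - real (card {k\<in>{1..n}. y k \<in> U}) / real n"
        using n by (simp add: diff_divide_distrib)
      then show "real (card {k\<in>{1..n}. y k \<notin> U}) / real n \<le> \<kappa> + w * r * \<kappa>' + \<kappa>'"
        using elim(1) N_U by (simp add: n_def y_def)
    qed
    also have "\<dots> = \<kappa> + \<kappa>' * (5 * w * r + 1)"
      by (simp add: card_cartesian_product w_def r_def algebra_simps)
    also have "\<dots> \<le> \<kappa> + \<kappa>' * ((r + 1)^2 + 5 * w * r + 1)"
      using \<kappa>' by (intro add_left_mono mult_left_mono) auto
    also have "\<dots> = \<kappa> + \<tau>" by (simp only: \<kappa>'M)
    finally show ?case by (simp add: n_def y_def t_def)
  qed
  show ?thesis using that[of \<omega>] \<omega>_R freq bad unfolding R_def by blast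
qed

end

section \<open>Upper bound\<close>

lemma log_enat_le:
  assumes "s \<le> enat k" "real k \<le> exp B"
  shows "log_enat s \<le> ereal B"
proof -
  obtain m where m: "s = enat m" "m \<le> k" using assms(1) by (cases s) auto
  show ?thesis
  proof (cases "m = 0")
    case False
    have "ln (real m) \<le> ln (exp B)" using False m assms(2) by (subst ln_le_cancel_iff) auto
    then show ?thesis using False m by (simp add: log_enat_def)
  qed (simp add: m log_enat_def)
qed

text \<open>Counting by weights requires positive weights, but a letter may have probability 0.
  Adding l to every probability and renormalizing gives positive weights whose cross entropy tends
  to the entropy as l tends to 0; letters with p j = 0 contribute 0 throughout.\<close>

lemma smoothed_cross_entropy:
  fixes p :: "nat \<Rightarrow> real"
  assumes R: "finite R" and p: "\<And>j. j \<in> R \<Longrightarrow> p j \<ge> 0" "(\<Sum>j\<in>R. p j) = 1" and e: "e > 0"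
  obtains q where "\<And>j. j \<in> R \<Longrightarrow> q j > 0" "(\<Sum>j\<in>R. q j) = 1"
    "(\<Sum>j\<in>R. p j * - ln (q j)) \<le> - (\<Sum>j\<in>R. p j * ln (p j)) + e"
proof -
  define r where "r = real (card R)"
  define q where "q l j = (p j + l) / (1 + r * l)" for l j
  have "((\<lambda>l. p j * - ln (q l j)) \<longlongrightarrow> p j * - ln (p j)) (at_right 0)" if j: "j \<in> R" for j
  proof (cases "p j = 0")
    case False
    then have "p j > 0" using p(1)[OF j] by simp
    moreover have "((\<lambda>l. q l j) \<longlongrightarrow> (p j + 0) / (1 + r * 0)) (at_right 0)"
      unfolding q_def by (intro tendsto_intros) auto
    ultimately show ?thesis by (intro tendsto_intros) auto
  qed simp
  then have "((\<lambda>l. \<Sum>j\<in>R. p j * - ln (q l j)) \<longlongrightarrow> (\<Sum>j\<in>R. p j * - ln (p j))) (at_right 0)"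
    by (rule tendsto_sum)
  then have "\<forall>\<^sub>F l in at_right 0. (\<Sum>j\<in>R. p j * - ln (q l j)) < (\<Sum>j\<in>R. p j * - ln (p j)) + e"
    using e by (intro order_tendstoD(2)) auto
  moreover have "\<forall>\<^sub>F l in at_right (0::real). l > 0" by (rule eventually_at_right_less)
  ultimately have "\<forall>\<^sub>F l in at_right 0. (\<Sum>j\<in>R. p j * - ln (q l j)) < (\<Sum>j\<in>R. p j * - ln (p j)) + e \<and> l > 0"
    by eventually_elim auto
  then obtain l where l: "(\<Sum>j\<in>R. p j * - ln (q l j)) < (\<Sum>j\<in>R. p j * - ln (p j)) + e" "l > 0"
    using eventually_happens'[OF trivial_limit_at_right_real] by blast
  have pos: "1 + r * l > 0" using l(2) by (intro add_pos_nonneg) (auto simp: r_def)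
  show ?thesis
  proof (rule that[of "q l"])
    show "q l j > 0" if "j \<in> R" for j
      unfolding q_def using p(1)[OF that] l(2) pos by (intro divide_pos_pos) auto
    have "(\<Sum>j\<in>R. q l j) = (\<Sum>j\<in>R. p j + l) / (1 + r * l)"
      unfolding q_def by (rule sum_divide_distrib[symmetric])
    also have "(\<Sum>j\<in>R. p j + l) = 1 + r * l" using p(2) by (simp add: sum.distrib r_def)
    finally show "(\<Sum>j\<in>R. q l j) = 1" using pos by simp
    show "(\<Sum>j\<in>R. p j * - ln (q l j)) \<le> - (\<Sum>j\<in>R. p j * ln (p j)) + e"
      using l(1) by (simp add: sum_negf)
  qed
qed

lemma sum_over_word:
  fixes f :: "nat \<Rightarrow> real" and n :: nat
  assumes R: "finite R" and w: "\<And>k. k \<in> {1..n} \<Longrightarrow> w k \<in> R"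
  shows "(\<Sum>k=1..n. f (w k)) = (\<Sum>j\<in>R. real (card {k\<in>{1..n}. w k = j}) * f j)"
proof -
  have "(\<Sum>k=1..n. f (w k)) = (\<Sum>j\<in>R. \<Sum>k\<in>{k\<in>{1..n}. w k = j}. f (w k))"
    using R w by (intro sum.group[symmetric]) auto
  also have "\<dots> = (\<Sum>j\<in>R. \<Sum>k\<in>{k\<in>{1..n}. w k = j}. f j)"
    by (intro sum.cong refl) auto
  finally show ?thesis by simp
qed

context bernoulli_model
begin

lemma P_real: "p \<in> P \<Longrightarrow> y \<in> topspace Y \<Longrightarrow> p y = complex_of_real (Re (p y))"
  and P_Re_nonneg: "p \<in> P \<Longrightarrow> y \<in> topspace Y \<Longrightarrow> Re (p y) \<ge> 0"
  using P_nonneg by (auto simp: complex_nonneg_Reals_iff complex_eq_iff)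

text \<open>A separated family injects into pairs consisting of a word of letters and a sparse list
  of corrections. Where the code predicts y k within \<epsilon>/2 nothing is recorded; elsewhere the
  values of \<open>P\<close> are stored with mesh \<epsilon>/2. Equal pairs give homomorphisms
  closer than \<epsilon>. The words are counted through their letter frequencies, the corrections as
  a Hamming ball.\<close>

lemma separated_card_le:
  assumes \<epsilon>: "\<epsilon> > 0" and t: "t > 0"
  obtains F m \<delta> c where "finite_code \<mu> c" "finite F" "F \<noteq> {}" "F \<subseteq> carrier G" "\<delta> > 0"
    "\<forall>\<^sub>F i in sequentially. \<forall>S. finite S \<longrightarrow> S \<subseteq> approx_hom G Y N b P F m \<delta> (d i) (\<sigma> i) \<longrightarrow>
       (\<forall>x\<in>S. \<forall>y\<in>S. x \<noteq> y \<longrightarrow> rho_max (d i) P x y \<ge> \<epsilon>) \<longrightarrow>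
       real (card S) \<le> exp (real (d i) * (code_entropy \<mu> c + t))"
proof -
  \<comment> \<open>\<open>None\<close> means that no correction is stored; otherwise all p in
    \<open>P\<close> are rounded down on the grid of mesh \<epsilon>/2, which stays finite because p
    takes values in [0,1].\<close>
  define V :: "(('y \<Rightarrow> complex) \<Rightarrow> int) option set" where
    "V = insert None (Some ` PiE P (\<lambda>_. {0..\<lfloor>2 / \<epsilon>\<rfloor>}))"
  have V: "finite V" unfolding V_def using finite_P by (intro finite.insertI finite_imageI finite_PiE) auto
  obtain \<kappa> where \<kappa>: "\<kappa> > 0" and ball: "\<And>n z. real (card {u \<in> PiE {1..n::nat} (\<lambda>_. V).
      real (card {k\<in>{1..n}. u k \<noteq> z k}) \<le> \<kappa> * real n}) \<le> exp (t / 2 * real n)"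
    using card_hamming_ball_le[OF V half_gt_zero[OF t]] by blast
  \<comment> \<open>No particular partition has to be refined for the upper bound, so coding starts
    from the trivial one.\<close>
  have c0: "finite_code \<mu> (\<lambda>_. 0)" by (auto simp: finite_code_def intro: finite_subset[of _ "{0}"])
  have PY: "P \<subseteq> cfun Y" using P_cfun by blast
  obtain c W \<Theta> where c: "finite_code \<mu> c" and W: "finite W" "W \<subseteq> carrier G"
    and \<Theta>: "\<And>w. \<Theta> w \<in> topspace Y"
    and err: "measure Z {z \<in> space Z. \<exists>f\<in>P. cmod (f (\<Psi> z) - f (\<Theta> (\<lambda>g\<in>W. c (z g)))) \<ge> \<epsilon> / 2} < \<kappa> / 2"
    by (rule coding[OF finite_P PY half_gt_zero[OF \<epsilon>] half_gt_zero[OF \<kappa>] c0], rule that, assumption+)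
  define R where "R = c ` space \<mu>"
  have R: "finite R" using c by (simp add: R_def finite_code_def)
  have psum: "(\<Sum>j\<in>R. code_prob \<mu> c j) = 1" unfolding R_def by (rule \<mu>.sum_code_prob[OF c])
  define h where "h = code_entropy \<mu> c"
  have nn: "code_prob \<mu> c j \<ge> 0" for j by (simp add: code_prob_def)
  have "t / 4 > 0" using t by simp
  then obtain q where q: "\<And>j. j \<in> R \<Longrightarrow> q j > 0" "(\<Sum>j\<in>R. q j) = 1"
    and qh: "(\<Sum>j\<in>R. code_prob \<mu> c j * - ln (q j)) \<le> h + t / 4"
    using smoothed_cross_entropy[OF R nn psum] unfolding h_def code_entropy_def R_def[symmetric] by metis
  define L where "L = (\<Sum>j\<in>R. \<bar>ln (q j)\<bar>)"
  have L: "L \<ge> 0" unfolding L_def by (intro sum_nonneg) auto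
  \<comment> \<open>The first entry keeps the share \<kappa>/2 + \<tau> of corrected sites below
    \<kappa>; the second bounds by t/4 the change of the cross entropy caused by deviating
    frequencies. Together with t/4 for smoothing and t/2 for the corrections this makes up
    t.\<close>
  define \<tau> where "\<tau> = min (\<kappa> / 2) (t / (4 * (L + 1)))"
  have \<tau>: "\<tau> > 0" using \<kappa> t L by (simp add: \<tau>_def)
  have \<tau>L: "\<tau> * L \<le> t / 4"
  proof -
    have "\<tau> * L \<le> t / (4 * (L + 1)) * (L + 1)" using L \<tau> by (intro mult_mono) (auto simp: \<tau>_def)
    also have "\<dots> = t / 4" using L by (simp add: field_simps)
    finally show ?thesis .
  qed
  obtain \<omega> where \<omega>: "\<And>y. \<omega> y \<in> R"
    and freq: "\<forall>\<^sub>F x in micro_filter. \<forall>j\<in>R.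
      \<bar>real (card {k\<in>{1..d (fst x)}. \<omega> (snd x k) = j}) / real (d (fst x)) - code_prob \<mu> c j\<bar> \<le> \<tau>"
    and bad: "\<forall>\<^sub>F x in micro_filter. real (card {k\<in>{1..d (fst x)}. \<exists>p\<in>P.
       cmod (p (snd x k) - p (\<Theta> (\<lambda>g\<in>W. \<omega> (snd x (T (fst x) g k))))) \<ge> \<epsilon> / 2}) / real (d (fst x)) \<le> \<kappa> / 2 + \<tau>"
    by (rule microstate_code[OF c W \<Theta> err \<tau>, folded R_def], rule that, assumption+)
  obtain F m \<delta> where F: "finite F" "F \<noteq> {}" "F \<subseteq> carrier G" "\<delta> > 0"
    and ev: "\<forall>\<^sub>F i in sequentially. \<forall>y\<in>microstates F m \<delta> i.
      (\<forall>j\<in>R. \<bar>real (card {k\<in>{1..d i}. \<omega> (y k) = j}) / real (d i) - code_prob \<mu> c j\<bar> \<le> \<tau>) \<and>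
      real (card {k\<in>{1..d i}. \<exists>p\<in>P. cmod (p (y k) - p (\<Theta> (\<lambda>g\<in>W. \<omega> (y (T i g k))))) \<ge> \<epsilon> / 2}) / real (d i) \<le> \<kappa> / 2 + \<tau>"
    using eventually_conj[OF freq bad] unfolding eventually_micro_filter micro_ev_def fst_conv snd_conv
    by (elim exE conjE) (rule that; assumption)
  show ?thesis
  proof (rule that[OF c F])
    show "\<forall>\<^sub>F i in sequentially. \<forall>S. finite S \<longrightarrow> S \<subseteq> approx_hom G Y N b P F m \<delta> (d i) (\<sigma> i) \<longrightarrow>
       (\<forall>x\<in>S. \<forall>y\<in>S. x \<noteq> y \<longrightarrow> rho_max (d i) P x y \<ge> \<epsilon>) \<longrightarrow>
       real (card S) \<le> exp (real (d i) * (code_entropy \<mu> c + t))"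
      using ev
    proof (eventually_elim, intro allI impI)
      fix i S
      assume elim: "\<forall>y\<in>microstates F m \<delta> i.
          (\<forall>j\<in>R. \<bar>real (card {k\<in>{1..d i}. \<omega> (y k) = j}) / real (d i) - code_prob \<mu> c j\<bar> \<le> \<tau>) \<and>
          real (card {k\<in>{1..d i}. \<exists>p\<in>P. cmod (p (y k) - p (\<Theta> (\<lambda>g\<in>W. \<omega> (y (T i g k))))) \<ge> \<epsilon> / 2}) / real (d i) \<le> \<kappa> / 2 + \<tau>"
        and S: "finite S" "S \<subseteq> approx_hom G Y N b P F m \<delta> (d i) (\<sigma> i)"
        and sep: "\<forall>x\<in>S. \<forall>y\<in>S. x \<noteq> y \<longrightarrow> rho_max (d i) P x y \<ge> \<epsilon>"
      define n where "n = d i"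
      have n: "n > 0" using d_pos by (simp add: n_def)
      have "\<forall>\<phi>\<in>S. \<exists>y. y \<in> microstates F m \<delta> i \<and> \<phi> = point_evaluation Y n y"
        using S(2) unfolding approx_hom_eq[OF F(3)] n_def by blast
      from bchoice[OF this] obtain y where
        y': "\<forall>\<phi>\<in>S. y \<phi> \<in> microstates F m \<delta> i \<and> \<phi> = point_evaluation Y n (y \<phi>)" ..
      have y: "y \<phi> \<in> microstates F m \<delta> i" and \<phi>y: "\<phi> = point_evaluation Y n (y \<phi>)" if "\<phi> \<in> S" for \<phi>
        using bspec[OF y' that] by simp_all
      have yY: "y \<phi> k \<in> topspace Y" if "\<phi> \<in> S" "k \<in> {1..n}" for \<phi> k
        using microstates_in[OF y[OF that(1)]] that(2) by (simp add: n_def)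
      define code where "code \<phi> k = (\<lambda>g\<in>W. \<omega> (y \<phi> (T i g k)))" for \<phi> k
      define good where "good \<phi> k \<longleftrightarrow> (\<forall>p\<in>P. cmod (p (y \<phi> k) - p (\<Theta> (code \<phi> k))) < \<epsilon> / 2)" for \<phi> k
      define wd where "wd \<phi> = (\<lambda>k\<in>{1..n}. \<omega> (y \<phi> k))" for \<phi>
      define u where "u \<phi> = (\<lambda>k\<in>{1..n}. if good \<phi> k then None
          else Some (\<lambda>p\<in>P. \<lfloor>Re (p (y \<phi> k)) * (2 / \<epsilon>)\<rfloor>))" for \<phi>
      have inj: "inj_on (\<lambda>\<phi>. (wd \<phi>, u \<phi>)) S"
      proof (rule inj_onI, rule ccontr)
        fix \<phi> \<psi> assume \<phi>: "\<phi> \<in> S" and \<psi>: "\<psi> \<in> S" and eq: "(wd \<phi>, u \<phi>) = (wd \<psi>, u \<psi>)" and ne: "\<phi> \<noteq> \<psi>"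
        have "\<forall>p\<in>P. \<forall>k\<in>{1..n}. cmod (p (y \<phi> k) - p (y \<psi> k)) < \<epsilon>"
        proof (intro ballI)
          fix p k assume p: "p \<in> P" and k: "k \<in> {1..n}"
          have uk: "u \<phi> k = u \<psi> k" using eq by simp
          show "cmod (p (y \<phi> k) - p (y \<psi> k)) < \<epsilon>"
          proof (cases "good \<phi> k")
            case True
            then have g2: "good \<psi> k" using uk k by (auto simp: u_def split: if_splits)
            have "code \<phi> k = code \<psi> k"
              unfolding code_def
            proof (rule restrict_ext)
              fix g assume "g \<in> W"
              then have "T i g k \<in> {1..n}" using T_in W k unfolding n_def by blast
              then show "\<omega> (y \<phi> (T i g k)) = \<omega> (y \<psi> (T i g k))"
                using eq unfolding wd_def by (metis prod.inject restrict_apply')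
            qed
            then have "cmod (p (y \<phi> k) - p (\<Theta> (code \<phi> k))) < \<epsilon> / 2" "cmod (p (y \<psi> k) - p (\<Theta> (code \<phi> k))) < \<epsilon> / 2"
              using True g2 p by (auto simp: good_def)
            then show ?thesis
              using norm_triangle_ineq4[of "p (y \<phi> k) - p (\<Theta> (code \<phi> k))" "p (y \<psi> k) - p (\<Theta> (code \<phi> k))"] by simp
          next
            case False
            then have "\<not> good \<psi> k" using uk k by (auto simp: u_def split: if_splits)
            then have "(\<lambda>p\<in>P. \<lfloor>Re (p (y \<phi> k)) * (2 / \<epsilon>)\<rfloor>) = (\<lambda>p\<in>P. \<lfloor>Re (p (y \<psi> k)) * (2 / \<epsilon>)\<rfloor>)"
              using uk k False by (simp add: u_def)
            from fun_cong[OF this, of p] p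
            have "\<lfloor>Re (p (y \<phi> k)) * (2 / \<epsilon>)\<rfloor> = \<lfloor>Re (p (y \<psi> k)) * (2 / \<epsilon>)\<rfloor>" by simp
            then have "\<bar>Re (p (y \<phi> k)) * (2 / \<epsilon>) - Re (p (y \<psi> k)) * (2 / \<epsilon>)\<bar> < 1" by linarith
            moreover have "Re (p (y \<phi> k)) * (2 / \<epsilon>) - Re (p (y \<psi> k)) * (2 / \<epsilon>)
                = (Re (p (y \<phi> k)) - Re (p (y \<psi> k))) * (2 / \<epsilon>)"
              by (rule left_diff_distrib[symmetric])
            moreover have "\<bar>2 / \<epsilon>\<bar> = 2 / \<epsilon>" using \<epsilon> by simp
            ultimately have "\<bar>Re (p (y \<phi> k)) - Re (p (y \<psi> k))\<bar> * (2 / \<epsilon>) < 1"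
              by (simp only: abs_mult)
            then have "2 * \<bar>Re (p (y \<phi> k)) - Re (p (y \<psi> k))\<bar> < \<epsilon>"
              using \<epsilon> by (simp add: field_simps)
            then have "\<bar>Re (p (y \<phi> k)) - Re (p (y \<psi> k))\<bar> < \<epsilon>"
              by (rule order_le_less_trans[rotated]) simp
            moreover have "p (y \<phi> k) - p (y \<psi> k) = complex_of_real (Re (p (y \<phi> k)) - Re (p (y \<psi> k)))"
              unfolding of_real_diff
              by (rule arg_cong2[where f = "(-)", OF P_real[OF p yY[OF \<phi> k]] P_real[OF p yY[OF \<psi> k]]])
            ultimately show ?thesis by (simp only: norm_of_real)
          qed
        qed
        then have "rho_max n P (point_evaluation Y n (y \<phi>)) (point_evaluation Y n (y \<psi>)) < \<epsilon>"
          using rho_max_less_iff[OF n] by blast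
        then have "rho_max n P \<phi> \<psi> < \<epsilon>" unfolding \<phi>y[OF \<phi>, symmetric] \<phi>y[OF \<psi>, symmetric] .
        then show False using sep \<phi> \<psi> ne by (auto simp: n_def not_le[symmetric])
      qed
      define Words where "Words = {w \<in> PiE {1..n} (\<lambda>_. R). (\<Sum>k=1..n. - ln (q (w k))) \<le> real n * (h + t / 2)}"
      \<comment> \<open>The Hamming ball of relative radius \<kappa> around the constant list
        \<open>None\<close>.\<close>
      define Sparse where "Sparse = {u \<in> PiE {1..n} (\<lambda>_. V). real (card {k\<in>{1..n}. u k \<noteq> None}) \<le> \<kappa> * real n}"
      have finW: "finite Words" unfolding Words_def by (rule finite_subset[OF _ finite_PiE[of "{1..n}" "\<lambda>_. R"]]) (use R in auto)
      have finS: "finite Sparse" unfolding Sparse_def by (rule finite_subset[OF _ finite_PiE[of "{1..n}" "\<lambda>_. V"]]) (use V in auto)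
      have wdW: "wd \<phi> \<in> Words" if \<phi>: "\<phi> \<in> S" for \<phi>
      proof -
        define f where "f j = real (card {k\<in>{1..n}. \<omega> (y \<phi> k) = j}) / real n" for j
        have f: "\<bar>f j - code_prob \<mu> c j\<bar> \<le> \<tau>" if "j \<in> R" for j
          using elim y[OF \<phi>] that unfolding f_def n_def by blast
        have "(\<Sum>k=1..n. - ln (q (wd \<phi> k))) = (\<Sum>k=1..n. - ln (q (\<omega> (y \<phi> k))))"
          by (intro sum.cong) (auto simp: wd_def)
        also have "\<dots> = (\<Sum>j\<in>R. real (card {k\<in>{1..n}. \<omega> (y \<phi> k) = j}) * - ln (q j))"
          by (rule sum_over_word[OF R \<omega>])
        also have "\<dots> = real n * (\<Sum>j\<in>R. f j * - ln (q j))"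
          using n by (simp add: f_def sum_distrib_left)
        also have "(\<Sum>j\<in>R. f j * - ln (q j)) = (\<Sum>j\<in>R. code_prob \<mu> c j * - ln (q j)) + (\<Sum>j\<in>R. (f j - code_prob \<mu> c j) * - ln (q j))"
          by (simp add: left_diff_distrib sum_subtractf sum_negf)
        also have "(\<Sum>j\<in>R. (f j - code_prob \<mu> c j) * - ln (q j)) \<le> (\<Sum>j\<in>R. \<tau> * \<bar>ln (q j)\<bar>)"
        proof (rule sum_mono)
          fix j assume j: "j \<in> R"
          have "(f j - code_prob \<mu> c j) * - ln (q j) \<le> \<bar>f j - code_prob \<mu> c j\<bar> * \<bar>ln (q j)\<bar>"
            using abs_ge_self[of "(f j - code_prob \<mu> c j) * - ln (q j)"] by (simp only: abs_mult abs_minus_cancel)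
          also have "\<dots> \<le> \<tau> * \<bar>ln (q j)\<bar>" using f[OF j] by (intro mult_right_mono) auto
          finally show "(f j - code_prob \<mu> c j) * - ln (q j) \<le> \<tau> * \<bar>ln (q j)\<bar>" .
        qed
        also have "(\<Sum>j\<in>R. \<tau> * \<bar>ln (q j)\<bar>) = \<tau> * L" by (simp add: L_def sum_distrib_left)
        finally have "(\<Sum>k=1..n. - ln (q (wd \<phi> k))) \<le> real n * ((\<Sum>j\<in>R. code_prob \<mu> c j * - ln (q j)) + \<tau> * L)"
          by (simp add: mult_left_mono)
        also have "\<dots> \<le> real n * (h + t / 2)" using qh \<tau>L by (intro mult_left_mono) auto
        finally show ?thesis using \<omega> by (auto simp: Words_def wd_def)
      qed
      have uS: "u \<phi> \<in> Sparse" if \<phi>: "\<phi> \<in> S" for \<phi>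
      proof -
        have "u \<phi> k \<in> V" if k: "k \<in> {1..n}" for k
        proof -
          have "\<lfloor>Re (p (y \<phi> k)) * (2 / \<epsilon>)\<rfloor> \<in> {0..\<lfloor>2 / \<epsilon>\<rfloor>}" if p: "p \<in> P" for p
          proof -
            have "Re (p (y \<phi> k)) \<le> 1"
              using P_le_one[OF p yY[OF \<phi> k]] complex_Re_le_cmod[of "p (y \<phi> k)"] by linarith
            then have "Re (p (y \<phi> k)) * (2 / \<epsilon>) \<le> 1 * (2 / \<epsilon>)" using \<epsilon> by (intro mult_right_mono) auto
            then have "\<lfloor>Re (p (y \<phi> k)) * (2 / \<epsilon>)\<rfloor> \<le> \<lfloor>2 / \<epsilon>\<rfloor>" by (intro floor_mono) simp
            moreover have "0 \<le> Re (p (y \<phi> k)) * (2 / \<epsilon>)"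
              using P_Re_nonneg[OF p yY[OF \<phi> k]] \<epsilon> by simp
            ultimately show ?thesis by simp
          qed
          then show ?thesis using k by (auto simp: u_def V_def)
        qed
        then have "u \<phi> \<in> PiE {1..n} (\<lambda>_. V)" unfolding u_def by auto
        moreover have "real (card {k\<in>{1..n}. u \<phi> k \<noteq> None}) \<le> \<kappa> * real n"
        proof -
          have "{k\<in>{1..n}. u \<phi> k \<noteq> None}
              = {k\<in>{1..n}. \<exists>p\<in>P. cmod (p (y \<phi> k) - p (\<Theta> (\<lambda>g\<in>W. \<omega> (y \<phi> (T i g k))))) \<ge> \<epsilon> / 2}"
            by (auto simp: u_def good_def code_def not_less)
          then have "real (card {k\<in>{1..n}. u \<phi> k \<noteq> None}) / real n \<le> \<kappa> / 2 + \<tau>"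
            using elim y[OF \<phi>] unfolding n_def by simp
          also have "\<dots> \<le> \<kappa>" by (simp add: \<tau>_def)
          finally show ?thesis using n by (simp add: field_simps)
        qed
        ultimately show ?thesis by (simp add: Sparse_def)
      qed
      have "card S \<le> card (Words \<times> Sparse)"
        using inj wdW uS finW finS by (intro card_inj_on_le[OF inj]) auto
      then have "real (card S) \<le> real (card Words) * real (card Sparse)"
        unfolding card_cartesian_product of_nat_mult[symmetric] by (rule of_nat_mono)
      also have "\<dots> \<le> exp (real n * (h + t / 2)) * exp (t / 2 * real n)"
      proof (intro mult_mono)
        have "real (card Words) \<le> 1 ^ card {1..n} * exp (real n * (h + t / 2))"
          using R q by (intro card_words_le[where q = "\<lambda>_. q" and V = R]) (auto simp: Words_def)
        then show "real (card Words) \<le> exp (real n * (h + t / 2))" by simp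
        show "real (card Sparse) \<le> exp (t / 2 * real n)"
          unfolding Sparse_def by (rule ball)
      qed auto
      also have "\<dots> = exp (real n * (h + t))"
        by (simp add: exp_add[symmetric] algebra_simps)
      finally show "real (card S) \<le> exp (real (d i) * (code_entropy \<mu> c + t))" by (simp add: n_def h_def)
    qed
  qed
qed

text \<open>The code depends on \<epsilon> and t, but its entropy never exceeds that of the base.
  One choice of F, m, \<delta> bounds all the infima, and then t is arbitrary.\<close>

theorem model_entropy_le: "model_entropy G d \<sigma> Y N b P \<le> base_entropy \<mu>"
  unfolding model_entropy_def
proof (rule SUP_least)
  fix \<epsilon> :: real assume "\<epsilon> \<in> {0<..}"
  then have \<epsilon>: "\<epsilon> > 0" by simp
  define E where "E F m \<delta> = limsup (\<lambda>i. ereal (1 / real (d i)) *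
          log_enat (separation_number \<epsilon> (approx_hom G Y N b P F m \<delta> (d i) (\<sigma> i)) (rho_max (d i) P)))" for F m \<delta>
  show "(INF F\<in>{F. finite F \<and> F \<noteq> {} \<and> F \<subseteq> carrier G}. INF m. INF \<delta>\<in>{0<..}. E F m \<delta>) \<le> base_entropy \<mu>"
  proof (rule ereal_le_epsilon2)
    fix t :: real assume t: "t > 0"
    obtain F m \<delta> c where c: "finite_code \<mu> c" and F: "finite F" "F \<noteq> {}" "F \<subseteq> carrier G" and \<delta>: "\<delta> > 0"
      and ev: "\<forall>\<^sub>F i in sequentially. \<forall>S. finite S \<longrightarrow> S \<subseteq> approx_hom G Y N b P F m \<delta> (d i) (\<sigma> i) \<longrightarrow>
       (\<forall>x\<in>S. \<forall>y\<in>S. x \<noteq> y \<longrightarrow> rho_max (d i) P x y \<ge> \<epsilon>) \<longrightarrow>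
       real (card S) \<le> exp (real (d i) * (code_entropy \<mu> c + t))"
      by (rule separated_card_le[OF \<epsilon> t])
    have "(INF F\<in>{F. finite F \<and> F \<noteq> {} \<and> F \<subseteq> carrier G}. INF m. INF \<delta>\<in>{0<..}. E F m \<delta>) \<le> E F m \<delta>"
    proof -
      have "(INF F\<in>{F. finite F \<and> F \<noteq> {} \<and> F \<subseteq> carrier G}. INF m. INF \<delta>\<in>{0<..}. E F m \<delta>) \<le> (INF m. INF \<delta>\<in>{0<..}. E F m \<delta>)"
        by (rule INF_lower) (use F in blast)
      also have "\<dots> \<le> (INF \<delta>\<in>{0<..}. E F m \<delta>)" by (rule INF_lower) simp
      also have "\<dots> \<le> E F m \<delta>" by (rule INF_lower) (use \<delta> in simp)
      finally show ?thesis .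
    qed
    also have "E F m \<delta> \<le> ereal (code_entropy \<mu> c + t)"
      unfolding E_def
    proof (rule Limsup_bounded)
      show "\<forall>\<^sub>F i in sequentially. ereal (1 / real (d i)) *
          log_enat (separation_number \<epsilon> (approx_hom G Y N b P F m \<delta> (d i) (\<sigma> i)) (rho_max (d i) P))
          \<le> ereal (code_entropy \<mu> c + t)"
        using ev
      proof eventually_elim
        case (elim i)
        let ?B = "real (d i) * (code_entropy \<mu> c + t)"
        \<comment> \<open>Rounding down to a natural number turns the uniform bound on finite
          separated sets into a finite bound for their supremum in \<open>enat\<close>.\<close>
        have "separation_number \<epsilon> (approx_hom G Y N b P F m \<delta> (d i) (\<sigma> i)) (rho_max (d i) P) \<le> enat (nat \<lfloor>exp ?B\<rfloor>)"
          unfolding separation_number_def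
        proof (rule SUP_least)
          fix S assume "S \<in> {S. finite S \<and> S \<subseteq> approx_hom G Y N b P F m \<delta> (d i) (\<sigma> i) \<and>
            (\<forall>x\<in>S. \<forall>y\<in>S. x \<noteq> y \<longrightarrow> \<epsilon> \<le> rho_max (d i) P x y)}"
          then have *: "finite S \<and> S \<subseteq> approx_hom G Y N b P F m \<delta> (d i) (\<sigma> i) \<and>
            (\<forall>x\<in>S. \<forall>y\<in>S. x \<noteq> y \<longrightarrow> \<epsilon> \<le> rho_max (d i) P x y)"
            by (rule CollectD)
          note S = conjunct1[OF *] conjunct1[OF conjunct2[OF *]] conjunct2[OF conjunct2[OF *]]
          have "real (card S) \<le> exp ?B"
            using mp[OF mp[OF mp[OF spec[OF elim, of S] S(1)] S(2)] S(3)] by simp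
          then have "card S \<le> nat \<lfloor>exp ?B\<rfloor>" by (simp add: le_nat_floor)
          then show "enat (card S) \<le> enat (nat \<lfloor>exp ?B\<rfloor>)" by simp
        qed
        then have "log_enat (separation_number \<epsilon> (approx_hom G Y N b P F m \<delta> (d i) (\<sigma> i)) (rho_max (d i) P)) \<le> ereal ?B"
          by (rule log_enat_le) (simp add: of_nat_nat)
        then have "ereal (1 / real (d i)) * log_enat (separation_number \<epsilon> (approx_hom G Y N b P F m \<delta> (d i) (\<sigma> i)) (rho_max (d i) P))
          \<le> ereal (1 / real (d i)) * ereal ?B"
          by (intro ereal_mult_left_mono) auto
        also have "\<dots> = ereal (code_entropy \<mu> c + t)" using d_pos[of i] by simp
        finally show ?case .
      qed
    qed
    also have "ereal (code_entropy \<mu> c + t) \<le> base_entropy \<mu> + ereal t"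
      using add_right_mono[OF code_entropy_le_base_entropy[OF c], of "ereal t"] by simp
    finally show "(INF F\<in>{F. finite F \<and> F \<noteq> {} \<and> F \<subseteq> carrier G}. INF m. INF \<delta>\<in>{0<..}. E F m \<delta>) \<le> base_entropy \<mu> + ereal t" .
  qed
qed

end

section \<open>Lower bound\<close>

text \<open>Numbering the cells of a partition; with the converse inequality for codes, the base
  entropy becomes a supremum over finite codes.\<close>

lemma partition_entropy_code:
  assumes Q: "finite_measurable_partition \<mu> Q"
  obtains c where "finite_code \<mu> c" "code_entropy \<mu> c = partition_entropy \<mu> Q"
proof -
  have fin: "finite Q" and sets: "Q \<subseteq> sets \<mu>" and part: "partition_on (space \<mu>) Q"
    using Q by (auto simp: finite_measurable_partition_def)
  obtain e :: "'a set \<Rightarrow> nat" where e: "inj_on e Q"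
    using finite_imp_inj_to_nat_seg[OF fin] by blast
  define c where "c x = e (THE A. A \<in> Q \<and> x \<in> A)" for x
  have c: "c x = e A" if "A \<in> Q" "x \<in> A" for x A
  proof -
    have "(THE A. A \<in> Q \<and> x \<in> A) = A"
      using that partition_onD2[OF part] by (intro the_equality) (auto simp: disjoint_def)
    then show ?thesis by (simp add: c_def)
  qed
  have cov: "\<exists>A\<in>Q. x \<in> A" if "x \<in> space \<mu>" for x
    using partition_onD1[OF part] that by blast
  have vim: "{x \<in> space \<mu>. c x = e A} = A" if A: "A \<in> Q" for A
  proof (intro equalityI subsetI)
    fix x assume x: "x \<in> {x \<in> space \<mu>. c x = e A}"
    then obtain B where B: "B \<in> Q" "x \<in> B" using cov by blast
    then have "e B = e A" using c x by simp
    then show "x \<in> A" using inj_onD[OF e _ B(1) A] B(2) by blast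
  next
    fix x assume "x \<in> A"
    then have "x \<in> space \<mu>" using partition_onD1[OF part] A by blast
    then show "x \<in> {x \<in> space \<mu>. c x = e A}" using c[OF A \<open>x \<in> A\<close>] by simp
  qed
  have img: "c ` space \<mu> = e ` Q"
  proof (intro equalityI subsetI)
    fix j assume "j \<in> c ` space \<mu>"
    then show "j \<in> e ` Q" using cov c by blast
  next
    fix j assume "j \<in> e ` Q"
    then obtain A where A: "A \<in> Q" "j = e A" by blast
    have "A \<noteq> {}" using A(1) partition_onD3[OF part] by metis
    then obtain x where "x \<in> A" by blast
    then have "x \<in> {x \<in> space \<mu>. c x = e A}" unfolding vim[OF A(1)] .
    then have "x \<in> space \<mu>" "j = c x" using A(2) by auto
    then show "j \<in> c ` space \<mu>" by (rule rev_image_eqI)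
  qed
  have "c \<in> \<mu> \<rightarrow>\<^sub>M count_space UNIV"
    unfolding measurable_count_space_eq2_countable
  proof (intro conjI ballI)
    fix j :: nat
    show "c -` {j} \<inter> space \<mu> \<in> sets \<mu>"
    proof (cases "j \<in> e ` Q")
      case True
      then obtain A where A: "A \<in> Q" "j = e A" by blast
      then have "c -` {j} \<inter> space \<mu> = A" using vim[OF A(1)] by auto
      then show ?thesis using A sets by auto
    next
      case False
      then have "c -` {j} \<inter> space \<mu> = {}" using img by blast
      then show ?thesis by simp
    qed
  qed auto
  then have "finite_code \<mu> c" using img fin by (simp add: finite_code_def)
  moreover have "code_entropy \<mu> c = partition_entropy \<mu> Q"
    unfolding code_entropy_def partition_entropy_def img
    by (subst sum.reindex[OF e]) (simp add: code_prob_def vim)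
  ultimately show ?thesis by (rule that)
qed

context sofic_model
begin

text \<open>Condition (i) thus amounts to finitely many tests, so a union bound applies to a random
  word. Finiteness appears after restricting the index functions to \<open>{1..j}\<close>.\<close>

lemma finite_product_set:
  assumes "finite F"
  shows "finite (product_set G Y b P F m)"
proof -
  let ?f = "\<lambda>(j::nat, s, p). (\<lambda>y\<in>topspace Y. \<Prod>l\<in>{1..j}. translate G Y b (s l) (p l) y)"
  let ?A = "\<Union>j\<in>{1..m}. {j} \<times> PiE {1..j} (\<lambda>_. F) \<times> PiE {1..j} (\<lambda>_. P)"
  have "product_set G Y b P F m \<subseteq> ?f ` ?A"
  proof
    fix f assume "f \<in> product_set G Y b P F m"
    then obtain j s p where f: "f = (\<lambda>y\<in>topspace Y. \<Prod>l\<in>{1..j}. translate G Y b (s l) (p l) y)"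
      and j: "1 \<le> j" "j \<le> m" and s: "\<forall>l\<in>{1..j}. s l \<in> F" and p: "\<forall>l\<in>{1..j}. p l \<in> P"
      unfolding product_set_def by blast
    have "f = ?f (j, restrict s {1..j}, restrict p {1..j})"
      unfolding f by (auto simp: fun_eq_iff intro!: prod.cong)
    moreover have "(j, restrict s {1..j}, restrict p {1..j}) \<in> ?A"
      using j s p by auto
    ultimately show "f \<in> ?f ` ?A" by blast
  qed
  moreover have "finite ?A" using assms finite_P by (intro finite_UN_I finite_cartesian_product finite_PiE) auto
  ultimately show ?thesis by (rule finite_surj[rotated])
qed

lemma product_set_real:
  assumes f: "f \<in> product_set G Y b P F m" and F: "F \<subseteq> carrier G" and y: "y \<in> topspace Y"
  shows "f y = complex_of_real (Re (f y))"
proof -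
  obtain j s p where eq: "f = (\<lambda>y\<in>topspace Y. \<Prod>l\<in>{1..j::nat}. translate G Y b (s l) (p l) y)"
    and s: "\<forall>l\<in>{1..j}. s l \<in> F" and p: "\<forall>l\<in>{1..j}. p l \<in> P"
    using f unfolding product_set_def by blast
  have "translate G Y b (s l) (p l) y \<in> \<real>" if l: "l \<in> {1..j}" for l
  proof -
    have "C (s l) y \<in> topspace Y" using C_in s l F y by blast
    then have "p l (C (s l) y) \<in> \<real>\<^sub>\<ge>\<^sub>0" using P_nonneg p l by blast
    then show ?thesis using y nonneg_Reals_subset_Reals by (auto simp: translate_apply)
  qed
  then have "(\<Prod>l\<in>{1..j}. translate G Y b (s l) (p l) y) \<in> \<real>" by (rule prod_in_Reals)
  then have "f y \<in> \<real>" using y unfolding eq by simp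
  then show ?thesis by (simp add: of_real_Re)
qed

end

section \<open>Tests on random words\<close>

context bernoulli_model
begin

lemma \<Psi>_push:
  fixes f :: "'y \<Rightarrow> real"
  assumes f: "f \<in> borel_measurable N"
  shows "(\<integral>z. f (\<Psi> z) \<partial>Z) = (\<integral>y. f y \<partial>N)"
  using integral_distr[OF \<Psi>_measurable f] by (simp add: \<Psi>_distr)

lemma word_measurable:
  fixes h :: "('g \<Rightarrow> nat) \<Rightarrow> 'b::topological_space"
  assumes "finite_code \<mu> c" "finite W" "W \<subseteq> I"
  shows "(\<lambda>z. h (\<lambda>g\<in>W. c (z g))) \<in> borel_measurable (PiM I (\<lambda>_. \<mu>))"
  using assms by (intro measurable_finite_word) (auto simp: finite_code_def)

lemma word_bounded:
  fixes h :: "('g \<Rightarrow> nat) \<Rightarrow> real"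
  assumes "finite_code \<mu> c" "finite W" "W \<subseteq> I"
  obtains B where "\<And>z. z \<in> space (PiM I (\<lambda>_. \<mu>)) \<Longrightarrow> \<bar>h (\<lambda>g\<in>W. c (z g))\<bar> \<le> B"
proof -
  let ?V = "PiE W (\<lambda>_. c ` space \<mu>)"
  have V: "finite ?V" using assms by (intro finite_PiE) (auto simp: finite_code_def)
  have "\<bar>h (\<lambda>g\<in>W. c (z g))\<bar> \<le> Max ((\<lambda>v. \<bar>h v\<bar>) ` ?V)" if z: "z \<in> space (PiM I (\<lambda>_. \<mu>))" for z
  proof -
    have "(\<lambda>g\<in>W. c (z g)) \<in> ?V" using z assms(3) by (auto simp: space_PiM PiE_iff)
    then show ?thesis using V by (intro Max_ge) auto
  qed
  then show ?thesis by (rule that)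
qed

lemma word_integrable:
  fixes h :: "('g \<Rightarrow> nat) \<Rightarrow> real"
  assumes "finite_code \<mu> c" "finite W" "W \<subseteq> carrier G"
  shows "integrable Z (\<lambda>z. h (\<lambda>g\<in>W. c (z g)))"
proof -
  obtain B where B: "\<And>z. z \<in> space Z \<Longrightarrow> \<bar>h (\<lambda>g\<in>W. c (z g))\<bar> \<le> B"
    using word_bounded[OF assms, of h] by metis
  show ?thesis
    using B by (intro Z.integrable_const_bound[where B = B] word_measurable assms) auto
qed

text \<open>The law of large numbers for each test, followed by a union bound. The constant 1/2
  could be any number in (0,1); it costs a factor 2 in the number of words.\<close>

lemma window_words_eventually:
  fixes \<H> :: "(('g \<Rightarrow> nat) \<Rightarrow> real) set"
  assumes c: "finite_code \<mu> c" and W: "finite W" "W \<subseteq> carrier G" and H: "finite \<H>" and e: "e > 0"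
  shows "\<forall>\<^sub>F i in sequentially. \<exists>A\<in>sets (PiM {1..d i} (\<lambda>_. \<mu>)). measure (PiM {1..d i} (\<lambda>_. \<mu>)) A \<ge> 1/2 \<and>
    (\<forall>u\<in>A. \<forall>h\<in>\<H>. \<bar>(\<Sum>k=1..d i. h (\<lambda>g\<in>W. c (u (T i g k)))) / real (d i) - (\<integral>z. h (\<lambda>g\<in>W. c (z g)) \<partial>Z)\<bar> < e)"
proof -
  let ?M = "\<lambda>i. PiM {1..d i} (\<lambda>_. \<mu>)"
  have M: "prob_space (?M i)" for i by (intro prob_space_PiM prob_\<mu>)
  define avg where "avg h i u = (\<Sum>k=1..d i. h (\<lambda>g\<in>W. c (u (T i g k)))) / real (d i)" for h :: "('g \<Rightarrow> nat) \<Rightarrow> real" and i u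
  define I where "I h = (\<integral>z. h (\<lambda>g\<in>W. c (z g)) \<partial>Z)" for h :: "('g \<Rightarrow> nat) \<Rightarrow> real"
  define bad where "bad h i = {u \<in> space (?M i). \<bar>avg h i u - I h\<bar> \<ge> e}" for h i
  have win: "(\<lambda>u. \<lambda>g\<in>W. u (T i g k)) \<in> ?M i \<rightarrow>\<^sub>M PiM W (\<lambda>_. \<mu>)" if "k \<in> {1..d i}" for i k
    using T_in W that by (intro measurable_restrict measurable_component_singleton) blast
  have avg_eq: "avg h i u = (\<Sum>k=1..d i. (\<lambda>z. h (\<lambda>g\<in>W. c (z g))) (\<lambda>g\<in>W. u (T i g k))) / real (d i)" for h i u
    unfolding avg_def by (simp cong: restrict_cong)
  have I_eq: "I h = (\<integral>z. h (\<lambda>g\<in>W. c (z g)) \<partial>PiM W (\<lambda>_. \<mu>))" for h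
  proof -
    have res: "(\<lambda>z. \<lambda>g\<in>W. z g) \<in> Z \<rightarrow>\<^sub>M PiM W (\<lambda>_. \<mu>)"
      using W by (intro measurable_restrict measurable_component_singleton) auto
    have d: "distr Z (PiM W (\<lambda>_. \<mu>)) (\<lambda>z. \<lambda>g\<in>W. z g) = PiM W (\<lambda>_. \<mu>)"
      using distr_PiM_reindex[of "carrier G" "\<lambda>_. \<mu>" "\<lambda>g. g" W] prob_\<mu> W by auto
    have "(\<integral>z. h (\<lambda>g\<in>W. c (z g)) \<partial>PiM W (\<lambda>_. \<mu>)) = (\<integral>z. h (\<lambda>g\<in>W. c ((\<lambda>g\<in>W. z g) g)) \<partial>Z)"
      using integral_distr[OF res word_measurable[OF c W(1) order_refl, of h]] unfolding d .
    then show ?thesis unfolding I_def by (simp cong: restrict_cong)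
  qed
  have bad_M: "bad h i \<in> sets (?M i)" for h i
  proof -
    have "(\<lambda>u. avg h i u) \<in> borel_measurable (?M i)"
      unfolding avg_eq
      by (intro borel_measurable_divide borel_measurable_sum borel_measurable_const
          measurable_compose[OF win word_measurable[OF c W(1) order_refl]])
    then show ?thesis unfolding bad_def by measurable
  qed
  have lim: "(\<lambda>i. measure (?M i) (bad h i)) \<longlonglongrightarrow> 0" for h
  proof -
    obtain B where B: "\<And>z. z \<in> space (PiM W (\<lambda>_. \<mu>)) \<Longrightarrow> \<bar>h (\<lambda>g\<in>W. c (z g))\<bar> \<le> B"
      using word_bounded[OF c W(1) order_refl, of h] by metis
    show ?thesis
      unfolding bad_def avg_eq I_eq
      by (rule window_law_of_large_numbers[OF prob_\<mu> W word_measurable[OF c W(1) order_refl, of h] B e])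
  qed
  have "(\<lambda>i. \<Sum>h\<in>\<H>. measure (?M i) (bad h i)) \<longlonglongrightarrow> 0"
    using lim by (intro tendsto_null_sum) auto
  then have "\<forall>\<^sub>F i in sequentially. (\<Sum>h\<in>\<H>. measure (?M i) (bad h i)) < 1/2"
    by (rule order_tendstoD) simp
  then show ?thesis
  proof eventually_elim
    case (elim i)
    interpret Mi: prob_space "?M i" by (rule M)
    let ?A = "space (?M i) - (\<Union>h\<in>\<H>. bad h i)"
    have U: "(\<Union>h\<in>\<H>. bad h i) \<in> sets (?M i)" using bad_M H by (intro sets.finite_UN) auto
    have "measure (?M i) (\<Union>h\<in>\<H>. bad h i) \<le> (\<Sum>h\<in>\<H>. measure (?M i) (bad h i))"
      using bad_M H by (intro Mi.finite_measure_subadditive_finite) auto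
    then have m: "measure (?M i) ?A \<ge> 1/2" using elim Mi.prob_compl[OF U] by simp
    have "\<bar>avg h i u - I h\<bar> < e" if "u \<in> ?A" "h \<in> \<H>" for u h
      using that unfolding bad_def by (metis (mono_tags, lifting) DiffE UN_I mem_Collect_eq not_le)
    then show ?case
      using m U unfolding avg_def I_def by (intro bexI[of _ ?A]) auto
  qed
qed

text \<open>From error in probability to error in mean: the difference is below \<epsilon> off the
  exceptional event and at most 2 B on it.\<close>

lemma coding_integral:
  assumes c: "finite_code \<mu> c" and W: "finite W" "W \<subseteq> carrier G" and \<Theta>: "\<And>w. \<Theta> w \<in> topspace Y"
    and Q: "finite Q" "Q \<subseteq> cfun Y" and f: "f \<in> Q"
    and B: "\<And>y. y \<in> topspace Y \<Longrightarrow> cmod (f y) \<le> B" and \<epsilon>: "\<epsilon> > 0"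
    and err: "measure Z {z \<in> space Z. \<exists>f\<in>Q. cmod (f (\<Psi> z) - f (\<Theta> (\<lambda>g\<in>W. c (z g)))) \<ge> \<epsilon>} < \<eta>"
  shows "integrable Z (\<lambda>z. cmod (f (\<Psi> z) - f (\<Theta> (\<lambda>g\<in>W. c (z g)))))"
    and "(\<integral>z. cmod (f (\<Psi> z) - f (\<Theta> (\<lambda>g\<in>W. c (z g)))) \<partial>Z) \<le> \<epsilon> + 2 * B * \<eta>"
proof -
  define E where "E = {z \<in> space Z. \<exists>f\<in>Q. cmod (f (\<Psi> z) - f (\<Theta> (\<lambda>g\<in>W. c (z g)))) \<ge> \<epsilon>}"
  have E: "E \<in> sets Z" unfolding E_def by (rule coding_error_sets[OF c W \<Theta> Q])
  have fm: "(\<lambda>z. f (\<Psi> z)) \<in> borel_measurable Z"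
    using measurable_compose[OF \<Psi>_measurable cfun_measurable] f Q by blast
  have wm: "(\<lambda>z. f (\<Theta> (\<lambda>g\<in>W. c (z g)))) \<in> borel_measurable Z"
    by (rule word_measurable[OF c W, of "\<lambda>w. f (\<Theta> w)"])
  have le: "cmod (f (\<Psi> z) - f (\<Theta> (\<lambda>g\<in>W. c (z g)))) \<le> 2 * B" if "z \<in> space Z" for z
    using norm_triangle_ineq4[of "f (\<Psi> z)" "f (\<Theta> (\<lambda>g\<in>W. c (z g)))"] B[OF \<Psi>_in[OF that]] B[OF \<Theta>[of "\<lambda>g\<in>W. c (z g)"]]
    by linarith
  show int: "integrable Z (\<lambda>z. cmod (f (\<Psi> z) - f (\<Theta> (\<lambda>g\<in>W. c (z g)))))"
    using le fm wm by (intro Z.integrable_const_bound[where B = "2 * B"]) auto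
  obtain y0 where "y0 \<in> topspace Y" using Y_nonempty by blast
  then have B0: "B \<ge> 0" using B[of y0] norm_ge_zero[of "f y0"] by linarith
  have "(\<integral>z. cmod (f (\<Psi> z) - f (\<Theta> (\<lambda>g\<in>W. c (z g)))) \<partial>Z) \<le> (\<integral>z. \<epsilon> + 2 * B * indicator E z \<partial>Z)"
  proof (rule integral_mono[OF int])
    show "integrable Z (\<lambda>z. \<epsilon> + 2 * B * indicator E z)"
      using E by (intro Bochner_Integration.integrable_add integrable_mult_right integrable_real_indicator) (auto simp: Z.emeasure_eq_measure)
    fix z assume z: "z \<in> space Z"
    show "cmod (f (\<Psi> z) - f (\<Theta> (\<lambda>g\<in>W. c (z g)))) \<le> \<epsilon> + 2 * B * indicator E z"
    proof (cases "z \<in> E")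
      case True
      then show ?thesis using le[OF z] \<epsilon> by simp
    next
      case False
      then have "cmod (f (\<Psi> z) - f (\<Theta> (\<lambda>g\<in>W. c (z g)))) < \<epsilon>"
        using f z unfolding E_def by (auto simp: not_le)
      then show ?thesis using False by simp
    qed
  qed
  also have "\<dots> = \<epsilon> + 2 * B * measure Z E"
    using E by (subst Bochner_Integration.integral_add) (auto simp: Z.prob_space Z.emeasure_eq_measure)
  also have "\<dots> \<le> \<epsilon> + 2 * B * \<eta>"
    using err B0 unfolding E_def by (intro add_left_mono mult_left_mono) auto
  finally show "(\<integral>z. cmod (f (\<Psi> z) - f (\<Theta> (\<lambda>g\<in>W. c (z g)))) \<partial>Z) \<le> \<epsilon> + 2 * B * \<eta>" .
qed

end

context bernoulli_model
begin

abbreviation shift :: "'g \<Rightarrow> ('g \<Rightarrow> 'a) \<Rightarrow> 'g \<Rightarrow> 'a" where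
  "shift s z \<equiv> (\<lambda>h\<in>carrier G. z (s \<otimes> h))"

lemma shift_measurable: "s \<in> carrier G \<Longrightarrow> shift s \<in> Z \<rightarrow>\<^sub>M Z"
  by (intro measurable_restrict measurable_component_singleton) auto

lemma shift_distr:
  assumes "s \<in> carrier G"
  shows "distr Z Z (shift s) = Z"
  using distr_PiM_reindex[of "carrier G" "\<lambda>_. \<mu>" "\<lambda>h. s \<otimes> h" "carrier G"] prob_\<mu> assms
  by (simp add: inj_on_def Pi_iff)

lemma integral_shift:
  fixes f :: "('g \<Rightarrow> 'a) \<Rightarrow> real"
  assumes "s \<in> carrier G" "f \<in> borel_measurable Z"
  shows "(\<integral>z. f (shift s z) \<partial>Z) = (\<integral>z. f z \<partial>Z)"
  using integral_distr[OF shift_measurable[OF assms(1)] assms(2)] unfolding shift_distr[OF assms(1)] by simp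

lemma coordinate_distr: "distr Z \<mu> (\<lambda>z. z \<one>) = \<mu>"
  using distr_PiM_component[of "carrier G" "\<lambda>_. \<mu>" \<one>] prob_\<mu> by simp

text \<open>Entropy as the mean of the information -ln p(letter). The information is thereby one
  more test function, and the law of large numbers for it yields the typical size of word
  probabilities.\<close>

lemma integral_log_code_prob:
  assumes c: "finite_code \<mu> c"
  shows "(\<integral>z. - ln (code_prob \<mu> c (c (z \<one>))) \<partial>Z) = code_entropy \<mu> c"
proof -
  have cm: "c \<in> \<mu> \<rightarrow>\<^sub>M count_space UNIV" and fin: "finite (c ` space \<mu>)" using c by (auto simp: finite_code_def)
  have comp: "(\<lambda>z. z \<one>) \<in> Z \<rightarrow>\<^sub>M \<mu>" by (intro measurable_component_singleton) auto
  have m: "(\<lambda>x. - ln (code_prob \<mu> c (c x))) \<in> borel_measurable \<mu>"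
    using measurable_compose[OF cm, of "\<lambda>j. - ln (code_prob \<mu> c j)" borel] by simp
  have "(\<integral>z. - ln (code_prob \<mu> c (c (z \<one>))) \<partial>Z) = (\<integral>x. - ln (code_prob \<mu> c (c x)) \<partial>\<mu>)"
    using integral_distr[OF comp m] unfolding coordinate_distr by simp
  also have "\<dots> = (\<integral>x. (\<Sum>j\<in>c ` space \<mu>. - ln (code_prob \<mu> c j) * indicator {x \<in> space \<mu>. c x = j} x) \<partial>\<mu>)"
  proof (rule Bochner_Integration.integral_cong[OF refl])
    fix x assume x: "x \<in> space \<mu>"
    have "(\<Sum>j\<in>c ` space \<mu>. - ln (code_prob \<mu> c j) * indicator {x \<in> space \<mu>. c x = j} x)
        = (\<Sum>j\<in>c ` space \<mu>. if j = c x then - ln (code_prob \<mu> c j) else 0)"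
      using x by (intro sum.cong) auto
    also have "\<dots> = - ln (code_prob \<mu> c (c x))" using x fin by (simp add: sum.delta)
    finally show "- ln (code_prob \<mu> c (c x)) = (\<Sum>j\<in>c ` space \<mu>. - ln (code_prob \<mu> c j) * indicator {x \<in> space \<mu>. c x = j} x)" ..
  qed
  also have "\<dots> = (\<Sum>j\<in>c ` space \<mu>. \<integral>x. - ln (code_prob \<mu> c j) * indicator {x \<in> space \<mu>. c x = j} x \<partial>\<mu>)"
    using finite_code_sets[OF c]
    by (intro Bochner_Integration.integral_sum integrable_mult_right integrable_real_indicator) (auto simp: \<mu>.emeasure_eq_measure)
  also have "\<dots> = (\<Sum>j\<in>c ` space \<mu>. - ln (code_prob \<mu> c j) * code_prob \<mu> c j)"
    using finite_code_sets[OF c] by (simp add: code_prob_def Int_def cong: conj_cong)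
  also have "\<dots> = code_entropy \<mu> c" by (simp add: code_entropy_def sum_negf mult.commute)
  finally show ?thesis .
qed

text \<open>Used for s = \<one>, where \<open>T i \<one>\<close> need not be the identity; being a
  permutation of the sites, it still leaves the letters independent with the law of the
  base.\<close>

lemma prob_word:
  assumes c: "finite_code \<mu> c" and s: "s \<in> carrier G"
  shows "measure (PiM {1..d i} (\<lambda>_. \<mu>)) {u \<in> space (PiM {1..d i} (\<lambda>_. \<mu>)). \<forall>k\<in>{1..d i}. c (u (T i s k)) = w k}
     = (\<Prod>k\<in>{1..d i}. code_prob \<mu> c (w k))"
    and "{u \<in> space (PiM {1..d i} (\<lambda>_. \<mu>)). \<forall>k\<in>{1..d i}. c (u (T i s k)) = w k} \<in> sets (PiM {1..d i} (\<lambda>_. \<mu>))"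
proof -
  interpret finite_product_prob_space "\<lambda>_. \<mu>" "{1..d i}" by unfold_locales simp
  let ?A = "\<lambda>l. {x \<in> space \<mu>. c x = w (\<sigma> i s l)}"
  have eq: "{u \<in> space (PiM {1..d i} (\<lambda>_. \<mu>)). \<forall>k\<in>{1..d i}. c (u (T i s k)) = w k} = PiE {1..d i} ?A"
  proof (intro equalityI subsetI)
    fix u assume u: "u \<in> {u \<in> space (PiM {1..d i} (\<lambda>_. \<mu>)). \<forall>k\<in>{1..d i}. c (u (T i s k)) = w k}"
    have "c (u l) = w (\<sigma> i s l)" if l: "l \<in> {1..d i}" for l
    proof -
      have "c (u (T i s (\<sigma> i s l))) = w (\<sigma> i s l)" using u sigma_in[OF s l] by blast
      then show ?thesis using s l by simp
    qed
    then show "u \<in> PiE {1..d i} ?A" using u by (auto simp: space_PiM PiE_iff)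
  next
    fix u assume u: "u \<in> PiE {1..d i} ?A"
    have "c (u (T i s k)) = w k" if k: "k \<in> {1..d i}" for k
    proof -
      have "c (u (T i s k)) = w (\<sigma> i s (T i s k))" using u T_in[OF s k] by (auto simp: PiE_iff)
      then show ?thesis using s k by simp
    qed
    then show "u \<in> {u \<in> space (PiM {1..d i} (\<lambda>_. \<mu>)). \<forall>k\<in>{1..d i}. c (u (T i s k)) = w k}"
      using u by (auto simp: space_PiM PiE_iff)
  qed
  have A: "?A l \<in> sets \<mu>" for l by (rule finite_code_sets[OF c])
  show "{u \<in> space (PiM {1..d i} (\<lambda>_. \<mu>)). \<forall>k\<in>{1..d i}. c (u (T i s k)) = w k} \<in> sets (PiM {1..d i} (\<lambda>_. \<mu>))"
    unfolding eq using A by (intro sets_PiM_I_finite) auto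
  have "measure (PiM {1..d i} (\<lambda>_. \<mu>)) (PiE {1..d i} ?A) = (\<Prod>l\<in>{1..d i}. measure \<mu> (?A l))"
    using A by (intro finite_measure_PiM_emb) auto
  also have "\<dots> = (\<Prod>l\<in>{1..d i}. code_prob \<mu> c (w (\<sigma> i s l)))" by (simp add: code_prob_def)
  also have "\<dots> = (\<Prod>k\<in>{1..d i}. code_prob \<mu> c (w k))"
    using prod.reindex_bij_betw[OF permutes_imp_bij[OF sigma_permutes[OF s]], of "\<lambda>k. code_prob \<mu> c (w k)" i] by simp
  finally show "measure (PiM {1..d i} (\<lambda>_. \<mu>)) {u \<in> space (PiM {1..d i} (\<lambda>_. \<mu>)). \<forall>k\<in>{1..d i}. c (u (T i s k)) = w k}
     = (\<Prod>k\<in>{1..d i}. code_prob \<mu> c (w k))" unfolding eq .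
qed

text \<open>Microstates are produced from words \<open>u\<close> with independent letters by letting the point at \<open>k\<close>
  be \<open>\<Theta>\<close> of the window of \<open>u\<close> around \<open>k\<close>. The typical letters \<open>c0 (u (T i \<one> k))\<close> are then read off
  from the functions \<open>\<xi>\<close>.\<close>

lemma random_microstates:
  assumes c0: "finite_code \<mu> c0" and F: "finite F" "F \<subseteq> carrier G" and \<delta>: "\<delta> > 0" and t: "t > 0"
    and \<xi>: "\<And>j. continuous_map Y euclideanreal (\<xi> j)"
    and \<xi>_err: "\<And>j. measure N {y \<in> space N. \<bar>\<xi> j y - (if j = c0 (\<Phi> y \<one>) then 1 else 0)\<bar> \<ge> 1/4} \<le> \<kappa>"
    and \<theta>: "real (card (c0 ` space \<mu>)) * \<kappa> < \<theta>"
  shows "\<forall>\<^sub>F i in sequentially. \<exists>B. B \<subseteq> PiE {1..d i} (\<lambda>_. c0 ` space \<mu>) \<and>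
    exp (real (d i) * (code_entropy \<mu> c0 - t)) / 2 \<le> real (card B) \<and>
    (\<forall>w\<in>B. \<exists>y\<in>microstates F m \<delta> i. real (card {k\<in>{1..d i}. \<exists>j\<in>c0 ` space \<mu>.
       \<bar>\<xi> j (y k) - (if j = w k then 1 else 0)\<bar> \<ge> 1/3}) \<le> \<theta> * real (d i))"
proof -
  define R where "R = c0 ` space \<mu>"
  have R: "finite R" using c0 by (simp add: R_def finite_code_def)
  \<comment> \<open>The functions that \<open>\<Theta>\<close> has to reproduce: products for
    condition (i), translates and \<open>P\<close> itself for condition (ii), and the stand-ins
    \<open>\<xi> j\<close> for reading the letters.\<close>
  define Q where "Q = product_set G Y b P F m \<union> (\<lambda>(s, p). translate G Y b s p) ` (F \<times> P) \<union> P
    \<union> (\<lambda>j. \<lambda>y\<in>topspace Y. complex_of_real (\<xi> j y)) ` R"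
  have Q: "finite Q" "Q \<subseteq> cfun Y"
  proof -
    show "finite Q" unfolding Q_def using finite_product_set[OF F(1)] F(1) finite_P R by blast
    have "translate G Y b s p \<in> cfun Y" if "s \<in> F" "p \<in> P" for s p
      using translate_in P_cfun that F by blast
    then show "Q \<subseteq> cfun Y"
      unfolding Q_def using product_set_cfun[OF F(2)] P_cfun complex_of_real_cfun[OF \<xi>] by auto
  qed
  obtain B where B: "B > 0" "\<And>f y. f \<in> Q \<Longrightarrow> y \<in> topspace Y \<Longrightarrow> cmod (f y) \<le> B"
  proof -
    have "\<exists>B. \<forall>y\<in>topspace Y. cmod (f y) \<le> B" if "f \<in> Q" for f
    proof -
      have "f \<in> cfun Y" using Q(2) that by blast
      then show ?thesis using cfun_bounded[OF compact_Y] by metis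
    qed
    then have "\<forall>f\<in>Q. \<exists>B. \<forall>y\<in>topspace Y. cmod (f y) \<le> B" by blast
    from bchoice[OF this] obtain \<beta> where \<beta>: "\<forall>f\<in>Q. \<forall>y\<in>topspace Y. cmod (f y) \<le> \<beta> f" ..
    show ?thesis
    proof (rule that[of "1 + (\<Sum>f\<in>Q. \<bar>\<beta> f\<bar>)"])
      show "0 < 1 + (\<Sum>f\<in>Q. \<bar>\<beta> f\<bar>)" by (intro add_pos_nonneg sum_nonneg) auto
      fix f y assume f: "f \<in> Q" and y: "y \<in> topspace Y"
      have "cmod (f y) \<le> \<beta> f" using \<beta> f y by blast
      also have "\<beta> f \<le> \<bar>\<beta> f\<bar>" by simp
      also have "\<dots> \<le> (\<Sum>f\<in>Q. \<bar>\<beta> f\<bar>)" using Q(1) f by (intro member_le_sum) auto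
      finally show "cmod (f y) \<le> 1 + (\<Sum>f\<in>Q. \<bar>\<beta> f\<bar>)" by simp
    qed
  qed
  \<comment> \<open>1/12 is the room between 1/4 and 1/3 in reading letters; \<delta>/4 serves
    condition (i); \<delta>^2/16 serves condition (ii), whose expected squared defect is at most 4
    \<zeta>. In \<open>\<eta>\<close> the first entry makes the mean coding error at most \<zeta>,
    the second fits the coding error into half of the slack \<open>gap\<close>; \<open>e\<close>
    leaves the other half to the random fluctuation.\<close>
  define \<zeta> where "\<zeta> = min (1/12) (min (\<delta> / 4) (\<delta>\<^sup>2 / 16))"
  define gap where "gap = \<theta> - real (card R) * \<kappa>"
  have gap: "gap > 0" using \<theta> by (simp add: gap_def R_def)
  define \<eta> where "\<eta> = min (\<zeta> / (4 * B)) (gap / 2)"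
  define e where "e = min (min (\<delta> / 4) (\<delta>\<^sup>2 / 4)) (min (gap / 2) t)"
  have \<zeta>: "\<zeta> > 0" "\<zeta> \<le> 1/12" "\<zeta> \<le> \<delta> / 4" "\<zeta> \<le> \<delta>\<^sup>2 / 16" using \<delta> by (auto simp: \<zeta>_def)
  have \<eta>: "\<eta> > 0" "\<eta> \<le> gap / 2" "\<eta> \<le> \<zeta> / (4 * B)" using \<zeta> B gap by (auto simp: \<eta>_def)
  have e: "e > 0" "e \<le> \<delta> / 4" "e \<le> \<delta>\<^sup>2 / 4" "e \<le> gap / 2" "e \<le> t" using \<delta> gap t by (auto simp: e_def)
  have \<zeta>\<eta>: "\<zeta> / 2 + 2 * B * \<eta> \<le> \<zeta>"
  proof -
    have "2 * B * \<eta> \<le> 2 * B * (\<zeta> / (4 * B))" using \<eta> B by (intro mult_left_mono) auto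
    also have "\<dots> = \<zeta> / 2" using B by simp
    finally show ?thesis by simp
  qed
  obtain c a W \<Theta> where c: "finite_code \<mu> c" and a': "\<And>x. c0 x = a (c x)" and W: "finite W" "W \<subseteq> carrier G"
    and \<Theta>: "\<And>w. \<Theta> w \<in> topspace Y"
    and err: "measure Z {z \<in> space Z. \<exists>f\<in>Q. cmod (f (\<Psi> z) - f (\<Theta> (\<lambda>g\<in>W. c (z g)))) \<ge> \<zeta> / 2} < \<eta>"
    by (rule coding[OF Q half_gt_zero[OF \<zeta>(1)] \<eta>(1) c0]) (rule that; assumption)
  \<comment> \<open>The window is enlarged so that a single word determines the point at k, the
    point intended at T_s k for s in F, and the letter at the unit.\<close>
  define U where "U = insert \<one> (W \<union> (\<Union>s\<in>F. (\<lambda>g. s \<otimes> g) ` W))"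
  have U: "finite U" "U \<subseteq> carrier G" "W \<subseteq> U" "\<one> \<in> U" "\<And>s g. s \<in> F \<Longrightarrow> g \<in> W \<Longrightarrow> s \<otimes> g \<in> U"
    using W F by (auto simp: U_def)
  define pt where "pt v = \<Theta> (restrict v W)" for v
  define pt' where "pt' s v = \<Theta> (\<lambda>g\<in>W. v (s \<otimes> g))" for s v
  define word where "word z = (\<lambda>g\<in>U. c (z g))" for z :: "'g \<Rightarrow> 'a"
  have pt_word: "pt (word z) = \<Theta> (\<lambda>g\<in>W. c (z g))" for z
    unfolding pt_def word_def using U(3) by (intro arg_cong[where f = \<Theta>] ext) auto
  have pt'_word: "pt' s (word z) = \<Theta> (\<lambda>g\<in>W. c (z (s \<otimes> g)))" if "s \<in> F" for s z
    unfolding pt'_def word_def using U(5)[OF that] by (intro arg_cong[where f = \<Theta>] ext) auto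
  have err_int: "integrable Z (\<lambda>z. cmod (f (\<Psi> z) - f (pt (word z))))"
    "(\<integral>z. cmod (f (\<Psi> z) - f (pt (word z))) \<partial>Z) \<le> \<zeta>" if f: "f \<in> Q" for f
  proof -
    note ci = coding_integral[OF c W \<Theta> Q f B(2)[OF f] half_gt_zero[OF \<zeta>(1)] err]
    show "integrable Z (\<lambda>z. cmod (f (\<Psi> z) - f (pt (word z))))" unfolding pt_word by (rule ci(1))
    show "(\<integral>z. cmod (f (\<Psi> z) - f (pt (word z))) \<partial>Z) \<le> \<zeta>"
      unfolding pt_word using ci(2) \<zeta>\<eta> by linarith
  qed
  \<comment> \<open>Four kinds of tests: H1 for condition (i), H2 for the squared defect of
    equivariance, H3 for misread letters, H4 for the information of the letter.\<close>
  define H1 where "H1 f v = Re (f (pt v))" for f v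
  define H2 where "H2 s p v = (cmod (p (C s (pt v)) - p (pt' s v)))\<^sup>2" for s p v
  define H3 where "H3 v = (if \<exists>j\<in>R. \<bar>\<xi> j (pt v) - (if j = a (v \<one>) then 1 else 0)\<bar> \<ge> 1/3 then 1 else 0 :: real)" for v
  define H4 where "H4 v = - ln (code_prob \<mu> c0 (a (v \<one>)))" for v
  define \<H> where "\<H> = H1 ` product_set G Y b P F m \<union> (\<lambda>(s, p). H2 s p) ` (F \<times> P) \<union> {H3, H4}"
  have fin\<H>: "finite \<H>" unfolding \<H>_def using finite_product_set[OF F(1)] F(1) finite_P by blast
  have int: "integrable Z (\<lambda>z. h (word z))" for h :: "_ \<Rightarrow> real"
    unfolding word_def by (rule word_integrable[OF c U(1,2)])
  have pt_in: "pt v \<in> topspace Y" "pt' s v \<in> topspace Y" for v s by (auto simp: pt_def pt'_def \<Theta>)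
  have I1: "\<bar>(\<integral>z. H1 f (word z) \<partial>Z) - (\<integral>y. Re (f y) \<partial>N)\<bar> \<le> \<delta> / 4" if f: "f \<in> product_set G Y b P F m" for f
  proof -
    have fQ: "f \<in> Q" and fc: "f \<in> cfun Y" using f Q(2) by (auto simp: Q_def)
    have fi: "integrable N f" by (rule cfun_integrable[OF fc])
    have rm: "(\<lambda>y. Re (f y)) \<in> borel_measurable N" using fi by simp
    have ri: "integrable Z (\<lambda>z. Re (f (\<Psi> z)))"
      using integrable_distr[OF \<Psi>_measurable, of "\<lambda>y. Re (f y)"] fi unfolding \<Psi>_distr by simp
    have "(\<integral>z. H1 f (word z) \<partial>Z) - (\<integral>y. Re (f y) \<partial>N) = (\<integral>z. H1 f (word z) - Re (f (\<Psi> z)) \<partial>Z)"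
      unfolding \<Psi>_push[OF rm, symmetric] using int ri by simp
    also have "\<bar>\<dots>\<bar> \<le> (\<integral>z. \<bar>H1 f (word z) - Re (f (\<Psi> z))\<bar> \<partial>Z)" by (rule integral_abs_bound)
    also have "\<dots> \<le> (\<integral>z. cmod (f (\<Psi> z) - f (pt (word z))) \<partial>Z)"
    proof (rule integral_mono)
      show "integrable Z (\<lambda>z. \<bar>H1 f (word z) - Re (f (\<Psi> z))\<bar>)" using int ri by simp
      show "\<bar>H1 f (word z) - Re (f (\<Psi> z))\<bar> \<le> cmod (f (\<Psi> z) - f (pt (word z)))" for z
        using abs_Re_le_cmod[of "f (\<Psi> z) - f (pt (word z))"] by (simp add: H1_def abs_minus_commute)
    qed (rule err_int[OF fQ])
    finally show ?thesis using err_int(2)[OF fQ] \<zeta> by linarith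
  qed
  have I2: "(\<integral>z. H2 s p (word z) \<partial>Z) \<le> \<delta>\<^sup>2 / 4" if s: "s \<in> F" and p: "p \<in> P" for s p
  proof -
    have sG: "s \<in> carrier G" using s F by blast
    let ?f = "translate G Y b s p"
    have fQ: "?f \<in> Q" "p \<in> Q" using s p by (auto simp: Q_def)
    let ?D = "\<lambda>f z. cmod (f (\<Psi> z) - f (pt (word z)))"
    have Dm: "?D p \<in> borel_measurable Z" using err_int(1)[OF fQ(2)] by (rule borel_measurable_integrable)
    have Di: "integrable Z (\<lambda>z. ?D p (shift s z))"
      using integrable_distr[OF shift_measurable[OF sG], of "?D p"] err_int(1)[OF fQ(2)]
      unfolding shift_distr[OF sG] by simp
    \<comment> \<open>By equivariance of \<Psi> the defect is a difference of two coding errors,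
      that of the translate at z and that of p at the shifted point. The defect is at most 2, so its
      square is at most twice its size.\<close>
    have ae: "AE z in Z. H2 s p (word z) \<le> 2 * (?D ?f z + ?D p (shift s z))"
      using \<Psi>_equivariant[OF sG] AE_space
    proof eventually_elim
      case (elim z)
      have "pt (word (shift s z)) = pt' s (word z)"
        unfolding pt_word pt'_word[OF s] using W by (intro arg_cong[where f = \<Theta>] ext) auto
      moreover have "?f (\<Psi> z) = p (C s (\<Psi> z))" "?f (pt (word z)) = p (C s (pt (word z)))"
        using \<Psi>_in elim(2) pt_in by (auto simp: translate_apply)
      ultimately have "p (C s (pt (word z))) - p (pt' s (word z))
          = (p (\<Psi> (shift s z)) - p (pt (word (shift s z)))) - (?f (\<Psi> z) - ?f (pt (word z)))"
        using elim(1) by simp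
      then have le: "cmod (p (C s (pt (word z))) - p (pt' s (word z))) \<le> ?D ?f z + ?D p (shift s z)"
        by (metis add.commute norm_triangle_ineq4)
      have "cmod (p (C s (pt (word z))) - p (pt' s (word z))) \<le> 2"
        using norm_triangle_ineq4[of "p (C s (pt (word z)))" "p (pt' s (word z))"]
          P_le_one[OF p C_in[OF sG pt_in(1)[of "word z"]]] P_le_one[OF p pt_in(2)[of s "word z"]] by linarith
      then have "H2 s p (word z) \<le> 2 * cmod (p (C s (pt (word z))) - p (pt' s (word z)))"
        unfolding H2_def power2_eq_square by (intro mult_right_mono) auto
      then show ?case by (rule order_trans) (rule mult_left_mono[OF le], simp)
    qed
    have "(\<integral>z. H2 s p (word z) \<partial>Z) \<le> (\<integral>z. 2 * (?D ?f z + ?D p (shift s z)) \<partial>Z)"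
      using int ae err_int(1)[OF fQ(1)] Di by (intro integral_mono_AE) auto
    also have "\<dots> = 2 * ((\<integral>z. ?D ?f z \<partial>Z) + (\<integral>z. ?D p (shift s z) \<partial>Z))"
      using err_int(1)[OF fQ(1)] Di by simp
    also have "(\<integral>z. ?D p (shift s z) \<partial>Z) = (\<integral>z. ?D p z \<partial>Z)" by (rule integral_shift[OF sG Dm])
    finally show ?thesis using err_int(2)[OF fQ(1)] err_int(2)[OF fQ(2)] \<zeta>(4) by argo
  qed
  have I3: "(\<integral>z. H3 (word z) \<partial>Z) \<le> \<theta> - gap / 2"
  proof -
    define X where "X j = {y \<in> space N. \<bar>\<xi> j y - (if j = c0 (\<Phi> y \<one>) then 1 else 0)\<bar> \<ge> 1/4}" for j
    define E where "E = {z \<in> space Z. \<exists>f\<in>Q. cmod (f (\<Psi> z) - f (\<Theta> (\<lambda>g\<in>W. c (z g)))) \<ge> \<zeta> / 2}"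
    have E: "E \<in> sets Z" unfolding E_def by (rule coding_error_sets[OF c W \<Theta> Q])
    have EN: "{y \<in> space N. \<Phi> y \<in> E} \<in> sets N"
      using measurable_sets[OF \<Phi>_measurable E] by (simp add: vimage_def Int_def conj_commute)
    have XN: "X j \<in> sets N" for j
    proof -
      have "X j = {y \<in> space N. \<bar>\<xi> j y - indicator {y \<in> space N. c0 (\<Phi> y \<one>) = j} y\<bar> \<ge> 1/4}"
        by (auto simp: X_def indicator_def)
      also have "\<dots> \<in> sets N"
        using borel_measurable_continuous_map[OF \<xi> sets_N, of j] code_letter(1)[OF c0, of j] by measurable
      \<comment> \<open>Membership in \<open>X j\<close> is measurable because the letter of the
        unit coordinate defines a measurable set in \<open>N\<close>.\<close>
      finally show ?thesis .
    qed
    define L where "L = {z \<in> space Z. H3 (word z) = 1}"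
    have Hm: "(\<lambda>z. H3 (word z)) \<in> borel_measurable Z" using int by (rule borel_measurable_integrable)
    have L: "L \<in> sets Z" unfolding L_def using Hm by measurable
    have "(\<integral>z. H3 (word z) \<partial>Z) = (\<integral>z. indicator L z \<partial>Z)"
      by (rule Bochner_Integration.integral_cong) (auto simp: L_def H3_def indicator_def)
    also have "\<dots> = measure Z L" using L by simp
    also have "\<dots> = measure N {y \<in> space N. \<Phi> y \<in> L}" by (rule measure_\<Phi>_vimage[OF L, symmetric])
    also have "\<dots> \<le> measure N ({y \<in> space N. \<Phi> y \<in> E} \<union> (\<Union>j\<in>R. X j))"
    proof (rule N.finite_measure_mono_AE)
      show "AE y in N. y \<in> {y \<in> space N. \<Phi> y \<in> L} \<longrightarrow> y \<in> {y \<in> space N. \<Phi> y \<in> E} \<union> (\<Union>j\<in>R. X j)"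
        using \<Psi>_\<Phi>
      proof eventually_elim
        case (elim y)
        show ?case
        proof (rule impI, rule ccontr)
          assume y: "y \<in> {y \<in> space N. \<Phi> y \<in> L}" and n: "y \<notin> {y \<in> space N. \<Phi> y \<in> E} \<union> (\<Union>j\<in>R. X j)"
          have yY: "y \<in> topspace Y" "\<Phi> y \<in> space Z" using y \<Phi>_in by (auto simp: space_N)
          have "H3 (word (\<Phi> y)) = 1" using y by (simp add: L_def)
          then obtain j where j: "j \<in> R" "\<bar>\<xi> j (pt (word (\<Phi> y))) - (if j = a (word (\<Phi> y) \<one>) then 1 else 0)\<bar> \<ge> 1/3"
            unfolding H3_def by (metis zero_neq_one)
          have w: "a (word (\<Phi> y) \<one>) = c0 (\<Phi> y \<one>)" using U(4) by (simp add: word_def a')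
          let ?f = "\<lambda>y\<in>topspace Y. complex_of_real (\<xi> j y)"
          have "?f \<in> Q" using j by (auto simp: Q_def)
          then have "cmod (?f (\<Psi> (\<Phi> y)) - ?f (\<Theta> (\<lambda>g\<in>W. c (\<Phi> y g)))) < \<zeta> / 2"
            using n y yY unfolding E_def by (auto simp: not_le)
          then have "\<bar>\<xi> j y - \<xi> j (pt (word (\<Phi> y)))\<bar> < \<zeta> / 2"
            using elim yY(1) \<Theta> by (simp add: pt_word flip: of_real_diff)
          moreover have "\<bar>\<xi> j y - (if j = c0 (\<Phi> y \<one>) then 1 else 0)\<bar> < 1/4"
            using n j(1) y by (auto simp: X_def not_le)
          ultimately show False using j(2) \<zeta>(2) unfolding w by linarith
        qed
      qed
      show "{y \<in> space N. \<Phi> y \<in> E} \<union> (\<Union>j\<in>R. X j) \<in> sets N"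
        by (intro sets.Un EN sets.finite_UN R XN)
    qed
    also have "\<dots> \<le> measure N {y \<in> space N. \<Phi> y \<in> E} + measure N (\<Union>j\<in>R. X j)"
      by (intro measure_Un_le EN sets.finite_UN R XN)
    also have "measure N {y \<in> space N. \<Phi> y \<in> E} = measure Z E" by (rule measure_\<Phi>_vimage[OF E])
    also have "measure N (\<Union>j\<in>R. X j) \<le> (\<Sum>j\<in>R. measure N (X j))"
      using XN by (intro N.finite_measure_subadditive_finite R) blast
    also have "\<dots> \<le> (\<Sum>j\<in>R. \<kappa>)" using \<xi>_err unfolding X_def by (intro sum_mono)
    finally have "(\<integral>z. H3 (word z) \<partial>Z) \<le> measure Z E + real (card R) * \<kappa>" by simp
    then show ?thesis using err \<eta>(2) unfolding E_def gap_def by argo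
  qed
  have I4: "(\<integral>z. H4 (word z) \<partial>Z) = code_entropy \<mu> c0"
    unfolding integral_log_code_prob[OF c0, symmetric] H4_def word_def using U(4) by (simp add: a')
  have evT: "\<forall>\<^sub>F i in sequentially. \<forall>s\<in>F.
      (\<Sum>g\<in>W. real (card {k\<in>{1..d i}. T i (s \<otimes> g) k \<noteq> T i g (T i s k)}) / real (d i)) < \<delta>\<^sup>2 / 16"
  proof (intro eventually_ball_finite F(1) ballI)
    fix s assume s: "s \<in> F"
    have "(\<lambda>i. \<Sum>g\<in>W. real (card {k\<in>{1..d i}. T i (s \<otimes> g) k \<noteq> T i g (T i s k)}) / real (d i)) \<longlonglongrightarrow> 0"
      using s F W by (intro tendsto_null_sum T_mult_frac) auto
    then show "\<forall>\<^sub>F i in sequentially.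
      (\<Sum>g\<in>W. real (card {k\<in>{1..d i}. T i (s \<otimes> g) k \<noteq> T i g (T i s k)}) / real (d i)) < \<delta>\<^sup>2 / 16"
      by (rule order_tendstoD) (use \<delta> in simp)
  qed
  have evA: "\<forall>\<^sub>F i in sequentially. \<exists>A\<in>sets (PiM {1..d i} (\<lambda>_. \<mu>)). measure (PiM {1..d i} (\<lambda>_. \<mu>)) A \<ge> 1/2 \<and>
    (\<forall>u\<in>A. \<forall>h\<in>\<H>. \<bar>(\<Sum>k=1..d i. h (\<lambda>g\<in>U. c (u (T i g k)))) / real (d i) - (\<integral>z. h (word z) \<partial>Z)\<bar> < e)"
    unfolding word_def by (rule window_words_eventually[OF c U(1,2) fin\<H> e(1)])
  show ?thesis
    unfolding R_def[symmetric]
    using evT evA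
  proof eventually_elim
    case (elim i)
    define n where "n = d i"
    have n: "n > 0" using d_pos by (simp add: n_def)
    define M where "M = PiM {1..n} (\<lambda>_. \<mu>)"
    interpret M: prob_space M unfolding M_def by (intro prob_space_PiM prob_\<mu>)
    obtain A where A: "A \<in> sets M" "measure M A \<ge> 1/2"
      and test: "\<forall>u\<in>A. \<forall>h\<in>\<H>. \<bar>(\<Sum>k=1..n. h (\<lambda>g\<in>U. c (u (T i g k)))) / real n - (\<integral>z. h (word z) \<partial>Z)\<bar> < e"
      using elim(2) unfolding M_def n_def by blast
    define v where "v u k = (\<lambda>g\<in>U. c (u (T i g k)))" for u :: "nat \<Rightarrow> 'a" and k
    define y where "y u k = pt (v u k)" for u k
    define wd where "wd u = (\<lambda>k\<in>{1..n}. c0 (u (T i \<one> k)))" for u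
    have a_v: "a (v u k \<one>) = c0 (u (T i \<one> k))" for u k using U(4) by (simp add: v_def a')
    have wd_R: "wd u \<in> PiE {1..n} (\<lambda>_. R)" if u: "u \<in> A" for u
    proof -
      have us: "u \<in> space M" using u sets.sets_into_space[OF A(1)] by blast
      have "c0 (u (T i \<one> k)) \<in> R" if k: "k \<in> {1..n}" for k
      proof -
        have "T i \<one> k \<in> {1..n}" using T_in[of \<one> k i] k unfolding n_def by blast
        then have "u (T i \<one> k) \<in> space \<mu>" using us by (auto simp: M_def space_PiM PiE_iff)
        then show ?thesis by (simp add: R_def)
      qed
      then show ?thesis unfolding wd_def by auto
    qed
    define B where "B = wd ` A"
    have BP: "B \<subseteq> PiE {1..n} (\<lambda>_. R)" using wd_R by (auto simp: B_def)
    have finB: "finite B" using BP R by (intro finite_subset[OF BP] finite_PiE) auto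
    define K where "K w = {u \<in> space M. \<forall>k\<in>{1..n}. c0 (u (T i \<one> k)) = w k}" for w
    have K: "K w \<in> sets M" "measure M (K w) = (\<Prod>k\<in>{1..n}. code_prob \<mu> c0 (w k))" for w
      using prob_word[OF c0 one_closed, of i w] unfolding K_def M_def n_def by blast+
    \<comment> \<open>Words passing the test H4 have probability at most exp(-n (h - t)) each. Their
      cylinders cover a set of measure at least 1/2, so there must be at least exp(n (h - t)) / 2 of
      them.\<close>
    have Kw: "measure M (K w) \<le> exp (- (real n * (code_entropy \<mu> c0 - t)))" if w: "w \<in> B" for w
    proof -
      obtain u where u: "u \<in> A" "w = wd u" using w by (auto simp: B_def)
      have H4: "H4 \<in> \<H>" by (simp add: \<H>_def)
      have "(\<Sum>k=1..n. H4 (v u k)) = (\<Sum>k=1..n. - ln (code_prob \<mu> c0 (w k)))"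
        unfolding H4_def a_v u(2) wd_def by (intro sum.cong) auto
      then have "\<bar>(\<Sum>k=1..n. - ln (code_prob \<mu> c0 (w k))) / real n - code_entropy \<mu> c0\<bar> < e"
        using bspec[OF bspec[OF test u(1)] H4] unfolding I4 v_def by simp
      then have "code_entropy \<mu> c0 - t < (\<Sum>k=1..n. - ln (code_prob \<mu> c0 (w k))) / real n"
        using e(5) unfolding abs_diff_less_iff by argo
      then have lt: "real n * (code_entropy \<mu> c0 - t) < (\<Sum>k=1..n. - ln (code_prob \<mu> c0 (w k)))"
        using n by (simp add: less_divide_eq mult.commute)
      show ?thesis
      proof (cases "\<forall>k\<in>{1..n}. code_prob \<mu> c0 (w k) > 0")
        case True
        have "(\<Prod>k\<in>{1..n}. code_prob \<mu> c0 (w k)) = (\<Prod>k\<in>{1..n}. exp (ln (code_prob \<mu> c0 (w k))))"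
          using True by (intro prod.cong) auto
        also have "\<dots> = exp (\<Sum>k=1..n. ln (code_prob \<mu> c0 (w k)))" by (simp add: exp_sum)
        also have "\<dots> \<le> exp (- (real n * (code_entropy \<mu> c0 - t)))"
          using lt by (simp add: sum_negf)
        finally show ?thesis unfolding K(2) .
      next
        \<comment> \<open>Since \<open>ln 0 = 0\<close> in HOL, the sum of logarithms says nothing
          about a word containing a letter of probability 0; its probability is 0 anyway.\<close>
        case False
        then obtain k where "k \<in> {1..n}" "\<not> 0 < code_prob \<mu> c0 (w k)" by blast
        then have "k \<in> {1..n}" "code_prob \<mu> c0 (w k) = 0"
          by (simp_all add: code_prob_def zero_less_measure_iff)
        then have p0: "(\<Prod>k\<in>{1..n}. code_prob \<mu> c0 (w k)) = 0" by (intro prod_zero) auto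
        show ?thesis unfolding K(2) p0 by (rule exp_ge_zero)
      qed
    qed
    have "1/2 \<le> measure M A" by (rule A(2))
    also have "\<dots> \<le> measure M (\<Union>w\<in>B. K w)"
    proof (rule M.finite_measure_mono)
      show "A \<subseteq> (\<Union>w\<in>B. K w)"
        using sets.sets_into_space[OF A(1)] by (auto simp: B_def K_def wd_def)
      show "(\<Union>w\<in>B. K w) \<in> sets M" by (intro sets.finite_UN finB K)
    qed
    also have "\<dots> \<le> (\<Sum>w\<in>B. measure M (K w))"
      using K(1) by (intro M.finite_measure_subadditive_finite finB) auto
    also have "\<dots> \<le> (\<Sum>w\<in>B. exp (- (real n * (code_entropy \<mu> c0 - t))))"
      by (rule sum_mono[OF Kw])
    finally have "1/2 \<le> real (card B) * exp (- (real n * (code_entropy \<mu> c0 - t)))" by simp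
    then have "1/2 * exp (real n * (code_entropy \<mu> c0 - t))
        \<le> real (card B) * exp (- (real n * (code_entropy \<mu> c0 - t))) * exp (real n * (code_entropy \<mu> c0 - t))"
      by (rule mult_right_mono) simp
    then have cardB: "exp (real n * (code_entropy \<mu> c0 - t)) / 2 \<le> real (card B)"
      by (simp add: mult.assoc flip: exp_add)
    have micro: "y u \<in> microstates F m \<delta> i" if u: "u \<in> A" for u
      unfolding microstates_def
    proof (intro CollectI conjI ballI)
      show "y u \<in> {1..d i} \<rightarrow> topspace Y" by (simp add: y_def pt_in)
    next
      fix f assume f: "f \<in> product_set G Y b P F m"
      have "H1 f \<in> \<H>" using f by (simp add: \<H>_def)
      then have 1: "\<bar>(\<Sum>k=1..n. H1 f (v u k)) / real n - (\<integral>z. H1 f (word z) \<partial>Z)\<bar> < e"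
        using bspec[OF bspec[OF test u]] unfolding v_def by blast
      have fr: "f x = complex_of_real (Re (f x))" if "x \<in> topspace Y" for x
        by (rule product_set_real[OF f F(2) that])
      have "(\<Sum>k=1..d i. f (y u k)) / of_nat (d i) = complex_of_real ((\<Sum>k=1..n. H1 f (v u k)) / real n)"
      proof -
        have "(\<Sum>k=1..d i. f (y u k)) = (\<Sum>k=1..n. complex_of_real (H1 f (v u k)))"
          unfolding n_def H1_def y_def using fr pt_in by (intro sum.cong) auto
        then show ?thesis by (simp add: n_def)
      qed
      moreover have "(\<integral>y. f y \<partial>N) = complex_of_real (\<integral>y. Re (f y) \<partial>N)"
        unfolding integral_complex_of_real[symmetric]
        using fr by (intro Bochner_Integration.integral_cong) (auto simp: space_N)
      ultimately have "cmod ((\<Sum>k=1..d i. f (y u k)) / of_nat (d i) - (\<integral>y. f y \<partial>N))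
          = \<bar>(\<Sum>k=1..n. H1 f (v u k)) / real n - (\<integral>y. Re (f y) \<partial>N)\<bar>"
        by (simp only: of_real_diff[symmetric] norm_of_real)
      also have "\<dots> < \<delta>" using 1 I1[OF f] e(2) \<delta> by argo
      finally show "cmod ((\<Sum>k=1..d i. f (y u k)) / of_nat (d i) - (\<integral>y. f y \<partial>N)) < \<delta>" .
    next
      fix p s assume p: "p \<in> P" and s: "s \<in> F"
      have sG: "s \<in> carrier G" using s F by blast
      have "H2 s p \<in> \<H>" using s p by (auto simp: \<H>_def)
      then have 1: "\<bar>(\<Sum>k=1..n. H2 s p (v u k)) / real n - (\<integral>z. H2 s p (word z) \<partial>Z)\<bar> < e"
        using bspec[OF bspec[OF test u]] unfolding v_def by blast
      let ?b = "\<lambda>g k. if T i (s \<otimes> g) k \<noteq> T i g (T i s k) then 1 else 0 :: real"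
      \<comment> \<open>If T_{sg} k = T_g T_s k for all g in W, the point at T_s k is the one that
        \<open>pt'\<close> computes from the window at k, and the squared defect is the test H2. At
        other sites it is at most 2^2 = 4.\<close>
      have "(cmod (p (C s (y u k)) - p (y u (T i s k))))\<^sup>2 \<le> H2 s p (v u k) + 4 * (\<Sum>g\<in>W. ?b g k)" for k
      proof (cases "\<forall>g\<in>W. T i (s \<otimes> g) k = T i g (T i s k)")
        case True
        have "y u (T i s k) = pt' s (v u k)"
          unfolding y_def pt_def pt'_def
          using True U(3) U(5)[OF s] by (intro arg_cong[where f = \<Theta>] ext) (auto simp: v_def)
        then show ?thesis by (simp add: H2_def y_def sum_nonneg)
      next
        case False
        then obtain g where g: "g \<in> W" "T i (s \<otimes> g) k \<noteq> T i g (T i s k)" by blast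
        have "?b g k \<le> (\<Sum>g\<in>W. ?b g k)" by (rule member_le_sum[OF g(1) _ W(1)]) simp
        then have "1 \<le> (\<Sum>g\<in>W. ?b g k)" using g(2) by simp
        moreover have "cmod (p (C s (y u k)) - p (y u (T i s k))) \<le> 2"
          using norm_triangle_ineq4[of "p (C s (y u k))" "p (y u (T i s k))"]
            P_le_one[OF p C_in[OF sG pt_in(1)[of "v u k"]]] P_le_one[OF p pt_in(1)[of "v u (T i s k)"]]
          unfolding y_def by argo
        then have "(cmod (p (C s (y u k)) - p (y u (T i s k))))\<^sup>2 \<le> 2\<^sup>2" by (rule power_mono) simp
        moreover have "H2 s p (v u k) \<ge> 0" by (simp add: H2_def)
        ultimately show ?thesis by simp
      qed
      then have "(\<Sum>k=1..n. (cmod (p (C s (y u k)) - p (y u (T i s k))))\<^sup>2) / real n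
          \<le> (\<Sum>k=1..n. H2 s p (v u k) + 4 * (\<Sum>g\<in>W. ?b g k)) / real n"
        by (rule avg_mono)
      also have "\<dots> = (\<Sum>k=1..n. H2 s p (v u k)) / real n + 4 * ((\<Sum>k=1..n. \<Sum>g\<in>W. ?b g k) / real n)"
        by (simp add: sum.distrib add_divide_distrib sum_distrib_left)
      also have "(\<Sum>k=1..n. \<Sum>g\<in>W. ?b g k) = (\<Sum>g\<in>W. \<Sum>k=1..n. ?b g k)" by (rule sum.swap)
      also have "\<dots> = (\<Sum>g\<in>W. real (card {k\<in>{1..n}. T i (s \<otimes> g) k \<noteq> T i g (T i s k)}))"
        by (intro sum.cong refl) (simp add: sum.If_cases Int_def)
      also have "\<dots> / real n < \<delta>\<^sup>2 / 16"
        using bspec[OF elim(1) s] unfolding n_def by (simp only: sum_divide_distrib)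
      finally have "(\<Sum>k=1..n. (cmod (p (C s (y u k)) - p (y u (T i s k))))\<^sup>2) / real n
          < (\<Sum>k=1..n. H2 s p (v u k)) / real n + 4 * (\<delta>\<^sup>2 / 16)" by simp
      \<comment> \<open>Three quarters of \<delta>^2 are spent: on the mean of H2, on its
        fluctuation, and on sites where the sofic approximation is not multiplicative.\<close>
      also have "\<dots> \<le> \<delta>\<^sup>2 / 4 + e + 4 * (\<delta>\<^sup>2 / 16)"
        using 1 I2[OF s p] unfolding abs_diff_less_iff by argo
      also have "\<dots> \<le> \<delta>\<^sup>2" using e(3) zero_le_power2[of \<delta>] by argo
      finally have "sqrt ((\<Sum>k=1..n. (cmod (p (C s (y u k)) - p (y u (T i s k))))\<^sup>2) / real n) < sqrt (\<delta>\<^sup>2)"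
        by (simp only: real_sqrt_less_iff)
      then show "sqrt ((\<Sum>k=1..d i. (cmod (p (C s (y u k)) - p (y u (T i s k))))\<^sup>2) / real (d i)) < \<delta>"
        using \<delta> by (simp add: n_def)
    qed
    have letters: "real (card {k\<in>{1..n}. \<exists>j\<in>R. \<bar>\<xi> j (y u k) - (if j = wd u k then 1 else 0)\<bar> \<ge> 1/3}) \<le> \<theta> * real n"
      if u: "u \<in> A" for u
    proof -
      have "H3 \<in> \<H>" by (simp add: \<H>_def)
      then have "\<bar>(\<Sum>k=1..n. H3 (v u k)) / real n - (\<integral>z. H3 (word z) \<partial>Z)\<bar> < e"
        using bspec[OF bspec[OF test u]] unfolding v_def by blast
      then have "(\<Sum>k=1..n. H3 (v u k)) / real n \<le> \<theta>"
        using I3 e(4) unfolding abs_diff_less_iff by argo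
      moreover have "(\<Sum>k=1..n. H3 (v u k)) = (\<Sum>k=1..n. if \<exists>j\<in>R. \<bar>\<xi> j (y u k) - (if j = wd u k then 1 else 0)\<bar> \<ge> 1/3 then 1 else 0)"
        unfolding H3_def a_v y_def wd_def by (intro sum.cong) auto
      moreover have "\<dots> = real (card {k\<in>{1..n}. \<exists>j\<in>R. \<bar>\<xi> j (y u k) - (if j = wd u k then 1 else 0)\<bar> \<ge> 1/3})"
        by (subst sum.If_cases) (simp_all add: Int_def)
      ultimately show ?thesis using n by (simp add: divide_le_eq)
    qed
    show ?case
      unfolding n_def[symmetric]
    proof (intro exI[of _ B] conjI BP cardB ballI)
      fix w assume "w \<in> B"
      then obtain u where u: "u \<in> A" "w = wd u" by (auto simp: B_def)
      show "\<exists>y\<in>microstates F m \<delta> i. real (card {k\<in>{1..n}. \<exists>j\<in>R.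
          \<bar>\<xi> j (y k) - (if j = w k then 1 else 0)\<bar> \<ge> 1/3}) \<le> \<theta> * real n"
        using letters[OF u(1)] micro[OF u(1)] unfolding u(2) by (intro bexI[of _ "y u"])
    qed
  qed
qed

end

lemma log_enat_ge:
  assumes "enat k \<le> s" "exp B \<le> real k"
  shows "ereal B \<le> log_enat s"
proof (cases s)
  case (enat m)
  then have km: "k \<le> m" using assms(1) by simp
  have "0 < real k" using assms(2) exp_gt_zero[of B] by (rule order_less_le_trans[rotated])
  then have "0 < k" by simp
  have "B = ln (exp B)" by simp
  also have "\<dots> \<le> ln (real m)" using assms(2) km \<open>0 < k\<close> by (subst ln_le_cancel_iff) auto
  finally show ?thesis using enat km \<open>0 < k\<close> by (simp add: log_enat_def)
qed (simp add: log_enat_def)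

section \<open>From typical words to separated families\<close>

context bernoulli_model
begin

text \<open>Among the microstates of typical words take a maximal set that is pairwise not
  \<epsilon>-close on \<open>P\<close>. Every other typical word is close to a member, and closeness
  on \<open>P\<close> makes the stand-ins \<open>\<xi>\<close> close in mean, so the two words
  disagree at few sites. The Hamming balls around the members therefore cover all typical words, and
  the cardinality of one ball is subexponential up to t/3.\<close>

lemma separated_microstates:
  assumes c0: "finite_code \<mu> c0" and t: "t > 0"
  obtains \<epsilon> where "\<epsilon> > 0"
    "\<And>F m \<delta>. finite F \<Longrightarrow> F \<subseteq> carrier G \<Longrightarrow> \<delta> > 0 \<Longrightarrow> \<forall>\<^sub>F i in sequentially.
      \<exists>S. finite S \<and> S \<subseteq> approx_hom G Y N b P F m \<delta> (d i) (\<sigma> i) \<and>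
        (\<forall>x\<in>S. \<forall>y\<in>S. x \<noteq> y \<longrightarrow> rho_max (d i) P x y \<ge> \<epsilon>) \<and>
        exp (real (d i) * (code_entropy \<mu> c0 - t)) \<le> real (card S)"
proof -
  define R where "R = c0 ` space \<mu>"
  have R: "finite R" using c0 by (simp add: R_def finite_code_def)
  define h where "h = code_entropy \<mu> c0"
  define r where "r = real (card R)"
  have t3: "t / 3 > 0" using t by simp
  obtain \<kappa> where \<kappa>: "\<kappa> > 0" and ball: "\<And>n z. real (card {u \<in> PiE {1..n::nat} (\<lambda>_. R).
      real (card {k\<in>{1..n}. u k \<noteq> z k}) \<le> \<kappa> * real n}) \<le> exp (t / 3 * real n)"
    using card_hamming_ball_le[OF R t3] by blast
  \<comment> \<open>Budget for disagreements: \<kappa>/4 for the letters misread in each of the two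
    microstates, and 4 \<kappa>' for each of the r letters by Markov's inequality, with 4 r
    \<kappa>' below \<kappa>/2.\<close>
  define \<kappa>' where "\<kappa>' = \<kappa> / (8 * (r + 1))"
  have r: "r \<ge> 0" by (simp add: r_def)
  have \<kappa>': "\<kappa>' > 0" using \<kappa> r by (simp add: \<kappa>'_def)
  have r\<kappa>': "r * \<kappa>' < \<kappa> / 8"
  proof -
    have "r * \<kappa>' < (r + 1) * \<kappa>'" using \<kappa>' by (intro mult_strict_right_mono) auto
    also have "\<dots> = \<kappa> / 8" using r by (simp add: \<kappa>'_def field_simps)
    finally show ?thesis .
  qed
  obtain \<xi> where \<xi>: "\<And>j. continuous_map Y euclideanreal (\<xi> j)"
    "\<And>j. measure N {y \<in> space N. \<bar>\<xi> j y - (if j = c0 (\<Phi> y \<one>) then 1 else 0)\<bar> \<ge> 1/4} < \<kappa>'"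
    by (rule continuous_code[OF c0 \<kappa>'], rule that, assumption+)
  have ev0: "\<forall>\<^sub>F x in pair_filter. \<forall>j\<in>R.
      (\<Sum>k=1..d (fst x). cmod ((\<lambda>y\<in>topspace Y. complex_of_real (\<xi> j y)) (fst (snd x) k)
        - (\<lambda>y\<in>topspace Y. complex_of_real (\<xi> j y)) (snd (snd x) k))) / real (d (fst x)) < \<kappa>'"
  proof (intro eventually_ball_finite R ballI)
    fix j
    show "\<forall>\<^sub>F x in pair_filter.
      (\<Sum>k=1..d (fst x). cmod ((\<lambda>y\<in>topspace Y. complex_of_real (\<xi> j y)) (fst (snd x) k)
        - (\<lambda>y\<in>topspace Y. complex_of_real (\<xi> j y)) (snd (snd x) k))) / real (d (fst x)) < \<kappa>'"
      using pair_L1_close[OF complex_of_real_cfun[OF \<xi>(1)], of j] \<kappa>' unfolding L1_close_def by (rule order_tendstoD)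
  qed
  obtain F1 m1 \<delta>1 \<epsilon> where F1: "finite F1" "F1 \<subseteq> carrier G" "\<delta>1 > 0" and \<epsilon>: "\<epsilon> > 0"
    and ev1: "\<forall>\<^sub>F i in sequentially. \<forall>y\<in>microstates F1 m1 \<delta>1 i. \<forall>y'\<in>microstates F1 m1 \<delta>1 i.
       (\<forall>p\<in>P. \<forall>k\<in>{1..d i}. cmod (p (y k) - p (y' k)) < \<epsilon>) \<longrightarrow> (\<forall>j\<in>R.
      (\<Sum>k=1..d i. cmod ((\<lambda>y\<in>topspace Y. complex_of_real (\<xi> j y)) (y k)
        - (\<lambda>y\<in>topspace Y. complex_of_real (\<xi> j y)) (y' k))) / real (d i) < \<kappa>')"
    by (rule eventually_pair_filterD[OF ev0, unfolded fst_conv snd_conv], rule that, assumption+)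
  show ?thesis
  proof (rule that[OF \<epsilon>])
    fix F m \<delta>
    assume F: "finite F" "F \<subseteq> carrier G" "(\<delta>::real) > 0"
    \<comment> \<open>The scale \<epsilon> and the parameters with index 1 are already fixed by the
      code and t. Microstates for the combined parameters satisfy both these and the demands of the
      given F, m, \<delta>, so \<epsilon> stays the same for all of the latter.\<close>
    define F' m' \<delta>' where "F' = F \<union> F1" and "m' = max m m1" and "\<delta>' = min \<delta> \<delta>1"
    have F': "finite F'" "F' \<subseteq> carrier G" "\<delta>' > 0" using F F1 by (auto simp: F'_def \<delta>'_def)
    have sub1: "microstates F' m' \<delta>' i \<subseteq> microstates F1 m1 \<delta>1 i" for i
      by (rule microstates_antimono) (auto simp: F'_def m'_def \<delta>'_def)
    have sub: "microstates F' m' \<delta>' i \<subseteq> microstates F m \<delta> i" for i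
      by (rule microstates_antimono) (auto simp: F'_def m'_def \<delta>'_def)
    have \<theta>: "real (card (c0 ` space \<mu>)) * \<kappa>' < \<kappa> / 4"
      using r\<kappa>' \<kappa> unfolding r_def R_def by simp
    have rm: "\<forall>\<^sub>F i in sequentially. \<exists>B. B \<subseteq> PiE {1..d i} (\<lambda>_. R) \<and>
      exp (real (d i) * (h - t / 3)) / 2 \<le> real (card B) \<and>
      (\<forall>w\<in>B. \<exists>y\<in>microstates F' m' \<delta>' i. real (card {k\<in>{1..d i}. \<exists>j\<in>R.
       \<bar>\<xi> j (y k) - (if j = w k then 1 else 0)\<bar> \<ge> 1/3}) \<le> \<kappa> / 4 * real (d i))"
      unfolding R_def h_def by (rule random_microstates[OF c0 F' t3 \<xi>(1) less_imp_le[OF \<xi>(2)] \<theta>])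
    have big: "\<forall>\<^sub>F i in sequentially. d i \<ge> nat \<lceil>3 / t\<rceil>"
      using d_at_top unfolding filterlim_at_top by blast
    show "\<forall>\<^sub>F i in sequentially.
      \<exists>S. finite S \<and> S \<subseteq> approx_hom G Y N b P F m \<delta> (d i) (\<sigma> i) \<and>
        (\<forall>x\<in>S. \<forall>y\<in>S. x \<noteq> y \<longrightarrow> rho_max (d i) P x y \<ge> \<epsilon>) \<and>
        exp (real (d i) * (code_entropy \<mu> c0 - t)) \<le> real (card S)"
      using ev1 rm big
    proof eventually_elim
      case (elim i)
      define n where "n = d i"
      have n: "n > 0" using d_pos by (simp add: n_def)
      obtain B where B: "B \<subseteq> PiE {1..n} (\<lambda>_. R)" "exp (real n * (h - t / 3)) / 2 \<le> real (card B)"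
        and "\<forall>w\<in>B. \<exists>y\<in>microstates F' m' \<delta>' i. real (card {k\<in>{1..n}. \<exists>j\<in>R.
          \<bar>\<xi> j (y k) - (if j = w k then 1 else 0)\<bar> \<ge> 1/3}) \<le> \<kappa> / 4 * real n"
        using elim(2) unfolding n_def by blast
      then have "\<forall>w\<in>B. \<exists>y. y \<in> microstates F' m' \<delta>' i \<and> real (card {k\<in>{1..n}. \<exists>j\<in>R.
          \<bar>\<xi> j (y k) - (if j = w k then 1 else 0)\<bar> \<ge> 1/3}) \<le> \<kappa> / 4 * real n" by blast
      from bchoice[OF this] obtain y where y': "\<forall>w\<in>B. y w \<in> microstates F' m' \<delta>' i \<and> real (card {k\<in>{1..n}. \<exists>j\<in>R.
          \<bar>\<xi> j (y w k) - (if j = w k then 1 else 0)\<bar> \<ge> 1/3}) \<le> \<kappa> / 4 * real n" ..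
      have y: "y w \<in> microstates F' m' \<delta>' i" and letters: "real (card {k\<in>{1..n}. \<exists>j\<in>R.
          \<bar>\<xi> j (y w k) - (if j = w k then 1 else 0)\<bar> \<ge> 1/3}) \<le> \<kappa> / 4 * real n" if "w \<in> B" for w
        using bspec[OF y' that] by simp_all
      have finB: "finite B" using B(1) R by (intro finite_subset[OF B(1)] finite_PiE) auto
      define cl where "cl w w' \<longleftrightarrow> (\<forall>p\<in>P. \<forall>k\<in>{1..n}. cmod (p (y w k) - p (y w' k)) < \<epsilon>)" for w w'
      have cl_sym: "cl w w' \<longleftrightarrow> cl w' w" for w w' by (simp add: cl_def norm_minus_commute)
      have cl_refl: "cl w w" for w using \<epsilon> by (simp add: cl_def)
      let ?\<C> = "{S \<in> Pow B. \<forall>w\<in>S. \<forall>w'\<in>S. w \<noteq> w' \<longrightarrow> \<not> cl w w'}"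
      have "finite ?\<C>" using finB by simp
      moreover have "?\<C> \<noteq> {}" by blast
      ultimately have "\<exists>S\<in>?\<C>. \<forall>S'\<in>?\<C>. S \<subseteq> S' \<longrightarrow> S = S'" by (rule finite_has_maximal)
      then obtain S where S: "S \<in> ?\<C>" and max: "\<forall>S'\<in>?\<C>. S \<subseteq> S' \<longrightarrow> S = S'" ..
      have SB: "S \<subseteq> B" and sep: "\<And>w w'. w \<in> S \<Longrightarrow> w' \<in> S \<Longrightarrow> w \<noteq> w' \<Longrightarrow> \<not> cl w w'" using S by auto
      have cover: "\<exists>s\<in>S. cl w s" if w: "w \<in> B" for w
      proof (rule ccontr)
        assume no: "\<not> (\<exists>s\<in>S. cl w s)"
        then have "insert w S \<in> ?\<C>" using w SB sep cl_sym by auto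
        then have "S = insert w S" using bspec[OF max, of "insert w S"] by blast
        then have "w \<in> S" by blast
        then show False using no cl_refl by blast
      qed
      have hamming: "real (card {k\<in>{1..n}. w k \<noteq> s k}) \<le> \<kappa> * real n" if w: "w \<in> B" and s: "s \<in> B" and ws: "cl w s" for w s
      proof -
        define E where "E w = {k\<in>{1..n}. \<exists>j\<in>R. \<bar>\<xi> j (y w k) - (if j = w k then 1 else 0)\<bar> \<ge> 1/3}" for w
        define X where "X j = {k\<in>{1..n}. \<bar>\<xi> j (y w k) - \<xi> j (y s k)\<bar> \<ge> 1/4}" for j
        have X: "real (card (X j)) \<le> 4 * \<kappa>' * real n" if j: "j \<in> R" for j
        proof -
          have yin: "y w k \<in> topspace Y" "y s k \<in> topspace Y" if "k \<in> {1..n}" for k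
            using microstates_in[OF y[OF w]] microstates_in[OF y[OF s]] that unfolding n_def by auto
          have "(\<Sum>k=1..n. cmod ((\<lambda>y\<in>topspace Y. complex_of_real (\<xi> j y)) (y w k)
            - (\<lambda>y\<in>topspace Y. complex_of_real (\<xi> j y)) (y s k))) / real n < \<kappa>'"
            using elim(1) y[OF w] y[OF s] sub1[of i] ws j unfolding cl_def n_def by blast
          moreover have "(\<Sum>k=1..n. cmod ((\<lambda>y\<in>topspace Y. complex_of_real (\<xi> j y)) (y w k)
            - (\<lambda>y\<in>topspace Y. complex_of_real (\<xi> j y)) (y s k))) = (\<Sum>k=1..n. \<bar>\<xi> j (y w k) - \<xi> j (y s k)\<bar>)"
            using yin by (intro sum.cong refl) (simp flip: of_real_diff)
          ultimately have "real (card (X j)) / real n \<le> 4 * \<kappa>'"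
            using fraction_ge_le_avg[of "\<lambda>k. \<bar>\<xi> j (y w k) - \<xi> j (y s k)\<bar>" n] unfolding X_def by simp
          then show ?thesis using n by (simp add: divide_le_eq)
        qed
        \<comment> \<open>At a site outside the exceptional sets with different letters, the
          stand-in of the letter w k would be within 1/3 of 1 at one point and within 1/3 of 0 at
          the other, although the two values differ by less than 1/4.\<close>
        have "{k\<in>{1..n}. w k \<noteq> s k} \<subseteq> E w \<union> E s \<union> (\<Union>j\<in>R. X j)"
        proof (rule subsetI, rule ccontr)
          fix k assume k: "k \<in> {k\<in>{1..n}. w k \<noteq> s k}" and nk: "k \<notin> E w \<union> E s \<union> (\<Union>j\<in>R. X j)"
          have j: "w k \<in> R" using B(1) w k by (auto simp: PiE_iff)
          have "\<not> \<bar>\<xi> (w k) (y w k) - (if w k = w k then 1 else 0)\<bar> \<ge> 1/3" using nk k j unfolding E_def by blast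
          moreover have "\<not> \<bar>\<xi> (w k) (y s k) - (if w k = s k then 1 else 0)\<bar> \<ge> 1/3" using nk k j unfolding E_def by blast
          moreover have "\<not> \<bar>\<xi> (w k) (y w k) - \<xi> (w k) (y s k)\<bar> \<ge> 1/4" using nk k j unfolding X_def by blast
          moreover have "(w k = s k) = False" using k by simp
          ultimately have "\<bar>\<xi> (w k) (y w k) - 1\<bar> < 1/3" "\<bar>\<xi> (w k) (y s k) - 0\<bar> < 1/3"
            "\<bar>\<xi> (w k) (y w k) - \<xi> (w k) (y s k)\<bar> < 1/4"
            by (simp_all only: not_le if_True if_False simp_thms)
          then show False unfolding abs_diff_less_iff by linarith
        qed
        then have "card {k\<in>{1..n}. w k \<noteq> s k} \<le> card (E w \<union> E s \<union> (\<Union>j\<in>R. X j))"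
          using R by (intro card_mono) (auto simp: E_def X_def)
        also have "\<dots> \<le> card (E w) + card (E s) + (\<Sum>j\<in>R. card (X j))"
          using card_Un_le[of "E w \<union> E s" "\<Union>j\<in>R. X j"] card_Un_le[of "E w" "E s"] card_UN_le[OF R, of X] by linarith
        finally have "real (card {k\<in>{1..n}. w k \<noteq> s k}) \<le> real (card (E w) + card (E s) + (\<Sum>j\<in>R. card (X j)))"
          by (rule of_nat_mono)
        also have "\<dots> = real (card (E w)) + real (card (E s)) + (\<Sum>j\<in>R. real (card (X j)))" by simp
        also have "\<dots> \<le> \<kappa> / 4 * real n + \<kappa> / 4 * real n + (\<Sum>j\<in>R. 4 * \<kappa>' * real n)"
          using letters[OF w] letters[OF s] X unfolding E_def by (intro add_mono sum_mono) auto
        also have "\<dots> = (\<kappa> / 2 + 4 * (r * \<kappa>')) * real n" by (simp add: r_def algebra_simps)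
        also have "\<dots> \<le> \<kappa> * real n" using r\<kappa>' by (intro mult_right_mono) auto
        finally show ?thesis .
      qed
      define \<H> where "\<H> s = {u \<in> PiE {1..n} (\<lambda>_. R). real (card {k\<in>{1..n}. u k \<noteq> s k}) \<le> \<kappa> * real n}" for s
      have finS: "finite S" using finite_subset[OF SB finB] .
      have fin\<H>: "finite (\<H> s)" for s
        unfolding \<H>_def by (rule finite_subset[OF _ finite_PiE[of "{1..n}" "\<lambda>_. R"]]) (use R in auto)
      have "B \<subseteq> (\<Union>s\<in>S. \<H> s)"
      proof
        fix w assume w: "w \<in> B"
        obtain s where s: "s \<in> S" "cl w s" using cover[OF w] ..
        have sB: "s \<in> B" using SB s(1) ..
        have "w \<in> \<H> s"
          unfolding \<H>_def by (intro CollectI conjI hamming[OF w sB s(2)] subsetD[OF B(1) w])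
        then show "w \<in> (\<Union>s\<in>S. \<H> s)" using s(1) by (rule UN_I[rotated])
      qed
      then have "card B \<le> card (\<Union>s\<in>S. \<H> s)" using finS fin\<H> by (intro card_mono finite_UN_I)
      also have "\<dots> \<le> (\<Sum>s\<in>S. card (\<H> s))" by (rule card_UN_le[OF finS])
      finally have "real (card B) \<le> (\<Sum>s\<in>S. real (card (\<H> s)))" unfolding of_nat_sum[symmetric] by (rule of_nat_mono)
      also have "\<dots> \<le> (\<Sum>s\<in>S. exp (t / 3 * real n))" unfolding \<H>_def by (intro sum_mono ball)
      finally have BS: "real (card B) \<le> real (card S) * exp (t / 3 * real n)" by simp
      \<comment> \<open>The loss t is spent in thirds: on typicality, on the Hamming balls, and on
        the factor 2, absorbed once n is at least 3/t.\<close>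
      have "2 \<le> exp (t / 3 * real n)"
      proof -
        have "3 / t \<le> real n" using elim(3) unfolding n_def nat_ceiling_le_eq .
        then have "1 \<le> t / 3 * real n" using t by (simp add: field_simps)
        then show ?thesis using exp_ge_add_one_self[of "t / 3 * real n"] by argo
      qed
      then have "exp (real n * (h - t)) * exp (t / 3 * real n) * 2 \<le> exp (real n * (h - t)) * exp (t / 3 * real n) * exp (t / 3 * real n)"
        by (intro mult_left_mono) auto
      also have "\<dots> = exp (real n * (h - t / 3))" by (simp add: exp_add[symmetric] algebra_simps)
      also have "\<dots> \<le> real (card S) * exp (t / 3 * real n) * 2" using B(2) BS by simp
      finally have cardS: "exp (real n * (h - t)) \<le> real (card S)" by simp
      define \<phi> where "\<phi> w = point_evaluation Y n (y w)" for w
      have rho: "rho_max n P (\<phi> w) (\<phi> w') < \<epsilon> \<longleftrightarrow> cl w w'" for w w'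
        unfolding \<phi>_def cl_def by (rule rho_max_less_iff[OF n])
      have inj: "inj_on \<phi> S"
      proof (rule inj_onI, rule ccontr)
        fix w w' assume w: "w \<in> S" "w' \<in> S" "\<phi> w = \<phi> w'" "w \<noteq> w'"
        then have "cl w w'" using cl_refl[of w] rho[of w w] rho[of w w'] by simp
        then show False using sep w by blast
      qed
      show ?case
      proof (intro exI[of _ "\<phi> ` S"] conjI)
        show "finite (\<phi> ` S)" using finS by simp
        show "\<phi> ` S \<subseteq> approx_hom G Y N b P F m \<delta> (d i) (\<sigma> i)"
          unfolding approx_hom_eq[OF F(2)]
        proof (rule image_subsetI)
          fix w assume "w \<in> S"
          then have "w \<in> B" by (rule subsetD[OF SB])
          then show "\<phi> w \<in> point_evaluation Y (d i) ` microstates F m \<delta> i"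
            unfolding \<phi>_def n_def by (intro imageI subsetD[OF sub] y)
        qed
        show "\<forall>x\<in>\<phi> ` S. \<forall>y\<in>\<phi> ` S. x \<noteq> y \<longrightarrow> rho_max (d i) P x y \<ge> \<epsilon>"
        proof (intro ballI impI)
          fix x z assume x: "x \<in> \<phi> ` S" and z: "z \<in> \<phi> ` S" and xz: "x \<noteq> z"
          obtain w where w: "w \<in> S" "x = \<phi> w" using x by (rule imageE)
          obtain w' where w': "w' \<in> S" "z = \<phi> w'" using z by (rule imageE)
          have "w \<noteq> w'" using xz unfolding w(2) w'(2) by blast
          then have "\<not> rho_max n P x z < \<epsilon>" unfolding w(2) w'(2) rho using sep[OF w(1) w'(1)] by simp
          then show "rho_max (d i) P x z \<ge> \<epsilon>" unfolding n_def not_less .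
        qed
        show "exp (real (d i) * (code_entropy \<mu> c0 - t)) \<le> real (card (\<phi> ` S))"
          using cardS unfolding card_image[OF inj] n_def h_def .
      qed
    qed
  qed
qed

text \<open>It suffices to treat one finite partition at a time, numbered as a code. For each t a
  single \<epsilon> works for all F, m, \<delta>, so it survives the infima; the supremum over
  partitions also covers infinite base entropy.\<close>

theorem model_entropy_ge: "base_entropy \<mu> \<le> model_entropy G d \<sigma> Y N b P"
  unfolding base_entropy_def
proof (rule SUP_least)
  fix Q assume "Q \<in> {Q. finite_measurable_partition \<mu> Q}"
  then obtain c where c: "finite_code \<mu> c" and cQ: "code_entropy \<mu> c = partition_entropy \<mu> Q"
    using partition_entropy_code by blast
  define E where "E \<epsilon> F m \<delta> i = ereal (1 / real (d i)) *
          log_enat (separation_number \<epsilon> (approx_hom G Y N b P F m \<delta> (d i) (\<sigma> i)) (rho_max (d i) P))" for \<epsilon> F m \<delta> i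
  show "ereal (partition_entropy \<mu> Q) \<le> model_entropy G d \<sigma> Y N b P"
    unfolding cQ[symmetric]
  proof (rule ereal_le_epsilon2)
    fix t :: real assume t: "t > 0"
    obtain \<epsilon> where \<epsilon>: "\<epsilon> > 0" and ev: "\<And>F m \<delta>. finite F \<Longrightarrow> F \<subseteq> carrier G \<Longrightarrow> \<delta> > 0 \<Longrightarrow> \<forall>\<^sub>F i in sequentially.
      \<exists>S. finite S \<and> S \<subseteq> approx_hom G Y N b P F m \<delta> (d i) (\<sigma> i) \<and>
        (\<forall>x\<in>S. \<forall>y\<in>S. x \<noteq> y \<longrightarrow> rho_max (d i) P x y \<ge> \<epsilon>) \<and>
        exp (real (d i) * (code_entropy \<mu> c - t)) \<le> real (card S)"
      by (rule separated_microstates[OF c t]) (rule that; assumption)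
    have "ereal (code_entropy \<mu> c - t) \<le> limsup (E \<epsilon> F m \<delta>)" if F: "finite F" "F \<subseteq> carrier G" "\<delta> > 0" for F m \<delta>
    proof (rule le_Limsup)
      show "\<forall>\<^sub>F i in sequentially. ereal (code_entropy \<mu> c - t) \<le> E \<epsilon> F m \<delta> i"
        using ev[OF F, of m]
      proof eventually_elim
        case (elim i)
        then obtain S where S: "finite S \<and> S \<subseteq> approx_hom G Y N b P F m \<delta> (d i) (\<sigma> i) \<and>
          (\<forall>x\<in>S. \<forall>y\<in>S. x \<noteq> y \<longrightarrow> rho_max (d i) P x y \<ge> \<epsilon>)"
          "exp (real (d i) * (code_entropy \<mu> c - t)) \<le> real (card S)" by blast
        have "enat (card S) \<le> separation_number \<epsilon> (approx_hom G Y N b P F m \<delta> (d i) (\<sigma> i)) (rho_max (d i) P)"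
          unfolding separation_number_def by (rule SUP_upper, rule CollectI, rule S(1))
        then have "ereal (real (d i) * (code_entropy \<mu> c - t))
            \<le> log_enat (separation_number \<epsilon> (approx_hom G Y N b P F m \<delta> (d i) (\<sigma> i)) (rho_max (d i) P))"
          using S(2) by (rule log_enat_ge)
        then have "ereal (1 / real (d i)) * ereal (real (d i) * (code_entropy \<mu> c - t)) \<le> E \<epsilon> F m \<delta> i"
          unfolding E_def by (intro ereal_mult_left_mono) auto
        then show ?case using d_pos[of i] by simp
      qed
    qed simp
    then have "ereal (code_entropy \<mu> c - t)
        \<le> (INF F\<in>{F. finite F \<and> F \<noteq> {} \<and> F \<subseteq> carrier G}. INF m. INF \<delta>\<in>{0<..}. limsup (E \<epsilon> F m \<delta>))"
      by (intro INF_greatest) auto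
    also have "\<dots> \<le> model_entropy G d \<sigma> Y N b P"
      unfolding model_entropy_def E_def by (rule SUP_upper) (use \<epsilon> in simp)
    finally have "ereal (code_entropy \<mu> c - t) + ereal t \<le> model_entropy G d \<sigma> Y N b P + ereal t"
      by (rule add_right_mono)
    then show "ereal (code_entropy \<mu> c) \<le> model_entropy G d \<sigma> Y N b P + ereal t" by simp
  qed
qed

theorem model_entropy_eq: "model_entropy G d \<sigma> Y N b P = base_entropy \<mu>"
  by (rule antisym[OF model_entropy_le model_entropy_ge])

end

section \<open>A model of the Bernoulli action\<close>

text \<open>Coding by membership in a countable base \<open>U\<close>: a sequence \<open>s\<close> is the code of a point if and only
  if it selects arbitrarily small nonempty base sets, any two selected sets contain the closure of
  a third, and the selection is upward closed.\<close>

lemma (in Metric_space) base_code_range: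
  fixes U :: "nat \<Rightarrow> 'a set" and s :: "nat \<Rightarrow> bool"
  assumes complete: mcomplete and U: "\<And>m. openin mtopology (U m)"
    and base: "\<And>V x. openin mtopology V \<Longrightarrow> x \<in> V \<Longrightarrow> \<exists>m. x \<in> U m \<and> U m \<subseteq> V"
  defines "small \<equiv> \<lambda>n m. \<forall>x\<in>U m. \<forall>y\<in>U m. d x y < inverse (real (Suc n))"
  shows "(\<exists>x\<in>M. \<forall>m. s m \<longleftrightarrow> x \<in> U m) \<longleftrightarrow>
    (\<forall>n. \<exists>m. s m \<and> small n m) \<and>
    (\<forall>m m'. s m \<longrightarrow> s m' \<longrightarrow> (\<exists>l. s l \<and> U l \<noteq> {} \<and> mtopology closure_of U l \<subseteq> U m \<inter> U m')) \<and>
    (\<forall>m l. s l \<longrightarrow> U l \<subseteq> U m \<longrightarrow> s m)" (is "?L \<longleftrightarrow> ?A \<and> ?B \<and> ?C")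
proof
  assume ?L
  then obtain x where x: "x \<in> M" and s: "\<And>m. s m \<longleftrightarrow> x \<in> U m" by blast
  have ?A
  proof
    fix n
    let ?r = "inverse (real (Suc n)) / 2"
    have "x \<in> mball x ?r" using x by simp
    then obtain m where m: "x \<in> U m" "U m \<subseteq> mball x ?r" using base[OF openin_mball] by blast
    have "small n m"
      unfolding small_def
    proof (intro ballI)
      fix y z assume "y \<in> U m" "z \<in> U m"
      then have "y \<in> M" "z \<in> M" "d x y < ?r" "d x z < ?r" using m(2) by auto
      then show "d y z < inverse (real (Suc n))" using triangle[of y x z] x commute[of x y] by linarith
    qed
    then show "\<exists>m. s m \<and> small n m" using m(1) s by blast
  qed
  moreover have ?B
  proof (intro allI impI)
    fix m m' assume "s m" "s m'"
    then have "x \<in> U m \<inter> U m'" "openin mtopology (U m \<inter> U m')" using s U by auto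
    then obtain r where r: "r > 0" "mcball x r \<subseteq> U m \<inter> U m'" unfolding openin_mtopology_mcball by blast
    have "x \<in> mball x r" using x r by simp
    then obtain l where l: "x \<in> U l" "U l \<subseteq> mball x r" using base[OF openin_mball] by blast
    have "U l \<subseteq> mcball x r" using l(2) mball_subset_mcball by blast
    then have "mtopology closure_of U l \<subseteq> mcball x r" by (rule closure_of_minimal) simp
    then show "\<exists>l. s l \<and> U l \<noteq> {} \<and> mtopology closure_of U l \<subseteq> U m \<inter> U m'" using l(1) r(2) s by blast
  qed
  moreover have ?C using s by blast
  ultimately show "?A \<and> ?B \<and> ?C" by blast
next
  assume ABC: "?A \<and> ?B \<and> ?C"
  have A: "\<exists>m. s m \<and> small n m" for n using ABC by blast
  have B: "\<exists>l. s l \<and> U l \<noteq> {} \<and> mtopology closure_of U l \<subseteq> U m \<inter> U m'" if "s m" "s m'" for m m'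
    using conjunct1[OF conjunct2[OF ABC]] that by blast
  have C: "s m" if "s l" "U l \<subseteq> U m" for m l using conjunct2[OF conjunct2[OF ABC]] that by blast
  have UM: "U m \<subseteq> M" for m using openin_subset[OF U, of m] by simp
  have cl: "U m \<subseteq> mtopology closure_of U m" for m using closure_of_subset[of "U m" mtopology] UM by simp
  \<comment> \<open>The selected point is found by Cantor's theorem: dependent choice builds
    selected nonempty sets, each containing the closure of the next and with diameters tending to
    0.\<close>
  have "\<exists>f. \<forall>n. (s (f n) \<and> U (f n) \<noteq> {} \<and> small n (f n)) \<and> mtopology closure_of U (f (Suc n)) \<subseteq> U (f n)"
  proof (rule dependent_nat_choice)
    obtain m where m: "s m" "small 0 m" using A by blast
    obtain l where l: "s l" "U l \<noteq> {}" "mtopology closure_of U l \<subseteq> U m \<inter> U m" using B[OF m(1) m(1)] by blast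
    have "U l \<subseteq> U m" using cl[of l] l(3) by blast
    then have "small 0 l" using m(2) unfolding small_def by blast
    then show "\<exists>l. s l \<and> U l \<noteq> {} \<and> small 0 l" using l by blast
  next
    fix m n assume m: "s m \<and> U m \<noteq> {} \<and> small n m"
    obtain m1 where m1: "s m1" "small (Suc n) m1" using A by blast
    obtain l where l: "s l" "U l \<noteq> {}" "mtopology closure_of U l \<subseteq> U m \<inter> U m1" using B[OF conjunct1[OF m] m1(1)] by blast
    have "U l \<subseteq> U m1" using cl[of l] l(3) by blast
    then have "small (Suc n) l" using m1(2) unfolding small_def by blast
    then show "\<exists>l. (s l \<and> U l \<noteq> {} \<and> small (Suc n) l) \<and> mtopology closure_of U l \<subseteq> U m" using l by blast
  qed
  then obtain f where f: "\<And>n. s (f n)" "\<And>n. U (f n) \<noteq> {}" "\<And>n. small n (f n)"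
    "\<And>n. mtopology closure_of U (f (Suc n)) \<subseteq> U (f n)" by blast
  have small_ball: "\<exists>n. \<forall>y\<in>U (f n). \<forall>z\<in>U (f n). d y z < e" if "e > 0" for e
  proof -
    obtain n where "inverse (real (Suc n)) < e" using reals_Archimedean[OF \<open>e > 0\<close>] by blast
    then show ?thesis using f(3)[of n] unfolding small_def by (meson less_trans)
  qed
  have "\<Inter> (range (\<lambda>n. mtopology closure_of U (f (Suc n)))) \<noteq> {}"
  proof (rule complete[unfolded mcomplete_nest, rule_format], intro conjI allI impI)
    show "mtopology closure_of U (f (Suc n)) \<noteq> {}" for n using cl f(2) by blast
    show "decseq (\<lambda>n. mtopology closure_of U (f (Suc n)))"
    proof (rule decseq_SucI)
      show "mtopology closure_of U (f (Suc (Suc n))) \<le> mtopology closure_of U (f (Suc n))" for n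
        using f(4)[of "Suc n"] cl[of "f (Suc n)"] by blast
    qed
    fix e :: real assume "e > 0"
    then obtain n where n: "\<forall>y\<in>U (f n). \<forall>z\<in>U (f n). d y z < e" using small_ball by blast
    obtain a where a: "a \<in> U (f n)" using f(2) by blast
    have "mtopology closure_of U (f (Suc n)) \<subseteq> mcball a e"
    proof
      fix z assume "z \<in> mtopology closure_of U (f (Suc n))"
      then have "z \<in> U (f n)" using f(4) by blast
      then have "d a z < e" "a \<in> M" "z \<in> M" using n a UM by blast+
      then show "z \<in> mcball a e" by simp
    qed
    then show "\<exists>n a. mtopology closure_of U (f (Suc n)) \<subseteq> mcball a e" by blast
  qed simp
  then obtain x where x': "\<And>n. x \<in> mtopology closure_of U (f (Suc n))" by blast
  have x: "x \<in> U (f n)" for n using x'[of n] f(4)[of n] by blast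
  have xM: "x \<in> M" using x[of 0] UM by blast
  have "s m \<longleftrightarrow> x \<in> U m" for m
  proof
    assume xm: "x \<in> U m"
    then obtain r where r: "r > 0" "mball x r \<subseteq> U m" using U[of m] unfolding openin_mtopology by blast
    obtain n where n: "\<forall>y\<in>U (f n). \<forall>z\<in>U (f n). d y z < r" using small_ball[OF r(1)] by blast
    have "U (f n) \<subseteq> mball x r"
    proof
      fix z assume z: "z \<in> U (f n)"
      then have "d x z < r" "z \<in> M" using n x UM by blast+
      then show "z \<in> mball x r" using xM by simp
    qed
    then show "s m" using C[OF f(1)] r(2) by blast
  next
    assume "s m"
    then obtain l where l: "s l" "mtopology closure_of U l \<subseteq> U m" using B[of m m] by blast
    \<comment> \<open>U_l meets every U_{f n}, because some selected nonempty set lies in both, and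
      the sets U_{f n} shrink to x.\<close>
    have "x \<in> mtopology closure_of U l"
      unfolding metric_closure_of
    proof (intro CollectI conjI allI impI xM)
      fix r :: real assume "r > 0"
      then obtain n where n: "\<forall>y\<in>U (f n). \<forall>z\<in>U (f n). d y z < r" using small_ball by blast
      obtain l' where l': "U l' \<noteq> {}" "mtopology closure_of U l' \<subseteq> U l \<inter> U (f n)" using B[OF l(1) f(1)] by blast
      then obtain z where z: "z \<in> U l" "z \<in> U (f n)" using cl[of l'] by blast
      then have "d x z < r" "z \<in> M" using n x UM by blast+
      then show "\<exists>y\<in>U l. y \<in> mball x r" using z(1) xM by auto
    qed
    then show "x \<in> U m" using l(2) by blast
  qed
  then show ?L using xM by blast
qed

text \<open>The last conclusion makes the set of codes of points measurable: by
  \<open>base_code_range\<close> being a code is expressed by countable quantifiers over the entries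
  of the sequence, with the relations between base sets acting as constants.\<close>

lemma standard_borel_code:
  assumes sb: "standard_borel \<mu>" and ne: "space \<mu> \<noteq> {}"
  obtains U :: "nat \<Rightarrow> 'a set" where "sets \<mu> = sigma_sets (space \<mu>) (range U)" "range U \<subseteq> Pow (space \<mu>)"
    "\<And>x y. x \<in> space \<mu> \<Longrightarrow> y \<in> space \<mu> \<Longrightarrow> (\<And>m. x \<in> U m \<longleftrightarrow> y \<in> U m) \<Longrightarrow> x = y"
    "\<And>(M :: 'z measure) F. (\<And>m. Measurable.pred M (\<lambda>z. F z m)) \<Longrightarrow>
       Measurable.pred M (\<lambda>z. \<exists>x\<in>space \<mu>. \<forall>m. F z m \<longleftrightarrow> x \<in> U m)"
proof -
  obtain T where T: "completely_metrizable_space T" "second_countable T" "sets \<mu> = sets (borel_of T)"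
    using sb by (auto simp: standard_borel_def)
  have sp: "space \<mu> = topspace T" using sets_eq_imp_space_eq[OF T(3)] by simp
  obtain M d where Md: "Metric_space M d" "Metric_space.mcomplete M d" "T = Metric_space.mtopology M d"
    using T(1) by (auto simp: completely_metrizable_space_def)
  interpret Metric_space M d by fact
  have spM: "space \<mu> = M" using sp Md(3) by simp
  obtain \<B> where \<B>: "countable \<B>" "\<And>V. V \<in> \<B> \<Longrightarrow> openin T V"
    "\<And>V x. openin T V \<Longrightarrow> x \<in> V \<Longrightarrow> \<exists>W\<in>\<B>. x \<in> W \<and> W \<subseteq> V"
    using T(2) unfolding second_countable_def by metis
  obtain x0 where "x0 \<in> topspace T" using ne sp by blast
  then have "\<B> \<noteq> {}" using \<B>(3)[OF openin_topspace, of x0] by blast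
  define U where "U = from_nat_into \<B>"
  have rU: "range U = \<B>" unfolding U_def by (rule range_from_nat_into[OF \<open>\<B> \<noteq> {}\<close> \<B>(1)])
  have U: "openin mtopology (U m)" for m using \<B>(2) rU Md(3) by blast
  have base: "\<exists>m. x \<in> U m \<and> U m \<subseteq> V" if V: "openin mtopology V" "x \<in> V" for V x
  proof -
    obtain W where W: "W \<in> \<B>" "x \<in> W" "W \<subseteq> V" using \<B>(3)[of V x] V Md(3) by blast
    then obtain m where "W = U m" using rU by blast
    then show ?thesis using W by blast
  qed
  have sub: "range U \<subseteq> Pow (space \<mu>)" using openin_subset[OF U] spM by auto
  have "sigma_sets (space \<mu>) (range U) = sigma_sets (space \<mu>) {V. openin T V}"
  proof (rule sigma_sets_eqI)
    fix V assume "V \<in> range U"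
    then show "V \<in> sigma_sets (space \<mu>) {V. openin T V}" using \<B>(2) rU by blast
  next
    fix V assume V: "V \<in> {V. openin T V}"
    have "V = \<Union>{W\<in>\<B>. W \<subseteq> V}"
    proof
      show "V \<subseteq> \<Union>{W\<in>\<B>. W \<subseteq> V}" using \<B>(3) V by blast
    qed blast
    moreover have "\<Union>{W\<in>\<B>. W \<subseteq> V} \<in> sigma_sets (space \<mu>) (range U)"
    proof (rule sigma_sets_UNION)
      show "countable {W\<in>\<B>. W \<subseteq> V}" using \<B>(1) by (rule countable_subset[rotated]) blast
      show "W \<in> sigma_sets (space \<mu>) (range U)" if "W \<in> {W\<in>\<B>. W \<subseteq> V}" for W
        using that rU by (intro sigma_sets.Basic) blast
    qed
    ultimately show "V \<in> sigma_sets (space \<mu>) (range U)" by simp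
  qed
  then have sets: "sets \<mu> = sigma_sets (space \<mu>) (range U)"
    using T(3) sp by (simp add: sets_borel_of)
  have sep: "x = y" if x: "x \<in> space \<mu>" and y: "y \<in> space \<mu>" and eq: "\<And>m. x \<in> U m \<longleftrightarrow> y \<in> U m" for x y
  proof (rule ccontr)
    assume "x \<noteq> y"
    then have "d x y > 0" "x \<in> mball x (d x y)" using x y spM by auto
    then obtain m where m: "x \<in> U m" "U m \<subseteq> mball x (d x y)" using base[OF openin_mball] by blast
    then have "y \<in> mball x (d x y)" using eq by blast
    then show False by simp
  qed
  have meas: "Measurable.pred L (\<lambda>z. \<exists>x\<in>space \<mu>. \<forall>m. F z m \<longleftrightarrow> x \<in> U m)"
    if [measurable]: "\<And>m. Measurable.pred L (\<lambda>z. F z m)" for L :: "'z measure" and F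
  proof -
    have meas: "Measurable.pred L (\<lambda>z. (\<forall>n. \<exists>m. F z m \<and> c1 n m) \<and>
      (\<forall>m m'. F z m \<longrightarrow> F z m' \<longrightarrow> (\<exists>l. F z l \<and> c2 l m m')) \<and> (\<forall>m l. F z l \<longrightarrow> c3 l m \<longrightarrow> F z m))"
      for c1 c3 :: "nat \<Rightarrow> nat \<Rightarrow> bool" and c2 :: "nat \<Rightarrow> nat \<Rightarrow> nat \<Rightarrow> bool"
      by measurable
    have "(\<lambda>z. \<exists>x\<in>space \<mu>. \<forall>m. F z m \<longleftrightarrow> x \<in> U m) = (\<lambda>z.
      (\<forall>n. \<exists>m. F z m \<and> (\<forall>x\<in>U m. \<forall>y\<in>U m. d x y < inverse (real (Suc n)))) \<and>
      (\<forall>m m'. F z m \<longrightarrow> F z m' \<longrightarrow> (\<exists>l. F z l \<and> (U l \<noteq> {} \<and> mtopology closure_of U l \<subseteq> U m \<inter> U m'))) \<and>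
      (\<forall>m l. F z l \<longrightarrow> U l \<subseteq> U m \<longrightarrow> F z m))"
      unfolding spM by (rule ext, rule base_code_range[OF Md(2) U base])
    then show ?thesis using meas by simp
  qed
  show ?thesis using that[OF sets sub sep meas] by blast
qed

text \<open>Base 3 with digits 0 and 1 avoids the double expansions of base 2: a first difference at
  place k contributes 3^(-k), and all later places together at most half of that.\<close>

lemma ternary_expansion_injective:
  fixes x y :: "nat \<Rightarrow> real"
  assumes x: "\<And>n. x n \<in> {0, 1}" and y: "\<And>n. y n \<in> {0, 1}"
    and eq: "(\<Sum>n. (1/3) ^ n * x n) = (\<Sum>n. (1/3) ^ n * y n)"
  shows "x = y"
proof (rule ccontr)
  assume ne: "x \<noteq> y"
  define k where "k = (LEAST n. x n \<noteq> y n)"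
  define z where "z n = x n - y n" for n
  have ex: "\<exists>n. x n \<noteq> y n" using ne by (auto simp: fun_eq_iff)
  have k: "x k \<noteq> y k" unfolding k_def by (rule LeastI_ex[OF ex])
  have lt: "x n = y n" if "n < k" for n using not_less_Least[of n "\<lambda>n. x n \<noteq> y n"] that unfolding k_def by blast
  have geo: "summable (\<lambda>n. (1/3::real) ^ n)" by (rule summable_geometric) simp
  have summ: "summable (\<lambda>n. (1/3) ^ n * w n)" if w: "\<And>n. \<bar>w n\<bar> \<le> 1" for w :: "nat \<Rightarrow> real"
  proof (rule summable_comparison_test'[OF geo])
    show "norm ((1/3) ^ n * w n) \<le> (1/3) ^ n" for n
      using mult_left_mono[OF w[of n], of "(1/3) ^ n"] by (simp add: abs_mult)
  qed
  have z1: "\<bar>z n\<bar> \<le> 1" and x1: "\<bar>x n\<bar> \<le> 1" and y1: "\<bar>y n\<bar> \<le> 1" for n using x[of n] y[of n] by (auto simp: z_def)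
  have z0: "(\<Sum>n. (1/3) ^ n * z n) = 0"
    using suminf_diff[OF summ[of x, OF x1] summ[of y, OF y1]] eq by (simp add: z_def right_diff_distrib)
  have "(\<Sum>n. (1/3) ^ n * z n) = (\<Sum>n. (1/3) ^ (n + Suc k) * z (n + Suc k)) + (\<Sum>n<Suc k. (1/3) ^ n * z n)"
    by (rule suminf_split_initial_segment[OF summ[OF z1]])
  also have "(\<Sum>n<Suc k. (1/3) ^ n * z n) = (1/3) ^ k * z k"
    using lt by (simp add: z_def)
  finally have zk: "(1/3) ^ k * z k = - (\<Sum>n. (1/3) ^ (n + Suc k) * z (n + Suc k))" using z0 by simp
  have "\<bar>(1/3) ^ k * z k\<bar> = \<bar>\<Sum>n. (1/3) ^ (n + Suc k) * z (n + Suc k)\<bar>" unfolding zk by simp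
  also have "\<dots> \<le> (\<Sum>n. (1/3) ^ Suc k * (1/3) ^ n)"
  proof -
    have "norm (\<Sum>n. (1/3) ^ (n + Suc k) * z (n + Suc k)) \<le> (\<Sum>n. (1/3) ^ Suc k * (1/3) ^ n)"
    proof (rule norm_suminf_le)
      show "norm ((1/3) ^ (n + Suc k) * z (n + Suc k)) \<le> (1/3) ^ Suc k * (1/3) ^ n" for n
        using mult_left_mono[OF z1[of "n + Suc k"], of "(1/3) ^ (n + Suc k)"] by (simp add: abs_mult power_add mult.commute)
      show "summable (\<lambda>n. (1/3) ^ Suc k * (1/3::real) ^ n)" by (rule summable_mult[OF geo])
    qed
    then show ?thesis by simp
  qed
  also have "\<dots> = (1/3) ^ Suc k * (3/2)" by (subst suminf_mult[OF geo]) (simp add: suminf_geometric)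
  also have "\<dots> < (1/3) ^ k" by simp
  finally have "(1/3) ^ k * \<bar>z k\<bar> < (1/3) ^ k" by (simp add: abs_mult)
  moreover have "\<bar>z k\<bar> = 1" using k x[of k] y[of k] by (auto simp: z_def)
  ultimately show False by simp
qed

lemma continuous_on_coordinate:
  fixes S :: "('i \<Rightarrow> 'b::topological_space) set"
  shows "continuous_on S (\<lambda>x. x i)"
  by (rule continuous_on_subset[OF continuous_on_product_coordinates subset_UNIV])

lemma continuous_on_suminf:
  fixes f :: "nat \<Rightarrow> 'a::topological_space \<Rightarrow> real"
  assumes "\<And>n. continuous_on S (f n)" "\<And>n x. x \<in> S \<Longrightarrow> norm (f n x) \<le> M n" "summable M"
  shows "continuous_on S (\<lambda>x. \<Sum>n. f n x)"
proof (rule uniform_limit_theorem)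
  show "uniform_limit S (\<lambda>n x. \<Sum>i<n. f i x) (\<lambda>x. \<Sum>n. f n x) sequentially"
    using assms(2,3) by (rule Weierstrass_m_test)
  show "\<forall>\<^sub>F n in sequentially. continuous_on S (\<lambda>x. \<Sum>i<n. f i x)"
    using assms(1) by (intro always_eventually allI continuous_on_sum) auto
qed simp

lemma cfun_of_real: "continuous_on K f \<Longrightarrow> (\<lambda>y\<in>K. complex_of_real (f y)) \<in> cfun (top_of_set K)"
  by (simp add: cfun_def continuous_on_of_real cong: continuous_on_cong_simp)

text \<open>The real functions belonging to \<open>A\<close> form a point-separating ring with
  constants, so Stone-Weierstrass and closedness of \<open>A\<close> give all real continuous
  functions; a complex function is assembled from its real and imaginary parts.\<close>

lemma unital_C_star_subalgebra_eq_cfun: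
  fixes K :: "'y::t2_space set"
  assumes K: "compact K" and A: "unital_C_star_subalgebra (top_of_set K) A"
    and sep: "\<And>x y. x \<in> K \<Longrightarrow> y \<in> K \<Longrightarrow> x \<noteq> y \<Longrightarrow>
      \<exists>f. continuous_on K f \<and> (\<lambda>z\<in>K. complex_of_real (f z)) \<in> A \<and> f x \<noteq> f y"
  shows "A = cfun (top_of_set K)"
proof -
  have sub: "A \<subseteq> cfun (top_of_set K)" and one: "(\<lambda>y\<in>K. 1) \<in> A"
    and addA: "\<And>f g. f \<in> A \<Longrightarrow> g \<in> A \<Longrightarrow> (\<lambda>y\<in>K. f y + g y) \<in> A"
    and scal: "\<And>c f. f \<in> A \<Longrightarrow> (\<lambda>y\<in>K. c * f y) \<in> A"
    and multA: "\<And>f g. f \<in> A \<Longrightarrow> g \<in> A \<Longrightarrow> (\<lambda>y\<in>K. f y * g y) \<in> A"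
    and closed: "\<And>f. f \<in> cfun (top_of_set K) \<Longrightarrow> (\<forall>e>0. \<exists>g\<in>A. \<forall>y\<in>K. cmod (f y - g y) \<le> e) \<Longrightarrow> f \<in> A"
    using A unfolding unital_C_star_subalgebra_def topspace_euclidean_subtopology by simp_all
  define R where "R = {f. continuous_on K f \<and> (\<lambda>z\<in>K. complex_of_real (f z)) \<in> A}"
  interpret function_ring_on R K
  proof
    show "compact K" by fact
    show "continuous_on K f" if "f \<in> R" for f using that by (simp add: R_def)
    show "(\<lambda>x. f x + g x) \<in> R" if "f \<in> R" "g \<in> R" for f g
    proof -
      have "(\<lambda>y\<in>K. complex_of_real (f y + g y)) = (\<lambda>y\<in>K. (\<lambda>z\<in>K. complex_of_real (f z)) y + (\<lambda>z\<in>K. complex_of_real (g z)) y)"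
        by (rule restrict_ext) simp
      then have "(\<lambda>y\<in>K. complex_of_real (f y + g y)) \<in> A" using that addA unfolding R_def by (simp only: mem_Collect_eq)
      then show ?thesis using that unfolding R_def by (simp only: mem_Collect_eq continuous_on_add)
    qed
    show "(\<lambda>x. f x * g x) \<in> R" if "f \<in> R" "g \<in> R" for f g
    proof -
      have "(\<lambda>y\<in>K. complex_of_real (f y * g y)) = (\<lambda>y\<in>K. (\<lambda>z\<in>K. complex_of_real (f z)) y * (\<lambda>z\<in>K. complex_of_real (g z)) y)"
        by (rule restrict_ext) simp
      then have "(\<lambda>y\<in>K. complex_of_real (f y * g y)) \<in> A" using that multA unfolding R_def by (simp only: mem_Collect_eq)
      then show ?thesis using that unfolding R_def by (simp only: mem_Collect_eq continuous_on_mult)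
    qed
    show "(\<lambda>_. c) \<in> R" for c
    proof -
      have "(\<lambda>y\<in>K. complex_of_real c) = (\<lambda>y\<in>K. complex_of_real c * (\<lambda>y\<in>K. 1) y)" by (rule restrict_ext) simp
      then show ?thesis using scal[OF one, of "complex_of_real c"] unfolding R_def by simp
    qed
    show "\<exists>f\<in>R. f x \<noteq> f y" if "x \<in> K" "y \<in> K" "x \<noteq> y" for x y
      using sep[OF that] unfolding R_def by blast
  qed
  have real: "(\<lambda>z\<in>K. complex_of_real (f z)) \<in> A" if f: "continuous_on K f" for f
  proof (rule closed)
    show "(\<lambda>z\<in>K. complex_of_real (f z)) \<in> cfun (top_of_set K)"
      by (rule cfun_of_real[OF f])
    show "\<forall>e>0. \<exists>g\<in>A. \<forall>y\<in>K. cmod ((\<lambda>z\<in>K. complex_of_real (f z)) y - g y) \<le> e"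
    proof (intro allI impI)
      fix e :: real assume "e > 0"
      then obtain g where g: "g \<in> R" "\<forall>x\<in>K. \<bar>f x - g x\<bar> < e" using Stone_Weierstrass_basic[OF f] by blast
      have "cmod (complex_of_real (f y) - complex_of_real (g y)) \<le> e" if "y \<in> K" for y
        using g(2) that unfolding of_real_diff[symmetric] norm_of_real by (simp add: less_imp_le)
      then show "\<exists>g\<in>A. \<forall>y\<in>K. cmod ((\<lambda>z\<in>K. complex_of_real (f z)) y - g y) \<le> e"
        using g(1) unfolding R_def by (intro bexI[of _ "\<lambda>z\<in>K. complex_of_real (g z)"]) auto
    qed
  qed
  have "f \<in> A" if f: "f \<in> cfun (top_of_set K)" for f
  proof -
    have c: "continuous_on K f" using cfun_continuous[OF f] by simp
    have re: "(\<lambda>z\<in>K. complex_of_real (Re (f z))) \<in> A" and im: "(\<lambda>z\<in>K. complex_of_real (Im (f z))) \<in> A"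
      using c by (auto intro!: real continuous_intros)
    have "f = (\<lambda>y\<in>K. (\<lambda>z\<in>K. complex_of_real (Re (f z))) y + (\<lambda>y\<in>K. \<i> * (\<lambda>z\<in>K. complex_of_real (Im (f z))) y) y)"
    proof
      fix y show "f y = (\<lambda>y\<in>K. (\<lambda>z\<in>K. complex_of_real (Re (f z))) y + (\<lambda>y\<in>K. \<i> * (\<lambda>z\<in>K. complex_of_real (Im (f z))) y) y) y"
        using f by (cases "y \<in> K") (auto simp: complex_eq cfun_def extensional_def)
    qed
    then show ?thesis using addA[OF re scal[OF im, of \<i>]] by simp
  qed
  then show ?thesis using sub by blast
qed

lemma measurable_borel_of_subspace:
  fixes f :: "'z \<Rightarrow> 'y::topological_space"
  assumes f: "f \<in> borel_measurable M" and K: "\<And>z. z \<in> space M \<Longrightarrow> f z \<in> K"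
  shows "f \<in> M \<rightarrow>\<^sub>M borel_of (top_of_set K)"
  unfolding borel_of_def
proof (rule measurable_measure_of)
  fix V assume "V \<in> {V. openin (top_of_set K) V}"
  then obtain W where W: "open W" "V = K \<inter> W" by (auto simp: openin_open)
  then have "f -` V \<inter> space M = f -` W \<inter> space M" using K by auto
  then show "f -` V \<inter> space M \<in> sets M" using measurable_sets[OF f, of W] W(1) by simp
qed (use K in \<open>auto dest: openin_imp_subset\<close>)

text \<open>The model lives on the Cantor set of 0-1 functions on G x nat, enumerated so as to lie
  in \<open>nat \<Rightarrow> real\<close>: the entry for (h, m) records whether x_h belongs to U_m.
  The coding need not be continuous in x, but the shift becomes a permutation of coordinates and
  hence continuous, and the compact space needs no topology on the base.\<close>

locale bernoulli_coding = group G for G :: "('g, 'r) monoid_scheme" (structure) +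
  fixes \<mu> :: "'a measure" and U :: "nat \<Rightarrow> 'a set"
  assumes countable_carrier: "countable (carrier G)" and prob: "prob_space \<mu>"
    and sets_\<mu>: "sets \<mu> = sigma_sets (space \<mu>) (range U)" and U_space: "range U \<subseteq> Pow (space \<mu>)"
    and U_separates: "\<And>x y. x \<in> space \<mu> \<Longrightarrow> y \<in> space \<mu> \<Longrightarrow> (\<And>m. x \<in> U m \<longleftrightarrow> y \<in> U m) \<Longrightarrow> x = y"
    and U_code: "\<And>(M :: (nat \<Rightarrow> real) measure) F. (\<And>m. Measurable.pred M (\<lambda>z. F z m)) \<Longrightarrow>
       Measurable.pred M (\<lambda>z. \<exists>x\<in>space \<mu>. \<forall>m. F z m \<longleftrightarrow> x \<in> U m)"
begin

abbreviation "Z \<equiv> PiM (carrier G) (\<lambda>_. \<mu>)"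

text \<open>G x nat is countably infinite even for finite G, so this enumeration is a bijection onto
  the natural numbers.\<close>

definition enc :: "'g \<Rightarrow> nat \<Rightarrow> nat" where "enc h m = to_nat_on (carrier G \<times> (UNIV :: nat set)) (h, m)"
definition elt :: "nat \<Rightarrow> 'g" where "elt n = fst (from_nat_into (carrier G \<times> (UNIV :: nat set)) n)"
definition idx :: "nat \<Rightarrow> nat" where "idx n = snd (from_nat_into (carrier G \<times> (UNIV :: nat set)) n)"

lemma enc_bijection:
  shows elt_in [simp]: "elt n \<in> carrier G" and enc_elt_idx [simp]: "enc (elt n) (idx n) = n"
    and elt_enc [simp]: "h \<in> carrier G \<Longrightarrow> elt (enc h m) = h" and idx_enc [simp]: "h \<in> carrier G \<Longrightarrow> idx (enc h m) = m"
proof -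
  have c: "countable (carrier G \<times> (UNIV :: nat set))" using countable_carrier by simp
  have ne: "carrier G \<times> (UNIV :: nat set) \<noteq> {}" using one_closed by blast
  have inf: "infinite (carrier G \<times> (UNIV :: nat set))" using ne by (simp add: finite_cartesian_product_iff)
  have "from_nat_into (carrier G \<times> (UNIV :: nat set)) n \<in> carrier G \<times> UNIV" by (rule from_nat_into[OF ne])
  then show "elt n \<in> carrier G" unfolding elt_def by auto
  show "enc (elt n) (idx n) = n" unfolding enc_def elt_def idx_def using to_nat_on_from_nat_into_infinite[OF c inf] by simp
  show "h \<in> carrier G \<Longrightarrow> elt (enc h m) = h" "h \<in> carrier G \<Longrightarrow> idx (enc h m) = m"
    unfolding enc_def elt_def idx_def using from_nat_into_to_nat_on[OF c, of "(h, m)"] by simp_all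
qed

definition K :: "(nat \<Rightarrow> real) set" where "K = {y. \<forall>n. y n \<in> {0, 1}}"
definition \<theta> :: "('g \<Rightarrow> 'a) \<Rightarrow> nat \<Rightarrow> real" where "\<theta> x = (\<lambda>n. if x (elt n) \<in> U (idx n) then 1 else 0)"
definition b :: "'g \<Rightarrow> (nat \<Rightarrow> real) \<Rightarrow> nat \<Rightarrow> real" where
  "b g = (\<lambda>y\<in>K. \<lambda>n. y (enc (inv g \<otimes> elt n) (idx n)))"
definition N :: "(nat \<Rightarrow> real) measure" where "N = distr Z (borel_of (top_of_set K)) \<theta>"
text \<open>The whole 0-1 code of the unit coordinate packed into one real number. The factor 2/3 is
  the reciprocal of the sum of all powers of 1/3 and scales the value into [0,1], as a partition {p,
  1 - p} requires.\<close>

definition v :: "(nat \<Rightarrow> real) \<Rightarrow> real" where "v y = (\<Sum>m. (1/3) ^ m * y (enc \<one> m)) * (2/3)"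
definition p :: "(nat \<Rightarrow> real) \<Rightarrow> complex" where "p = (\<lambda>y\<in>K. complex_of_real (v y))"
definition q :: "(nat \<Rightarrow> real) \<Rightarrow> complex" where "q = (\<lambda>y\<in>K. complex_of_real (1 - v y))"

lemma K_bit: "y \<in> K \<Longrightarrow> y n \<in> {0, 1}" by (simp add: K_def)

lemma compact_K: "compact K"
proof -
  have "K = PiE UNIV (\<lambda>_. {0, 1})" by (auto simp: K_def)
  moreover have "compactin (product_topology (\<lambda>_. euclidean) UNIV) (PiE UNIV (\<lambda>_::nat. {0, 1::real}))"
    unfolding compactin_PiE by (simp add: finite_imp_compactin)
  ultimately show ?thesis unfolding euclidean_product_topology compactin_euclidean_iff by simp
qed

lemma \<theta>_in [simp]: "\<theta> x \<in> K" by (simp add: K_def \<theta>_def)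

lemma b_in [simp]: "y \<in> K \<Longrightarrow> b g y \<in> K" by (simp add: K_def b_def)

lemma b_apply: "y \<in> K \<Longrightarrow> b g y n = y (enc (inv g \<otimes> elt n) (idx n))" by (simp add: b_def)

lemma space_N [simp]: "space N = K" and sets_N: "sets N = sets (borel_of (top_of_set K))"
  by (simp_all add: N_def)

lemma U_sets [measurable]: "U m \<in> sets \<mu>" unfolding sets_\<mu> by (rule sigma_sets.Basic) simp

lemma \<theta>_measurable: "\<theta> \<in> Z \<rightarrow>\<^sub>M borel_of (top_of_set K)"
proof (rule measurable_borel_of_subspace)
  show "\<theta> \<in> borel_measurable Z"
  proof (rule measurable_coordinatewise_then_product)
    fix n
    have [measurable]: "(\<lambda>x. x (elt n)) \<in> Z \<rightarrow>\<^sub>M \<mu>" by (intro measurable_component_singleton) simp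
    show "(\<lambda>x. \<theta> x n) \<in> borel_measurable Z" unfolding \<theta>_def by measurable
  qed
qed simp

lemma \<theta>_measurable_N: "\<theta> \<in> Z \<rightarrow>\<^sub>M N" using \<theta>_measurable measurable_cong_sets[OF refl sets_N] by blast

lemma coordinate_measurable [measurable]: "(\<lambda>y. y n) \<in> borel_measurable N"
proof (rule borel_measurable_continuous_map[OF _ sets_N])
  show "continuous_map (top_of_set K) euclidean (\<lambda>y. y n)" by (simp add: continuous_on_coordinate)
qed

lemma b_continuous: "continuous_on K (b g)"
proof (rule continuous_on_coordinatewise_then_product)
  fix n
  have "continuous_on K (\<lambda>y. y (enc (inv g \<otimes> elt n) (idx n)))" by (rule continuous_on_coordinate)
  then show "continuous_on K (\<lambda>y. b g y n)" by (rule continuous_on_eq) (simp add: b_apply)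
qed

lemma b_measurable: "b g \<in> N \<rightarrow>\<^sub>M N"
proof -
  have "b g \<in> N \<rightarrow>\<^sub>M borel_of (top_of_set K)"
  proof (rule measurable_borel_of_subspace)
    show "b g \<in> borel_measurable N"
    proof (rule measurable_coordinatewise_then_product)
      fix n
      show "(\<lambda>y. b g y n) \<in> borel_measurable N"
        using coordinate_measurable[of "enc (inv g \<otimes> elt n) (idx n)"]
        by (rule measurable_cong[THEN iffD1, rotated]) (simp add: b_apply)
    qed
  qed simp
  then show ?thesis using measurable_cong_sets[OF refl sets_N] by blast
qed

lemma bernoulli_apply: "x \<in> space Z \<Longrightarrow> h \<in> carrier G \<Longrightarrow> bernoulli_action G \<mu> g x h = x (inv g \<otimes> h)"
  by (simp add: bernoulli_action_def)

lemma \<theta>_equivariant: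
  assumes "g \<in> carrier G" "x \<in> space Z"
  shows "\<theta> (bernoulli_action G \<mu> g x) = b g (\<theta> x)"
proof
  fix n show "\<theta> (bernoulli_action G \<mu> g x) n = b g (\<theta> x) n"
    unfolding b_apply[OF \<theta>_in] unfolding \<theta>_def by (simp add: bernoulli_apply[OF assms(2)] assms(1))
qed

lemma bernoulli_pmp:
  assumes g: "g \<in> carrier G"
  shows "bernoulli_action G \<mu> g \<in> Z \<rightarrow>\<^sub>M Z" "distr Z Z (bernoulli_action G \<mu> g) = Z"
proof -
  have m: "(\<lambda>x. \<lambda>h\<in>carrier G. x (inv g \<otimes> h)) \<in> Z \<rightarrow>\<^sub>M Z"
    using g by (intro measurable_restrict measurable_component_singleton) simp
  have eq: "(\<lambda>h\<in>carrier G. x (inv g \<otimes> h)) = bernoulli_action G \<mu> g x" if "x \<in> space Z" for x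
    using that by (simp add: bernoulli_action_def)
  show "bernoulli_action G \<mu> g \<in> Z \<rightarrow>\<^sub>M Z" by (rule measurable_cong[THEN iffD1, OF _ m]) (simp only: eq)
  have "distr Z Z (bernoulli_action G \<mu> g) = distr Z Z (\<lambda>x. \<lambda>h\<in>carrier G. x (inv g \<otimes> h))"
    by (rule distr_cong) (simp_all add: eq)
  also have "\<dots> = Z"
    using distr_PiM_reindex[of "carrier G" "\<lambda>_. \<mu>" "\<lambda>h. inv g \<otimes> h" "carrier G"] prob g
    by (simp add: inj_on_def Pi_iff)
  finally show "distr Z Z (bernoulli_action G \<mu> g) = Z" .
qed

lemma b_distr:
  assumes g: "g \<in> carrier G"
  shows "distr N N (b g) = N"
proof -
  have N: "N = distr Z N \<theta>" unfolding N_def by (rule distr_cong) simp_all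
  have "distr N N (b g) = distr (distr Z N \<theta>) N (b g)" using N by simp
  also have "\<dots> = distr Z N (b g \<circ> \<theta>)" by (rule distr_distr[OF b_measurable \<theta>_measurable_N])
  also have "\<dots> = distr Z N (\<theta> \<circ> bernoulli_action G \<mu> g)"
    by (rule distr_cong) (simp_all add: \<theta>_equivariant[OF g])
  also have "\<dots> = distr (distr Z Z (bernoulli_action G \<mu> g)) N \<theta>"
    by (rule distr_distr[OF \<theta>_measurable_N bernoulli_pmp(1)[OF g], symmetric])
  also have "\<dots> = N" using bernoulli_pmp(2)[OF g] N by simp
  finally show ?thesis .
qed

lemma b_mult:
  assumes g: "g \<in> carrier G" "g' \<in> carrier G" and y: "y \<in> K"
  shows "b (g \<otimes> g') y = b g (b g' y)"
proof
  fix n show "b (g \<otimes> g') y n = b g (b g' y) n"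
    using g y by (simp add: b_apply inv_mult_group m_assoc)
qed

lemma b_group_action: "group_action G K b"
  unfolding group_action_def group_hom_def group_hom_axioms_def
proof (intro conjI)
  show "group G" by (rule is_group)
  show "group (BijGroup K)" by (rule group_BijGroup)
  have one: "b \<one> y = y" if "y \<in> K" for y
    using that by (intro ext) (simp add: b_apply)
  have bij: "b g \<in> Bij K" if g: "g \<in> carrier G" for g
  proof -
    have "b g (b (inv g) y) = y" "b (inv g) (b g y) = y" if "y \<in> K" for y
      using b_mult[of g "inv g" y] b_mult[of "inv g" g y] g that one by simp_all
    then have "bij_betw (b g) K K" by (intro bij_betw_byWitness[where f' = "b (inv g)"]) auto
    then show ?thesis by (simp add: Bij_def b_def)
  qed
  show "b \<in> hom G (BijGroup K)"
  proof (rule homI)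
    show "b g \<in> carrier (BijGroup K)" if "g \<in> carrier G" for g using bij[OF that] by (simp add: BijGroup_def)
    fix g g' assume g: "g \<in> carrier G" "g' \<in> carrier G"
    have "b (g \<otimes> g') = compose K (b g) (b g')"
    proof
      fix y show "b (g \<otimes> g') y = compose K (b g) (b g') y"
        using b_mult[OF g, of y] by (cases "y \<in> K") (simp_all add: compose_def, simp add: b_def)
    qed
    then show "b (g \<otimes> g') = b g \<otimes>\<^bsub>BijGroup K\<^esub> b g'" using bij g by (simp add: BijGroup_def)
  qed
qed

lemma b_pmp: "pmp_action G N b"
proof -
  interpret product_prob_space "\<lambda>_. \<mu>" "carrier G" using prob by (simp add: product_prob_spaceI)
  have "prob_space N" unfolding N_def by (rule P.prob_space_distr[OF \<theta>_measurable])
  then show ?thesis unfolding pmp_action_def using b_group_action b_measurable b_distr by simp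
qed

lemma summable_ternary: "y \<in> K \<Longrightarrow> summable (\<lambda>m. (1/3) ^ m * y (c m))"
proof (rule summable_comparison_test'[OF summable_geometric[of "1/3::real"]])
  show "norm ((1/3) ^ m * y (c m)) \<le> (1/3) ^ m" if "y \<in> K" for m using K_bit[OF that, of "c m"] by auto
qed simp

lemma v_bounds: assumes y: "y \<in> K" shows "0 \<le> v y" "v y \<le> 1"
proof -
  have le: "(1/3) ^ m * y (enc \<one> m) \<le> (1/3) ^ m" and ge: "0 \<le> (1/3) ^ m * y (enc \<one> m)" for m
    using K_bit[OF y, of "enc \<one> m"] by auto
  show "0 \<le> v y" unfolding v_def using suminf_nonneg[OF summable_ternary[OF y] ge] by simp
  have "(\<Sum>m. (1/3) ^ m * y (enc \<one> m)) \<le> (\<Sum>m. (1/3::real) ^ m)"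
    by (rule suminf_le[OF le summable_ternary[OF y] summable_geometric]) simp
  then show "v y \<le> 1" unfolding v_def by (simp add: suminf_geometric)
qed

lemma v_continuous: "continuous_on K v"
proof -
  have "continuous_on K (\<lambda>y. \<Sum>m. (1/3) ^ m * y (enc \<one> m))"
  proof (rule continuous_on_suminf[where M = "\<lambda>m. (1/3) ^ m"])
    show "continuous_on K (\<lambda>y. (1/3) ^ m * y (enc \<one> m))" for m
      by (intro continuous_on_mult continuous_on_const continuous_on_coordinate)
    show "norm ((1/3) ^ m * y (enc \<one> m)) \<le> (1/3) ^ m" if "y \<in> K" for m y using K_bit[OF that, of "enc \<one> m"] by auto
  qed (simp add: summable_geometric)
  then show ?thesis unfolding v_def by (intro continuous_on_mult continuous_on_const)
qed

lemma partition: "partition_of_unity (top_of_set K) {p, q}"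
proof -
  \<comment> \<open>A partition of unity is a set here, so the two functions must be distinct for
    both to be counted in the sum; they differ at the zero sequence.\<close>
  have "(\<lambda>_. 0) \<in> K" by (simp add: K_def)
  then have "p (\<lambda>_. 0) \<noteq> q (\<lambda>_. 0)" by (simp add: p_def q_def v_def)
  then have ne: "p \<noteq> q" by metis
  have "p \<in> cfun (top_of_set K)" "q \<in> cfun (top_of_set K)"
    unfolding p_def q_def by (intro cfun_of_real continuous_on_diff continuous_on_const v_continuous)+
  moreover have "p y \<in> \<real>\<^sub>\<ge>\<^sub>0 \<and> q y \<in> \<real>\<^sub>\<ge>\<^sub>0 \<and> p y + q y = 1" if "y \<in> K" for y
    using v_bounds[OF that] that unfolding p_def q_def
    by (simp add: complex_nonneg_Reals_iff)
  ultimately show ?thesis using ne by (simp add: partition_of_unity_def)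
qed

text \<open>After moving by the inverse of h the function \<open>v\<close> sees the code of
  coordinate h, and its value determines all digits; two points of \<open>K\<close> differ at some
  coordinate.\<close>

lemma v_separates:
  assumes y: "y \<in> K" "y' \<in> K" "y \<noteq> y'"
  shows "\<exists>h\<in>carrier G. v (b (inv h) y) \<noteq> v (b (inv h) y')"
proof (rule ccontr)
  assume "\<not> ?thesis"
  then have eq: "v (b (inv h) y) = v (b (inv h) y')" if "h \<in> carrier G" for h using that by blast
  have v: "v (b (inv h) z) = (\<Sum>m. (1/3) ^ m * z (enc h m)) * (2/3)" if "h \<in> carrier G" "z \<in> K" for h z
    using that by (simp add: v_def b_apply)
  have "y n = y' n" for n
  proof -
    have "(\<lambda>m. y (enc (elt n) m)) = (\<lambda>m. y' (enc (elt n) m))"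
      using eq[of "elt n"] K_bit y by (intro ternary_expansion_injective) (simp_all add: v)
    from fun_cong[OF this, of "idx n"] show ?thesis by simp
  qed
  then show False using y(3) by blast
qed

lemma generating: "dynamically_generating G (top_of_set K) b {p, q}"
  unfolding dynamically_generating_def
proof (intro allI impI)
  fix A assume A: "unital_C_star_subalgebra (top_of_set K) A \<and>
    (\<forall>g\<in>carrier G. translate G (top_of_set K) b g ` A \<subseteq> A) \<and> {p, q} \<subseteq> A"
  show "A = cfun (top_of_set K)"
  proof (rule unital_C_star_subalgebra_eq_cfun[OF compact_K conjunct1[OF A]])
    fix x y assume xy: "x \<in> K" "y \<in> K" "x \<noteq> y"
    obtain h where h: "h \<in> carrier G" "v (b (inv h) x) \<noteq> v (b (inv h) y)" using v_separates[OF xy] by blast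
    have "translate G (top_of_set K) b h p = (\<lambda>z\<in>K. complex_of_real (v (b (inv h) z)))"
      unfolding translate_def topspace_euclidean_subtopology by (rule restrict_ext) (simp add: p_def)
    moreover have "translate G (top_of_set K) b h p \<in> A" using A h(1) by blast
    moreover have "continuous_on K (\<lambda>z. v (b (inv h) z))"
      by (rule continuous_on_compose2[OF v_continuous b_continuous]) auto
    ultimately show "\<exists>f. continuous_on K f \<and> (\<lambda>z\<in>K. complex_of_real (f z)) \<in> A \<and> f x \<noteq> f y"
      using h(2) by (intro exI[of _ "\<lambda>z. v (b (inv h) z)"]) simp
  qed
qed

lemma topological_model: "topological_model G (top_of_set K) N b {p, q}"
  unfolding topological_model_def
proof (intro conjI ballI)
  show "compact_space (top_of_set K)" using compact_K by (simp add: compact_space_subtopology)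
  show "metrizable_space (top_of_set K)" by (intro metrizable_space_subtopology metrizable_space_euclidean)
  show "continuous_map (top_of_set K) (top_of_set K) (b g)" for g
    using b_continuous by (auto simp: continuous_map_in_subtopology)
qed (rule sets_N b_pmp partition generating)+

text \<open>The codes of actual points of the product. \<open>K\<close> also contains 0-1 sequences
  that come from no point, so the isomorphism has to be stated on this set.\<close>

definition B :: "(nat \<Rightarrow> real) set" where
  "B = {y \<in> K. \<forall>h\<in>carrier G. \<exists>x\<in>space \<mu>. \<forall>m. y (enc h m) = 1 \<longleftrightarrow> x \<in> U m}"

lemma B_sets: "B \<in> sets N"
proof -
  have "Measurable.pred N (\<lambda>y. \<forall>n. \<exists>x\<in>space \<mu>. \<forall>m. y (enc (elt n) m) = 1 \<longleftrightarrow> x \<in> U m)"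
    by (intro pred_intros_countable U_code) measurable
  then have "{y \<in> K. \<forall>n. \<exists>x\<in>space \<mu>. \<forall>m. y (enc (elt n) m) = 1 \<longleftrightarrow> x \<in> U m} \<in> sets N"
    unfolding pred_def space_N .
  moreover have "carrier G = range elt"
  proof (intro equalityI subsetI)
    fix h assume "h \<in> carrier G"
    then have "elt (enc h 0) = h" by simp
    then show "h \<in> range elt" by (metis rangeI)
  qed auto
  ultimately show ?thesis unfolding B_def by simp
qed

lemma \<theta>_enc: "h \<in> carrier G \<Longrightarrow> \<theta> x (enc h m) = 1 \<longleftrightarrow> x h \<in> U m" by (simp add: \<theta>_def)

lemma \<theta>_image: "\<theta> ` space Z = B"
proof (intro equalityI subsetI)
  fix y assume "y \<in> \<theta> ` space Z"
  then obtain x where x: "x \<in> space Z" "y = \<theta> x" by blast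
  have "x h \<in> space \<mu>" if "h \<in> carrier G" for h using x(1) that by (auto simp: space_PiM)
  then show "y \<in> B" unfolding B_def x(2) using \<theta>_enc by auto
next
  fix y assume y: "y \<in> B"
  have "\<forall>h\<in>carrier G. \<exists>x. x \<in> space \<mu> \<and> (\<forall>m. y (enc h m) = 1 \<longleftrightarrow> x \<in> U m)" using y unfolding B_def by blast
  from bchoice[OF this] obtain x where x: "\<And>h. h \<in> carrier G \<Longrightarrow> x h \<in> space \<mu>"
    "\<And>h m. h \<in> carrier G \<Longrightarrow> y (enc h m) = 1 \<longleftrightarrow> x h \<in> U m" by blast
  have "\<theta> (restrict x (carrier G)) n = y n" for n
    using x(2)[of "elt n" "idx n"] y K_bit[of y n] by (auto simp: \<theta>_def B_def)
  then have "y = \<theta> (restrict x (carrier G))" by (simp add: fun_eq_iff)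
  moreover have "restrict x (carrier G) \<in> space Z" using x(1) by (auto simp: space_PiM)
  ultimately show "y \<in> \<theta> ` space Z" by blast
qed

lemma \<theta>_inj: "inj_on \<theta> (space Z)"
proof (rule inj_onI)
  fix x x' assume x: "x \<in> space Z" "x' \<in> space Z" and eq: "\<theta> x = \<theta> x'"
  show "x = x'"
  proof (rule PiE_ext)
    show "x \<in> (\<Pi>\<^sub>E h\<in>carrier G. space \<mu>)" "x' \<in> (\<Pi>\<^sub>E h\<in>carrier G. space \<mu>)" using x by (simp_all add: space_PiM)
    fix h assume h: "h \<in> carrier G"
    show "x h = x' h"
    proof (rule U_separates)
      show "x h \<in> space \<mu>" "x' h \<in> space \<mu>" using x h by (auto simp: space_PiM)
      show "x h \<in> U m \<longleftrightarrow> x' h \<in> U m" for m using \<theta>_enc[OF h] eq by metis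
    qed
  qed
qed

text \<open>Measurability is tested on the generators: coordinate h of the decoded point lies in U_m
  exactly when the entry \<open>enc h m\<close> equals 1.\<close>

lemma \<theta>_inverse_measurable: "inv_into (space Z) \<theta> \<in> restrict_space N B \<rightarrow>\<^sub>M Z"
proof -
  let ?J = "inv_into (space Z) \<theta>"
  have sp: "space (restrict_space N B) = B" using B_sets by (auto simp: space_restrict_space B_def)
  have J: "?J y \<in> space Z" "\<theta> (?J y) = y" if "y \<in> B" for y
    using that inv_into_into[of y \<theta> "space Z"] f_inv_into_f[of y \<theta> "space Z"] unfolding \<theta>_image by blast+
  have "(\<lambda>y h. ?J y h) \<in> restrict_space N B \<rightarrow>\<^sub>M Z"
  proof (rule measurable_PiM_single')
    show "(\<lambda>y h. ?J y h) \<in> space (restrict_space N B) \<rightarrow> (\<Pi>\<^sub>E h\<in>carrier G. space \<mu>)"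
      using J(1) unfolding sp by (auto simp: space_PiM)
    fix h assume h: "h \<in> carrier G"
    show "(\<lambda>y. ?J y h) \<in> restrict_space N B \<rightarrow>\<^sub>M \<mu>"
    proof (rule measurable_sigma_sets[OF sets_\<mu> U_space])
      show "(\<lambda>y. ?J y h) \<in> space (restrict_space N B) \<rightarrow> space \<mu>" using J(1) h unfolding sp by (auto simp: space_PiM)
      fix V assume "V \<in> range U"
      then obtain m where m: "V = U m" by blast
      have mem: "?J y h \<in> U m \<longleftrightarrow> y (enc h m) = 1" if "y \<in> B" for y
        using \<theta>_enc[OF h, of "?J y" m] J(2)[OF that] by simp
      have "(\<lambda>y. ?J y h) -` V \<inter> space (restrict_space N B) = {y \<in> space (restrict_space N B). y (enc h m) = 1}"
        unfolding sp m using mem by auto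
      also have "\<dots> \<in> sets (restrict_space N B)"
      proof -
        have [measurable]: "(\<lambda>y. y (enc h m)) \<in> borel_measurable (restrict_space N B)"
          by (rule measurable_restrict_space1[OF coordinate_measurable])
        show ?thesis by measurable
      qed
      finally show "(\<lambda>y. ?J y h) -` V \<inter> space (restrict_space N B) \<in> sets (restrict_space N B)" .
    qed
  qed
  then show ?thesis by simp
qed

text \<open>The coding is injective and equivariant on the entire product, so the conull sets can be
  all of \<open>space Z\<close> and its image \<open>B\<close>. Invariance of \<open>B\<close>
  follows from equivariance, and \<open>N\<close> is carried by \<open>B\<close> because it is the
  image measure.\<close>

lemma isomorphic: "isomorphic_actions G Z (bernoulli_action G \<mu>) N b"
  unfolding isomorphic_actions_def
proof (rule bexI[OF _ sets.top], rule bexI[OF _ B_sets], intro exI[of _ \<theta>] conjI ballI)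
  have sub: "B \<subseteq> K" by (auto simp: B_def)
  have RZ: "space (restrict_space Z (space Z)) = space Z" "space (restrict_space N B) = B"
    using sub by (auto simp: space_restrict_space)
  have \<theta>R: "\<theta> \<in> restrict_space Z (space Z) \<rightarrow>\<^sub>M restrict_space N B"
    using \<theta>_image by (intro measurable_restrict_space2 measurable_restrict_space1[OF \<theta>_measurable_N]) (auto simp: RZ)
  have eN: "emeasure N S = emeasure Z (\<theta> -` S \<inter> space Z)" if "S \<in> sets N" for S
    using emeasure_distr[OF \<theta>_measurable, of S] that unfolding sets_N by (simp add: N_def)
  show "emeasure Z (space Z - space Z) = 0" by simp
  have "\<theta> -` (space N - B) \<inter> space Z = {}" using \<theta>_image by blast
  then show "emeasure N (space N - B) = 0" using eN[of "space N - B"] B_sets by (simp del: space_N)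
  show bz: "bernoulli_action G \<mu> g ` space Z \<subseteq> space Z" if "g \<in> carrier G" for g
    using measurable_space[OF bernoulli_pmp(1)[OF that]] by blast
  show "b g ` B \<subseteq> B" if g: "g \<in> carrier G" for g
  proof -
    have "b g (\<theta> x) \<in> \<theta> ` space Z" if "x \<in> space Z" for x
      using \<theta>_equivariant[OF g that] bz[OF g] that by (metis imageI subset_iff)
    then show ?thesis unfolding \<theta>_image[symmetric] by blast
  qed
  show "bij_betw \<theta> (space Z) B" unfolding bij_betw_def using \<theta>_inj \<theta>_image by simp
  show "\<theta> \<in> restrict_space Z (space Z) \<rightarrow>\<^sub>M restrict_space N B" by (rule \<theta>R)
  show "inv_into (space Z) \<theta> \<in> restrict_space N B \<rightarrow>\<^sub>M restrict_space Z (space Z)"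
    using measurable_space[OF \<theta>_inverse_measurable]
    by (intro measurable_restrict_space2[OF _ \<theta>_inverse_measurable]) blast
  show "distr (restrict_space Z (space Z)) (restrict_space N B) \<theta> = restrict_space N B"
  proof (rule measure_eqI)
    fix S assume "S \<in> sets (distr (restrict_space Z (space Z)) (restrict_space N B) \<theta>)"
    then have S: "S \<in> sets (restrict_space N B)" by simp
    then have SB: "S \<subseteq> B" "S \<in> sets N" using B_sets by (auto simp: sets_restrict_space)
    have "emeasure (distr (restrict_space Z (space Z)) (restrict_space N B) \<theta>) S
        = emeasure (restrict_space Z (space Z)) (\<theta> -` S \<inter> space Z)"
      using emeasure_distr[OF \<theta>R S] unfolding RZ .
    also have "\<dots> = emeasure Z (\<theta> -` S \<inter> space Z)" by (rule emeasure_restrict_space) auto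
    also have "\<dots> = emeasure N S" using eN[OF SB(2)] ..
    also have "\<dots> = emeasure (restrict_space N B) S"
      using SB(1) B_sets sub by (intro emeasure_restrict_space[symmetric]) (simp_all add: Int_absorb2)
    finally show "emeasure (distr (restrict_space Z (space Z)) (restrict_space N B) \<theta>) S = emeasure (restrict_space N B) S" .
  qed simp
  show "\<theta> (bernoulli_action G \<mu> g z) = b g (\<theta> z)" if "g \<in> carrier G" "z \<in> space Z" for g z
    by (rule \<theta>_equivariant[OF that])
qed

end

lemma bernoulli_model_exists:
  fixes \<mu> :: "'a measure"
  assumes G: "group G" "countable (carrier G)" and \<mu>: "standard_borel \<mu>" "prob_space \<mu>"
  obtains T :: "(nat \<Rightarrow> real) topology" and N b P where "topological_model G T N b P"
    "isomorphic_actions G (PiM (carrier G) (\<lambda>_. \<mu>)) (bernoulli_action G \<mu>) N b"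
proof -
  interpret \<mu>: prob_space \<mu> by (rule \<mu>(2))
  show thesis
  proof (rule standard_borel_code[OF \<mu>(1) \<mu>.not_empty])
    fix U :: "nat \<Rightarrow> 'a set"
    assume U: "sets \<mu> = sigma_sets (space \<mu>) (range U)" "range U \<subseteq> Pow (space \<mu>)"
      "\<And>x y. x \<in> space \<mu> \<Longrightarrow> y \<in> space \<mu> \<Longrightarrow> (\<And>m. x \<in> U m \<longleftrightarrow> y \<in> U m) \<Longrightarrow> x = y"
      "\<And>(M :: (nat \<Rightarrow> real) measure) F. (\<And>m. Measurable.pred M (\<lambda>z. F z m)) \<Longrightarrow>
         Measurable.pred M (\<lambda>z. \<exists>x\<in>space \<mu>. \<forall>m. F z m \<longleftrightarrow> x \<in> U m)"
    interpret bernoulli_coding G \<mu> U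
    proof (intro bernoulli_coding.intro bernoulli_coding_axioms.intro)
      show "x = y" if "x \<in> space \<mu>" "y \<in> space \<mu>" "\<And>m. x \<in> U m \<longleftrightarrow> y \<in> U m" for x y
        by (rule U(3)[OF that])
      show "Measurable.pred M (\<lambda>z. \<exists>x\<in>space \<mu>. \<forall>m. F z m \<longleftrightarrow> x \<in> U m)"
        if "\<And>m. Measurable.pred M (\<lambda>z. F z m)" for M :: "(nat \<Rightarrow> real) measure" and F
        by (rule U(4)[OF that])
    qed (rule G(1) G(2) \<mu>(2) U(1) U(2))+
    show thesis by (rule that[OF topological_model isomorphic])
  qed
qed

theorem theorem2p3:
  fixes G :: "('g, 'r) monoid_scheme"
    and d :: "nat \<Rightarrow> nat"
    and \<sigma> :: "nat \<Rightarrow> 'g \<Rightarrow> nat \<Rightarrow> nat"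
    and \<mu> :: "'a measure"
  assumes "sofic_group G"
    and "sofic_approximation G d \<sigma>"
    and "standard_borel \<mu>"
    and "prob_space \<mu>"
  shows "sofic_entropy G d \<sigma> (PiM (carrier G) (\<lambda>_. \<mu>)) (bernoulli_action G \<mu>) = base_entropy \<mu>"
proof -
  have G: "group G" "countable (carrier G)" using assms(1) by (auto simp: sofic_group_def)
  have eq: "model_entropy G d \<sigma> T N b P = base_entropy \<mu>"
    if model: "topological_model G T N b P" "isomorphic_actions G (PiM (carrier G) (\<lambda>_. \<mu>)) (bernoulli_action G \<mu>) N b"
    for T :: "(nat \<Rightarrow> real) topology" and N b P
  proof -
    have "sofic_model G d \<sigma> T N b P"
      using G(1) assms(2) model(1)
      by (intro sofic_model.intro sofic_sequence.intro sofic_sequence_axioms.intro sofic_model_axioms.intro)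
    then obtain \<Phi> \<Psi> where "bernoulli_model G d \<sigma> T N b P \<mu> \<Phi> \<Psi>"
      by (rule isomorphic_bernoulli_model[OF _ assms(4) model(2)])
    then show ?thesis by (rule bernoulli_model.model_entropy_eq)
  qed
  \<comment> \<open>The definite description denotes only if some model exists; here standardness of
    the base enters. Uniqueness of the value is \<open>eq\<close>.\<close>
  obtain T :: "(nat \<Rightarrow> real) topology" and N b P where model: "topological_model G T N b P"
    "isomorphic_actions G (PiM (carrier G) (\<lambda>_. \<mu>)) (bernoulli_action G \<mu>) N b"
    using bernoulli_model_exists[OF G assms(3,4)] .
  show ?thesis
    unfolding sofic_entropy_def
  proof (rule the_equality)
    show "\<exists>(T :: (nat \<Rightarrow> real) topology) N b P. topological_model G T N b P \<and>
      isomorphic_actions G (PiM (carrier G) (\<lambda>_. \<mu>)) (bernoulli_action G \<mu>) N b \<and>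
      base_entropy \<mu> = model_entropy G d \<sigma> T N b P"
      by (intro exI conjI, rule model(1), rule model(2), rule eq[OF model, symmetric])
    fix h assume "\<exists>(T :: (nat \<Rightarrow> real) topology) N b P. topological_model G T N b P \<and>
      isomorphic_actions G (PiM (carrier G) (\<lambda>_. \<mu>)) (bernoulli_action G \<mu>) N b \<and>
      h = model_entropy G d \<sigma> T N b P"
    then show "h = base_entropy \<mu>" using eq by (elim exE conjE) (simp only:)
  qed
qed

end
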